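(* Let $\beta>0$, let $p=p_n\ge n$ with $p/n\to\gamma\in[1,\infty)$ as $n\to\infty$, let $x$ satisfy $\gamma x>x^*=\beta(\sqrt\gamma+1)^2$, and let $J_{\beta,x}$ be a constant with $$0<J_{\beta,x}<1-2\beta\int\frac{1}{\gamma x-y}\,\sigma_\beta(dy)-\beta\,\frac{\gamma-1}{\gamma x}.$$ Let $\lambda_{(1)}$ be the largest eigenvalue of the $\beta$-Laguerre ensemble with parameters $(n,p,\beta)$, and let $\tilde Q$ and the importance sampling estimator $\tilde L_p$ be as defined in the context. Then $\tilde L_p$ is asymptotically efficient for estimating $P(\lambda_{(1)}>px)$, that is, $E^{\tilde Q}[\tilde L_p]=P(\lambda_{(1)}>px)$ and $$\lim_{n\to\infty}\frac{\log E^{\tilde Q}[\tilde L_p^2]}{2\log P(\lambda_{(1)}>px)}=1.$$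
   Context: The $\beta$-Laguerre ensemble with parameters $(n,p,\beta)$, $p\ge n$, $\beta>0$: random $(\lambda_1,\dots,\lambda_n)\in(0,\infty)^n$ with density $$f_{n,p,\beta}(\lambda_1,\dots,\lambda_n)=c_{n,p,\beta}\prod_{1\le i<j\le n}|\lambda_i-\lambda_j|^{\beta}\prod_{i=1}^n\lambda_i^{\frac{\beta(p-n+1)}{2}-1}e^{-\frac12\sum_{i=1}^n\lambda_i},\qquad c_{n,p,\beta}=2^{-\frac{\beta np}{2}}\prod_{j=1}^n\frac{\Gamma(1+\frac\beta2)}{\Gamma(1+\frac\beta2 j)\,\Gamma(\frac\beta2(p-n+j))}.$$ The order statistics $\lambda_{(1)}>\cdots>\lambda_{(n)}$ have joint density $g_{n,p,\beta}(\lambda_1,\dots,\lambda_n)=n!\,f_{n,p,\beta}(\lambda_1,\dots,\lambda_n)\,I_{(\lambda_1>\cdots>\lambda_n)}$. Put $A_n=c_{n,p,\beta}/c_{n-1,p-1,\beta}$. $\sigma_\beta$ is the Marchenko–Pastur law arising as the limit of the empirical distribution of $(\lambda_1/n,\dots,\lambda_n/n)$ when $p/n\to\gamma$: it is supported on $[x_*,x^*]$ with $x_*=\beta(\sqrt\gamma-1)^2$, $x^*=\beta(\sqrt\gamma+1)^2$, and has density $\frac{\sqrt{(y-x_* )(x^*-y)}}{2\pi\beta y}$ there. (The upper bound on $J_{\beta,x}$ in the claim is positive when $\gamma x>x^*$.) Measure $\tilde Q$: first sample $\lambda_{(2)}>\cdots>\lambda_{(n)}$ with density $g_{n-1,p-1,\beta}$;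 then, given these, sample $\lambda_{(1)}$ with density $J_{\beta,x}e^{-J_{\beta,x}(\lambda_{(1)}-px\vee\lambda_{(2)})}I_{(\lambda_{(1)}>px\vee\lambda_{(2)})}$, where $a\vee b=\max(a,b)$. $\tilde Q$ is the resulting law of $(\lambda_{(1)},\dots,\lambda_{(n)})$ and $E^{\tilde Q}$ its expectation. With $P$ the law of the ordered eigenvalues of the $\beta$-Laguerre ensemble with parameters $(n,p,\beta)$, $$\tilde L_p=\frac{dP}{d\tilde Q}1_{(\lambda_{(1)}>px)}=\frac{nA_n\prod_{i=2}^n(\lambda_{(1)}-\lambda_{(i)})^\beta\,\lambda_{(1)}^{\frac{\beta(p-n+1)}{2}-1}e^{-\frac12\lambda_{(1)}}}{J_{\beta,x}e^{-J_{\beta,x}(\lambda_{(1)}-px\vee\lambda_{(2)})}},$$ well defined $\tilde Q$-almost surely. *)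

theory Defs
  imports "HOL-Probability.Probability"
begin

text \<open>
  Configurations of \<open>n\<close> eigenvalues are functions on the index set \<open>{1..n}\<close>, measured by the
  product of \<open>n\<close> copies of Lebesgue measure. The parameter \<open>p\<close> is real, so that no integrality
  of \<open>p\<close> is presupposed.
\<close>

definition laguerre_const :: "nat \<Rightarrow> real \<Rightarrow> real \<Rightarrow> real" where
  "laguerre_const n p \<beta> =
     2 powr (- (\<beta> * real n * p / 2)) *
     (\<Prod>j=1..n. Gamma (1 + \<beta> / 2) /
        (Gamma (1 + \<beta> / 2 * real j) * Gamma (\<beta> / 2 * (p - real n + real j))))"

definition laguerre_density :: "nat \<Rightarrow> real \<Rightarrow> real \<Rightarrow> (nat \<Rightarrow> real) \<Rightarrow> real" where
  "laguerre_density n p \<beta> l =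
     (if \<forall>i\<in>{1..n}. 0 < l i
      then laguerre_const n p \<beta> *
           (\<Prod>j=1..n. \<Prod>i=1..<j. \<bar>l i - l j\<bar> powr \<beta>) *
           (\<Prod>i=1..n. l i powr (\<beta> * (p - real n + 1) / 2 - 1)) *
           exp (- (1 / 2) * (\<Sum>i=1..n. l i))
      else 0)"

definition laguerre_ensemble :: "nat \<Rightarrow> real \<Rightarrow> real \<Rightarrow> (nat \<Rightarrow> real) measure" where
  "laguerre_ensemble n p \<beta> =
     density (\<Pi>\<^sub>M i\<in>{1..n}. lborel) (\<lambda>l. ennreal (laguerre_density n p \<beta> l))"

definition ordered_laguerre_density :: "nat \<Rightarrow> real \<Rightarrow> real \<Rightarrow> (nat \<Rightarrow> real) \<Rightarrow> real" where
  "ordered_laguerre_density n p \<beta> l =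
     (if \<forall>i\<in>{1..n}. \<forall>j\<in>{1..n}. i < j \<longrightarrow> l i > l j
      then fact n * laguerre_density n p \<beta> l else 0)"

definition mp_lower :: "real \<Rightarrow> real \<Rightarrow> real" where
  "mp_lower \<beta> \<gamma> = \<beta> * (sqrt \<gamma> - 1)\<^sup>2"

definition mp_upper :: "real \<Rightarrow> real \<Rightarrow> real" where
  "mp_upper \<beta> \<gamma> = \<beta> * (sqrt \<gamma> + 1)\<^sup>2"

definition marchenko_pastur :: "real \<Rightarrow> real \<Rightarrow> real measure" where
  "marchenko_pastur \<beta> \<gamma> =
     density lborel (\<lambda>y. ennreal
       (sqrt ((y - mp_lower \<beta> \<gamma>) * (mp_upper \<beta> \<gamma> - y)) / (2 * pi * \<beta> * y) *
        indicator {mp_lower \<beta> \<gamma>..mp_upper \<beta> \<gamma>} y))"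

text \<open>
  The importance sampling measure, for \<open>n \<ge> 2\<close>. The first stage samples the lower order
  statistics \<open>l 2 > \<dots> > l n\<close>, which keep their indices; they form an ordered ensemble of size
  \<open>n - 1\<close>, whence the shift of the argument of the density. The second stage samples \<open>l 1\<close>
  from an exponential law of rate \<open>J\<close> started at \<open>max (p * x) (l 2)\<close>.
\<close>

definition lower_eigenvalues :: "nat \<Rightarrow> real \<Rightarrow> real \<Rightarrow> (nat \<Rightarrow> real) measure" where
  "lower_eigenvalues n p \<beta> =
     density (\<Pi>\<^sub>M i\<in>{2..n}. lborel)
       (\<lambda>l. ennreal (ordered_laguerre_density (n - 1) (p - 1) \<beta> (\<lambda>i. l (i + 1))))"

definition shifted_exponential :: "real \<Rightarrow> real \<Rightarrow> real measure" where
  "shifted_exponential J a =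
     density lborel (\<lambda>t. ennreal (J * exp (- J * (t - a)) * indicator {a<..} t))"

definition importance_measure :: "nat \<Rightarrow> real \<Rightarrow> real \<Rightarrow> real \<Rightarrow> real \<Rightarrow> (nat \<Rightarrow> real) measure" where
  "importance_measure n p \<beta> x J =
     lower_eigenvalues n p \<beta> \<bind>
       (\<lambda>l. distr (shifted_exponential J (max (p * x) (l 2)))
                   (\<Pi>\<^sub>M i\<in>{1..n}. lborel) (\<lambda>t. l(1 := t)))"

text \<open>
  The likelihood ratio of the ordered ensemble with respect to \<open>importance_measure\<close> on the event
  \<open>l 1 > p * x\<close>, which has full measure under the latter, as has \<open>l 1 > l 2 > \<dots> > l n > 0\<close>.
  The values off this set are irrelevant.
\<close>

definition importance_estimator ::
  "nat \<Rightarrow> real \<Rightarrow> real \<Rightarrow> real \<Rightarrow> real \<Rightarrow> (nat \<Rightarrow> real) \<Rightarrow> real" where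
  "importance_estimator n p \<beta> x J l =
     real n * (laguerre_const n p \<beta> / laguerre_const (n - 1) (p - 1) \<beta>) *
     (\<Prod>i=2..n. (l 1 - l i) powr \<beta>) *
     l 1 powr (\<beta> * (p - real n + 1) / 2 - 1) * exp (- (1 / 2) * l 1) /
     (J * exp (- J * (l 1 - max (p * x) (l 2))))"

definition largest_eigenvalue_tail :: "nat \<Rightarrow> real \<Rightarrow> real \<Rightarrow> real \<Rightarrow> real" where
  "largest_eigenvalue_tail n p \<beta> y =
     measure (laguerre_ensemble n p \<beta>)
       {l \<in> space (laguerre_ensemble n p \<beta>). Max (l ` {1..n}) > y}"

end

theory Submission
  imports Defs "HOL-Real_Asymp.Real_Asymp"
begin

text \<open>
  Splitting off the largest eigenvalue turns the tail probability and the second moment of the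
  estimator into one-dimensional integrals over \<open>z > p x\<close>, whose integrands are the Laguerre weight
  of \<open>z\<close> (squared for the second moment) times the moment of order \<open>\<beta>\<close> (respectively \<open>2 \<beta>\<close>) of the
  characteristic polynomial \<open>\<Prod>(z - l i)\<close> of the ensemble of size \<open>n - 1\<close>. These moments are only
  needed up to factors \<open>exp (\<epsilon> n)\<close>, and to this precision each is the corresponding power of
  \<open>\<Prod>(z - L i)\<close>, where \<open>L\<close> is the equilibrium configuration (the zeros of a Laguerre polynomial).
  The upper bound holds because the density decays from its maximum quickly enough to control
  exponential moments of \<open>\<Sum>\<bar>l i - L i\<bar>\<close>; the lower bound holds because, by Aomoto's recursion, the
  expectation of \<open>\<Prod>(z - l i)\<close> is exactly \<open>\<Prod>(z - L i)\<close>.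

  The Stieltjes transform of \<open>L\<close> satisfies a Riccati inequality, so beyond the spectral edge the
  logarithmic derivative of the first integrand is at most \<open>- \<rho>(z) / 2\<close> with \<open>\<rho>\<close> explicit, and the limit of
  \<open>\<rho>(p x)\<close> is precisely the upper bound imposed on \<open>J\<close>. Hence the second moment is at most
  \<open>exp (\<epsilon> n)\<close> times the squared tail probability, while Cauchy--Schwarz gives the converse
  inequality. Comparing \<open>p x\<close> with a point closer to the edge, where the tail probability is still
  at most 1, shows that the tail probability at \<open>p x\<close> is exponentially small.
\<close>

section \<open>Symmetric functions and order statistics\<close>


text \<open>Everything needed about the ensemble is derived from its density by integration by
  parts, for real \<beta> and \<open>p\<close> alike. The obstacle is entropy: comparing an integral
  over \<open>n\<close> coordinates with the maximum of its integrand costs factors of order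
  \<open>exp (c * n * ln n)\<close>, more than the \<open>exp (\<epsilon> * n)\<close> that can be
  afforded. They are absorbed because the energy has order \<open>n\<^sup>2\<close>: configurations
  whose energy exceeds the optimum by more than \<open>n * sqrt n\<close> carry negligible mass, and
  below that threshold the deviations are cheap enough. The maximum is taken for shape
  \<open>\<kappa> + 1\<close>, not \<kappa>. This keeps it away from 0 and makes its coordinates the
  exact zeros of the expected characteristic polynomial for shape \<kappa>; the surplus product of
  the \<open>l i\<close> becomes the measure \<open>dt / t\<close> in each coordinate. The ratio of
  normalising constants is a factor of the tail probability, and its square one of the second
  moment. It is eliminated by comparison with tail probabilities.\<close>

abbreviation lebesgue_on_indices :: "'a set \<Rightarrow> ('a \<Rightarrow> real) measure"
  where "lebesgue_on_indices I \<equiv> \<Pi>\<^sub>M i\<in>I. lborel"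

interpretation lborel_product: product_sigma_finite "\<lambda>_. lborel :: real measure"
  by standard

section \<open>Lebesgue measure under renaming of the coordinates\<close>

lemma distr_lebesgue_reindex:
  fixes f :: "'b \<Rightarrow> 'a"
  assumes "finite I" "bij_betw f J I"
  shows "distr (lebesgue_on_indices I) (lebesgue_on_indices J) (\<lambda>l. \<lambda>i\<in>J. l (f i))
           = lebesgue_on_indices J"
proof -
  have finJ: "finite J" using assms bij_betw_finite by blast
  have fJ: "f ` J = I" "inj_on f J" using assms(2) by (auto simp: bij_betw_def)
  have meas: "(\<lambda>l. \<lambda>i\<in>J. l (f i)) \<in> measurable (lebesgue_on_indices I) (lebesgue_on_indices J)"
    using fJ by (intro measurable_restrict measurable_component_singleton) auto
  show ?thesis
  proof (rule lborel_product.PiM_eqI)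
    fix A :: "'b \<Rightarrow> real set" assume A: "\<And>i. i \<in> J \<Longrightarrow> A i \<in> sets lborel"
    let ?g = "the_inv_into J f"
    have g: "?g (f i) = i" if "i \<in> J" for i using that fJ by (simp add: the_inv_into_f_f)
    have eq: "(\<lambda>l. \<lambda>i\<in>J. l (f i)) -` (Pi\<^sub>E J A) \<inter> space (lebesgue_on_indices I)
            = Pi\<^sub>E I (\<lambda>k. A (?g k))"
      using fJ g by (auto simp: space_PiM PiE_iff extensional_def)
    have gI: "?g k \<in> J" if "k \<in> I" for k using that fJ the_inv_into_into[of f J k J] by auto
    have "emeasure (distr (lebesgue_on_indices I) (lebesgue_on_indices J) (\<lambda>l. \<lambda>i\<in>J. l (f i))) (Pi\<^sub>E J A)
        = emeasure (lebesgue_on_indices I) (Pi\<^sub>E I (\<lambda>k. A (?g k)))"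
      using A finJ by (subst emeasure_distr[OF meas]) (auto intro!: sets_PiM_I_finite simp: eq)
    also have "\<dots> = (\<Prod>k\<in>I. emeasure lborel (A (?g k)))"
      using A gI assms(1) by (intro lborel_product.emeasure_PiM) auto
    also have "\<dots> = (\<Prod>i\<in>J. emeasure lborel (A i))"
      using fJ g by (subst fJ(1)[symmetric], subst prod.reindex) (auto intro!: prod.cong)
    finally show "emeasure (distr (lebesgue_on_indices I) (lebesgue_on_indices J) (\<lambda>l. \<lambda>i\<in>J. l (f i))) (Pi\<^sub>E J A)
      = (\<Prod>i\<in>J. emeasure lborel (A i))" .
  qed (use finJ in auto)
qed

lemma nn_integral_lebesgue_reindex:
  assumes "finite I" "bij_betw f J I" and [measurable]: "g \<in> borel_measurable (lebesgue_on_indices J)"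
  shows "(\<integral>\<^sup>+l. g (\<lambda>i\<in>J. l (f i)) \<partial>lebesgue_on_indices I) = (\<integral>\<^sup>+l. g l \<partial>lebesgue_on_indices J)"
proof -
  have fJ: "f ` J = I" using assms(2) by (auto simp: bij_betw_def)
  have meas: "(\<lambda>l. \<lambda>i\<in>J. l (f i)) \<in> measurable (lebesgue_on_indices I) (lebesgue_on_indices J)"
    using fJ by (intro measurable_restrict measurable_component_singleton) auto
  show ?thesis
    using nn_integral_distr[OF meas, of g] by (simp add: distr_lebesgue_reindex[OF assms(1,2)] assms)
qed

text \<open>A permutation of \<open>I\<close> fixes all other indices, so
  \<open>\<lambda>i. l (s i)\<close> is already extensional and equals its restriction to
  \<open>I\<close>.\<close>

lemma measurable_permute_coordinates:
  assumes "s permutes I"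
  shows "(\<lambda>l. \<lambda>i. l (s i)) \<in> measurable (lebesgue_on_indices I) (lebesgue_on_indices I)"
proof -
  have "(\<lambda>l. \<lambda>i\<in>I. l (s i)) \<in> measurable (lebesgue_on_indices I) (lebesgue_on_indices I)"
    using permutes_in_image[OF assms] by (intro measurable_restrict measurable_component_singleton) auto
  then show ?thesis
    by (rule measurable_cong[THEN iffD1, rotated])
       (use assms in \<open>auto simp: space_PiM PiE_iff extensional_def permutes_def fun_eq_iff\<close>)
qed

lemma permute_coordinates_eq_restrict:
  assumes "s permutes I" "l \<in> space (lebesgue_on_indices I)"
  shows "(\<lambda>i. l (s i)) = (\<lambda>i\<in>I. l (s i))"
  using assms by (auto simp: space_PiM PiE_iff extensional_def permutes_def fun_eq_iff)

lemma distr_lebesgue_permute: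
  assumes "finite I" "s permutes I"
  shows "distr (lebesgue_on_indices I) (lebesgue_on_indices I) (\<lambda>l. \<lambda>i. l (s i)) = lebesgue_on_indices I"
  using distr_lebesgue_reindex[OF assms(1) permutes_imp_bij[OF assms(2)]]
  by (subst (asm) distr_cong[OF refl refl permute_coordinates_eq_restrict[OF assms(2), symmetric]])

lemma nn_integral_lebesgue_permute:
  assumes "finite I" "s permutes I" and [measurable]: "g \<in> borel_measurable (lebesgue_on_indices I)"
  shows "(\<integral>\<^sup>+l. g (\<lambda>i. l (s i)) \<partial>lebesgue_on_indices I) = (\<integral>\<^sup>+l. g l \<partial>lebesgue_on_indices I)"
  using nn_integral_distr[OF measurable_permute_coordinates[OF assms(2)], of g]
  by (simp add: distr_lebesgue_permute[OF assms(1,2)])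

lemma integral_lebesgue_permute:
  fixes g :: "('a \<Rightarrow> real) \<Rightarrow> real"
  assumes "finite I" "s permutes I" and [measurable]: "g \<in> borel_measurable (lebesgue_on_indices I)"
  shows "(\<integral>l. g (\<lambda>i. l (s i)) \<partial>lebesgue_on_indices I) = (\<integral>l. g l \<partial>lebesgue_on_indices I)"
  using integral_distr[OF measurable_permute_coordinates[OF assms(2)] assms(3)]
  by (simp add: distr_lebesgue_permute[OF assms(1,2)])

definition decreasing :: "nat \<Rightarrow> (nat \<Rightarrow> real) \<Rightarrow> bool"
  where "decreasing n l \<longleftrightarrow> (\<forall>i\<in>{1..n}. \<forall>j\<in>{1..n}. i < j \<longrightarrow> l j < l i)"

lemma decreasing_less_iff:
  assumes "decreasing n l" "i \<in> {1..n}" "j \<in> {1..n}"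
  shows "l i < l j \<longleftrightarrow> j < i"
  using assms unfolding decreasing_def
  by (metis linorder_neqE_nat order.asym order.irrefl)

lemma decreasing_inj_on: "decreasing n l \<Longrightarrow> inj_on l {1..n}"
  unfolding inj_on_def by (metis decreasing_less_iff linorder_neqE_nat order.irrefl)

text \<open>The sorting permutation is the inverse of \<open>j \<mapsto> 1 + card {k. l k > l j}\<close>.\<close>

lemma ex1_sorting_permutation:
  assumes "inj_on l {1..n}"
  shows "\<exists>!s. s permutes {1..n} \<and> decreasing n (\<lambda>i. l (s i))"
proof -
  define r where "r j = (if j \<in> {1..n} then 1 + card {k\<in>{1..n}. l k > l j} else j)" for j
  have less: "r i < r j" if "i \<in> {1..n}" "j \<in> {1..n}" "l i > l j" for i j
  proof -
    have "{k\<in>{1..n}. l k > l i} \<subset> {k\<in>{1..n}. l k > l j}" using that by auto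
    then show ?thesis using that unfolding r_def by (simp add: psubset_card_mono)
  qed
  have rin: "r i \<in> {1..n}" if "i \<in> {1..n}" for i
  proof -
    have "{k\<in>{1..n}. l k > l i} \<subset> {1..n}" using that by (intro psubsetI) blast+
    then have "card {k\<in>{1..n}. l k > l i} < card {1..n}" by (intro psubset_card_mono) auto
    then show ?thesis using that by (auto simp: r_def)
  qed
  have inj: "inj_on r {1..n}"
    using less assms unfolding inj_on_def by (metis linorder_neqE_linordered_idom order.irrefl)
  have "r ` {1..n} = {1..n}"
    using inj rin by (intro card_subset_eq) (auto simp: card_image)
  then have rp: "r permutes {1..n}"
    using inj by (intro bij_imp_permutes) (auto simp: bij_betw_def r_def)
  have unique: "s = inv r" if s: "s permutes {1..n}" "decreasing n (\<lambda>i. l (s i))" for s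
  proof -
    have "r (s i) = i" for i
    proof (cases "i \<in> {1..n}")
      case True
      then have si: "s i \<in> {1..n}" using permutes_in_image[OF s(1)] by blast
      have "{k\<in>{1..n}. l k > l (s i)} = s ` {k\<in>{1..n}. l (s k) > l (s i)}"
      proof (intro set_eqI iffI)
        fix k assume "k \<in> {k\<in>{1..n}. l k > l (s i)}"
        then show "k \<in> s ` {k\<in>{1..n}. l (s k) > l (s i)}"
          using permutes_in_image[OF permutes_inv[OF s(1)], of k] permutes_inverses(1)[OF s(1), of k]
          by (intro image_eqI[of _ _ "inv s k"]) auto
      qed (use permutes_in_image[OF s(1)] in auto)
      also have "{k\<in>{1..n}. l (s k) > l (s i)} = {1..<i}"
        using decreasing_less_iff[OF s(2) True] True by auto
      finally have "card {k\<in>{1..n}. l k > l (s i)} = card {1..<i}"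
        using s(1) by (simp add: card_image permutes_inj_on)
      then show ?thesis using si True by (simp add: r_def)
    next
      case False
      then show ?thesis using s(1) by (auto simp: permutes_def r_def)
    qed
    then show ?thesis using permutes_inverses(2)[OF rp] by (metis ext)
  qed
  have "decreasing n (\<lambda>i. l (inv r i))"
    unfolding decreasing_def
  proof (intro ballI impI)
    fix i j assume ij: "i \<in> {1..n}" "j \<in> {1..n}" "i < j"
    have m: "inv r i \<in> {1..n}" "inv r j \<in> {1..n}"
      using ij permutes_in_image[OF permutes_inv[OF rp]] by blast+
    have "r (inv r i) = i" "r (inv r j) = j" using permutes_inverses(1)[OF rp] by auto
    then show "l (inv r j) < l (inv r i)"
      using less[OF m(2,1)] ij(3) inj_onD[OF assms _ m(1,2)]
      by (cases "l (inv r j)" "l (inv r i)" rule: linorder_cases) force+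
  qed
  then show ?thesis using unique permutes_inv[OF rp] by blast
qed

text \<open>By Fubini in the coordinate \<open>j\<close>: every fibre of the hyperplane is the
  single point \<open>l i\<close>.\<close>

lemma AE_lebesgue_coordinates_neq:
  assumes "finite I" "i \<in> I" "j \<in> I" "i \<noteq> j"
  shows "AE l in lebesgue_on_indices I. l i \<noteq> l j"
proof -
  have I: "insert j (I - {j}) = I" using assms by auto
  have "{l \<in> space (lebesgue_on_indices I). l i = l j} \<in> sets (lebesgue_on_indices I)"
    using assms by measurable
  have "emeasure (lebesgue_on_indices I) {l \<in> space (lebesgue_on_indices I). l i = l j}
     = (\<integral>\<^sup>+l. indicator {l. l i = l j} l \<partial>lebesgue_on_indices I)"
    by (subst nn_integral_indicator[symmetric], fact) (auto intro!: nn_integral_cong simp: indicator_def)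
  also have "\<dots> = (\<integral>\<^sup>+l. \<integral>\<^sup>+t. indicator {l. l i = l j} (l(j := t)) \<partial>lborel \<partial>lebesgue_on_indices (I - {j}))"
  proof (subst I[symmetric], rule lborel_product.product_nn_integral_insert)
    have "{l \<in> space (lebesgue_on_indices I). l i = l j} \<in> sets (lebesgue_on_indices I)"
      using assms by measurable
    then have "indicator {l \<in> space (lebesgue_on_indices I). l i = l j} \<in> borel_measurable (lebesgue_on_indices I)"
      by simp
    then show "indicator {l. l i = l j} \<in> borel_measurable (lebesgue_on_indices (insert j (I - {j})))"
      unfolding I by (rule measurable_cong[THEN iffD1, rotated]) (auto simp: indicator_def)
  qed (use assms in auto)
  also have "\<dots> = (\<integral>\<^sup>+l. emeasure lborel {l i} \<partial>lebesgue_on_indices (I - {j}))"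
  proof (rule nn_integral_cong)
    fix l
    have "(\<integral>\<^sup>+t. indicator {l. l i = l j} (l(j := t)) \<partial>lborel) = (\<integral>\<^sup>+t. indicator {l i} t \<partial>lborel)"
      using assms by (intro nn_integral_cong) (auto simp: indicator_def)
    then show "(\<integral>\<^sup>+t. indicator {l. l i = l j} (l(j := t)) \<partial>lborel) = emeasure lborel {l i}"
      by simp
  qed
  also have "\<dots> = 0" by simp
  finally show ?thesis
    using assms by (intro AE_I[of _ _ "{l \<in> space (lebesgue_on_indices I). l i = l j}"]) auto
qed

lemma AE_lebesgue_inj_on:
  assumes "finite I"
  shows "AE l in lebesgue_on_indices I. inj_on l I"
proof -
  have "AE l in lebesgue_on_indices I. \<forall>i\<in>I. \<forall>j\<in>I. i \<noteq> j \<longrightarrow> l i \<noteq> l j"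
    using assms AE_lebesgue_coordinates_neq[OF assms]
    by (intro AE_finite_allI) auto
  then show ?thesis by eventually_elim (auto simp: inj_on_def)
qed

lemma measurable_decreasing [measurable]:
  "Measurable.pred (lebesgue_on_indices {1..n}) (decreasing n)"
  unfolding decreasing_def by measurable

text \<open>Almost every \<open>l\<close> is injective and is then sorted by exactly one
  permutation, so the sorting indicators of all permutations add up to 1. By symmetry of
  \<open>f\<close> and invariance of Lebesgue measure, the \<open>fact n\<close> summands have equal
  integrals.\<close>

lemma nn_integral_symmetric:
  assumes [measurable]: "f \<in> borel_measurable (lebesgue_on_indices {1..n})"
    and sym: "\<And>l s. s permutes {1..n} \<Longrightarrow> f (\<lambda>i. l (s i)) = f l"
  shows "(\<integral>\<^sup>+l. f l \<partial>lebesgue_on_indices {1..n})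
       = fact n * (\<integral>\<^sup>+l. f l * indicator {l. decreasing n l} l \<partial>lebesgue_on_indices {1..n})"
proof -
  let ?P = "{s. s permutes {1..n}}"
  have ind [measurable]: "(\<lambda>l. f l * indicator {l. decreasing n l} l) \<in> borel_measurable (lebesgue_on_indices {1..n})"
  proof -
    have "(\<lambda>l. if decreasing n l then f l else 0) \<in> borel_measurable (lebesgue_on_indices {1..n})"
      by measurable
    then show ?thesis
      by (rule measurable_cong[THEN iffD1, rotated]) (auto simp: indicator_def)
  qed
  have fin: "finite ?P" by (simp add: finite_permutations)
  have mc: "(\<lambda>l. f l * indicator {l. decreasing n l} (\<lambda>i. l (s i))) \<in> borel_measurable (lebesgue_on_indices {1..n})"
    if "s \<in> ?P" for s
    using measurable_compose[OF measurable_permute_coordinates ind, of s] that sym[of s] by simp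
  have "(\<integral>\<^sup>+l. f l \<partial>lebesgue_on_indices {1..n})
     = (\<integral>\<^sup>+l. (\<Sum>s\<in>?P. f l * indicator {l. decreasing n l} (\<lambda>i. l (s i))) \<partial>lebesgue_on_indices {1..n})"
  proof (rule nn_integral_cong_AE)
    have "AE l in lebesgue_on_indices {1..n}. inj_on l {1..n}" by (rule AE_lebesgue_inj_on) simp
    then show "AE l in lebesgue_on_indices {1..n}.
        f l = (\<Sum>s\<in>?P. f l * indicator {l. decreasing n l} (\<lambda>i. l (s i)))"
    proof eventually_elim
      case (elim l)
      obtain s where s: "s permutes {1..n}" "decreasing n (\<lambda>i. l (s i))"
        and u: "\<And>t. t permutes {1..n} \<Longrightarrow> decreasing n (\<lambda>i. l (t i)) \<Longrightarrow> t = s"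
        using ex1_sorting_permutation[OF elim] by blast
      have "f l * indicator {l. decreasing n l} (\<lambda>i. l (t i)) = (if t = s then f l else 0)"
        if "t \<in> ?P" for t
      proof (cases "t = s")
        case False
        then have "\<not> decreasing n (\<lambda>i. l (t i))" using u that by blast
        then show ?thesis using False by (simp only: indicator_simps mem_Collect_eq not_False_eq_True if_False mult_zero_right)
      qed (use s(2) in \<open>simp only: indicator_simps mem_Collect_eq if_True mult_1_right simp_thms\<close>)
      then have "(\<Sum>t\<in>?P. f l * indicator {l. decreasing n l} (\<lambda>i. l (t i)))
          = (\<Sum>t\<in>?P. if t = s then f l else 0)"
        by (rule sum.cong[OF refl])
      then show ?case using s(1) fin by (simp only: sum.delta mem_Collect_eq if_True)
    qed
  qed
  also have "\<dots> = (\<Sum>s\<in>?P. \<integral>\<^sup>+l. f l * indicator {l. decreasing n l} (\<lambda>i. l (s i)) \<partial>lebesgue_on_indices {1..n})"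
    by (rule nn_integral_sum[OF mc])
  also have "\<dots> = (\<Sum>s\<in>?P. \<integral>\<^sup>+l. f l * indicator {l. decreasing n l} l \<partial>lebesgue_on_indices {1..n})"
  proof (rule sum.cong[OF refl])
    fix s assume s: "s \<in> ?P"
    show "(\<integral>\<^sup>+l. f l * indicator {l. decreasing n l} (\<lambda>i. l (s i)) \<partial>lebesgue_on_indices {1..n})
        = (\<integral>\<^sup>+l. f l * indicator {l. decreasing n l} l \<partial>lebesgue_on_indices {1..n})"
      using nn_integral_lebesgue_permute[OF _ _ ind, of s] s sym[of s] by simp
  qed
  also have "\<dots> = fact n * (\<integral>\<^sup>+l. f l * indicator {l. decreasing n l} l \<partial>lebesgue_on_indices {1..n})"
    by (simp add: card_permutations[OF refl])
  finally show ?thesis .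
qed


section \<open>Laguerre weights\<close>

text \<open>A Gamma weight of shape \<kappa> and rate 1/2, not normalised. The indicator carries the
  positivity condition of \<open>laguerre_density\<close>, so products of weights take it
  along.\<close>

definition laguerre_weight :: "real \<Rightarrow> real \<Rightarrow> real" where
  "laguerre_weight \<kappa> t = indicator {0<..} t * (t powr (\<kappa> - 1) * exp (- t / 2))"

lemma laguerre_weight_nonneg [simp]: "laguerre_weight \<kappa> t \<ge> 0"
  by (simp add: laguerre_weight_def)

lemma laguerre_weight_nonpos: "t \<le> 0 \<Longrightarrow> laguerre_weight \<kappa> t = 0"
  by (simp add: laguerre_weight_def)

lemma laguerre_weight_pos: "t > 0 \<Longrightarrow> laguerre_weight \<kappa> t > 0"
  by (simp add: laguerre_weight_def)

lemma measurable_laguerre_weight [measurable]: "laguerre_weight \<kappa> \<in> borel_measurable borel"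
  unfolding laguerre_weight_def by measurable

lemma laguerre_weight_mult_powr: "laguerre_weight \<kappa> t * t powr b = laguerre_weight (\<kappa> + b) t"
  by (auto simp: laguerre_weight_def indicator_def powr_add[symmetric] algebra_simps)

lemma laguerre_weight_mult: "laguerre_weight \<kappa> t * t = laguerre_weight (\<kappa> + 1) t"
  using laguerre_weight_mult_powr[of \<kappa> t 1] by (cases "t > 0") (auto simp: laguerre_weight_nonpos)

lemma nn_integral_powr_exp:
  assumes "s > 0" "c > 0"
  shows "(\<integral>\<^sup>+t. ennreal (indicator {0<..} t * (t powr (s - 1) * exp (- c * t))) \<partial>lborel)
       = ennreal (Gamma s / c powr s)"
proof -
  have "ennreal (Gamma s) = (\<integral>\<^sup>+t. ennreal (indicator {0<..} t * (t powr (s - 1) * exp (- t))) \<partial>lborel)"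
    unfolding Gamma_conv_nn_integral_real[OF assms(1)]
    by (rule nn_integral_cong_AE, rule AE_mp[OF AE_lborel_singleton[of 0]])
       (auto intro!: AE_I2 simp: indicator_def exp_minus field_simps)
  also have "\<dots> = ennreal \<bar>c\<bar> * (\<integral>\<^sup>+t. ennreal (indicator {0<..} (0 + c * t) * ((0 + c * t) powr (s - 1) * exp (- (0 + c * t)))) \<partial>lborel)"
    using assms by (intro nn_integral_real_affine) auto
  also have "(\<integral>\<^sup>+t. ennreal (indicator {0<..} (0 + c * t) * ((0 + c * t) powr (s - 1) * exp (- (0 + c * t)))) \<partial>lborel)
     = (\<integral>\<^sup>+t. ennreal (c powr (s - 1)) * ennreal (indicator {0<..} t * (t powr (s - 1) * exp (- c * t))) \<partial>lborel)"
    using assms by (intro nn_integral_cong)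
      (auto simp: indicator_def powr_mult ennreal_mult'[symmetric] zero_less_mult_iff)
  also have "\<dots> = ennreal (c powr (s - 1)) * (\<integral>\<^sup>+t. ennreal (indicator {0<..} t * (t powr (s - 1) * exp (- c * t))) \<partial>lborel)"
    by (intro nn_integral_cmult) auto
  finally have *: "ennreal (Gamma s) = ennreal (c powr s) * (\<integral>\<^sup>+t. ennreal (indicator {0<..} t * (t powr (s - 1) * exp (- c * t))) \<partial>lborel)"
    using assms by (simp add: mult.assoc[symmetric] ennreal_mult'[symmetric] powr_diff)
  have "ennreal (Gamma s / c powr s) = ennreal (1 / c powr s) * ennreal (Gamma s)"
    using assms by (simp add: ennreal_mult'[symmetric])
  also have "\<dots> = ennreal (1 / c powr s * c powr s) * (\<integral>\<^sup>+t. ennreal (indicator {0<..} t * (t powr (s - 1) * exp (- c * t))) \<partial>lborel)"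
    unfolding * by (subst ennreal_mult') (use assms in \<open>auto simp: mult.assoc\<close>)
  also have "1 / c powr s * c powr s = 1" using assms by simp
  finally show ?thesis by simp
qed

lemma integrable_laguerre_weight_powr:
  assumes "\<kappa> > 0"
  shows "integrable lborel (\<lambda>t. laguerre_weight \<kappa> t * (1 + t) powr b)"
proof -
  \<comment> \<open>With \<open>c \<ge> 4 * b\<close>, the bound
    \<open>1 + t \<le> c * exp (t / c)\<close> makes the polynomial factor cost at most
    \<open>exp (t / 4)\<close>, half of the exponential decay of the weight.\<close>
  define c where "c = max 1 (4 * b)"
  have int: "integrable lborel (\<lambda>t. c powr \<bar>b\<bar> * (indicator {0<..} t * (t powr (\<kappa> - 1) * exp (- (1 / 4) * t))))"
  proof (intro integrable_mult_right)
    show "integrable lborel (\<lambda>t. indicator {0<..} t * (t powr (\<kappa> - 1) * exp (- (1 / 4) * t)))"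
      using nn_integral_powr_exp[OF assms, of "1/4"]
      by (intro integrableI_nonneg) (auto simp del: times_divide_eq_left)
  qed
  show ?thesis
  proof (rule Bochner_Integration.integrable_bound[OF int])
    show "AE t in lborel. norm (laguerre_weight \<kappa> t * (1 + t) powr b)
       \<le> norm (c powr \<bar>b\<bar> * (indicator {0<..} t * (t powr (\<kappa> - 1) * exp (- (1 / 4) * t))))"
    proof (rule AE_I2)
      fix t :: real
      have "(1 + t) powr b \<le> c powr \<bar>b\<bar> * exp (t / 4)" if "t > 0"
      proof (cases "b \<le> 0")
        case True
        have "(1 + t) powr b \<le> (1 + t) powr 0" using that True by (intro powr_mono) auto
        also have "\<dots> \<le> c powr \<bar>b\<bar> * exp (t / 4)"
          using that ge_one_powr_ge_zero[of c "\<bar>b\<bar>"] mult_mono[of 1 "c powr \<bar>b\<bar>" 1 "exp (t/4)"]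
          by (auto simp: c_def)
        finally show ?thesis .
      next
        case False
        have c: "c \<ge> 1" "b / c \<le> 1 / 4" using False by (auto simp: c_def field_simps)
        have "1 + t \<le> c * (1 + t / c)" using c(1) by (simp add: field_simps)
        also have "\<dots> \<le> c * exp (t / c)" using c(1) by (intro mult_left_mono exp_ge_add_one_self) auto
        finally have "(1 + t) powr b \<le> (c * exp (t / c)) powr b" using that False by (intro powr_mono2) auto
        also have "\<dots> = c powr b * exp (b / c * t)"
          using c(1) by (simp add: powr_mult exp_powr_real mult.commute)
        also have "\<dots> \<le> c powr b * exp (t / 4)"
          using mult_right_mono[OF c(2), of t] that by (intro mult_left_mono) auto
        finally show ?thesis using False by simp
      qed
      then have le: "t powr (\<kappa> - 1) * exp (- t / 2) * (1 + t) powr b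
          \<le> t powr (\<kappa> - 1) * exp (- t / 2) * (c powr \<bar>b\<bar> * exp (t / 4))" if "t > 0"
        using that by (intro mult_left_mono) auto
      have "exp (- t / 2) * exp (t / 4) = exp (- (1 / 4) * t)"
        by (simp add: exp_add[symmetric])
      then have eq: "t powr (\<kappa> - 1) * exp (- t / 2) * (c powr \<bar>b\<bar> * exp (t / 4))
        = c powr \<bar>b\<bar> * (t powr (\<kappa> - 1) * exp (- (1 / 4) * t))"
        by (metis mult.assoc mult.left_commute)
      show "norm (laguerre_weight \<kappa> t * (1 + t) powr b)
       \<le> norm (c powr \<bar>b\<bar> * (indicator {0<..} t * (t powr (\<kappa> - 1) * exp (- (1 / 4) * t))))"
      proof (cases "t > 0")
        case True
        have e1: "laguerre_weight \<kappa> t * (1 + t) powr b = t powr (\<kappa> - 1) * exp (- t / 2) * (1 + t) powr b"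
          and e2: "indicator {0<..} t = (1 :: real)"
          using True by (simp_all add: laguerre_weight_def)
        have "0 \<le> t powr (\<kappa> - 1) * exp (- t / 2) * (1 + t) powr b" by (intro mult_nonneg_nonneg) auto
        then show ?thesis
          unfolding e1 e2 mult_1_left real_norm_def
          using le[unfolded eq, OF True] by linarith
      qed (simp add: laguerre_weight_def)
    qed
  qed measurable
qed

text \<open>For \<open>\<beta> \<le> 1\<close> the repulsion \<open>\<bar>x\<bar> powr \<beta>\<close> is not differentiable at 0; a parameter \<open>e > 0\<close>
  regularises it for integration by parts.\<close>

definition pair_product :: "real \<Rightarrow> real \<Rightarrow> nat \<Rightarrow> (nat \<Rightarrow> real) \<Rightarrow> real" where
  "pair_product \<beta> e n l = (\<Prod>j=1..n. \<Prod>i=1..<j. ((l i - l j)\<^sup>2 + e) powr (\<beta> / 2))"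

lemma pair_product_Suc:
  "pair_product \<beta> e (Suc n) l = pair_product \<beta> e n l * (\<Prod>i=1..n. ((l i - l (Suc n))\<^sup>2 + e) powr (\<beta> / 2))"
  by (simp add: pair_product_def atLeastLessThanSuc_atLeastAtMost)

lemma pair_product_cong: "(\<And>i. i \<in> {1..n} \<Longrightarrow> l i = l' i) \<Longrightarrow> pair_product \<beta> e n l = pair_product \<beta> e n l'"
  unfolding pair_product_def by (intro prod.cong refl) auto

lemma pair_product_nonneg [simp]: "pair_product \<beta> e n l \<ge> 0"
  unfolding pair_product_def by (intro prod_nonneg) auto

lemma sq_powr_half: "(x\<^sup>2) powr (\<beta> / 2) = \<bar>x\<bar> powr \<beta>" for x :: real
proof (cases "x = 0")
  case False
  then have "(x\<^sup>2) powr (\<beta> / 2) = (\<bar>x\<bar> powr 2) powr (\<beta> / 2)" by (simp add: powr_numeral)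
  then show ?thesis by (simp only: powr_powr) simp
qed simp

text \<open>Squaring turns the product over \<open>i < j\<close> into one over all ordered pairs of
  distinct indices, whose invariance under permutations is visible.\<close>

lemma prod_pairs_square:
  fixes F :: "nat \<Rightarrow> nat \<Rightarrow> real"
  assumes sym: "\<And>i j. F i j = F j i"
  shows "(\<Prod>j=1..n. \<Prod>i=1..<j. F i j)\<^sup>2 = (\<Prod>j=1..n. \<Prod>i\<in>{1..n}-{j}. F i j)"
proof (induction n)
  case (Suc n)
  have "(\<Prod>j=1..Suc n. \<Prod>i\<in>{1..Suc n}-{j}. F i j)
     = (\<Prod>j=1..n. \<Prod>i\<in>{1..Suc n}-{j}. F i j) * (\<Prod>i=1..n. F i (Suc n))"
    by (subst prod.nat_ivl_Suc') (auto intro!: arg_cong2[where f="(*)"] prod.cong)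
  also have "(\<Prod>j=1..n. \<Prod>i\<in>{1..Suc n}-{j}. F i j) = (\<Prod>j=1..n. F (Suc n) j * (\<Prod>i\<in>{1..n}-{j}. F i j))"
  proof (intro prod.cong refl)
    fix j assume "j \<in> {1..n}"
    then have "{1..Suc n}-{j} = insert (Suc n) ({1..n}-{j})" by auto
    then show "(\<Prod>i\<in>{1..Suc n}-{j}. F i j) = F (Suc n) j * (\<Prod>i\<in>{1..n}-{j}. F i j)" by simp
  qed
  also have "\<dots> = (\<Prod>i=1..n. F i (Suc n)) * (\<Prod>j=1..n. \<Prod>i=1..<j. F i j)\<^sup>2"
    by (simp only: prod.distrib Suc.IH sym[of "Suc n"])
  finally show ?case
    by (simp add: atLeastLessThanSuc_atLeastAtMost power2_eq_square mult_ac)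
qed simp

lemma pair_product_permute:
  assumes "s permutes {1..n}"
  shows "pair_product \<beta> e n (\<lambda>i. l (s i)) = pair_product \<beta> e n l"
proof -
  let ?F = "\<lambda>i j. ((l i - l j)\<^sup>2 + e) powr (\<beta> / 2)"
  have sym: "?F i j = ?F j i" for i j by (simp add: power2_commute)
  have "(pair_product \<beta> e n (\<lambda>i. l (s i)))\<^sup>2 = (\<Prod>j=1..n. \<Prod>i\<in>{1..n}-{j}. ?F (s i) (s j))"
    unfolding pair_product_def by (rule prod_pairs_square) (rule sym)
  also have "\<dots> = (\<Prod>j=1..n. \<Prod>i\<in>{1..n}-{s j}. ?F i (s j))"
  proof (rule prod.cong[OF refl])
    fix j assume "j \<in> {1..n}"
    have "s ` ({1..n} - {j}) = {1..n} - {s j}"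
      using permutes_image[OF assms] permutes_inj[OF assms] by (simp add: image_set_diff)
    then show "(\<Prod>i\<in>{1..n}-{j}. ?F (s i) (s j)) = (\<Prod>i\<in>{1..n}-{s j}. ?F i (s j))"
      by (metis (no_types, lifting) permutes_inj_on[OF assms] prod.reindex_cong)
  qed
  also have "\<dots> = (\<Prod>j=1..n. \<Prod>i\<in>{1..n}-{j}. ?F i j)"
    by (rule prod.permute[OF assms, symmetric, unfolded o_def])
  also have "\<dots> = (pair_product \<beta> e n l)\<^sup>2"
    unfolding pair_product_def by (rule prod_pairs_square[symmetric]) (rule sym)
  finally show ?thesis
    by (rule power2_eq_imp_eq) simp_all
qed

lemma measurable_pair_product [measurable]:
  "pair_product \<beta> e n \<in> borel_measurable (lebesgue_on_indices {1..n})"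
  unfolding pair_product_def by measurable

text \<open>Bounds the interaction of two particles by a product of one-variable factors, uniformly
  in the regularisation. Dominating functions can then be integrated coordinate by
  coordinate.\<close>

lemma pair_factor_le:
  fixes a t :: real
  assumes "a \<ge> 0" "t \<ge> 0" "0 \<le> e" "e \<le> 1" "\<beta> > 0"
  shows "((a - t)\<^sup>2 + e) powr (\<beta> / 2) \<le> (1 + a) powr \<beta> * (1 + t) powr \<beta>"
proof -
  have "(a - t)\<^sup>2 + e \<le> ((1 + a) * (1 + t))\<^sup>2"
  proof -
    have "(a - t)\<^sup>2 + e \<le> (a + t)\<^sup>2 + 1"
      using assms(4) mult_nonneg_nonneg[OF assms(1,2)] by (simp add: power2_eq_square algebra_simps)
    also have "\<dots> \<le> (1 + a + t)\<^sup>2" using assms by (simp add: power2_eq_square algebra_simps)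
    also have "\<dots> \<le> ((1 + a) * (1 + t))\<^sup>2"
      using assms by (intro power_mono) (auto simp: algebra_simps)
    finally show ?thesis .
  qed
  then have "((a - t)\<^sup>2 + e) powr (\<beta> / 2) \<le> (((1 + a) * (1 + t))\<^sup>2) powr (\<beta> / 2)"
    using assms by (intro powr_mono2) auto
  also have "\<dots> = ((1 + a) * (1 + t)) powr \<beta>" using assms by (simp add: sq_powr_half)
  finally show ?thesis using assms by (simp add: powr_mult)
qed

text \<open>Each coordinate takes part in \<open>n - 1\<close> pairs and pays a factor
  \<open>(1 + l i) powr \<beta>\<close> for each of them.\<close>

lemma pair_product_le:
  assumes "\<And>i. i \<in> {1..n} \<Longrightarrow> l i \<ge> 0" "0 \<le> e" "e \<le> 1" "\<beta> > 0"
  shows "pair_product \<beta> e n l \<le> (\<Prod>i=1..n. (1 + l i) powr (\<beta> * n))"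
  using assms(1)
proof (induction n)
  case 0
  then show ?case by (simp add: pair_product_def)
next
  case (Suc n)
  have nn: "l i \<ge> 0" if "i \<in> {1..Suc n}" for i using Suc.prems that by auto
  have "pair_product \<beta> e (Suc n) l
     \<le> (\<Prod>i=1..n. (1 + l i) powr (\<beta> * n)) * (\<Prod>i=1..n. (1 + l i) powr \<beta> * (1 + l (Suc n)) powr \<beta>)"
    unfolding pair_product_Suc
    using nn assms(2-) by (intro mult_mono Suc.IH prod_mono prod_nonneg conjI pair_factor_le) auto
  also have "\<dots> = (\<Prod>i=1..n. (1 + l i) powr (\<beta> * Suc n)) * (1 + l (Suc n)) powr (\<beta> * n)"
    using nn[of "Suc n"] by (simp add: prod.distrib powr_powr[symmetric] powr_realpow powr_add algebra_simps)
  also have "\<dots> \<le> (\<Prod>i=1..n. (1 + l i) powr (\<beta> * Suc n)) * (1 + l (Suc n)) powr (\<beta> * Suc n)"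
    using nn[of "Suc n"] assms by (intro mult_left_mono powr_mono prod_nonneg) (auto simp: algebra_simps)
  finally show ?case by simp
qed

lemma integrable_laguerre_bound:
  fixes n :: nat
  assumes [measurable]: "g \<in> borel_measurable (lebesgue_on_indices {1..n})"
    and bound: "\<And>l. \<bar>g l :: real\<bar> \<le> C * (\<Prod>i=1..n. laguerre_weight \<kappa> (l i) * (1 + l i) powr b)"
    and "\<kappa> > 0"
  shows "integrable (lebesgue_on_indices {1..n}) g"
proof (rule Bochner_Integration.integrable_bound)
  show "integrable (lebesgue_on_indices {1..n}) (\<lambda>l. C * (\<Prod>i=1..n. laguerre_weight \<kappa> (l i) * (1 + l i) powr b))"
    by (intro integrable_mult_right lborel_product.product_integrable_prod integrable_laguerre_weight_powr)
       (use assms(3) in simp_all)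
  show "AE l in lebesgue_on_indices {1..n}. norm (g l) \<le> norm (C * (\<Prod>i=1..n. laguerre_weight \<kappa> (l i) * (1 + l i) powr b))"
    using bound by (intro AE_I2) (auto intro: order_trans[OF _ abs_ge_self])
qed fact


section \<open>Integration by parts in one coordinate\<close>

lemma integral_FTC_positive_reals:
  fixes F f :: "real \<Rightarrow> real"
  assumes F: "\<And>t. t > 0 \<Longrightarrow> (F has_real_derivative f t) (at t)"
    and f: "\<And>t. t > 0 \<Longrightarrow> isCont f t"
    and int: "integrable lborel (\<lambda>t. indicator {0<..} t * f t)"
    and A: "(F \<longlongrightarrow> A) (at_right 0)" and B: "(F \<longlongrightarrow> B) at_top"
  shows "(\<integral>t. indicator {0<..} t * f t \<partial>lborel) = B - A"
proof -
  have ei: "einterval 0 \<infinity> = {0::real<..}"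
    by (auto simp: einterval_def zero_ereal_def)
  have "(LBINT x=0..\<infinity>. f x) = B - A"
  proof (rule interval_integral_FTC_integrable)
    show "(F has_vector_derivative f x) (at x)" if "0 < ereal x" for x
      using F[of x] that by (simp add: has_real_derivative_iff_has_vector_derivative zero_ereal_def)
    show "isCont f x" if "0 < ereal x" for x using f[of x] that by (simp add: zero_ereal_def)
    show "set_integrable lborel (einterval 0 \<infinity>) f" using int by (simp add: ei set_integrable_def)
    show "((F \<circ> real_of_ereal) \<longlongrightarrow> A) (at_right 0)"
      using A by (simp add: zero_ereal_def ereal_tendsto_simps)
    show "((F \<circ> real_of_ereal) \<longlongrightarrow> B) (at_left \<infinity>)"
      using B by (simp add: ereal_tendsto_simps)
  qed simp
  then show ?thesis
    by (simp add: interval_lebesgue_integral_def ei set_lebesgue_integral_def)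
qed

lemma pair_factors_has_derivative:
  fixes \<beta> e t :: real and n :: nat and l :: "nat \<Rightarrow> real"
  assumes "e > 0"
  shows "((\<lambda>t. \<Prod>i=1..n. ((l i - t)\<^sup>2 + e) powr (\<beta> / 2)) has_real_derivative
     (\<Prod>i=1..n. ((l i - t)\<^sup>2 + e) powr (\<beta> / 2)) * (\<Sum>i=1..n. \<beta> * (t - l i) / ((l i - t)\<^sup>2 + e))) (at t)"
proof (induction n)
  case (Suc n)
  have pos: "(l (Suc n) - t)\<^sup>2 + e > 0" using assms by (simp add: add_nonneg_pos)
  have "((\<lambda>t. ((l (Suc n) - t)\<^sup>2 + e) powr (\<beta> / 2)) has_real_derivative
      ((l (Suc n) - t)\<^sup>2 + e) powr (\<beta> / 2) * (\<beta> * (t - l (Suc n)) / ((l (Suc n) - t)\<^sup>2 + e))) (at t)"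
  proof (rule DERIV_cong[OF DERIV_fun_powr[where r = "\<beta> / 2"]])
    show "((\<lambda>t. (l (Suc n) - t)\<^sup>2 + e) has_real_derivative 2 * (t - l (Suc n))) (at t)"
      by (auto intro!: derivative_eq_intros)
    have half: "\<beta> / 2 * (A / B) * (2 * d) = A * (\<beta> * d / B)" for A B d :: real by simp
    have "((l (Suc n) - t)\<^sup>2 + e) powr (\<beta> / 2 - 1) = ((l (Suc n) - t)\<^sup>2 + e) powr (\<beta> / 2) / ((l (Suc n) - t)\<^sup>2 + e)"
      using pos by (simp add: powr_diff)
    then show "\<beta> / 2 * ((l (Suc n) - t)\<^sup>2 + e) powr (\<beta> / 2 - of_nat 1) * (2 * (t - l (Suc n)))
        = ((l (Suc n) - t)\<^sup>2 + e) powr (\<beta> / 2) * (\<beta> * (t - l (Suc n)) / ((l (Suc n) - t)\<^sup>2 + e))"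
      using half[of _ "(l (Suc n) - t)\<^sup>2 + e" "t - l (Suc n)"] by (simp only: of_nat_1)
  qed (rule pos)
  from DERIV_mult[OF Suc.IH this] show ?case
    by (simp add: algebra_simps)
qed simp

lemma pair_factors_le:
  fixes \<beta> e t :: real and n :: nat and l :: "nat \<Rightarrow> real"
  assumes "\<And>i. i \<in> {1..n} \<Longrightarrow> l i \<ge> 0" "t \<ge> 0" "0 \<le> e" "e \<le> 1" "\<beta> > 0"
  shows "(\<Prod>i=1..n. ((l i - t)\<^sup>2 + e) powr (\<beta> / 2))
     \<le> (\<Prod>i=1..n. (1 + l i) powr \<beta>) * (1 + t) powr (\<beta> * n)"
proof -
  have "(\<Prod>i=1..n. ((l i - t)\<^sup>2 + e) powr (\<beta> / 2)) \<le> (\<Prod>i=1..n. (1 + l i) powr \<beta> * (1 + t) powr \<beta>)"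
    using assms by (intro prod_mono conjI pair_factor_le) auto
  also have "\<dots> = (\<Prod>i=1..n. (1 + l i) powr \<beta>) * (1 + t) powr (\<beta> * n)"
    using assms(2) by (simp add: prod.distrib powr_powr[symmetric] powr_realpow)
  finally show ?thesis .
qed

lemma abs_le_quadratic:
  fixes x e :: real
  assumes "0 < e" "e \<le> 1"
  shows "\<bar>x\<bar> \<le> (x\<^sup>2 + e) / e"
proof -
  have "\<bar>x\<bar> * e \<le> x\<^sup>2 + e"
  proof (cases "\<bar>x\<bar> \<le> 1")
    case True
    then show ?thesis using assms mult_right_mono[OF True, of e] by (smt (verit) zero_le_power2)
  next
    case False
    then have "\<bar>x\<bar> * e \<le> \<bar>x\<bar> * \<bar>x\<bar>" using assms by (intro mult_left_mono) auto
    then show ?thesis using assms by (simp add: power2_eq_square)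
  qed
  then show ?thesis using assms by (simp add: field_simps)
qed

lemma abs_regularised_pole_le:
  fixes a t e :: real
  assumes "0 < e" "e \<le> 1"
  shows "\<bar>(t - a) / ((a - t)\<^sup>2 + e)\<bar> \<le> 1 / e"
proof -
  have "(a - t)\<^sup>2 + e > 0" using assms by (simp add: add_nonneg_pos)
  then show ?thesis
    using abs_le_quadratic[OF assms, of "t - a"] assms
    by (simp add: abs_divide power2_commute[of a t] field_simps)
qed

context
  fixes \<beta> e :: real and n :: nat and l :: "nat \<Rightarrow> real"
  assumes \<beta>: "\<beta> > 0" and e: "0 < e" "e \<le> 1" and l: "\<And>i. i \<in> {1..n} \<Longrightarrow> l i \<ge> 0"
begin

private definition "P t = (\<Prod>i=1..n. ((l i - t)\<^sup>2 + e) powr (\<beta> / 2))"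
private definition "D t = (\<Sum>i=1..n. \<beta> * (t - l i) / ((l i - t)\<^sup>2 + e))"

private lemma P_deriv: "(P has_real_derivative P t * D t) (at t)"
  using pair_factors_has_derivative[OF e(1)] unfolding P_def D_def .

private lemma P_cont: "isCont P t" using P_deriv by (rule DERIV_isCont)

private lemma D_cont: "isCont D t"
proof -
  have "(l i - t)\<^sup>2 + e \<noteq> 0" for i using e(1) by (smt (verit) zero_le_power2)
  then show ?thesis unfolding D_def by (intro continuous_intros) auto
qed

private lemma D_bound: "\<bar>D t\<bar> \<le> \<beta> * n / e"
proof -
  have "\<bar>D t\<bar> \<le> (\<Sum>i=1..n. \<beta> * (1 / e))"
    unfolding D_def
  proof (rule order_trans[OF sum_abs], rule sum_mono)
    fix i
    have "\<bar>\<beta> * (t - l i) / ((l i - t)\<^sup>2 + e)\<bar> = \<beta> * \<bar>(t - l i) / ((l i - t)\<^sup>2 + e)\<bar>"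
      using \<beta> by (simp add: abs_mult abs_divide)
    then show "\<bar>\<beta> * (t - l i) / ((l i - t)\<^sup>2 + e)\<bar> \<le> \<beta> * (1 / e)"
      using abs_regularised_pole_le[OF e, of t "l i"] \<beta> by (simp only: mult_left_mono less_imp_le)
  qed
  then show ?thesis by (simp add: mult.commute)
qed

private lemma P_meas [measurable]: "P \<in> borel_measurable borel"
  by (intro borel_measurable_continuous_onI continuous_at_imp_continuous_on ballI P_cont)

private lemma D_meas [measurable]: "D \<in> borel_measurable borel"
  by (intro borel_measurable_continuous_onI continuous_at_imp_continuous_on ballI D_cont)

private definition "C = (\<Prod>i=1..n. (1 + l i) powr \<beta>)"

private lemma P_bound: "t \<ge> 0 \<Longrightarrow> P t \<le> C * (1 + t) powr (\<beta> * n)"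
  unfolding P_def C_def using pair_factors_le[of n l t e \<beta>] \<beta> e l by simp

private lemma P_nonneg: "P t \<ge> 0" unfolding P_def by (intro prod_nonneg) auto
private lemma C_nonneg: "C \<ge> 0" unfolding C_def by (intro prod_nonneg) auto

private lemma weight_P_integrable:
  assumes "\<kappa> > 0" and [measurable]: "q \<in> borel_measurable borel"
    and q: "\<And>t. t > 0 \<Longrightarrow> \<bar>q t\<bar> \<le> K * (1 + t)"
  shows "integrable lborel (\<lambda>t. laguerre_weight \<kappa> t * (P t * q t))"
proof (rule Bochner_Integration.integrable_bound)
  show "integrable lborel (\<lambda>t. C * K * (laguerre_weight \<kappa> t * (1 + t) powr (\<beta> * n + 1)))"
    by (intro integrable_mult_right integrable_laguerre_weight_powr assms)
  show "AE t in lborel. norm (laguerre_weight \<kappa> t * (P t * q t))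
      \<le> norm (C * K * (laguerre_weight \<kappa> t * (1 + t) powr (\<beta> * n + 1)))"
  proof (rule AE_I2)
    fix t :: real
    show "norm (laguerre_weight \<kappa> t * (P t * q t))
      \<le> norm (C * K * (laguerre_weight \<kappa> t * (1 + t) powr (\<beta> * n + 1)))"
    proof (cases "t > 0")
      case True
      have "norm (laguerre_weight \<kappa> t * (P t * q t)) = laguerre_weight \<kappa> t * (P t * \<bar>q t\<bar>)"
        using P_nonneg by (simp add: abs_mult)
      also have "\<dots> \<le> laguerre_weight \<kappa> t * ((C * (1 + t) powr (\<beta> * n)) * (K * (1 + t)))"
        using True P_bound[of t] q[OF True] P_nonneg C_nonneg
        by (intro mult_left_mono mult_mono) auto
      also have "\<dots> = C * K * (laguerre_weight \<kappa> t * (1 + t) powr (\<beta> * n + 1))"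
        using True by (simp add: powr_add mult_ac)
      also have "\<dots> \<le> norm \<dots>" by simp
      finally show ?thesis .
    qed (simp add: laguerre_weight_nonpos)
  qed
qed measurable

private lemma tendsto_at_top:
  "((\<lambda>t. t powr \<kappa> * exp (- t / 2) * P t) \<longlongrightarrow> 0) at_top"
proof (rule tendsto_sandwich[OF _ _ tendsto_const])
  show "eventually (\<lambda>t. 0 \<le> t powr \<kappa> * exp (- t / 2) * P t) at_top"
    using P_nonneg by simp
  show "eventually (\<lambda>t. t powr \<kappa> * exp (- t / 2) * P t
      \<le> C * (t powr \<kappa> * exp (- t / 2) * (1 + t) powr (\<beta> * n))) at_top"
    using eventually_ge_at_top[of 0]
  proof eventually_elim
    case (elim t)
    then have "t powr \<kappa> * exp (- t / 2) * P t \<le> t powr \<kappa> * exp (- t / 2) * (C * (1 + t) powr (\<beta> * n))"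
      using P_bound by (intro mult_left_mono) auto
    then show ?case by (simp add: mult_ac)
  qed
  have "((\<lambda>t. t powr \<kappa> * exp (- t / 2) * (1 + t) powr (\<beta> * n)) \<longlongrightarrow> 0) at_top"
    by real_asymp
  then show "((\<lambda>t. C * (t powr \<kappa> * exp (- t / 2) * (1 + t) powr (\<beta> * n))) \<longlongrightarrow> 0) at_top"
    by (rule tendsto_mult_right_zero)
qed

private lemma has_deriv:
  assumes "t > 0"
  shows "((\<lambda>t. t powr \<kappa> * exp (- t / 2) * P t) has_real_derivative
       t powr (\<kappa> - 1) * exp (- t / 2) * (P t * (\<kappa> - t / 2 + t * D t))) (at t)"
proof -
  have "((\<lambda>t. t powr \<kappa> * exp (- t / 2) * P t) has_real_derivative
     (t powr \<kappa> * exp (- t / 2)) * (P t * D t) + (t powr \<kappa> * (exp (- t / 2) * (-1/2)) + \<kappa> * t powr (\<kappa> - 1) * exp (- t / 2)) * P t) (at t)"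
    using assms by (auto intro!: derivative_eq_intros P_deriv)
  also have "t powr \<kappa> = t powr (\<kappa> - 1) * t" using assms by (simp add: powr_diff)
  finally show ?thesis by (rule DERIV_cong) (simp add: algebra_simps)
qed

text \<open>The integrand is the derivative of \<open>t powr \<kappa> * exp (- t / 2) * P t\<close>,
  which tends to 0 at infinity and, as \<open>\<kappa> > 0\<close>, at 0.\<close>

lemma laguerre_parts:
  assumes \<kappa>: "\<kappa> > 0"
  shows "(\<integral>t. laguerre_weight \<kappa> t * ((\<Prod>i=1..n. ((l i - t)\<^sup>2 + e) powr (\<beta> / 2)) *
      (\<kappa> - t / 2 + (\<Sum>i=1..n. \<beta> * t * (t - l i) / ((l i - t)\<^sup>2 + e)))) \<partial>lborel) = 0"
proof -
  define f where "f t = t powr (\<kappa> - 1) * exp (- t / 2) * (P t * (\<kappa> - t / 2 + t * D t))" for t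
  have int: "integrable lborel (\<lambda>t. laguerre_weight \<kappa> t * (P t * (\<kappa> - t / 2 + t * D t)))"
  proof (rule weight_P_integrable[OF \<kappa>])
    fix t :: real assume t: "t > 0"
    have "\<bar>\<kappa> - t / 2 + t * D t\<bar> \<le> \<kappa> + t / 2 + t * (\<beta> * n / e)"
    proof -
      have "\<bar>t * D t\<bar> \<le> t * (\<beta> * n / e)"
        using t D_bound[of t] by (simp only: abs_mult abs_of_pos mult_left_mono less_imp_le)
      then show ?thesis using \<kappa> t by linarith
    qed
    also have "\<dots> \<le> (\<kappa> + 1 / 2 + \<beta> * n / e) * (1 + t)"
    proof -
      have aux: "\<kappa> + t / 2 + t * B \<le> (\<kappa> + 1 / 2 + B) * (1 + t)" if "B \<ge> 0" for B
      proof -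
        have "(\<kappa> + 1 / 2 + B) * (1 + t) = \<kappa> + t / 2 + t * B + (\<kappa> * t + 1 / 2 + B)"
          by (simp add: field_simps)
        then show ?thesis using that \<kappa> t by simp
      qed
      show ?thesis by (rule aux) (use \<beta> e in auto)
    qed
    finally show "\<bar>\<kappa> - t / 2 + t * D t\<bar> \<le> (\<kappa> + 1 / 2 + \<beta> * n / e) * (1 + t)" .
  qed measurable
  have eq: "indicator {0<..} t * f t = laguerre_weight \<kappa> t * (P t * (\<kappa> - t / 2 + t * D t))" for t
    by (simp add: f_def laguerre_weight_def)
  have "(\<integral>t. indicator {0<..} t * f t \<partial>lborel) = 0 - 0"
  proof (rule integral_FTC_positive_reals)
    show "((\<lambda>t. t powr \<kappa> * exp (- t / 2) * P t) has_real_derivative f t) (at t)" if "t > 0" for t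
      unfolding f_def by (rule has_deriv[OF that])
    show "isCont f t" if "t > 0" for t
      unfolding f_def using that by (intro continuous_intros P_cont D_cont) auto
    show "integrable lborel (\<lambda>t. indicator {0<..} t * f t)" unfolding eq by (rule int)
    have "((\<lambda>t. t powr \<kappa> * exp (- t / 2)) \<longlongrightarrow> 0) (at_right 0)" using \<kappa> by real_asymp
    moreover have "(P \<longlongrightarrow> P 0) (at_right 0)"
      using P_cont[of 0] by (simp add: isCont_def filterlim_at_split)
    ultimately show "((\<lambda>t. t powr \<kappa> * exp (- t / 2) * P t) \<longlongrightarrow> 0) (at_right 0)"
      using tendsto_mult[of _ 0 _ P "P 0"] by fastforce
  qed (rule tendsto_at_top)
  then show ?thesis
    unfolding eq by (simp add: P_def D_def sum_distrib_left mult_ac)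
qed

text \<open>For shape 1 the function \<open>exp (- t / 2) * P t\<close> is differentiated instead.
  It does not vanish at 0, and the boundary value \<open>P 0\<close> is what remains: the other
  particles now feel a particle sitting at the origin.\<close>

lemma laguerre_parts_boundary:
  shows "(\<integral>t. laguerre_weight 1 t * ((\<Prod>i=1..n. ((l i - t)\<^sup>2 + e) powr (\<beta> / 2)) *
      (- 1 / 2 + (\<Sum>i=1..n. \<beta> * (t - l i) / ((l i - t)\<^sup>2 + e)))) \<partial>lborel)
     = - (\<Prod>i=1..n. ((l i)\<^sup>2 + e) powr (\<beta> / 2))"
proof -
  define f where "f t = exp (- t / 2) * (P t * (- 1 / 2 + D t))" for t
  have int: "integrable lborel (\<lambda>t. laguerre_weight 1 t * (P t * (- 1 / 2 + D t)))"
  proof (rule weight_P_integrable)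
    fix t :: real assume t: "t > 0"
    have "\<bar>- 1 / 2 + D t\<bar> \<le> 1 / 2 + \<beta> * n / e"
      using D_bound[of t] by linarith
    also have "\<dots> \<le> (1 / 2 + \<beta> * n / e) * (1 + t)"
      using t \<beta> e mult_left_mono[of 1 "1 + t" "1 / 2 + \<beta> * n / e"] by simp
    finally show "\<bar>- 1 / 2 + D t\<bar> \<le> (1 / 2 + \<beta> * n / e) * (1 + t)" .
  qed simp_all
  have eq: "indicator {0<..} t * f t = laguerre_weight 1 t * (P t * (- 1 / 2 + D t))" for t
    by (simp add: f_def laguerre_weight_def indicator_def)
  have "(\<integral>t. indicator {0<..} t * f t \<partial>lborel) = 0 - P 0"
  proof (rule integral_FTC_positive_reals)
    show "((\<lambda>t. exp (- t / 2) * P t) has_real_derivative f t) (at t)" for t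
      unfolding f_def by (auto intro!: derivative_eq_intros P_deriv simp: algebra_simps)
    show "isCont f t" for t
      unfolding f_def by (intro continuous_intros P_cont D_cont) auto
    show "integrable lborel (\<lambda>t. indicator {0<..} t * f t)" unfolding eq by (rule int)
    have "(P \<longlongrightarrow> P 0) (at_right 0)"
      using P_cont[of 0] by (simp add: isCont_def filterlim_at_split)
    moreover have "((\<lambda>t::real. exp (- t / 2)) \<longlongrightarrow> 1) (at_right 0)" by real_asymp
    ultimately show "((\<lambda>t. exp (- t / 2) * P t) \<longlongrightarrow> P 0) (at_right 0)"
      using tendsto_mult[of _ 1 _ P "P 0"] by fastforce
    have "eventually (\<lambda>t. t powr 0 * exp (- t / 2) * P t = exp (- t / 2) * P t) at_top"
      using eventually_gt_at_top[of 0] by eventually_elim simp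
    then show "((\<lambda>t. exp (- t / 2) * P t) \<longlongrightarrow> 0) at_top"
      by (rule Lim_transform_eventually[OF tendsto_at_top])
  qed
  then show ?thesis
    unfolding eq by (simp add: P_def D_def)
qed

end


section \<open>Aomoto's recursion\<close>

lemma measurable_coordinate:
  "i \<in> I \<Longrightarrow> (\<lambda>l. l i) \<in> borel_measurable (lebesgue_on_indices I)"
  using measurable_component_singleton[of i I "\<lambda>_. lborel"] by simp

lemma measurable_monomial:
  fixes m n :: nat
  assumes "m \<le> n"
  shows "(\<lambda>l. \<Prod>i=1..m. l i) \<in> borel_measurable (lebesgue_on_indices {1..n})"
  using assms by (intro borel_measurable_prod measurable_coordinate) auto

definition laguerre_kernel :: "real \<Rightarrow> real \<Rightarrow> real \<Rightarrow> nat \<Rightarrow> (nat \<Rightarrow> real) \<Rightarrow> real" where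
  "laguerre_kernel \<beta> e \<kappa> n l = pair_product \<beta> e n l * (\<Prod>i=1..n. laguerre_weight \<kappa> (l i))"

lemma laguerre_kernel_nonneg [simp]: "laguerre_kernel \<beta> e \<kappa> n l \<ge> 0"
  unfolding laguerre_kernel_def by (intro mult_nonneg_nonneg prod_nonneg) auto

lemma measurable_laguerre_kernel [measurable]:
  "laguerre_kernel \<beta> e \<kappa> n \<in> borel_measurable (lebesgue_on_indices {1..n})"
  unfolding laguerre_kernel_def by measurable

lemma laguerre_kernel_eq_0: "i \<in> {1..n} \<Longrightarrow> l i \<le> 0 \<Longrightarrow> laguerre_kernel \<beta> e \<kappa> n l = 0"
  unfolding laguerre_kernel_def by (subst prod_zero) (auto intro: laguerre_weight_nonpos)

lemma laguerre_kernel_permute: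
  "s permutes {1..n} \<Longrightarrow> laguerre_kernel \<beta> e \<kappa> n (\<lambda>i. l (s i)) = laguerre_kernel \<beta> e \<kappa> n l"
  unfolding laguerre_kernel_def
  by (subst prod.permute[of s "{1..n}" "\<lambda>i. laguerre_weight \<kappa> (l i)"]) (simp_all add: pair_product_permute o_def)

lemma laguerre_kernel_Suc:
  "laguerre_kernel \<beta> e \<kappa> (Suc n) (l(Suc n := t)) =
     laguerre_kernel \<beta> e \<kappa> n l * (laguerre_weight \<kappa> t * (\<Prod>i=1..n. ((l i - t)\<^sup>2 + e) powr (\<beta> / 2)))"
proof -
  have "pair_product \<beta> e n (l(Suc n := t)) = pair_product \<beta> e n l" by (rule pair_product_cong) auto
  moreover have "(\<Prod>i=1..n. (((l(Suc n := t)) i - t)\<^sup>2 + e) powr (\<beta> / 2)) = (\<Prod>i=1..n. ((l i - t)\<^sup>2 + e) powr (\<beta> / 2))"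
    by (intro prod.cong) auto
  moreover have "(\<Prod>i=1..n. laguerre_weight \<kappa> ((l(Suc n := t)) i)) = (\<Prod>i=1..n. laguerre_weight \<kappa> (l i))"
    by (intro prod.cong) auto
  ultimately show ?thesis
    by (simp add: laguerre_kernel_def pair_product_Suc mult_ac)
qed

lemma laguerre_kernel_le:
  assumes "0 \<le> e" "e \<le> 1" "\<beta> > 0" "\<And>i. i \<in> {1..n} \<Longrightarrow> l i > 0"
    and q: "\<bar>q\<bar> \<le> C * (\<Prod>i=1..n. (1 + l i) powr b)"
  shows "\<bar>laguerre_kernel \<beta> e \<kappa> n l * q\<bar> \<le> C * (\<Prod>i=1..n. laguerre_weight \<kappa> (l i) * (1 + l i) powr (\<beta> * n + b))"
proof -
  have "\<bar>laguerre_kernel \<beta> e \<kappa> n l * q\<bar> = laguerre_kernel \<beta> e \<kappa> n l * \<bar>q\<bar>" by (simp add: abs_mult)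
  also have "\<dots> \<le> ((\<Prod>i=1..n. (1 + l i) powr (\<beta> * n)) * (\<Prod>i=1..n. laguerre_weight \<kappa> (l i))) * (C * (\<Prod>i=1..n. (1 + l i) powr b))"
    unfolding laguerre_kernel_def
    using assms by (intro mult_mono pair_product_le q mult_right_mono prod_nonneg mult_nonneg_nonneg) (auto simp: less_imp_le)
  also have "\<dots> = C * (\<Prod>i=1..n. laguerre_weight \<kappa> (l i) * (1 + l i) powr (\<beta> * n + b))"
    by (simp add: prod.distrib powr_add mult_ac)
  finally show ?thesis .
qed

lemma laguerre_kernel_le':
  assumes "0 \<le> e" "e \<le> 1" "\<beta> > 0"
    and q: "(\<And>i. i \<in> {1..n} \<Longrightarrow> l i > 0) \<Longrightarrow> \<bar>q\<bar> \<le> C * (\<Prod>i=1..n. (1 + l i) powr b)"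
  shows "\<bar>laguerre_kernel \<beta> e \<kappa> n l * q\<bar> \<le> C * (\<Prod>i=1..n. laguerre_weight \<kappa> (l i) * (1 + l i) powr (\<beta> * n + b))"
proof (cases "\<forall>i\<in>{1..n}. l i > 0")
  case True
  then show ?thesis using laguerre_kernel_le[OF assms(1-3) _ q] by blast
next
  case False
  then obtain i where i: "i \<in> {1..n}" "l i \<le> 0" by auto
  have p0: "(\<Prod>i=1..n. laguerre_weight \<kappa> (l i) * (1 + l i) powr (\<beta> * n + b)) = 0"
    using i by (subst prod_zero) (auto intro!: bexI[of _ i] simp: laguerre_weight_nonpos)
  show ?thesis unfolding laguerre_kernel_eq_0[of i n l, OF i] p0 by simp
qed

lemma integrable_laguerre_kernel:
  assumes "0 \<le> e" "e \<le> 1" "\<beta> > 0" "\<kappa> > 0"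
    and [measurable]: "q \<in> borel_measurable (lebesgue_on_indices {1..n})"
    and q: "\<And>l. (\<And>i. i \<in> {1..n} \<Longrightarrow> l i > 0) \<Longrightarrow> \<bar>q l\<bar> \<le> C * (\<Prod>i=1..n. (1 + l i) powr b)"
  shows "integrable (lebesgue_on_indices {1..n}) (\<lambda>l. laguerre_kernel \<beta> e \<kappa> n l * q l)"
proof (rule integrable_laguerre_bound)
  show "\<bar>laguerre_kernel \<beta> e \<kappa> n l * q l\<bar> \<le> C * (\<Prod>i=1..n. laguerre_weight \<kappa> (l i) * (1 + l i) powr (\<beta> * n + b))" for l
    using assms by (intro laguerre_kernel_le') auto
qed (use \<open>\<kappa> > 0\<close> in measurable)

lemma one_plus_le_prod:
  fixes n :: nat
  assumes "\<And>i. i \<in> {1..n} \<Longrightarrow> l i > (0 :: real)" "k \<in> {1..n}"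
  shows "1 + l k \<le> (\<Prod>i=1..n. (1 + l i) powr 1)"
proof -
  have "(\<Prod>i\<in>{k}. (1 + l i) powr 1) \<le> (\<Prod>i=1..n. (1 + l i) powr 1)"
    using assms by (intro prod_mono2) (auto simp: add_nonneg_nonneg less_imp_le)
  then show ?thesis using assms(1)[of k] assms(2) by simp
qed

lemma prod_le_prod_one_plus:
  fixes n :: nat
  assumes "\<And>i. i \<in> {1..n} \<Longrightarrow> l i > (0 :: real)" "m \<le> n"
  shows "\<bar>\<Prod>i=1..m. l i\<bar> \<le> (\<Prod>i=1..n. (1 + l i) powr 1)"
proof -
  have pos: "l i > 0" if "i \<in> {1..m}" for i using that assms by auto
  have "\<bar>\<Prod>i=1..m. l i\<bar> = (\<Prod>i=1..m. l i)" using pos by (intro abs_of_nonneg prod_nonneg) (auto simp: less_imp_le)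
  also have "\<dots> \<le> (\<Prod>i=1..m. (1 + l i) powr 1)"
    using pos by (intro prod_mono) (fastforce simp: less_imp_le)
  also have "\<dots> \<le> (\<Prod>i=1..n. (1 + l i) powr 1)"
    using assms by (intro prod_mono2) (auto simp: less_imp_le)
  finally show ?thesis .
qed

lemma prod_one_plus_combine:
  fixes n :: nat
  assumes "\<And>i. i \<in> {1..n} \<Longrightarrow> l i > (0 :: real)"
  shows "(\<Prod>i=1..n. (1 + l i) powr a) * (\<Prod>i=1..n. (1 + l i) powr b) = (\<Prod>i=1..n. (1 + l i) powr (a + b))"
  by (simp add: prod.distrib powr_add)

text \<open>Exchanging a particle inside the monomial with one outside replaces \<open>l i\<close>
  by \<open>l k\<close>. The factor \<open>l i\<close> on the left completes both sides to the same
  symmetric product without a division.\<close>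

lemma prod_transpose_swap:
  fixes l :: "nat \<Rightarrow> real"
  assumes "i \<in> {1..m}" "m < k"
  shows "(\<Prod>j=1..m. l (Transposition.transpose i k j)) * l i = (\<Prod>j=1..m. l j) * l k"
proof -
  have "(\<Prod>j\<in>{1..m}-{i}. l (Transposition.transpose i k j)) = (\<Prod>j\<in>{1..m}-{i}. l j)"
    using assms by (intro prod.cong) (auto simp: Transposition.transpose_def)
  then show ?thesis
    using assms by (subst (1 2) prod.remove[of _ i]) (auto simp: mult_ac)
qed

lemma prod_transpose_fix:
  fixes l :: "nat \<Rightarrow> real"
  assumes "m < i" "m < k"
  shows "(\<Prod>j=1..m. l (Transposition.transpose i k j)) = (\<Prod>j=1..m. l j)"
  using assms by (intro prod.cong) (auto simp: Transposition.transpose_def)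

lemma pair_product_tendsto:
  assumes "\<beta> > 0" "e \<longlonglongrightarrow> 0" "\<And>k. e k \<ge> 0"
  shows "(\<lambda>k. pair_product \<beta> (e k) n l) \<longlonglongrightarrow> pair_product \<beta> 0 n l"
  unfolding pair_product_def
proof (intro tendsto_prod tendsto_powr')
  fix i j
  show "(\<lambda>k. (l i - l j)\<^sup>2 + e k) \<longlonglongrightarrow> (l i - l j)\<^sup>2 + 0"
    by (intro tendsto_intros assms)
  show "(l i - l j)\<^sup>2 + 0 \<noteq> 0 \<or> 0 < \<beta> / 2 \<and> (\<forall>\<^sub>F k in sequentially. 0 \<le> (l i - l j)\<^sup>2 + e k)"
    using assms by simp
qed simp

text \<open>Dominated convergence as the regularisation is removed. The dominating product is the
  same for all \<open>e k \<le> 1\<close>.\<close>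

lemma integral_laguerre_kernel_tendsto:
  assumes "\<beta> > 0" "\<kappa> > 0" and e: "e \<longlonglongrightarrow> 0" "\<And>k. e k \<ge> 0" "\<And>k. e k \<le> 1"
    and q [measurable]: "\<And>k. q k \<in> borel_measurable (lebesgue_on_indices {1..n})"
    and r [measurable]: "r \<in> borel_measurable (lebesgue_on_indices {1..n})"
    and lim: "AE l in lebesgue_on_indices {1..n}. (\<lambda>k. q k l) \<longlonglongrightarrow> r l"
    and bound: "\<And>k l. (\<And>i. i \<in> {1..n} \<Longrightarrow> l i > 0) \<Longrightarrow> \<bar>q k l\<bar> \<le> C * (\<Prod>i=1..n. (1 + l i) powr b)"
  shows "(\<lambda>k. \<integral>l. laguerre_kernel \<beta> (e k) \<kappa> n l * q k l \<partial>lebesgue_on_indices {1..n})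
     \<longlonglongrightarrow> (\<integral>l. laguerre_kernel \<beta> 0 \<kappa> n l * r l \<partial>lebesgue_on_indices {1..n})"
proof (rule integral_dominated_convergence)
  show "integrable (lebesgue_on_indices {1..n}) (\<lambda>l. C * (\<Prod>i=1..n. laguerre_weight \<kappa> (l i) * (1 + l i) powr (\<beta> * n + b)))"
    by (intro integrable_mult_right lborel_product.product_integrable_prod integrable_laguerre_weight_powr assms) auto
  show "AE l in lebesgue_on_indices {1..n}. (\<lambda>k. laguerre_kernel \<beta> (e k) \<kappa> n l * q k l) \<longlonglongrightarrow> laguerre_kernel \<beta> 0 \<kappa> n l * r l"
    using lim
  proof eventually_elim
    case (elim l)
    then show ?case
      unfolding laguerre_kernel_def
      by (intro tendsto_mult pair_product_tendsto tendsto_const assms)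
  qed
  show "AE l in lebesgue_on_indices {1..n}. norm (laguerre_kernel \<beta> (e k) \<kappa> n l * q k l)
      \<le> C * (\<Prod>i=1..n. laguerre_weight \<kappa> (l i) * (1 + l i) powr (\<beta> * n + b))" for k
    unfolding real_norm_def using assms by (intro AE_I2 laguerre_kernel_le') auto
qed measurable

lemma integral_linear_combination:
  fixes a b :: "'a \<Rightarrow> real"
  assumes "integrable M a" "integrable M b" "\<And>i. i \<in> I \<Longrightarrow> integrable M (t i)"
  shows "(\<integral>x. u * a x - v * b x + (\<Sum>i\<in>I. w * t i x) \<partial>M)
     = u * (\<integral>x. a x \<partial>M) - v * (\<integral>x. b x \<partial>M) + (\<Sum>i\<in>I. w * (\<integral>x. t i x \<partial>M))"
  using assms by (simp add: Bochner_Integration.integral_add Bochner_Integration.integral_diff Bochner_Integration.integral_sum)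

section \<open>Moments of monomials\<close>

context
  fixes \<beta> \<kappa> :: real and n :: nat
  assumes \<beta>: "\<beta> > 0" and \<kappa>: "\<kappa> > 0"
begin

private abbreviation "K e \<equiv> laguerre_kernel \<beta> e \<kappa> (Suc n)"
private abbreviation "L \<equiv> lebesgue_on_indices {1..Suc n}"

private lemma measurable_last [simp]:
  "(\<lambda>l. l (Suc n)) \<in> borel_measurable (lebesgue_on_indices {Suc 0..Suc n})"
  by (rule measurable_coordinate) simp

private lemma measurable_monomial' [simp]:
  "m \<le> n \<Longrightarrow> (\<lambda>l. prod l {Suc 0..m}) \<in> borel_measurable (lebesgue_on_indices {Suc 0..Suc n})"
  using measurable_monomial[of m "Suc n"] by simp

lemma integrable_kernel_monomial:
  assumes "0 \<le> e" "e \<le> 1" "m \<le> Suc n"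
  shows "integrable L (\<lambda>l. K e l * (\<Prod>i=1..m. l i))"
proof (rule integrable_laguerre_kernel[where C = 1 and b = 1])
  show "(\<lambda>l. \<Prod>i=1..m. l i) \<in> borel_measurable L" by (rule measurable_monomial[OF assms(3)])
  show "\<bar>\<Prod>i=1..m. l i\<bar> \<le> 1 * (\<Prod>i=1..Suc n. (1 + l i) powr 1)" if "\<And>i. i \<in> {1..Suc n} \<Longrightarrow> l i > 0" for l :: "nat \<Rightarrow> real"
    using prod_le_prod_one_plus[of "Suc n" l m, OF that assms(3)] by (simp only: mult_1)
qed (use assms \<beta> \<kappa> in auto)

private lemma integrable_kernel_monomial_mult:
  assumes "0 \<le> e" "e \<le> 1" "m \<le> Suc n" and [measurable]: "q \<in> borel_measurable L"
    and q: "\<And>l. (\<And>i. i \<in> {1..Suc n} \<Longrightarrow> l i > 0) \<Longrightarrow> \<bar>q l\<bar> \<le> C * (1 + l (Suc n))" and C: "C \<ge> 0"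
  shows "integrable L (\<lambda>l. K e l * ((\<Prod>i=1..m. l i) * q l))"
proof (rule integrable_laguerre_kernel[where C = C and b = "1 + 1"])
  have [measurable]: "(\<lambda>l. \<Prod>i=1..m. l i) \<in> borel_measurable L" by (rule measurable_monomial[OF assms(3)])
  show "(\<lambda>l. (\<Prod>i=1..m. l i) * q l) \<in> borel_measurable L" by measurable
  fix l :: "nat \<Rightarrow> real" assume l: "\<And>i. i \<in> {1..Suc n} \<Longrightarrow> l i > 0"
  have "\<bar>(\<Prod>i=1..m. l i) * q l\<bar> \<le> (\<Prod>i=1..Suc n. (1 + l i) powr 1) * (C * (\<Prod>i=1..Suc n. (1 + l i) powr 1))"
    unfolding abs_mult
  proof (intro mult_mono prod_nonneg ballI abs_ge_zero)
    show "\<bar>q l\<bar> \<le> C * (\<Prod>i=1..Suc n. (1 + l i) powr 1)"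
      by (rule order_trans[OF q[of l, OF l] mult_left_mono[OF one_plus_le_prod[of "Suc n" l "Suc n", OF l] C]]) auto
    show "\<bar>\<Prod>i=1..m. l i\<bar> \<le> (\<Prod>i=1..Suc n. (1 + l i) powr 1)"
      by (rule prod_le_prod_one_plus[OF l assms(3)])
  qed simp
  then show "\<bar>(\<Prod>i=1..m. l i) * q l\<bar> \<le> C * (\<Prod>i=1..Suc n. (1 + l i) powr (1 + 1))"
    using prod_one_plus_combine[of "Suc n" l 1 1] l by (simp only: mult.left_commute[of _ C])
qed (use assms \<beta> \<kappa> in auto)

private lemma integrable_pole_term:
  assumes e: "0 < e" "e \<le> 1" and m: "m \<le> n" and i: "i \<in> {1..n}"
  shows "integrable L (\<lambda>l. K e l * ((\<Prod>i=1..m. l i) * (l (Suc n) * (l (Suc n) - l i) / ((l i - l (Suc n))\<^sup>2 + e))))"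
proof (rule integrable_kernel_monomial_mult[where C = "1 / e"])
  show "(\<lambda>l. l (Suc n) * (l (Suc n) - l i) / ((l i - l (Suc n))\<^sup>2 + e)) \<in> borel_measurable L"
  proof -
    have [measurable]: "(\<lambda>l. l i) \<in> borel_measurable L" using i by (intro measurable_coordinate) auto
    have [measurable]: "(\<lambda>l. l (Suc n)) \<in> borel_measurable L" by (intro measurable_coordinate) auto
    show ?thesis by measurable
  qed
  fix l :: "nat \<Rightarrow> real" assume l: "\<And>i. i \<in> {1..Suc n} \<Longrightarrow> l i > 0"
  have "\<bar>l (Suc n) * (l (Suc n) - l i) / ((l i - l (Suc n))\<^sup>2 + e)\<bar> = l (Suc n) * \<bar>(l (Suc n) - l i) / ((l i - l (Suc n))\<^sup>2 + e)\<bar>"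
    using l[of "Suc n"] by (simp add: abs_mult abs_divide)
  also have "\<dots> \<le> l (Suc n) * (1 / e)"
    using l[of "Suc n"] abs_regularised_pole_le[OF e] by (intro mult_left_mono) auto
  also have "\<dots> \<le> 1 / e * (1 + l (Suc n))" using e by (simp add: field_simps)
  finally show "\<bar>l (Suc n) * (l (Suc n) - l i) / ((l i - l (Suc n))\<^sup>2 + e)\<bar> \<le> 1 / e * (1 + l (Suc n))" .
qed (use assms in auto)

text \<open>The monomial contains no \<open>l (Suc n)\<close>, so for frozen \<open>l 1\<close>,
  ..., \<open>l n\<close> the integral over the last coordinate is a multiple of the one in
  \<open>laguerre_parts\<close> and vanishes.\<close>

private lemma kernel_parts:
  assumes e: "0 < e" "e \<le> 1" and m: "m \<le> n"
  shows "(\<integral>l. K e l * ((\<Prod>i=1..m. l i) * (\<kappa> - l (Suc n) / 2 +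
     (\<Sum>i=1..n. \<beta> * (l (Suc n) * (l (Suc n) - l i) / ((l i - l (Suc n))\<^sup>2 + e))))) \<partial>L) = 0" (is "integral\<^sup>L L ?g = 0")
    and "integrable L (\<lambda>l. K e l * ((\<Prod>i=1..m. l i) * (\<kappa> - l (Suc n) / 2 +
     (\<Sum>i=1..n. \<beta> * (l (Suc n) * (l (Suc n) - l i) / ((l i - l (Suc n))\<^sup>2 + e))))))"
proof -
  have g: "?g = (\<lambda>l. \<kappa> * (K e l * (\<Prod>i=1..m. l i)) - 1 / 2 * (K e l * ((\<Prod>i=1..m. l i) * l (Suc n)))
     + (\<Sum>i=1..n. \<beta> * (K e l * ((\<Prod>i=1..m. l i) * (l (Suc n) * (l (Suc n) - l i) / ((l i - l (Suc n))\<^sup>2 + e))))))"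
    by (rule ext) (simp add: ring_distribs sum_distrib_left mult_ac)
  have "integrable L (\<lambda>l. K e l * ((\<Prod>i=1..m. l i) * l (Suc n)))"
    using e m by (intro integrable_kernel_monomial_mult[where C = 1]) (auto simp: less_imp_le)
  then show int: "integrable L ?g"
    unfolding g using e m
    by (intro Bochner_Integration.integrable_add Bochner_Integration.integrable_diff
          integrable_mult_right Bochner_Integration.integrable_sum integrable_pole_term integrable_kernel_monomial) auto
  have ins: "{1..Suc n} = insert (Suc n) {1..n}" by auto
  have "integral\<^sup>L L ?g = (\<integral>l. \<integral>t. ?g (l(Suc n := t)) \<partial>lborel \<partial>lebesgue_on_indices {1..n})"
    using int unfolding ins by (intro lborel_product.product_integral_insert) auto
  also have "\<dots> = (\<integral>l. 0 \<partial>lebesgue_on_indices {1..n})"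
  proof (rule Bochner_Integration.integral_cong[OF refl])
    fix l :: "nat \<Rightarrow> real"
    show "(\<integral>t. ?g (l(Suc n := t)) \<partial>lborel) = 0"
    proof (cases "\<forall>i\<in>{1..n}. l i > 0")
      case True
      have 1: "(\<Prod>i=1..m. (l(Suc n := t)) i) = (\<Prod>i=1..m. l i)" for t
        using m by (intro prod.cong) auto
      have 2: "(\<Sum>i=1..n. \<beta> * (t * (t - (l(Suc n := t)) i) / (((l(Suc n := t)) i - t)\<^sup>2 + e)))
          = (\<Sum>i=1..n. \<beta> * t * (t - l i) / ((l i - t)\<^sup>2 + e))" for t
        by (intro sum.cong) auto
      have "?g (l(Suc n := t)) = (laguerre_kernel \<beta> e \<kappa> n l * (\<Prod>i=1..m. l i)) *
          (laguerre_weight \<kappa> t * ((\<Prod>i=1..n. ((l i - t)\<^sup>2 + e) powr (\<beta> / 2)) *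
             (\<kappa> - t / 2 + (\<Sum>i=1..n. \<beta> * t * (t - l i) / ((l i - t)\<^sup>2 + e)))))" for t
        unfolding laguerre_kernel_Suc 1 fun_upd_same 2 by (simp only: mult_ac)
      then show ?thesis
        using laguerre_parts[of \<beta> e n l \<kappa>] \<beta> e \<kappa> True by (simp add: less_imp_le)
    next
      case False
      then obtain i where "i \<in> {1..n}" "l i \<le> 0" by (auto simp: not_less)
      then have "laguerre_kernel \<beta> e \<kappa> n l = 0" by (rule laguerre_kernel_eq_0)
      then show ?thesis unfolding laguerre_kernel_Suc by simp
    qed
  qed
  finally show "integral\<^sup>L L ?g = 0" by simp
qed

private lemma transpose_permutes: "i \<in> {1..n} \<Longrightarrow> Transposition.transpose i (Suc n) permutes {1..Suc n}"
  by (intro permutes_swap_id) auto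

text \<open>For \<open>i \<le> m\<close> the monomial times \<open>l (Suc n)\<close> contains both
  \<open>l i\<close> and \<open>l (Suc n)\<close> and is unchanged when they are exchanged, while
  the pole changes sign. The integral is its own negative.\<close>

private lemma pole_term_eq_0:
  assumes e: "0 < e" "e \<le> 1" and m: "m \<le> n" and i: "i \<in> {1..m}"
  shows "(\<integral>l. K e l * ((\<Prod>i=1..m. l i) * (l (Suc n) * (l (Suc n) - l i) / ((l i - l (Suc n))\<^sup>2 + e))) \<partial>L) = 0"
   (is "integral\<^sup>L L ?g = 0")
proof -
  let ?s = "Transposition.transpose i (Suc n)"
  have i': "i \<in> {1..n}" using i m by auto
  have "?g (\<lambda>j. l (?s j)) = - ?g l" for l
  proof -
    have "(\<Prod>j=1..m. l (?s j)) * l i = (\<Prod>j=1..m. l j) * l (Suc n)"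
      using i m by (intro prod_transpose_swap) auto
    then have "?g (\<lambda>j. l (?s j)) = K e l * (((\<Prod>j=1..m. l j) * l (Suc n)) * (l i - l (Suc n)) / ((l (Suc n) - l i)\<^sup>2 + e))"
      unfolding laguerre_kernel_permute[OF transpose_permutes[OF i']]
      by (simp add: mult.assoc[symmetric])
    also have "\<dots> = - ?g l"
      unfolding power2_commute[of "l (Suc n)" "l i"]
      by (simp add: right_diff_distrib left_diff_distrib diff_divide_distrib mult_ac)
    finally show ?thesis .
  qed
  moreover have "(\<integral>l. ?g (\<lambda>j. l (?s j)) \<partial>L) = integral\<^sup>L L ?g"
    using integrable_pole_term[OF e m i'] transpose_permutes[OF i']
    by (intro integral_lebesgue_permute) auto
  ultimately show ?thesis by simp
qed

text \<open>For \<open>i > m\<close> the exchange of \<open>l i\<close> and \<open>l (Suc n)\<close>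
  leaves the monomial alone. Adding the two versions of the numerator gives
  \<open>(l i - l (Suc n))\<^sup>2\<close>, which cancels the pole up to the regularisation.\<close>

private lemma pole_term_eq_half:
  assumes e: "0 < e" "e \<le> 1" and m: "m < i" and i: "i \<in> {1..n}"
  shows "(\<integral>l. K e l * ((\<Prod>i=1..m. l i) * (l (Suc n) * (l (Suc n) - l i) / ((l i - l (Suc n))\<^sup>2 + e))) \<partial>L)
       = 1 / 2 * (\<integral>l. K e l * ((\<Prod>i=1..m. l i) * ((l i - l (Suc n))\<^sup>2 / ((l i - l (Suc n))\<^sup>2 + e))) \<partial>L)"
   (is "integral\<^sup>L L ?g = 1 / 2 * integral\<^sup>L L ?h")
proof -
  let ?s = "Transposition.transpose i (Suc n)"
  have mn: "m \<le> n" using m i by auto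
  note int = integrable_pole_term[OF e mn i]
  have h: "?h l = ?g l + ?g (\<lambda>j. l (?s j))" for l
  proof -
    have "(\<Prod>j=1..m. l (?s j)) = (\<Prod>j=1..m. l j)"
      using i m by (intro prod_transpose_fix) auto
    then have gs: "?g (\<lambda>j. l (?s j)) = K e l * ((\<Prod>j=1..m. l j) * (l i * (l i - l (Suc n)) / ((l i - l (Suc n))\<^sup>2 + e)))"
      unfolding laguerre_kernel_permute[OF transpose_permutes[OF i]]
      by (simp add: power2_commute)
    have "?g l + ?g (\<lambda>j. l (?s j)) = K e l * ((\<Prod>j=1..m. l j) * ((l (Suc n) * (l (Suc n) - l i) + l i * (l i - l (Suc n))) / ((l i - l (Suc n))\<^sup>2 + e)))"
      unfolding gs by (simp add: distrib_left add_divide_distrib)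
    then show ?thesis by (simp add: power2_eq_square algebra_simps)
  qed
  have perm: "(\<integral>l. ?g (\<lambda>j. l (?s j)) \<partial>L) = integral\<^sup>L L ?g"
    using int transpose_permutes[OF i] by (intro integral_lebesgue_permute) auto
  have int': "integrable L (\<lambda>l. ?g (\<lambda>j. l (?s j)))"
  proof -
    have "integrable (distr L L (\<lambda>l j. l (?s j))) ?g"
      using int transpose_permutes[OF i] by (subst distr_lebesgue_permute) auto
    then show ?thesis
      by (rule integrable_distr[OF measurable_permute_coordinates[OF transpose_permutes[OF i]]])
  qed
  show ?thesis unfolding h using int int' perm by simp
qed

text \<open>Of the \<open>n\<close> pole terms in \<open>kernel_parts\<close>, the first
  \<open>m\<close> vanish, and each of the other \<open>n - m\<close> tends to half the integral of
  the monomial. The limit of the identity reads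
  \<open>\<kappa> * A - B / 2 + \<beta> / 2 * (n - m) * A = 0\<close>, where \<open>B\<close>
  carries the additional factor \<open>l (Suc n)\<close>.\<close>

theorem aomoto:
  assumes m: "m \<le> n"
  shows "(2 * \<kappa> + \<beta> * (real n - real m)) * (\<integral>l. K 0 l * (\<Prod>i=1..m. l i) \<partial>L)
       = (\<integral>l. K 0 l * (\<Prod>i=1..Suc m. l i) \<partial>L)"
proof -
  define e where "e k = inverse (real (Suc k))" for k
  have e: "e \<longlonglongrightarrow> 0" "\<And>k. e k > 0" "\<And>k. e k \<le> 1"
    unfolding e_def using LIMSEQ_inverse_real_of_nat by (auto simp: inverse_le_1_iff)
  have e0: "\<And>k. e k \<ge> 0" using e(2) by (simp add: less_imp_le)
  define A where "A c = (\<integral>l. K c l * (\<Prod>i=1..m. l i) \<partial>L)" for c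
  define B where "B c = (\<integral>l. K c l * ((\<Prod>i=1..m. l i) * l (Suc n)) \<partial>L)" for c
  define H where "H c i = (\<integral>l. K c l * ((\<Prod>i=1..m. l i) * ((l i - l (Suc n))\<^sup>2 / ((l i - l (Suc n))\<^sup>2 + c))) \<partial>L)" for c i
  have mon [measurable]: "(\<lambda>l. \<Prod>i=1..m. l i) \<in> borel_measurable L"
    using m by (intro measurable_monomial) auto
  have coord [measurable]: "(\<lambda>l. l i) \<in> borel_measurable L" if "i \<in> {1..Suc n}" for i
    using that by (rule measurable_coordinate)
  have monb: "\<bar>\<Prod>i=1..m. l i\<bar> \<le> (\<Prod>i=1..Suc n. (1 + l i) powr 1)" if "\<And>i. i \<in> {1..Suc n} \<Longrightarrow> l i > 0" for l :: "nat \<Rightarrow> real"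
    using prod_le_prod_one_plus[of "Suc n" l m, OF that] m by simp
  have eq: "\<kappa> * A (e k) - 1 / 2 * B (e k) + \<beta> / 2 * (\<Sum>i\<in>{Suc m..n}. H (e k) i) = 0" for k
  proof -
    define T where "T i = (\<integral>l. K (e k) l * ((\<Prod>i=1..m. l i) * (l (Suc n) * (l (Suc n) - l i) / ((l i - l (Suc n))\<^sup>2 + e k))) \<partial>L)" for i
    have i1: "integrable L (\<lambda>l. K (e k) l * (\<Prod>i=1..m. l i))"
      using e e0 m by (intro integrable_kernel_monomial) auto
    have i2: "integrable L (\<lambda>l. K (e k) l * ((\<Prod>i=1..m. l i) * l (Suc n)))"
      using e e0 m by (intro integrable_kernel_monomial_mult[where C = 1]) (auto simp: less_imp_le)
    have i3: "integrable L (\<lambda>l. K (e k) l * ((\<Prod>i=1..m. l i) * (l (Suc n) * (l (Suc n) - l i) / ((l i - l (Suc n))\<^sup>2 + e k))))" if "i \<in> {1..n}" for i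
      using integrable_pole_term e m that by blast
    have "0 = (\<integral>l. K (e k) l * ((\<Prod>i=1..m. l i) * (\<kappa> - l (Suc n) / 2 +
       (\<Sum>i=1..n. \<beta> * (l (Suc n) * (l (Suc n) - l i) / ((l i - l (Suc n))\<^sup>2 + e k))))) \<partial>L)"
      using kernel_parts(1)[OF e(2,3) m] by simp
    also have "\<dots> = (\<integral>l. \<kappa> * (K (e k) l * (\<Prod>i=1..m. l i)) - 1 / 2 * (K (e k) l * ((\<Prod>i=1..m. l i) * l (Suc n)))
     + (\<Sum>i=1..n. \<beta> * (K (e k) l * ((\<Prod>i=1..m. l i) * (l (Suc n) * (l (Suc n) - l i) / ((l i - l (Suc n))\<^sup>2 + e k))))) \<partial>L)"
      by (intro Bochner_Integration.integral_cong refl) (simp add: ring_distribs sum_distrib_left mult_ac)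
    also have "\<dots> = \<kappa> * A (e k) - 1 / 2 * B (e k) + (\<Sum>i=1..n. \<beta> * T i)"
      unfolding A_def B_def T_def by (rule integral_linear_combination) (use i1 i2 i3 in auto)
    also have "(\<Sum>i=1..n. \<beta> * T i) = (\<Sum>i\<in>{Suc m..n}. \<beta> * T i)"
    proof (intro sum.mono_neutral_right ballI)
      fix i assume "i \<in> {1..n} - {Suc m..n}"
      then show "\<beta> * T i = 0" unfolding T_def using pole_term_eq_0[OF e(2,3) m, of i] by auto
    qed auto
    also have "\<dots> = (\<Sum>i\<in>{Suc m..n}. \<beta> * (1 / 2 * H (e k) i))"
    proof (rule sum.cong[OF refl])
      fix i assume "i \<in> {Suc m..n}"
      then show "\<beta> * T i = \<beta> * (1 / 2 * H (e k) i)"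
        unfolding T_def H_def using pole_term_eq_half[OF e(2,3), of m i] by simp
    qed
    finally show ?thesis by (simp add: sum_distrib_left mult_ac)
  qed
  have limA: "(\<lambda>k. A (e k)) \<longlonglongrightarrow> A 0"
    unfolding A_def
  proof (intro integral_laguerre_kernel_tendsto[where C = 1 and b = 1])
    show "\<bar>\<Prod>i=1..m. l i\<bar> \<le> 1 * (\<Prod>i=1..Suc n. (1 + l i) powr 1)" if "\<And>i. i \<in> {1..Suc n} \<Longrightarrow> l i > 0" for l :: "nat \<Rightarrow> real"
      using monb[OF that] by (simp only: mult_1)
  qed (use \<beta> \<kappa> e e0 m in auto)
  have limB: "(\<lambda>k. B (e k)) \<longlonglongrightarrow> B 0"
    unfolding B_def
  proof (intro integral_laguerre_kernel_tendsto[where C = 1 and b = "1 + 1"])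
    fix l :: "nat \<Rightarrow> real" assume l: "\<And>i. i \<in> {1..Suc n} \<Longrightarrow> l i > 0"
    have "\<bar>(\<Prod>i=1..m. l i) * l (Suc n)\<bar> \<le> (\<Prod>i=1..Suc n. (1 + l i) powr 1) * (\<Prod>i=1..Suc n. (1 + l i) powr 1)"
      unfolding abs_mult
    proof (intro mult_mono monb[OF l] prod_nonneg ballI)
      show "\<bar>l (Suc n)\<bar> \<le> (\<Prod>i=1..Suc n. (1 + l i) powr 1)"
        using one_plus_le_prod[of "Suc n" l "Suc n", OF l] l[of "Suc n"] by (simp del: prod.cl_ivl_Suc)
    qed auto
    then show "\<bar>(\<Prod>i=1..m. l i) * l (Suc n)\<bar> \<le> 1 * (\<Prod>i=1..Suc n. (1 + l i) powr (1 + 1))"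
      using prod_one_plus_combine[of "Suc n" l 1 1] l by (simp only: mult_1)
  qed (use \<beta> \<kappa> e e0 m in \<open>auto intro!: borel_measurable_times\<close>)
  have limH: "(\<lambda>k. H (e k) i) \<longlonglongrightarrow> A 0" if i: "i \<in> {Suc m..n}" for i
  proof -
    have [measurable]: "(\<lambda>l. l i) \<in> borel_measurable L" "(\<lambda>l. l (Suc n)) \<in> borel_measurable L"
      using coord[of i] coord[of "Suc n"] i by simp_all
    show ?thesis
      unfolding H_def A_def
    proof (intro integral_laguerre_kernel_tendsto[where C = 1 and b = 1])
      \<comment> \<open>The regularised quotient tends to 1 off the diagonal, but is constantly 0 on
        it.\<close>
      have "AE l in L. l i \<noteq> l (Suc n)" using i by (intro AE_lebesgue_coordinates_neq) auto
      then show "AE l in L. (\<lambda>k. (\<Prod>i=1..m. l i) * ((l i - l (Suc n))\<^sup>2 / ((l i - l (Suc n))\<^sup>2 + e k))) \<longlonglongrightarrow> (\<Prod>i=1..m. l i)"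
      proof eventually_elim
        case (elim l)
        have "(\<lambda>k. (\<Prod>i=1..m. l i) * ((l i - l (Suc n))\<^sup>2 / ((l i - l (Suc n))\<^sup>2 + e k)))
           \<longlonglongrightarrow> (\<Prod>i=1..m. l i) * ((l i - l (Suc n))\<^sup>2 / ((l i - l (Suc n))\<^sup>2 + 0))"
          using elim by (intro tendsto_intros e) auto
        then show ?case using elim by simp
      qed
      fix l :: "nat \<Rightarrow> real" and k assume l: "\<And>i. i \<in> {1..Suc n} \<Longrightarrow> l i > 0"
      have "\<bar>(\<Prod>i=1..m. l i) * ((l i - l (Suc n))\<^sup>2 / ((l i - l (Suc n))\<^sup>2 + e k))\<bar> \<le> (\<Prod>i=1..Suc n. (1 + l i) powr 1) * 1"
        unfolding abs_mult
      proof (intro mult_mono monb[OF l] prod_nonneg ballI)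
        have "(l i - l (Suc n))\<^sup>2 + e k > 0" using e(2)[of k] by (simp add: add_nonneg_pos)
        then show "\<bar>(l i - l (Suc n))\<^sup>2 / ((l i - l (Suc n))\<^sup>2 + e k)\<bar> \<le> 1"
          using e0[of k] by (simp add: divide_le_eq_1)
      qed auto
      then show "\<bar>(\<Prod>i=1..m. l i) * ((l i - l (Suc n))\<^sup>2 / ((l i - l (Suc n))\<^sup>2 + e k))\<bar> \<le> 1 * (\<Prod>i=1..Suc n. (1 + l i) powr 1)"
        by (simp only: mult_1 mult_1_right)
    qed (use \<beta> \<kappa> e e0 in measurable)
  qed
  have "(\<lambda>k. \<kappa> * A (e k) - 1 / 2 * B (e k) + \<beta> / 2 * (\<Sum>i\<in>{Suc m..n}. H (e k) i))
     \<longlonglongrightarrow> \<kappa> * A 0 - 1 / 2 * B 0 + \<beta> / 2 * (\<Sum>i\<in>{Suc m..n}. A 0)"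
    by (intro tendsto_intros limA limB limH)
  then have lim: "\<kappa> * A 0 - 1 / 2 * B 0 + \<beta> / 2 * (\<Sum>i\<in>{Suc m..n}. A 0) = 0"
    unfolding eq using LIMSEQ_unique tendsto_const by blast
  have "B 0 = (\<integral>l. K 0 l * (\<Prod>i=1..Suc m. l i) \<partial>L)"
  proof (cases "m = n")
    case False
    let ?s = "Transposition.transpose (Suc m) (Suc n)"
    have s: "?s permutes {1..Suc n}" using m by (intro permutes_swap_id) auto
    have mon': "(\<lambda>l. \<Prod>i=1..Suc m. l i) \<in> borel_measurable L"
      using m by (intro measurable_monomial) auto
    have "(\<integral>l. K 0 (\<lambda>j. l (?s j)) * (\<Prod>i=1..Suc m. l (?s i)) \<partial>L) = (\<integral>l. K 0 l * (\<Prod>i=1..Suc m. l i) \<partial>L)"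
      using s by (intro integral_lebesgue_permute[where g = "\<lambda>l. K 0 l * (\<Prod>i=1..Suc m. l i)"]
          borel_measurable_times mon' measurable_laguerre_kernel) auto
    moreover have "(\<Prod>i=1..Suc m. l (?s i)) = (\<Prod>i=1..m. l i) * l (Suc n)" for l :: "nat \<Rightarrow> real"
      using prod_transpose_fix[of m "Suc m" "Suc n" l] m by (simp del: prod.cl_ivl_Suc add: prod.nat_ivl_Suc')
    ultimately show ?thesis by (simp only: B_def laguerre_kernel_permute[OF s])
  qed (simp add: B_def)
  then show ?thesis using lim m unfolding A_def by (simp add: of_nat_diff field_simps)
qed

end

lemma kernel_shift:
  "laguerre_kernel \<beta> e (\<kappa> + 1) n l = laguerre_kernel \<beta> e \<kappa> n l * (\<Prod>i=1..n. l i)"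
  by (simp add: laguerre_kernel_def laguerre_weight_mult[symmetric] prod.distrib mult_ac)

lemma kernel_shift_powr:
  "laguerre_kernel \<beta> e (\<kappa> + b) n l = laguerre_kernel \<beta> e \<kappa> n l * (\<Prod>i=1..n. l i powr b)"
  by (simp add: laguerre_kernel_def laguerre_weight_mult_powr[symmetric] prod.distrib mult_ac)

section \<open>Shape 1: passing from \<open>Suc n\<close> particles to \<open>n\<close>\<close>

context
  fixes \<beta> :: real and n :: nat
  assumes \<beta>: "\<beta> > 0"
begin

private abbreviation "K1 e \<equiv> laguerre_kernel \<beta> e 1 (Suc n)"
private abbreviation "L1 \<equiv> lebesgue_on_indices {1..Suc n}"

private lemma boundary_pole_term:
  assumes e: "0 < e" "e \<le> 1" and i: "i \<in> {1..n}"
  shows "integrable L1 (\<lambda>l. K1 e l * ((l (Suc n) - l i) / ((l i - l (Suc n))\<^sup>2 + e)))" (is "integrable L1 ?g")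
    and "(\<integral>l. K1 e l * ((l (Suc n) - l i) / ((l i - l (Suc n))\<^sup>2 + e)) \<partial>L1) = 0"
proof -
  have [measurable]: "(\<lambda>l. l i) \<in> borel_measurable L1" "(\<lambda>l. l (Suc n)) \<in> borel_measurable L1"
    using i by (auto intro!: measurable_coordinate)
  show int: "integrable L1 ?g"
  proof (rule integrable_laguerre_kernel[where C = "1 / e" and b = 0])
    fix l :: "nat \<Rightarrow> real" assume l: "\<And>i. i \<in> {1..Suc n} \<Longrightarrow> l i > 0"
    have "(\<Prod>i=1..Suc n. (1 + l i) powr 0) = 1"
    proof (rule prod.neutral, rule ballI)
      fix j assume "j \<in> {1..Suc n}"
      then show "(1 + l j) powr 0 = 1" using l[of j] by simp
    qed
    then show "\<bar>(l (Suc n) - l i) / ((l i - l (Suc n))\<^sup>2 + e)\<bar> \<le> 1 / e * (\<Prod>i=1..Suc n. (1 + l i) powr 0)"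
      using abs_regularised_pole_le[OF e] by simp
  next
    show "(\<lambda>l. (l (Suc n) - l i) / ((l i - l (Suc n))\<^sup>2 + e)) \<in> borel_measurable L1" by measurable
  qed (use e \<beta> in auto)
  let ?s = "Transposition.transpose i (Suc n)"
  have s: "?s permutes {1..Suc n}" using i by (intro permutes_swap_id) auto
  have "?g (\<lambda>j. l (?s j)) = - ?g l" for l
    unfolding laguerre_kernel_permute[OF s] power2_commute[of "l (?s i)"]
    by (simp add: left_diff_distrib right_diff_distrib diff_divide_distrib)
  moreover have "(\<integral>l. ?g (\<lambda>j. l (?s j)) \<partial>L1) = integral\<^sup>L L1 ?g"
    using int s by (intro integral_lebesgue_permute) auto
  ultimately show "integral\<^sup>L L1 ?g = 0" by simp
qed

private lemma kernel_integral_regularised: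
  assumes e: "0 < e" "e \<le> 1"
  shows "(\<integral>l. K1 e l \<partial>L1)
     = 2 * (\<integral>l. laguerre_kernel \<beta> e 1 n l * (\<Prod>i=1..n. ((l i)\<^sup>2 + e) powr (\<beta> / 2)) \<partial>lebesgue_on_indices {1..n})"
proof -
  let ?g = "\<lambda>l. K1 e l * (- 1 / 2 + (\<Sum>i=1..n. \<beta> * ((l (Suc n) - l i) / ((l i - l (Suc n))\<^sup>2 + e))))"
  \<comment> \<open>The summand with coefficient 0 only brings the integrand into the form of
    \<open>integral_linear_combination\<close>.\<close>
  have g: "?g = (\<lambda>l. 0 * K1 e l - 1 / 2 * K1 e l
     + (\<Sum>i=1..n. \<beta> * (K1 e l * ((l (Suc n) - l i) / ((l i - l (Suc n))\<^sup>2 + e)))))"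
    by (rule ext) (simp add: ring_distribs sum_distrib_left mult_ac)
  have intK: "integrable L1 (\<lambda>l. K1 e l)"
    using integrable_kernel_monomial[of \<beta> 1 e 0 n] \<beta> e by simp
  have int: "integrable L1 ?g"
    unfolding g using boundary_pole_term(1)[OF e]
    by (intro Bochner_Integration.integrable_add Bochner_Integration.integrable_diff
          integrable_mult_right Bochner_Integration.integrable_sum intK) auto
  have "integral\<^sup>L L1 ?g = 0 * (\<integral>l. K1 e l \<partial>L1) - 1 / 2 * (\<integral>l. K1 e l \<partial>L1)
     + (\<Sum>i=1..n. \<beta> * (\<integral>l. K1 e l * ((l (Suc n) - l i) / ((l i - l (Suc n))\<^sup>2 + e)) \<partial>L1))"
    unfolding g by (rule integral_linear_combination) (use intK boundary_pole_term(1)[OF e] in auto)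
  also have "\<dots> = - 1 / 2 * (\<integral>l. K1 e l \<partial>L1)"
    using boundary_pole_term(2)[OF e] by simp
  finally have lhs: "integral\<^sup>L L1 ?g = - 1 / 2 * (\<integral>l. K1 e l \<partial>L1)" .
  have ins: "{1..Suc n} = insert (Suc n) {1..n}" by auto
  have "integral\<^sup>L L1 ?g = (\<integral>l. \<integral>t. ?g (l(Suc n := t)) \<partial>lborel \<partial>lebesgue_on_indices {1..n})"
    using int unfolding ins by (intro lborel_product.product_integral_insert) auto
  also have "\<dots> = (\<integral>l. - (laguerre_kernel \<beta> e 1 n l * (\<Prod>i=1..n. ((l i)\<^sup>2 + e) powr (\<beta> / 2))) \<partial>lebesgue_on_indices {1..n})"
  proof (rule Bochner_Integration.integral_cong[OF refl])
    fix l :: "nat \<Rightarrow> real"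
    show "(\<integral>t. ?g (l(Suc n := t)) \<partial>lborel) = - (laguerre_kernel \<beta> e 1 n l * (\<Prod>i=1..n. ((l i)\<^sup>2 + e) powr (\<beta> / 2)))"
    proof (cases "\<forall>i\<in>{1..n}. l i > 0")
      case True
      have 2: "(\<Sum>i=1..n. \<beta> * ((t - (l(Suc n := t)) i) / (((l(Suc n := t)) i - t)\<^sup>2 + e)))
          = (\<Sum>i=1..n. \<beta> * (t - l i) / ((l i - t)\<^sup>2 + e))" for t
        by (intro sum.cong) auto
      have gt: "?g (l(Suc n := t)) = laguerre_kernel \<beta> e 1 n l *
          (laguerre_weight 1 t * ((\<Prod>i=1..n. ((l i - t)\<^sup>2 + e) powr (\<beta> / 2)) *
             (- 1 / 2 + (\<Sum>i=1..n. \<beta> * (t - l i) / ((l i - t)\<^sup>2 + e)))))" for t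
        unfolding laguerre_kernel_Suc fun_upd_same 2 by (simp only: mult_ac)
      have nn: "l i \<ge> 0" if "i \<in> {1..n}" for i using True that by (simp add: less_imp_le)
      show ?thesis
        unfolding gt integral_mult_right_zero using laguerre_parts_boundary[of \<beta> e n l, OF \<beta> e nn] by simp
    next
      case False
      then obtain i where "i \<in> {1..n}" "l i \<le> 0" by (auto simp: not_less)
      then have "laguerre_kernel \<beta> e 1 n l = 0" by (rule laguerre_kernel_eq_0)
      then show ?thesis unfolding laguerre_kernel_Suc by simp
    qed
  qed
  finally show ?thesis unfolding lhs by simp
qed

text \<open>At shape 1 all pole terms cancel by antisymmetry. What is left balances the decay rate
  1/2 of the weight against the boundary term at 0, which multiplies the kernel of the other
  particles by \<open>l i powr \<beta>\<close> and so raises their shape by \<beta>. This fixes the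
  constant that a recurrence in \<kappa> alone leaves open.\<close>

lemma kernel_integral_one:
  "(\<integral>l. laguerre_kernel \<beta> 0 1 (Suc n) l \<partial>lebesgue_on_indices {1..Suc n})
   = 2 * (\<integral>l. laguerre_kernel \<beta> 0 (1 + \<beta>) n l \<partial>lebesgue_on_indices {1..n})"
proof -
  define e where "e k = inverse (real (Suc k))" for k
  have e: "e \<longlonglongrightarrow> 0" "\<And>k. e k > 0" "\<And>k. e k \<le> 1"
    unfolding e_def using LIMSEQ_inverse_real_of_nat by (auto simp: inverse_le_1_iff)
  have e0: "\<And>k. e k \<ge> 0" using e(2) by (simp add: less_imp_le)
  have "(\<lambda>k. \<integral>l. K1 (e k) l * 1 \<partial>L1) \<longlonglongrightarrow> (\<integral>l. K1 0 l * 1 \<partial>L1)"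
  proof (rule integral_laguerre_kernel_tendsto[where C = 1 and b = 0])
    fix l :: "nat \<Rightarrow> real" assume l: "\<And>i. i \<in> {1..Suc n} \<Longrightarrow> l i > 0"
    have "(\<Prod>i=1..Suc n. (1 + l i) powr 0) = 1"
    proof (rule prod.neutral, rule ballI)
      fix j assume "j \<in> {1..Suc n}"
      then show "(1 + l j) powr 0 = 1" using l[of j] by simp
    qed
    then show "\<bar>1::real\<bar> \<le> 1 * (\<Prod>i=1..Suc n. (1 + l i) powr 0)" by simp
  qed (use \<beta> e e0 in auto)
  moreover have "(\<lambda>k. \<integral>l. laguerre_kernel \<beta> (e k) 1 n l * (\<Prod>i=1..n. ((l i)\<^sup>2 + e k) powr (\<beta> / 2)) \<partial>lebesgue_on_indices {1..n})
     \<longlonglongrightarrow> (\<integral>l. laguerre_kernel \<beta> 0 1 n l * (\<Prod>i=1..n. ((l i)\<^sup>2 + 0) powr (\<beta> / 2)) \<partial>lebesgue_on_indices {1..n})"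
  proof (rule integral_laguerre_kernel_tendsto[where C = 1 and b = \<beta>])
    show "AE l in lebesgue_on_indices {1..n}. (\<lambda>k. \<Prod>i=1..n. ((l i)\<^sup>2 + e k) powr (\<beta> / 2)) \<longlonglongrightarrow> (\<Prod>i=1..n. ((l i)\<^sup>2 + 0) powr (\<beta> / 2))"
      using \<beta> e0 by (intro AE_I2 tendsto_prod tendsto_powr' tendsto_intros e(1)) auto
    fix l :: "nat \<Rightarrow> real" and k assume l: "\<And>i. i \<in> {1..n} \<Longrightarrow> l i > 0"
    have "(\<Prod>i=1..n. ((l i - 0)\<^sup>2 + e k) powr (\<beta> / 2)) \<le> (\<Prod>i=1..n. (1 + l i) powr \<beta>) * (1 + 0) powr (\<beta> * n)"
      using l \<beta> e e0 by (intro pair_factors_le) (auto simp: less_imp_le)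
    then show "\<bar>\<Prod>i=1..n. ((l i)\<^sup>2 + e k) powr (\<beta> / 2)\<bar> \<le> 1 * (\<Prod>i=1..n. (1 + l i) powr \<beta>)"
      by (subst abs_of_nonneg) (auto intro: prod_nonneg)
  qed (use \<beta> e e0 in measurable)
  moreover have "laguerre_kernel \<beta> 0 1 n l * (\<Prod>i=1..n. ((l i)\<^sup>2 + 0) powr (\<beta> / 2)) = laguerre_kernel \<beta> 0 (1 + \<beta>) n l" for l
  proof (cases "\<forall>i\<in>{1..n}. l i > 0")
    case True
    have "(\<Prod>i=1..n. ((l i)\<^sup>2 + 0) powr (\<beta> / 2)) = (\<Prod>i=1..n. l i powr \<beta>)"
    proof (rule prod.cong[OF refl])
      fix i assume "i \<in> {1..n}"
      then have "l i > 0" using True by blast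
      then show "((l i)\<^sup>2 + 0) powr (\<beta> / 2) = l i powr \<beta>" by (simp add: sq_powr_half)
    qed
    then show ?thesis by (simp add: kernel_shift_powr)
  next
    case False
    then obtain i where "i \<in> {1..n}" "l i \<le> 0" by (auto simp: not_less)
    then show ?thesis using laguerre_kernel_eq_0[of i n l] by (simp only: mult_zero_left)
  qed
  ultimately have "(\<lambda>k. \<integral>l. K1 (e k) l \<partial>L1) \<longlonglongrightarrow> (\<integral>l. K1 0 l \<partial>L1)"
    and "(\<lambda>k. 2 * (\<integral>l. laguerre_kernel \<beta> (e k) 1 n l * (\<Prod>i=1..n. ((l i)\<^sup>2 + e k) powr (\<beta> / 2)) \<partial>lebesgue_on_indices {1..n}))
     \<longlonglongrightarrow> 2 * (\<integral>l. laguerre_kernel \<beta> 0 (1 + \<beta>) n l \<partial>lebesgue_on_indices {1..n})"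
    by (simp_all add: tendsto_mult_left)
  then show ?thesis
    unfolding kernel_integral_regularised[OF e(2,3)] by (rule LIMSEQ_unique)
qed

end


section \<open>The normalising constant\<close>

text \<open>Convexity of \<open>ln f\<close> on the positive half-line in multiplicative form, so
  that products are handled without logarithms.\<close>

definition log_convex :: "(real \<Rightarrow> real) \<Rightarrow> bool" where
  "log_convex f \<longleftrightarrow> (\<forall>x>0. \<forall>y>0. \<forall>t\<in>{0..1}. f ((1 - t) * x + t * y) \<le> f x powr (1 - t) * f y powr t)"

lemma log_convexD:
  "log_convex f \<Longrightarrow> x > 0 \<Longrightarrow> y > 0 \<Longrightarrow> 0 \<le> t \<Longrightarrow> t \<le> 1 \<Longrightarrow>
    f ((1 - t) * x + t * y) \<le> f x powr (1 - t) * f y powr t"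
  unfolding log_convex_def by auto

lemma log_convex_mult:
  assumes "log_convex f" "log_convex g" "\<And>x. x > 0 \<Longrightarrow> f x > 0" "\<And>x. x > 0 \<Longrightarrow> g x > 0"
  shows "log_convex (\<lambda>x. f x * g x)"
  unfolding log_convex_def
proof (intro allI impI ballI)
  fix x y t :: real assume *: "x > 0" "y > 0" "t \<in> {0..1}"
  have z: "(1 - t) * x + t * y > 0"
    using * by (cases "t = 0") (auto intro!: add_nonneg_pos)
  have "f ((1 - t) * x + t * y) * g ((1 - t) * x + t * y)
      \<le> (f x powr (1 - t) * f y powr t) * (g x powr (1 - t) * g y powr t)"
    using * assms(1,2) assms(3,4)[OF z] unfolding log_convex_def by (intro mult_mono) auto
  then show "f ((1 - t) * x + t * y) * g ((1 - t) * x + t * y)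
      \<le> (f x * g x) powr (1 - t) * (f y * g y) powr t"
    by (simp add: powr_mult mult_ac)
qed

lemma log_convex_prod:
  assumes "\<And>i. i \<in> I \<Longrightarrow> log_convex (f i)" "\<And>i x. i \<in> I \<Longrightarrow> x > 0 \<Longrightarrow> f i x > 0"
  shows "log_convex (\<lambda>x. \<Prod>i\<in>I. f i x)"
  using assms
proof (induction I rule: infinite_finite_induct)
  case (insert i I)
  then show ?case by (auto intro!: log_convex_mult prod_pos)
qed (auto simp: log_convex_def)

lemma log_convex_exponential: "c > 0 \<Longrightarrow> log_convex (\<lambda>x. c powr (a * x))"
  unfolding log_convex_def by (auto simp: powr_powr powr_add[symmetric] algebra_simps)

lemma log_convex_Gamma_shift:
  assumes "a \<ge> 0"
  shows "log_convex (\<lambda>x. Gamma (x + a))"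
  unfolding log_convex_def
proof (intro allI impI ballI)
  fix x y t :: real assume *: "x > 0" "y > 0" "t \<in> {0..1}"
  have z: "(1 - t) * x + t * y > 0"
    using * by (cases "t = 0") (auto intro!: add_nonneg_pos)
  have G: "Gamma (x + a) > 0" "Gamma (y + a) > 0" "Gamma ((1 - t) * x + t * y + a) > 0"
    using * assms z by (auto intro!: Gamma_real_pos)
  have "(1 - t) * x + t * y + a = (1 - t) * (x + a) + t * (y + a)" by (simp add: algebra_simps)
  then have "ln (Gamma ((1 - t) * x + t * y + a)) \<le> (1 - t) * ln (Gamma (x + a)) + t * ln (Gamma (y + a))"
    using convex_onD[OF log_convex_Gamma_real, of t "x + a" "y + a"] * assms by simp
  then have "exp (ln (Gamma ((1 - t) * x + t * y + a))) \<le> exp ((1 - t) * ln (Gamma (x + a)) + t * ln (Gamma (y + a)))"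
    by simp
  then show "Gamma ((1 - t) * x + t * y + a) \<le> Gamma (x + a) powr (1 - t) * Gamma (y + a) powr t"
    using G by (simp add: exp_add powr_def)
qed

context
  fixes f q :: "real \<Rightarrow> real"
  assumes lc: "log_convex f" and pos: "\<And>x. x > 0 \<Longrightarrow> f x > 0"
    and step: "\<And>x. x > 0 \<Longrightarrow> f (x + 1) = q x * f x"
begin

private lemma q_pos: "x > 0 \<Longrightarrow> q x > 0"
  using pos[of x] pos[of "x + 1"] step[of x] by (simp add: zero_less_mult_iff)

private lemma log_convex_upper:
  assumes "x > 0" "x < y" "y \<le> x + 1"
  shows "f y \<le> f x * q x powr (y - x)"
proof -
  have "f ((1 - (y - x)) * x + (y - x) * (x + 1)) \<le> f x powr (1 - (y - x)) * f (x + 1) powr (y - x)"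
    using lc assms unfolding log_convex_def by auto
  also have "(1 - (y - x)) * x + (y - x) * (x + 1) = y" by (simp add: algebra_simps)
  also have "f x powr (1 - (y - x)) * f (x + 1) powr (y - x) = f x * q x powr (y - x)"
    using pos[OF assms(1)] q_pos[OF assms(1)]
    by (simp add: step[OF assms(1)] powr_mult powr_add[symmetric] mult_ac)
  finally show ?thesis .
qed

text \<open>Here \<open>x + 1\<close> lies between \<open>x\<close> and \<open>y\<close>, so
  log-convexity bounds \<open>f (x + 1)\<close> above in terms of \<open>f x\<close> and
  \<open>f y\<close>. Solving for \<open>f y\<close> gives a lower bound.\<close>

private lemma log_convex_lower:
  assumes "x > 0" "x + 1 < y" "y \<le> x + 2"
  shows "f (x + 1) * q x powr (y - (x + 1)) \<le> f y"
proof -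
  define t where "t = y - (x + 1)"
  have t: "t > 0" using assms by (simp add: t_def)
  have y0: "f y > 0" using pos assms by simp
  have eq: "(1 - 1 / (1 + t)) * x + 1 / (1 + t) * y = x + 1"
  proof -
    have "(1 - 1 / (1 + t)) * x + 1 / (1 + t) * y = (t * x + y) / (1 + t)"
    proof -
      have "1 - 1 / (1 + t) = t / (1 + t)" using t by (simp add: field_simps)
      then show ?thesis by (simp add: add_divide_distrib)
    qed
    also have "t * x + y = (x + 1) * (1 + t)" by (simp add: t_def algebra_simps)
    finally show ?thesis using t by simp
  qed
  have "f ((1 - 1 / (1 + t)) * x + 1 / (1 + t) * y) \<le> f x powr (1 - 1 / (1 + t)) * f y powr (1 / (1 + t))"
    using assms t by (intro log_convexD[OF lc]) auto
  then have "f (x + 1) powr (1 + t) \<le> (f x powr (1 - 1 / (1 + t)) * f y powr (1 / (1 + t))) powr (1 + t)"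
    unfolding eq using pos[of "x + 1"] assms t by (intro powr_mono2) auto
  also have "\<dots> = f x powr t * f y"
  proof -
    have "(1 - 1 / (1 + t)) * (1 + t) = t" using t by (simp add: field_simps)
    then show ?thesis using t y0 by (simp add: powr_mult powr_powr)
  qed
  also have "f x powr t = f (x + 1) powr t / q x powr t"
    using pos[OF assms(1)] q_pos[OF assms(1)] by (simp add: step[OF assms(1)] powr_mult)
  finally have "f (x + 1) * f (x + 1) powr t \<le> f (x + 1) powr t / q x powr t * f y"
    using pos[of "x + 1"] assms by (simp add: powr_add)
  then have "f (x + 1) * f (x + 1) powr t \<le> f y / q x powr t * f (x + 1) powr t"
    by (simp add: mult_ac)
  then have "f (x + 1) \<le> f y / q x powr t"
    by (rule mult_right_le_imp_le) (use pos[of "x + 1"] assms in simp)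
  then show ?thesis
    unfolding t_def[symmetric] using q_pos[OF assms(1)] by (simp add: field_simps)
qed

lemmas log_convex_bounds = log_convex_upper log_convex_lower

lemmas recurrence_factor_pos = q_pos

end

text \<open>As in the Bohr--Mollerup theorem: the quotient of two solutions is 1-periodic, and far to the
  right log-convexity pins both solutions down between consecutive integer steps.\<close>

lemma log_convex_recurrence_unique:
  assumes f: "log_convex f" "\<And>x. x > 0 \<Longrightarrow> f x > 0" "\<And>x. x > 0 \<Longrightarrow> f (x + 1) = q x * f x"
    and g: "log_convex g" "\<And>x. x > 0 \<Longrightarrow> g x > 0" "\<And>x. x > 0 \<Longrightarrow> g (x + 1) = q x * g x"
    and lim: "\<And>x. x > 0 \<Longrightarrow> (\<lambda>m. q (x + real m + 1) / q (x + real m)) \<longlonglongrightarrow> 1"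
    and xy: "x > 0" "y > 0"
  shows "f x / g x = f y / g y"
proof -
  define R where "R x = f x / g x" for x
  have q: "q x > 0" if "x > 0" for x
    by (rule recurrence_factor_pos[OF f that])
  have fb: "x > 0 \<Longrightarrow> x < y \<Longrightarrow> y \<le> x + 1 \<Longrightarrow> f y \<le> f x * q x powr (y - x)"
    "x > 0 \<Longrightarrow> x + 1 < y \<Longrightarrow> y \<le> x + 2 \<Longrightarrow> f (x + 1) * q x powr (y - (x + 1)) \<le> f y" for x y
    using log_convex_bounds[of f q x y] f by auto
  have gb: "x > 0 \<Longrightarrow> x < y \<Longrightarrow> y \<le> x + 1 \<Longrightarrow> g y \<le> g x * q x powr (y - x)"
    "x > 0 \<Longrightarrow> x + 1 < y \<Longrightarrow> y \<le> x + 2 \<Longrightarrow> g (x + 1) * q x powr (y - (x + 1)) \<le> g y" for x y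
    using log_convex_bounds[of g q x y] g by auto
  have R_step: "R (x + 1) = R x" if "x > 0" for x
    using f(3)[OF that] g(3)[OF that] q[OF that] by (simp add: R_def)
  have R_nat: "R (x + real m) = R x" if "x > 0" for x m
  proof (induction m)
    case (Suc m)
    then show ?case using R_step[of "x + real m"] that by (simp add: add_ac)
  qed simp
  have local: "R y = R x" if "0 < x" "x < y" "y \<le> x + 1" for x y
  proof -
    define t where "t = y - x"
    have bounds: "(q (x + real m) / q (x + real m + 1)) powr t \<le> R y / R x"
        "R y / R x \<le> (q (x + real m + 1) / q (x + real m)) powr t" for m
    proof -
      \<comment> \<open>By periodicity \<open>R (u + 1) = R x\<close> and \<open>R v = R y\<close>.
        Since \<open>v\<close> lies in \<open>(u + 1, u + 2]\<close>, the lower bound for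
        \<open>f v\<close> and \<open>g v\<close> starts from \<open>u\<close> and the upper one
        from \<open>u + 1\<close>, so the quotient is controlled by \<open>q (u + 1) / q u\<close>,
        which tends to 1.\<close>
      define u v where "u = x + real m" and "v = y + real m + 1"
      have u: "u > 0" "u + 1 < v" "v \<le> u + 2" "v - (u + 1) = t" "v \<le> (u + 1) + 1" "u + 1 > 0"
        using that by (auto simp: u_def v_def t_def)
      have p: "f v > 0" "g v > 0" "f (u + 1) > 0" "g (u + 1) > 0" "q u > 0" "q (u + 1) > 0"
        using u f(2) g(2) q[of u] q[of "u + 1"] by auto
      have fl: "f (u + 1) * q u powr t \<le> f v" and fu: "f v \<le> f (u + 1) * q (u + 1) powr t"
        using fb(2)[OF u(1,2,3)] fb(1)[OF u(6,2,5)] u(4) by auto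
      have gl: "g (u + 1) * q u powr t \<le> g v" and gu: "g v \<le> g (u + 1) * q (u + 1) powr t"
        using gb(2)[OF u(1,2,3)] gb(1)[OF u(6,2,5)] u(4) by auto
      have eq: "R y / R x = (f v / f (u + 1)) / (g v / g (u + 1))"
      proof -
        have "R v = R y" "R (u + 1) = R x"
          using R_nat[of y "Suc m"] R_nat[of x "Suc m"] that by (simp_all add: u_def v_def add_ac)
        then have "R y / R x = R v / R (u + 1)" by simp
        then show ?thesis by (simp add: R_def mult_ac)
      qed
      have 1: "q u powr t \<le> f v / f (u + 1)" "f v / f (u + 1) \<le> q (u + 1) powr t"
        "q u powr t \<le> g v / g (u + 1)" "g v / g (u + 1) \<le> q (u + 1) powr t"
        using fl fu gl gu p by (auto simp: field_simps)
      have "q u powr t / q (u + 1) powr t \<le> (f v / f (u + 1)) / (g v / g (u + 1))"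
        using 1 p by (intro frac_le) auto
      then show "(q (x + real m) / q (x + real m + 1)) powr t \<le> R y / R x"
        unfolding eq using p by (simp add: u_def powr_divide)
      have "(f v / f (u + 1)) / (g v / g (u + 1)) \<le> q (u + 1) powr t / q u powr t"
        using 1 p by (intro frac_le) auto
      then show "R y / R x \<le> (q (x + real m + 1) / q (x + real m)) powr t"
        unfolding eq using p by (simp add: u_def powr_divide)
    qed
    have l1: "(\<lambda>m. (q (x + real m + 1) / q (x + real m)) powr t) \<longlonglongrightarrow> 1 powr t"
      using lim[OF that(1)] by (intro tendsto_powr tendsto_const) auto
    have l2: "(\<lambda>m. (q (x + real m) / q (x + real m + 1)) powr t) \<longlonglongrightarrow> (inverse 1) powr t"
      using tendsto_inverse[OF lim[OF that(1)]] by (intro tendsto_powr tendsto_const) auto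
    have "1 \<le> R y / R x" using LIMSEQ_le_const2[OF l2] bounds(1) by auto
    moreover have "R y / R x \<le> 1" using LIMSEQ_le_const[OF l1] bounds(2) by auto
    moreover have "R x > 0" using f(2) g(2) that by (simp add: R_def)
    ultimately show ?thesis by simp
  qed
  have main: "R y = R x" if "0 < x" "x < y" for x y
  proof -
    define m where "m = nat \<lfloor>y - x\<rfloor>"
    have m: "real m \<le> y - x" "y - x < real m + 1"
      using that unfolding m_def by (auto simp: of_nat_nat)
    have "R y = R ((y - real m) + real m)" by simp
    also have "\<dots> = R (y - real m)" using m that by (intro R_nat) auto
    also have "\<dots> = R x"
      using m that by (cases "y - real m = x") (auto intro!: local)
    finally show ?thesis .
  qed
  show ?thesis
    using main[of x y] main[of y x] xy by (cases x y rule: linorder_cases) (auto simp: R_def)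
qed

section \<open>The Selberg integral of Laguerre type\<close>

definition laguerre_integral :: "real \<Rightarrow> real \<Rightarrow> nat \<Rightarrow> real" where
  "laguerre_integral \<beta> \<kappa> n = (\<integral>l. laguerre_kernel \<beta> 0 \<kappa> n l \<partial>lebesgue_on_indices {1..n})"

lemma integrable_kernel:
  assumes "\<beta> > 0" "\<kappa> > 0"
  shows "integrable (lebesgue_on_indices {1..n}) (laguerre_kernel \<beta> 0 \<kappa> n)"
proof -
  have "integrable (lebesgue_on_indices {1..n}) (\<lambda>l. laguerre_kernel \<beta> 0 \<kappa> n l * 1)"
  proof (rule integrable_laguerre_kernel[where C = 1 and b = 0])
    fix l :: "nat \<Rightarrow> real" assume l: "\<And>i. i \<in> {1..n} \<Longrightarrow> l i > 0"
    have "(\<Prod>i=1..n. (1 + l i) powr 0) = 1"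
    proof (rule prod.neutral, rule ballI)
      fix j assume "j \<in> {1..n}"
      then show "(1 + l j) powr 0 = 1" using l[of j] by simp
    qed
    then show "\<bar>1::real\<bar> \<le> 1 * (\<Prod>i=1..n. (1 + l i) powr 0)" by simp
  qed (use assms in auto)
  then show ?thesis by simp
qed

lemma laguerre_kernel_pos:
  assumes "inj_on l {1..n}" "\<And>i. i \<in> {1..n} \<Longrightarrow> l i > 0"
  shows "laguerre_kernel \<beta> 0 \<kappa> n l > 0"
proof -
  have "pair_product \<beta> 0 n l > 0"
    unfolding pair_product_def
  proof (intro prod_pos ballI)
    fix i j assume "j \<in> {1..n}" "i \<in> {1..<j}"
    then have "l i \<noteq> l j" using inj_onD[OF assms(1), of i j] by auto
    then show "((l i - l j)\<^sup>2 + 0) powr (\<beta> / 2) > 0" by simp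
  qed
  moreover have "(\<Prod>i=1..n. laguerre_weight \<kappa> (l i)) > 0"
    using assms(2) by (intro prod_pos ballI laguerre_weight_pos)
  ultimately show ?thesis by (simp add: laguerre_kernel_def)
qed

text \<open>If the integral were 0, the kernel would vanish almost everywhere, but it is positive at
  almost every point of the unit cube, which has measure 1.\<close>

lemma laguerre_integral_pos:
  assumes "\<beta> > 0" "\<kappa> > 0"
  shows "laguerre_integral \<beta> \<kappa> n > 0"
proof (rule ccontr)
  let ?K = "laguerre_kernel \<beta> 0 \<kappa> n" and ?L = "lebesgue_on_indices {1..n}"
  assume "\<not> laguerre_integral \<beta> \<kappa> n > 0"
  moreover have "laguerre_integral \<beta> \<kappa> n \<ge> 0"
    unfolding laguerre_integral_def by (intro integral_nonneg_AE) auto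
  ultimately have "integral\<^sup>L ?L ?K = 0" unfolding laguerre_integral_def by linarith
  then have "AE l in ?L. ?K l = 0"
    using integral_nonneg_eq_0_iff_AE[OF integrable_kernel[OF assms, of n]] by auto
  moreover have "AE l in ?L. inj_on l {1..n}" by (rule AE_lebesgue_inj_on) simp
  ultimately have ae: "AE l in ?L. l \<notin> (\<Pi>\<^sub>E i\<in>{1..n}. {0<..<1::real})"
  proof eventually_elim
    case (elim l)
    then show ?case using laguerre_kernel_pos[OF elim(2), of \<beta> \<kappa>] by (force simp: PiE_iff)
  qed
  have box: "(\<Pi>\<^sub>E i\<in>{1..n}. {0<..<1::real}) \<in> sets ?L" by (intro sets_PiM_I_finite) auto
  have "emeasure ?L (\<Pi>\<^sub>E i\<in>{1..n}. {0<..<1::real}) = 0"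
    using ae box by (simp add: AE_iff_measurable[OF _ refl] AE_iff_null null_sets_def
        sets.sets_into_space Int_absorb1 Collect_conj_eq Int_def[symmetric])
  moreover have "emeasure ?L (\<Pi>\<^sub>E i\<in>{1..n}. {0<..<1::real}) = (\<Prod>i=1..n. emeasure lborel {0<..<1::real})"
    by (intro lborel_product.emeasure_PiM) auto
  ultimately show False by simp
qed

lemma monomial_integral:
  assumes "\<beta> > 0" "\<kappa> > 0" "m \<le> n"
  shows "(\<integral>l. laguerre_kernel \<beta> 0 \<kappa> n l * (\<Prod>i=1..m. l i) \<partial>lebesgue_on_indices {1..n})
     = (\<Prod>j<m. 2 * \<kappa> + \<beta> * (real n - 1 - real j)) * laguerre_integral \<beta> \<kappa> n"
  using assms(3)
proof (induction m)
  case (Suc m)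
  then obtain N where n: "n = Suc N" "m \<le> N" by (cases n) auto
  show ?case
    using aomoto[OF assms(1,2) n(2)] Suc.IH Suc.prems n(1) by (simp add: mult_ac del: prod.cl_ivl_Suc)
qed (simp add: laguerre_integral_def)

lemma laguerre_integral_step:
  assumes "\<beta> > 0" "\<kappa> > 0"
  shows "laguerre_integral \<beta> (\<kappa> + 1) n = (\<Prod>j<n. 2 * \<kappa> + \<beta> * real j) * laguerre_integral \<beta> \<kappa> n"
proof -
  have "laguerre_integral \<beta> (\<kappa> + 1) n = (\<Prod>j<n. 2 * \<kappa> + \<beta> * (real n - 1 - real j)) * laguerre_integral \<beta> \<kappa> n"
    using monomial_integral[OF assms, of n n] by (simp add: laguerre_integral_def kernel_shift)
  also have "(\<Prod>j<n. 2 * \<kappa> + \<beta> * (real n - 1 - real j)) = (\<Prod>j<n. 2 * \<kappa> + \<beta> * real (n - Suc j))"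
    by (intro prod.cong) (auto simp: of_nat_diff)
  also have "\<dots> = (\<Prod>j<n. 2 * \<kappa> + \<beta> * real j)" by (rule prod.nat_diff_reindex)
  finally show ?thesis .
qed

text \<open>Hoelder's inequality: the kernel depends on \<kappa> only through the power
  \<open>w powr (\<kappa> - 1)\<close> of the product \<open>w\<close> of all coordinates. Dividing
  the kernels by their integrals \<open>a\<close> and \<open>b\<close> reduces the claim to Young's
  inequality at each point.\<close>

lemma laguerre_integral_log_convex:
  assumes \<beta>: "\<beta> > 0"
  shows "log_convex (\<lambda>\<kappa>. laguerre_integral \<beta> \<kappa> n)"
  unfolding log_convex_def
proof (intro allI impI ballI)
  fix x y t :: real assume xy: "x > 0" "y > 0" and t: "t \<in> {0..1}"
  define z where "z = (1 - t) * x + t * y"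
  define a b where "a = laguerre_integral \<beta> x n" and "b = laguerre_integral \<beta> y n"
  have z: "z > 0" unfolding z_def using xy t by (cases "t = 0") (auto intro!: add_nonneg_pos)
  have ab: "a > 0" "b > 0" unfolding a_def b_def using laguerre_integral_pos \<beta> xy by auto
  let ?K = "\<lambda>\<kappa>. laguerre_kernel \<beta> 0 \<kappa> n"
  have ptw: "?K z l \<le> (a powr (1 - t) * b powr t) * ((1 - t) / a * ?K x l + t / b * ?K y l)" for l
  proof (cases "\<forall>i\<in>{1..n}. l i > 0")
    case True
    define w where "w = (\<Prod>i=1..n. l i)"
    have w: "w > 0" unfolding w_def using True by (intro prod_pos) auto
    have K: "?K \<kappa> l = ?K 1 l * w powr (\<kappa> - 1)" for \<kappa>
      using kernel_shift_powr[of \<beta> 0 1 "\<kappa> - 1" n l] by (simp add: w_def prod_powr_distrib)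
    have "w powr (z - 1) = (a * (w powr (x - 1) / a)) powr (1 - t) * (b * (w powr (y - 1) / b)) powr t"
      using ab w by (simp add: powr_powr powr_add[symmetric] z_def algebra_simps)
    also have "\<dots> = (a powr (1 - t) * b powr t) * ((w powr (x - 1) / a) powr (1 - t) * (w powr (y - 1) / b) powr t)"
      using ab w by (simp only: powr_mult mult_ac)
    also have "\<dots> \<le> (a powr (1 - t) * b powr t) * ((1 - t) * (w powr (x - 1) / a) + t * (w powr (y - 1) / b))"
      using ab w t by (intro mult_left_mono Youngs_inequality_0) auto
    finally have "?K 1 l * w powr (z - 1) \<le> ?K 1 l * ((a powr (1 - t) * b powr t) * ((1 - t) * (w powr (x - 1) / a) + t * (w powr (y - 1) / b)))"
      by (intro mult_left_mono) auto
    then show ?thesis unfolding K[of x] K[of y] K[of z] by (simp add: algebra_simps)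
  next
    case False
    then obtain i where i: "i \<in> {1..n}" "l i \<le> 0" by (auto simp: not_less)
    show ?thesis unfolding laguerre_kernel_eq_0[of i n l, OF i] by simp
  qed
  have "laguerre_integral \<beta> z n \<le> (\<integral>l. (a powr (1 - t) * b powr t) * ((1 - t) / a * ?K x l + t / b * ?K y l) \<partial>lebesgue_on_indices {1..n})"
    unfolding laguerre_integral_def
    by (intro integral_mono ptw integrable_kernel \<beta> z integrable_mult_right Bochner_Integration.integrable_add xy)
  also have "\<dots> = (a powr (1 - t) * b powr t) * ((1 - t) / a * a + t / b * b)"
    using integrable_kernel[OF \<beta> xy(1), of n] integrable_kernel[OF \<beta> xy(2), of n]
    by (simp add: a_def b_def laguerre_integral_def)
  also have "\<dots> = a powr (1 - t) * b powr t" using ab by simp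
  finally show "laguerre_integral \<beta> ((1 - t) * x + t * y) n
     \<le> laguerre_integral \<beta> x n powr (1 - t) * laguerre_integral \<beta> y n powr t"
    by (simp add: z_def a_def b_def)
qed

text \<open>For fixed size, both the integral and the Gamma product \<open>g\<close> are log-convex
  in \<kappa> and gain the factor \<open>q \<kappa>\<close> when \<kappa> grows by 1, so they are
  proportional. The constant is read off at \<open>\<kappa> = 1\<close>, where
  \<open>kernel_integral_one\<close> leads to size \<open>n\<close> and shape
  \<open>1 + \<beta>\<close>. This is why the induction hypothesis must hold for every
  \<kappa>.\<close>

theorem laguerre_selberg:
  assumes \<beta>: "\<beta> > 0" and "\<kappa> > 0"
  shows "laguerre_integral \<beta> \<kappa> n = 2 powr (n * \<kappa> + \<beta> * n * (real n - 1) / 2) *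
     (\<Prod>j=1..n. Gamma (1 + \<beta> / 2 * j) * Gamma (\<kappa> + \<beta> / 2 * (real j - 1)) / Gamma (1 + \<beta> / 2))"
  using assms(2)
proof (induction n arbitrary: \<kappa>)
  case 0
  then show ?case by (simp add: laguerre_integral_def laguerre_kernel_def pair_product_def
      PiM_empty lebesgue_integral_count_space_finite)
next
  case (Suc n)
  define g where "g \<kappa> = (\<Prod>j<Suc n. 2 powr (1 * \<kappa>) * Gamma (\<kappa> + \<beta> / 2 * real j))" for \<kappa>
  define q where "q \<kappa> = (\<Prod>j<Suc n. 2 * \<kappa> + \<beta> * real j)" for \<kappa>
  have Gpos: "Gamma (\<kappa> + \<beta> / 2 * real j) > 0" if "\<kappa> > 0" for \<kappa> j
    using that \<beta> by (intro Gamma_real_pos add_pos_nonneg) auto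
  have gpos: "g \<kappa> > 0" if "\<kappa> > 0" for \<kappa>
    unfolding g_def using Gpos[OF that] by (intro prod_pos ballI mult_pos_pos) auto
  have "laguerre_integral \<beta> \<kappa> (Suc n) / g \<kappa> = laguerre_integral \<beta> 1 (Suc n) / g 1"
  proof (rule log_convex_recurrence_unique[where q = q])
    show "log_convex (\<lambda>\<kappa>. laguerre_integral \<beta> \<kappa> (Suc n))" by (rule laguerre_integral_log_convex[OF \<beta>])
    show "log_convex g"
      unfolding g_def using Gpos \<beta>
      by (intro log_convex_prod log_convex_mult log_convex_exponential log_convex_Gamma_shift) auto
    show "laguerre_integral \<beta> (\<kappa> + 1) (Suc n) = q \<kappa> * laguerre_integral \<beta> \<kappa> (Suc n)" if "\<kappa> > 0" for \<kappa>
      unfolding q_def by (rule laguerre_integral_step[OF \<beta> that])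
    show "g (\<kappa> + 1) = q \<kappa> * g \<kappa>" if "\<kappa> > 0" for \<kappa>
      unfolding g_def q_def prod.distrib[symmetric]
    proof (rule prod.cong[OF refl])
      fix j
      have "\<kappa> + \<beta> / 2 * real j > 0" using that \<beta> by (intro add_pos_nonneg) auto
      then have "Gamma (\<kappa> + \<beta> / 2 * real j + 1) = (\<kappa> + \<beta> / 2 * real j) * Gamma (\<kappa> + \<beta> / 2 * real j)"
        by (intro Gamma_plus1) (auto simp: nonpos_Ints_def)
      moreover have "\<kappa> + 1 + \<beta> / 2 * real j = \<kappa> + \<beta> / 2 * real j + 1" by simp
      moreover have "2 powr (1 * (\<kappa> + 1)) * ((\<kappa> + \<beta> / 2 * real j) * G) = (2 * \<kappa> + \<beta> * real j) * (2 powr (1 * \<kappa>) * G)" for G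
        by (simp add: powr_add algebra_simps)
      ultimately show "2 powr (1 * (\<kappa> + 1)) * Gamma (\<kappa> + 1 + \<beta> / 2 * real j)
          = (2 * \<kappa> + \<beta> * real j) * (2 powr (1 * \<kappa>) * Gamma (\<kappa> + \<beta> / 2 * real j))"
        by (simp only:)
    qed
    show "(\<lambda>m. q (x + real m + 1) / q (x + real m)) \<longlonglongrightarrow> 1" if "x > 0" for x
    proof -
      have "(\<lambda>m. \<Prod>j<Suc n. (2 * (x + real m + 1) + \<beta> * real j) / (2 * (x + real m) + \<beta> * real j)) \<longlonglongrightarrow> (\<Prod>j<Suc n. 1)"
      proof (intro tendsto_prod)
        fix j
        show "(\<lambda>m. (2 * (x + real m + 1) + \<beta> * real j) / (2 * (x + real m) + \<beta> * real j)) \<longlonglongrightarrow> 1"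
          by real_asymp
      qed
      then show ?thesis unfolding q_def prod_dividef by simp
    qed
  qed (use laguerre_integral_pos[OF \<beta>] gpos Suc.prems in auto)
  then have "laguerre_integral \<beta> \<kappa> (Suc n) = laguerre_integral \<beta> 1 (Suc n) * g \<kappa> / g 1"
    using gpos[OF Suc.prems] by (simp add: field_simps)
  also have "laguerre_integral \<beta> 1 (Suc n) = 2 * laguerre_integral \<beta> (1 + \<beta>) n"
    unfolding laguerre_integral_def by (rule kernel_integral_one[OF \<beta>])
  also have "laguerre_integral \<beta> (1 + \<beta>) n = 2 powr (n * (1 + \<beta>) + \<beta> * n * (real n - 1) / 2) *
     (\<Prod>j=1..n. Gamma (1 + \<beta> / 2 * j) * Gamma (1 + \<beta> + \<beta> / 2 * (real j - 1)) / Gamma (1 + \<beta> / 2))"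
    using \<beta> by (intro Suc.IH) auto
  finally have Z: "laguerre_integral \<beta> \<kappa> (Suc n) = 2 * (2 powr (n * (1 + \<beta>) + \<beta> * n * (real n - 1) / 2) *
     (\<Prod>j=1..n. Gamma (1 + \<beta> / 2 * j) * Gamma (1 + \<beta> + \<beta> / 2 * (real j - 1)) / Gamma (1 + \<beta> / 2))) * g \<kappa> / g 1" .
  have g1: "g 1 = 2 ^ Suc n * (\<Prod>j<Suc n. Gamma (1 + \<beta> / 2 * real j))"
    unfolding g_def by (simp only: prod.distrib prod_constant) simp
  \<comment> \<open>In terms of the values \<open>Gamma (1 + \<beta> / 2 * k)\<close>, the product
    on the left runs over \<open>k = 2, ..., n + 1\<close> and that on the right over
    \<open>k = 0, ..., n\<close>. Only the ends differ, and the value at \<open>k = 0\<close> is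
    1.\<close>
  have "(\<Prod>j=1..n. Gamma (1 + \<beta> + \<beta> / 2 * (real j - 1))) * Gamma (1 + \<beta> / 2)
      = (\<Prod>j<Suc n. Gamma (1 + \<beta> / 2 * real j)) * Gamma (1 + \<beta> / 2 * real (Suc n))"
  proof -
    have "(\<Prod>j<Suc (Suc n). Gamma (1 + \<beta> / 2 * real j))
       = Gamma (1 + \<beta> / 2 * real 0) * (\<Prod>j<Suc n. Gamma (1 + \<beta> / 2 * real (Suc j)))"
      by (rule prod.lessThan_Suc_shift)
    also have "(\<Prod>j<Suc n. Gamma (1 + \<beta> / 2 * real (Suc j)))
      = Gamma (1 + \<beta> / 2 * real (Suc 0)) * (\<Prod>j<n. Gamma (1 + \<beta> / 2 * real (Suc (Suc j))))"
      by (rule prod.lessThan_Suc_shift)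
    also have "(\<Prod>j<n. Gamma (1 + \<beta> / 2 * real (Suc (Suc j)))) = (\<Prod>j=1..n. Gamma (1 + \<beta> + \<beta> / 2 * (real j - 1)))"
      by (rule prod.reindex_bij_witness[of _ "\<lambda>j. j - 1" Suc]) (auto simp: algebra_simps)
    finally show ?thesis by (simp add: mult_ac)
  qed
  then have tele: "(\<Prod>j=1..n. Gamma (1 + \<beta> + \<beta> / 2 * (real j - 1))) / (\<Prod>j<Suc n. Gamma (1 + \<beta> / 2 * real j))
      = Gamma (1 + \<beta> / 2 * real (Suc n)) / Gamma (1 + \<beta> / 2)"
    using Gpos[of 1] \<beta> Gamma_real_pos[of "1 + \<beta> / 2"] by (simp add: frac_eq_eq mult_ac prod_zero_iff less_imp_neq[symmetric] del: prod.lessThan_Suc)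
  have gk: "g \<kappa> = 2 powr (Suc n * \<kappa>) * (\<Prod>j=1..Suc n. Gamma (\<kappa> + \<beta> / 2 * (real j - 1)))"
  proof -
    have "(\<Prod>j<Suc n. Gamma (\<kappa> + \<beta> / 2 * real j)) = (\<Prod>j=1..Suc n. Gamma (\<kappa> + \<beta> / 2 * (real j - 1)))"
      by (rule prod.reindex_bij_witness[of _ "\<lambda>j. j - 1" Suc]) auto
    moreover have "(2 powr \<kappa>) ^ Suc n = 2 powr (Suc n * \<kappa>)"
      by (subst powr_realpow[symmetric]) (simp_all add: powr_powr mult.commute)
    ultimately show ?thesis unfolding g_def by (simp only: prod.distrib prod_constant mult_1) simp
  qed
  define P1 where "P1 = (\<Prod>j=1..n. Gamma (1 + \<beta> / 2 * real j))"
  define P2 where "P2 = (\<Prod>j=1..Suc n. Gamma (\<kappa> + \<beta> / 2 * (real j - 1)))"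
  define G where "G = Gamma (1 + \<beta> / 2)"
  define T where "T = Gamma (1 + \<beta> / 2 * real (Suc n))"
  have "laguerre_integral \<beta> \<kappa> (Suc n) =
     (2 * 2 powr (n * (1 + \<beta>) + \<beta> * n * (real n - 1) / 2) * 2 powr (Suc n * \<kappa>) / 2 ^ Suc n)
       * (P1 * P2 / G ^ n) * ((\<Prod>j=1..n. Gamma (1 + \<beta> + \<beta> / 2 * (real j - 1))) / (\<Prod>j<Suc n. Gamma (1 + \<beta> / 2 * real j)))"
    unfolding Z g1 gk prod_dividef prod.distrib P1_def P2_def G_def by (simp add: mult_ac del: prod.lessThan_Suc prod.cl_ivl_Suc)
  also have "\<dots> = (2 * 2 powr (n * (1 + \<beta>) + \<beta> * n * (real n - 1) / 2) * 2 powr (Suc n * \<kappa>) / 2 ^ Suc n)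
      * ((P1 * T) * P2 / G ^ Suc n)"
    unfolding tele T_def[symmetric] G_def[symmetric] by (simp add: mult_ac)
  also have "2 * 2 powr (n * (1 + \<beta>) + \<beta> * n * (real n - 1) / 2) * 2 powr (Suc n * \<kappa>) / 2 ^ Suc n
      = 2 powr (Suc n * \<kappa> + \<beta> * Suc n * (real (Suc n) - 1) / 2)"
  proof -
    have "n * (1 + \<beta>) + \<beta> * n * (real n - 1) / 2 + Suc n * \<kappa> = (Suc n * \<kappa> + \<beta> * Suc n * (real (Suc n) - 1) / 2) + n"
      by (simp add: field_simps)
    then have "2 powr (n * (1 + \<beta>) + \<beta> * n * (real n - 1) / 2) * 2 powr (Suc n * \<kappa>)
       = 2 powr (Suc n * \<kappa> + \<beta> * Suc n * (real (Suc n) - 1) / 2) * 2 ^ n"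
      by (simp only: powr_add[symmetric] powr_realpow[symmetric] zero_less_numeral)
    then show ?thesis by simp
  qed
  also have "(P1 * T) * P2 / G ^ Suc n = (\<Prod>j=1..Suc n. Gamma (1 + \<beta> / 2 * j) * Gamma (\<kappa> + \<beta> / 2 * (real j - 1)) / Gamma (1 + \<beta> / 2))"
    unfolding prod_dividef prod.distrib P1_def P2_def G_def T_def by simp
  finally show ?case .
qed

text \<open>The constant in closed form is the reciprocal of the Selberg integral, so the density
  has total mass 1. From here on only the integrals are used.\<close>

lemma laguerre_const_eq:
  assumes "\<beta> > 0" "p \<ge> real n"
  shows "laguerre_const n p \<beta> * laguerre_integral \<beta> (\<beta> * (p - real n + 1) / 2) n = 1"
proof -
  have "\<beta> * (p - real n + 1) / 2 > 0" using assms by simp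
  note Z = laguerre_selberg[OF assms(1) this, of n]
  have e: "n * (\<beta> * (p - real n + 1) / 2) + \<beta> * n * (real n - 1) / 2 = \<beta> * real n * p / 2"
    by (simp add: field_simps)
  have "(\<Prod>j=1..n. Gamma (1 + \<beta> / 2) / (Gamma (1 + \<beta> / 2 * real j) * Gamma (\<beta> / 2 * (p - real n + real j)))) *
     (\<Prod>j=1..n. Gamma (1 + \<beta> / 2 * j) * Gamma (\<beta> * (p - real n + 1) / 2 + \<beta> / 2 * (real j - 1)) / Gamma (1 + \<beta> / 2)) = 1"
    unfolding prod.distrib[symmetric]
  proof (rule prod.neutral, rule ballI)
    fix j assume j: "j \<in> {1..n}"
    have "Gamma (1 + \<beta> / 2) > 0" "Gamma (1 + \<beta> / 2 * real j) > 0" "Gamma (\<beta> / 2 * (p - real n + real j)) > 0"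
      using assms j by (auto intro!: Gamma_real_pos add_pos_nonneg mult_pos_pos)
    moreover have arg: "\<beta> * (p - real n + 1) / 2 + \<beta> / 2 * (real j - 1) = \<beta> / 2 * (p - real n + real j)"
      by (simp add: field_simps)
    ultimately show "Gamma (1 + \<beta> / 2) / (Gamma (1 + \<beta> / 2 * real j) * Gamma (\<beta> / 2 * (p - real n + real j))) *
      (Gamma (1 + \<beta> / 2 * j) * Gamma (\<beta> * (p - real n + 1) / 2 + \<beta> / 2 * (real j - 1)) / Gamma (1 + \<beta> / 2)) = 1"
      unfolding arg by simp
  qed
  then have *: "laguerre_const n p \<beta> * laguerre_integral \<beta> (\<beta> * (p - real n + 1) / 2) n
    = 2 powr (- (\<beta> * real n * p / 2)) * 2 powr (\<beta> * real n * p / 2) * 1"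
    unfolding laguerre_const_def Z e by (simp only: mult_ac)
  show ?thesis unfolding * by (simp add: powr_add[symmetric])
qed


section \<open>The equilibrium configuration\<close>

lemma sum_pairs:
  fixes f :: "nat \<Rightarrow> nat \<Rightarrow> real"
  shows "(\<Sum>j=1..n. \<Sum>i=1..<j. f i j + f j i) = (\<Sum>i=1..n. \<Sum>j\<in>{1..n}-{i}. f i j)"
proof (induction n)
  case (Suc n)
  have "(\<Sum>i=1..Suc n. \<Sum>j\<in>{1..Suc n}-{i}. f i j)
     = (\<Sum>i=1..n. \<Sum>j\<in>{1..Suc n}-{i}. f i j) + (\<Sum>j=1..n. f (Suc n) j)"
    by (subst sum.nat_ivl_Suc') (auto intro!: arg_cong2[where f="(+)"] sum.cong)
  also have "(\<Sum>i=1..n. \<Sum>j\<in>{1..Suc n}-{i}. f i j) = (\<Sum>i=1..n. f i (Suc n) + (\<Sum>j\<in>{1..n}-{i}. f i j))"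
  proof (intro sum.cong refl)
    fix i assume "i \<in> {1..n}"
    then have "{1..Suc n}-{i} = insert (Suc n) ({1..n}-{i})" by auto
    then show "(\<Sum>j\<in>{1..Suc n}-{i}. f i j) = f i (Suc n) + (\<Sum>j\<in>{1..n}-{i}. f i j)" by simp
  qed
  also have "\<dots> = (\<Sum>i=1..n. f i (Suc n)) + (\<Sum>j=1..n. \<Sum>i=1..<j. f i j + f j i)"
    by (subst sum.distrib) (simp only: Suc.IH)
  finally show ?case
    by (simp add: atLeastLessThanSuc_atLeastAtMost sum.distrib add_ac)
qed simp

text \<open>The critical point equations of \<open>laguerre_kernel \<beta> 0 (\<kappa> + 1)\<close>. With this shift of \<open>\<kappa>\<close>, the
  polynomial with roots \<open>L i\<close> is the expected characteristic polynomial for parameter \<open>\<kappa>\<close>.\<close>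

definition equilibrium :: "real \<Rightarrow> real \<Rightarrow> nat \<Rightarrow> (nat \<Rightarrow> real) \<Rightarrow> bool" where
  "equilibrium \<beta> \<kappa> n L \<longleftrightarrow> decreasing n L \<and> (\<forall>i\<in>{1..n}. L i > 0) \<and>
     (\<forall>i\<in>{1..n}. \<beta> * (\<Sum>j\<in>{1..n}-{i}. 1 / (L i - L j)) + \<kappa> / L i = 1 / 2)"

text \<open>The symmetry of the kernel moves the updated coordinate to the last place, where
  \<open>laguerre_kernel_Suc\<close> splits it off.\<close>

lemma laguerre_kernel_update:
  assumes i: "i \<in> {1..Suc n}"
  defines "s \<equiv> Transposition.transpose i (Suc n)"
  shows "laguerre_kernel \<beta> 0 \<kappa> (Suc n) (L(i := t)) =
    laguerre_kernel \<beta> 0 \<kappa> n (\<lambda>j. L (s j)) * (laguerre_weight \<kappa> t * (\<Prod>j\<in>{1..Suc n}-{i}. ((L j - t)\<^sup>2) powr (\<beta> / 2)))"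
proof -
  have s: "s permutes {1..Suc n}" unfolding s_def using i by (intro permutes_swap_id) auto
  have "laguerre_kernel \<beta> 0 \<kappa> (Suc n) (L(i := t)) = laguerre_kernel \<beta> 0 \<kappa> (Suc n) (\<lambda>j. (L(i := t)) (s j))"
    by (rule laguerre_kernel_permute[OF s, symmetric])
  also have "(\<lambda>j. (L(i := t)) (s j)) = (\<lambda>j. L (s j))(Suc n := t)"
    by (auto simp: s_def Transposition.transpose_def fun_eq_iff)
  also have "laguerre_kernel \<beta> 0 \<kappa> (Suc n) ((\<lambda>j. L (s j))(Suc n := t)) =
    laguerre_kernel \<beta> 0 \<kappa> n (\<lambda>j. L (s j)) * (laguerre_weight \<kappa> t * (\<Prod>j=1..n. ((L (s j) - t)\<^sup>2 + 0) powr (\<beta> / 2)))"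
    by (rule laguerre_kernel_Suc)
  also have "(\<Prod>j=1..n. ((L (s j) - t)\<^sup>2 + 0) powr (\<beta> / 2)) = (\<Prod>j\<in>{1..Suc n}-{i}. ((L j - t)\<^sup>2) powr (\<beta> / 2))"
    by (rule prod.reindex_bij_witness[of _ s s]) (use i in \<open>auto simp: s_def Transposition.transpose_def\<close>)
  finally show ?thesis .
qed

text \<open>As a function of one coordinate the kernel is \<open>C * exp (F t)\<close> near
  \<open>L i\<close> with \<open>C > 0\<close>. A local maximum forces \<open>F\<close> to have
  derivative 0 there, which is the force balance.\<close>

lemma equilibrium_of_local_max:
  assumes "\<beta> > 0" "\<kappa> > 0" and L: "decreasing n L" "\<And>i. i \<in> {1..n} \<Longrightarrow> L i > 0"
    and max: "\<And>i. i \<in> {1..n} \<Longrightarrow> \<exists>d>0. \<forall>t. \<bar>L i - t\<bar> < d \<longrightarrow>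
       laguerre_kernel \<beta> 0 (\<kappa> + 1) n (L(i := t)) \<le> laguerre_kernel \<beta> 0 (\<kappa> + 1) n L"
  shows "equilibrium \<beta> \<kappa> n L"
  unfolding equilibrium_def
proof (intro conjI ballI)
  show "L i > 0" if "i \<in> {1..n}" for i using L(2) that .
  fix i assume i: "i \<in> {1..n}"
  then obtain m where n: "n = Suc m" by (cases n) auto
  define s where "s = Transposition.transpose i (Suc m)"
  have s: "s permutes {1..Suc m}" unfolding s_def using i n by (intro permutes_swap_id) auto
  define C where "C = laguerre_kernel \<beta> 0 (\<kappa> + 1) m (\<lambda>j. L (s j))"
  have C: "C > 0"
    unfolding C_def
  proof (rule laguerre_kernel_pos)
    have "inj_on (L \<circ> s) {1..Suc m}"
      using decreasing_inj_on[OF L(1)] n s by (intro comp_inj_on permutes_inj_on[OF s]) (simp add: permutes_image)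
    then have "inj_on (\<lambda>j. L (s j)) {1..Suc m}" by (simp add: o_def)
    then show "inj_on (\<lambda>j. L (s j)) {1..m}" by (rule inj_on_subset) auto
    show "L (s j) > 0" if "j \<in> {1..m}" for j
      using permutes_in_image[OF s, of j] that n by (intro L(2)) auto
  qed
  define F where "F t = (\<Sum>j\<in>{1..n}-{i}. \<beta> / 2 * ln ((L j - t)\<^sup>2)) + (\<kappa> * ln t - t / 2)" for t
  have neq: "L j \<noteq> L i" if "j \<in> {1..n} - {i}" for j
    using inj_onD[OF decreasing_inj_on[OF L(1)], of j i] that i by auto
  have K: "laguerre_kernel \<beta> 0 (\<kappa> + 1) n (L(i := t)) = C * exp (F t)"
    if "t > 0" "\<And>j. j \<in> {1..n} - {i} \<Longrightarrow> L j \<noteq> t" for t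
  proof -
    have "(\<Prod>j\<in>{1..n}-{i}. ((L j - t)\<^sup>2) powr (\<beta> / 2)) = (\<Prod>j\<in>{1..n}-{i}. exp (\<beta> / 2 * ln ((L j - t)\<^sup>2)))"
      using that by (intro prod.cong) (auto simp: powr_def)
    also have "\<dots> = exp (\<Sum>j\<in>{1..n}-{i}. \<beta> / 2 * ln ((L j - t)\<^sup>2))" by (simp add: exp_sum)
    finally have 1: "(\<Prod>j\<in>{1..n}-{i}. ((L j - t)\<^sup>2) powr (\<beta> / 2)) = exp (\<Sum>j\<in>{1..n}-{i}. \<beta> / 2 * ln ((L j - t)\<^sup>2))" .
    have 2: "laguerre_weight (\<kappa> + 1) t = exp (\<kappa> * ln t - t / 2)"
      using that by (simp add: laguerre_weight_def powr_def exp_add[symmetric])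
    have "laguerre_kernel \<beta> 0 (\<kappa> + 1) n (L(i := t)) = C * (laguerre_weight (\<kappa> + 1) t * (\<Prod>j\<in>{1..n}-{i}. ((L j - t)\<^sup>2) powr (\<beta> / 2)))"
      using laguerre_kernel_update[of i m] i unfolding n C_def s_def by blast
    then show ?thesis unfolding 1 2 F_def by (simp add: exp_add[symmetric] add_ac)
  qed
  obtain d where d: "d > 0" "\<And>t. \<bar>L i - t\<bar> < d \<Longrightarrow> laguerre_kernel \<beta> 0 (\<kappa> + 1) n (L(i := t)) \<le> laguerre_kernel \<beta> 0 (\<kappa> + 1) n L"
    using max[OF i] by blast
  \<comment> \<open>Within this radius \<open>t\<close> stays positive, meets no other particle, and
    remains where \<open>L i\<close> is known to be maximal.\<close>
  define d' where "d' = Min (insert (min d (L i)) ((\<lambda>j. \<bar>L j - L i\<bar>) ` ({1..n} - {i})))"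
  have d': "d' > 0" unfolding d'_def using d(1) L(2)[OF i] neq by (subst Min_gr_iff) auto
  have d'_le: "d' \<le> d" "d' \<le> L i" "\<And>j. j \<in> {1..n} - {i} \<Longrightarrow> d' \<le> \<bar>L j - L i\<bar>"
  proof -
    have "d' \<le> min d (L i)" unfolding d'_def by (intro Min_le) auto
    then show "d' \<le> d" "d' \<le> L i" by auto
    show "\<And>j. j \<in> {1..n} - {i} \<Longrightarrow> d' \<le> \<bar>L j - L i\<bar>" unfolding d'_def by (intro Min_le) auto
  qed
  have "(\<Sum>j\<in>{1..n}-{i}. \<beta> / (L i - L j)) + (\<kappa> / L i - 1 / 2) = 0"
  proof (rule DERIV_local_max[OF _ d'])
    show "(F has_real_derivative (\<Sum>j\<in>{1..n}-{i}. \<beta> / (L i - L j)) + (\<kappa> / L i - 1 / 2)) (at (L i))"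
      unfolding F_def
    proof (intro DERIV_add DERIV_sum)
      fix j assume j: "j \<in> {1..n} - {i}"
      have half: "\<beta> / 2 * (2 * a * (- 1) / a\<^sup>2) = \<beta> / - a" if "a \<noteq> 0" for a :: real
        using that by (simp add: power2_eq_square field_simps)
      have "((\<lambda>t. \<beta> / 2 * ln ((L j - t)\<^sup>2)) has_real_derivative \<beta> / 2 * (2 * (L j - L i) * (- 1) / (L j - L i)\<^sup>2)) (at (L i))"
        using neq[OF j] by (auto intro!: derivative_eq_intros simp: power2_eq_square zero_less_mult_iff)
      then show "((\<lambda>t. \<beta> / 2 * ln ((L j - t)\<^sup>2)) has_real_derivative \<beta> / (L i - L j)) (at (L i))"
        using half[of "L j - L i"] neq[OF j] by simp
    qed (use L(2)[OF i] in \<open>auto intro!: derivative_eq_intros\<close>)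
    show "\<forall>t. \<bar>L i - t\<bar> < d' \<longrightarrow> F t \<le> F (L i)"
    proof (intro allI impI)
      fix t assume t: "\<bar>L i - t\<bar> < d'"
      have "t > 0" using t d'_le(2) by linarith
      moreover have "L j \<noteq> t" if "j \<in> {1..n} - {i}" for j using d'_le(3)[OF that] t by auto
      ultimately have "C * exp (F t) \<le> laguerre_kernel \<beta> 0 (\<kappa> + 1) n L"
        using K[of t] d(2)[of t] t d'_le(1) by auto
      also have "\<dots> = C * exp (F (L i))"
        using K[of "L i"] L(2)[OF i] neq by simp
      finally show "F t \<le> F (L i)" using C by simp
    qed
  qed
  then show "\<beta> * (\<Sum>j\<in>{1..n}-{i}. 1 / (L i - L j)) + \<kappa> / L i = 1 / 2"
    unfolding sum_distrib_left times_divide_eq_right mult_1_right by linarith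
qed (rule L(1))

lemma laguerre_kernel_le_prod:
  assumes "\<beta> > 0"
  shows "laguerre_kernel \<beta> 0 \<kappa> n l \<le> (\<Prod>i=1..n. laguerre_weight \<kappa> (l i) * (1 + l i) powr (\<beta> * n))"
proof -
  have one: "\<bar>1::real\<bar> \<le> 1 * (\<Prod>i=1..n. (1 + l i) powr 0)" if l: "\<And>i. i \<in> {1..n} \<Longrightarrow> l i > 0"
  proof -
    have "(\<Prod>i=1..n. (1 + l i) powr 0) = 1"
    proof (rule prod.neutral, rule ballI)
      fix j assume "j \<in> {1..n}"
      then show "(1 + l j) powr 0 = 1" using l[of j] by simp
    qed
    then show ?thesis by simp
  qed
  show ?thesis
    using laguerre_kernel_le'[of 0 \<beta> n l 1 1 0 \<kappa>, OF _ _ assms one] by simp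
qed

text \<open>The coordinates outside \<open>{1..n}\<close> are pinned to 0, so that Tychonoff's
  theorem applies to the whole function space. The order is only weak, to keep the set
  closed.\<close>

lemma compact_decreasing_box:
  "compact {l :: nat \<Rightarrow> real. (\<forall>i. l i \<in> (if i \<in> {1..n} then {0..R} else {0})) \<and>
     (\<forall>i\<in>{1..n}. \<forall>j\<in>{1..n}. i < j \<longrightarrow> l j \<le> l i)}" (is "compact ?S")
proof -
  let ?B = "\<lambda>i. if i \<in> {1..n} then {0..R} else {0::real}"
  have "compactin (product_topology (\<lambda>_. euclidean) UNIV) (PiE UNIV ?B)"
    by (subst compactin_PiE) auto
  then have c: "compact (PiE UNIV ?B)" by (simp add: euclidean_product_topology)
  have "closed {l :: nat \<Rightarrow> real. \<forall>i\<in>{1..n}. \<forall>j\<in>{1..n}. i < j \<longrightarrow> l j \<le> l i}"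
  proof -
    have "{l :: nat \<Rightarrow> real. \<forall>i\<in>{1..n}. \<forall>j\<in>{1..n}. i < j \<longrightarrow> l j \<le> l i}
        = (\<Inter>i\<in>{1..n}. \<Inter>j\<in>{1..n} \<inter> {i<..}. {l. l j \<le> l i})" by auto
    then show ?thesis
      by (auto intro!: closed_INT closed_Collect_le continuous_on_product_coordinates)
  qed
  then have "compact (PiE UNIV ?B \<inter> {l :: nat \<Rightarrow> real. \<forall>i\<in>{1..n}. \<forall>j\<in>{1..n}. i < j \<longrightarrow> l j \<le> l i})"
    using c by (intro compact_Int_closed)
  moreover have "PiE UNIV ?B \<inter> {l :: nat \<Rightarrow> real. \<forall>i\<in>{1..n}. \<forall>j\<in>{1..n}. i < j \<longrightarrow> l j \<le> l i} = ?S"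
    by (simp only: PiE_UNIV_domain Pi_def Collect_conj_eq UNIV_I simp_thms)
  ultimately show ?thesis by simp
qed

text \<open>The kernel attains its maximum over the weakly decreasing configurations in
  \<open>[0, R]\<close>. At the maximum no coordinate is 0 and no two coincide, since the kernel
  vanishes there, and none reaches \<open>R\<close>, by the choice of \<open>R\<close>. So small
  changes of one coordinate stay in the set, and the maximum is a critical point.\<close>

theorem equilibrium_exists:
  assumes \<beta>: "\<beta> > 0" and \<kappa>: "\<kappa> > 0"
  obtains L where "equilibrium \<beta> \<kappa> n L"
proof -
  let ?K = "laguerre_kernel \<beta> 0 (\<kappa> + 1) n"
  define h where "h t = laguerre_weight (\<kappa> + 1) t * (1 + t) powr (\<beta> * n)" for t
  have h0: "h t \<ge> 0" for t by (simp add: h_def)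
  have heq: "h t = t powr \<kappa> * exp (- t / 2) * (1 + t) powr (\<beta> * n)" if "t > 0" for t
    using that by (simp add: h_def laguerre_weight_def)
  have lim: "(h \<longlongrightarrow> 0) at_top"
  proof -
    have "((\<lambda>t. t powr \<kappa> * exp (- t / 2) * (1 + t) powr (\<beta> * n)) \<longlongrightarrow> 0) at_top" by real_asymp
    then show ?thesis
      by (rule Lim_transform_eventually) (use eventually_gt_at_top[of 0] in \<open>eventually_elim, simp add: heq\<close>)
  qed
  have "\<exists>B. \<forall>t. h t \<le> B"
  proof -
    have "eventually (\<lambda>t. h t < 1) at_top" using order_tendstoD(2)[OF lim, of 1] by simp
    then obtain T where T: "\<And>t. t \<ge> T \<Longrightarrow> h t < 1" by (auto simp: eventually_at_top_linorder)
    have "h t \<le> max 1 (\<bar>T\<bar> powr \<kappa> * (1 + \<bar>T\<bar>) powr (\<beta> * n))" for t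
    proof (cases "t \<ge> T \<or> t \<le> 0")
      case True
      then show ?thesis using T[of t] by (auto simp: h_def laguerre_weight_nonpos)
    next
      case False
      then have "t powr \<kappa> * exp (- t / 2) * (1 + t) powr (\<beta> * n) \<le> \<bar>T\<bar> powr \<kappa> * 1 * (1 + \<bar>T\<bar>) powr (\<beta> * n)"
        using \<beta> \<kappa> by (intro mult_mono powr_mono2) auto
      then show ?thesis using False by (simp add: heq)
    qed
    then show ?thesis by blast
  qed
  then obtain B' where "\<And>t. h t \<le> B'" by blast
  then obtain B where B: "B \<ge> 1" "\<And>t. h t \<le> B" by (metis max.cobounded1 max.cobounded2 order_trans)
  define l0 where "l0 i = (if i \<in> {1..n} then real (n + 1 - i) else 0)" for i
  have Kl0: "?K l0 > 0" by (intro laguerre_kernel_pos) (auto simp: l0_def inj_on_def)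
  \<comment> \<open>The kernel is at most the product of the \<open>h (l i)\<close>, and each factor
    is at most \<open>B\<close>. One coordinate beyond this threshold already puts the kernel below
    its value at the comparison point \<open>l0\<close>. The bound \<open>B \<ge> 1\<close> allows
    the exponent \<open>n\<close> where \<open>n - 1\<close> factors remain.\<close>
  have "eventually (\<lambda>t. h t < ?K l0 / B ^ n) at_top" using order_tendstoD(2)[OF lim] Kl0 B(1) by simp
  then obtain T where T: "\<And>t. t \<ge> T \<Longrightarrow> h t < ?K l0 / B ^ n" by (auto simp: eventually_at_top_linorder)
  define R where "R = max T (real n)"
  define S where "S = {l :: nat \<Rightarrow> real. (\<forall>i. l i \<in> (if i \<in> {1..n} then {0..R} else {0})) \<and>
     (\<forall>i\<in>{1..n}. \<forall>j\<in>{1..n}. i < j \<longrightarrow> l j \<le> l i)}"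
  have l0S: "l0 \<in> S" unfolding S_def l0_def R_def by auto
  have S0: "l i \<ge> 0" if "l \<in> S" for l i
  proof -
    have "l i \<in> (if i \<in> {1..n} then {0..R} else {0})" using that unfolding S_def by blast
    then show ?thesis by (auto split: if_splits)
  qed
  have cont: "continuous_on S ?K"
  proof -
    have "continuous_on S (\<lambda>l. pair_product \<beta> 0 n l * (\<Prod>i=1..n. l i powr \<kappa> * exp (- l i / 2)))"
      unfolding pair_product_def
      using \<beta> \<kappa> S0
      by (intro continuous_on_mult continuous_on_prod continuous_on_powr' continuous_on_add continuous_on_power
          continuous_on_diff continuous_on_const continuous_on_exp continuous_on_divide continuous_on_minus
          continuous_on_subset[OF continuous_on_product_coordinates subset_UNIV]) auto
    moreover have "pair_product \<beta> 0 n l * (\<Prod>i=1..n. l i powr \<kappa> * exp (- l i / 2)) = ?K l" if "l \<in> S" for l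
    proof -
      have "(\<Prod>i=1..n. l i powr \<kappa> * exp (- l i / 2)) = (\<Prod>i=1..n. laguerre_weight (\<kappa> + 1) (l i))"
        using \<kappa> S0[OF that] by (intro prod.cong refl) (auto simp: laguerre_weight_def indicator_def not_less order.antisym)
      then show ?thesis by (simp add: laguerre_kernel_def)
    qed
    ultimately show ?thesis by (simp cong: continuous_on_cong)
  qed
  have "compact S" unfolding S_def by (rule compact_decreasing_box)
  moreover have "S \<noteq> {}" using l0S by blast
  ultimately obtain L where L: "L \<in> S" and Lmax: "\<And>l. l \<in> S \<Longrightarrow> ?K l \<le> ?K L"
    using continuous_attains_sup[OF _ _ cont] by blast
  have KL: "?K L > 0" using Lmax[OF l0S] Kl0 by linarith
  have Lpos: "L i > 0" if "i \<in> {1..n}" for i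
    using KL laguerre_kernel_eq_0[OF that, of L \<beta> 0 "\<kappa> + 1"] by force
  have Ldec: "decreasing n L"
    unfolding decreasing_def
  proof (intro ballI impI)
    fix i j assume ij: "i \<in> {1..n}" "j \<in> {1..n}" "i < j"
    have "L j \<noteq> L i"
    proof
      assume "L j = L i"
      then have p0: "(\<Prod>i=1..<j. ((L i - L j)\<^sup>2 + 0) powr (\<beta> / 2)) = 0"
        using ij by (subst prod_zero) (auto intro!: bexI[of _ i])
      have "pair_product \<beta> 0 n L = 0" unfolding pair_product_def
        by (rule prod_zero, simp, rule bexI[where x = j], rule p0, rule ij(2))
      then show False using KL by (simp add: laguerre_kernel_def)
    qed
    moreover have "L j \<le> L i" using L ij unfolding S_def by blast
    ultimately show "L j < L i" by simp
  qed
  have LR: "L i < R" if i: "i \<in> {1..n}" for i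
  proof (rule ccontr)
    assume "\<not> L i < R"
    then have hi: "h (L i) < ?K l0 / B ^ n" by (intro T) (simp add: R_def)
    have "?K L \<le> (\<Prod>i=1..n. h (L i))"
      unfolding h_def by (rule laguerre_kernel_le_prod[OF \<beta>])
    also have "\<dots> = h (L i) * (\<Prod>j\<in>{1..n}-{i}. h (L j))" using i by (intro prod.remove) auto
    also have "\<dots> \<le> h (L i) * (\<Prod>j\<in>{1..n}-{i}. B)"
      using B h0 by (intro mult_left_mono prod_mono) auto
    also have "\<dots> \<le> h (L i) * B ^ n"
    proof -
      have "card ({1..n} - {i}) \<le> n" using i by simp
      then have "B ^ card ({1..n} - {i}) \<le> B ^ n" using B(1) by (rule power_increasing)
      then show ?thesis using h0 by (simp add: mult_left_mono)
    qed
    also have "\<dots> < ?K l0" using hi B(1) by (simp add: field_simps)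
    finally show False using Lmax[OF l0S] by simp
  qed
  have "equilibrium \<beta> \<kappa> n L"
  proof (rule equilibrium_of_local_max[OF \<beta> \<kappa> Ldec Lpos])
    fix i assume i: "i \<in> {1..n}"
    define d where "d = Min (insert (min (R - L i) (L i)) ((\<lambda>j. \<bar>L j - L i\<bar>) ` ({1..n} - {i})))"
    have neq: "L j \<noteq> L i" if "j \<in> {1..n} - {i}" for j
      using inj_onD[OF decreasing_inj_on[OF Ldec], of j i] that i by auto
    have d: "d > 0" unfolding d_def using LR[OF i] Lpos[OF i] neq by (subst Min_gr_iff) auto
    have "d \<le> min (R - L i) (L i)" unfolding d_def by (intro Min_le) auto
    then have d1: "d \<le> R - L i" "d \<le> L i" by auto
    have d2: "d \<le> \<bar>L j - L i\<bar>" if "j \<in> {1..n} - {i}" for j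
      unfolding d_def using that by (intro Min_le) auto
    have "L(i := t) \<in> S" if t: "\<bar>L i - t\<bar> < d" for t
      unfolding S_def
    proof (intro CollectI conjI allI ballI impI)
      fix j show "(L(i := t)) j \<in> (if j \<in> {1..n} then {0..R} else {0})"
      proof (cases "j = i")
        case False
        have "L j \<in> (if j \<in> {1..n} then {0..R} else {0})" using L unfolding S_def by blast
        then show ?thesis using False by (simp only: fun_upd_other not_False_eq_True)
      qed (use i t d1 in auto)
    next
      fix j k assume jk: "j \<in> {1..n}" "k \<in> {1..n}" "j < k"
      have "L k < L j" using Ldec jk unfolding decreasing_def by blast
      then show "(L(i := t)) k \<le> (L(i := t)) j"
        using d2[of j] d2[of k] t jk by (auto simp: abs_if split: if_splits)
    qed
    then show "\<exists>d>0. \<forall>t. \<bar>L i - t\<bar> < d \<longrightarrow> ?K (L(i := t)) \<le> ?K L"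
      using d Lmax by blast
  qed simp
  then show ?thesis by (rule that)
qed


text \<open>With \<open>q = B / (A - B)\<close>, the number \<open>v\<close> is the convex
  combination of the exponent on the right and \<open>w\<close> with weights
  \<open>1 / (1 + q)\<close> and \<open>q / (1 + q)\<close>; convexity of \<open>exp\<close> gives
  the claim. It bounds the difference quotient of \<open>L i * exp (v i)\<close> by the exponential
  of that of \<open>L i * v i\<close>.\<close>

lemma weighted_exp_tangent:
  fixes A B v w :: real
  assumes "B \<ge> 0" "A > B"
  shows "(A * exp v - B * exp w) / (A - B) \<le> exp ((A * v - B * w) / (A - B))"
proof -
  define q where "q = B / (A - B)"
  have q: "q \<ge> 0" "A / (A - B) = 1 + q" using assms by (auto simp: q_def field_simps)
  define e where "e = (1 + q) * v - q * w"
  have "exp ((1 - q / (1 + q)) * e + q / (1 + q) * w) \<le> (1 - q / (1 + q)) * exp e + q / (1 + q) * exp w"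
    using q convex_onD[OF exp_convex, of "q / (1 + q)" e w] by (simp add: field_simps)
  also have "(1 - q / (1 + q)) * e + q / (1 + q) * w = v"
  proof -
    have "(1 - q / (1 + q)) = 1 / (1 + q)" using q by (simp add: field_simps)
    then have "(1 - q / (1 + q)) * e + q / (1 + q) * w = (e + q * w) / (1 + q)" by (simp add: add_divide_distrib)
    also have "e + q * w = (1 + q) * v" by (simp add: e_def)
    finally show ?thesis using q by simp
  qed
  finally have "(1 + q) * exp v \<le> (1 + q) * ((1 - q / (1 + q)) * exp e + q / (1 + q) * exp w)"
    using q by (intro mult_left_mono) auto
  also have "\<dots> = exp e + q * exp w"
  proof -
    have r: "1 - q / (1 + q) = 1 / (1 + q)" using q by (simp add: field_simps)
    show ?thesis unfolding r using q by (simp add: distrib_left)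
  qed
  finally have "(1 + q) * exp v - q * exp w \<le> exp e" by simp
  moreover have "(A * exp v - B * exp w) / (A - B) = (1 + q) * exp v - q * exp w"
    by (simp only: q(2)[symmetric]) (simp add: q_def diff_divide_distrib)
  moreover have "(A * v - B * w) / (A - B) = e"
    unfolding e_def by (simp only: q(2)[symmetric]) (simp add: q_def diff_divide_distrib)
  ultimately show ?thesis by simp
qed

section \<open>Identities and estimates at the equilibrium\<close>

locale laguerre_equilibrium =
  fixes \<beta> \<kappa> :: real and n :: nat and L :: "nat \<Rightarrow> real"
  assumes \<beta>: "\<beta> > 0" and \<kappa>: "\<kappa> > 0" and eq: "equilibrium \<beta> \<kappa> n L"
begin

lemma L_decreasing: "decreasing n L" and L_pos: "i \<in> {1..n} \<Longrightarrow> L i > 0"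
  and force_balance: "i \<in> {1..n} \<Longrightarrow> \<beta> * (\<Sum>j\<in>{1..n}-{i}. 1 / (L i - L j)) + \<kappa> / L i = 1 / 2"
  using eq unfolding equilibrium_def by auto

lemma L_less: "i \<in> {1..n} \<Longrightarrow> j \<in> {1..n} \<Longrightarrow> i < j \<Longrightarrow> L j < L i"
  using L_decreasing unfolding decreasing_def by blast

lemma L_le_first: "i \<in> {1..n} \<Longrightarrow> L i \<le> L 1"
  using L_less[of 1 i] by (cases "i = 1") auto

lemma sum_pairs_L:
  "(\<Sum>i=1..n. g i * (\<Sum>j\<in>{1..n}-{i}. 1 / (L i - L j))) = (\<Sum>j=1..n. \<Sum>i=1..<j. (g i - g j) / (L i - L j))"
proof -
  have "(\<Sum>i=1..n. g i * (\<Sum>j\<in>{1..n}-{i}. 1 / (L i - L j))) = (\<Sum>i=1..n. \<Sum>j\<in>{1..n}-{i}. g i / (L i - L j))"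
    by (simp add: sum_distrib_left)
  also have "\<dots> = (\<Sum>j=1..n. \<Sum>i=1..<j. g i / (L i - L j) + g j / (L j - L i))"
    by (rule sum_pairs[symmetric])
  also have "\<dots> = (\<Sum>j=1..n. \<Sum>i=1..<j. (g i - g j) / (L i - L j))"
  proof (intro sum.cong refl)
    fix i j
    have "g j / (L j - L i) = - (g j / (L i - L j))" by (metis minus_diff_eq minus_divide_right)
    then show "g i / (L i - L j) + g j / (L j - L i) = (g i - g j) / (L i - L j)" by (simp add: diff_divide_distrib)
  qed
  finally show ?thesis .
qed

text \<open>The force balance weighted by an arbitrary \<open>g\<close>; every identity below is a choice of \<open>g\<close>.\<close>

lemma weighted_balance:
  "\<beta> * (\<Sum>j=1..n. \<Sum>i=1..<j. (g i - g j) / (L i - L j)) + \<kappa> * (\<Sum>i=1..n. g i / L i) = (\<Sum>i=1..n. g i) / 2"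
proof -
  have "(\<Sum>i=1..n. g i) / 2 = (\<Sum>i=1..n. g i * (\<beta> * (\<Sum>j\<in>{1..n}-{i}. 1 / (L i - L j)) + \<kappa> / L i))"
    unfolding sum_divide_distrib by (intro sum.cong refl, subst force_balance, assumption, simp)
  also have "\<dots> = \<beta> * (\<Sum>i=1..n. g i * (\<Sum>j\<in>{1..n}-{i}. 1 / (L i - L j))) + \<kappa> * (\<Sum>i=1..n. g i / L i)"
    by (simp add: distrib_left sum.distrib sum_distrib_left mult_ac)
  finally show ?thesis unfolding sum_pairs_L by (rule sym)
qed

text \<open>The choice \<open>g = L\<close>, the virial identity: each of the
  \<open>n * (n - 1) / 2\<close> pairs contributes exactly 1.\<close>

lemma sum_L: "(\<Sum>i=1..n. L i) = 2 * \<kappa> * n + \<beta> * n * (real n - 1)"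
proof -
  have "(\<Sum>j=1..n. \<Sum>i=1..<j. (L i - L j) / (L i - L j)) = (\<Sum>j=1..n. real (j - 1))"
  proof (rule sum.cong[OF refl])
    fix j assume j: "j \<in> {1..n}"
    have "(\<Sum>i=1..<j. (L i - L j) / (L i - L j)) = (\<Sum>i=1..<j. 1)"
      using j L_less by (intro sum.cong) force+
    then show "(\<Sum>i=1..<j. (L i - L j) / (L i - L j)) = real (j - 1)" by simp
  qed
  also have "\<dots> = n * (real n - 1) / 2" by (induction n) (auto simp: field_simps)
  finally have 1: "(\<Sum>j=1..n. \<Sum>i=1..<j. (L i - L j) / (L i - L j)) = n * (real n - 1) / 2" .
  have 2: "(\<Sum>i=1..n. L i / L i) = n" using L_pos by (subst sum.cong[OF refl, of _ _ "\<lambda>_. 1"]) force+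
  show ?thesis using weighted_balance[of L] unfolding 1 2 by (simp add: field_simps)
qed

text \<open>For constant \<open>g\<close> all pair terms vanish, so the positive terms
  \<open>\<kappa> / L i\<close> add up to \<open>n / 2\<close>. This keeps the equilibrium away from
  0.\<close>

lemma inverse_L_le: 
  assumes "i \<in> {1..n}" shows "\<kappa> / L i \<le> n / 2"
proof -
  have "\<kappa> / L i \<le> (\<Sum>i=1..n. \<kappa> / L i)"
    using assms \<kappa> L_pos by (intro member_le_sum) (auto simp: less_imp_le)
  also have "\<dots> = n / 2" using weighted_balance[of "\<lambda>_. 1"] by (simp add: sum_distrib_left)
  finally show ?thesis .
qed

text \<open>Adding the balances of the particles \<open>1..i\<close> cancels their mutual repulsion.\<close>

lemma gap:
  assumes "i \<in> {1..n}" "j \<in> {1..n}" "i < j"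
  shows "2 * \<beta> / n \<le> L i - L j"
proof -
  define g where "g k = (if k \<le> i then 1 else 0 :: real)" for k
  have term_nonneg: "(g k - g m) / (L k - L m) \<ge> 0" if "k \<in> {1..<m}" "m \<in> {1..n}" for k m
    using that L_less[of k m] by (intro divide_nonneg_nonneg) (auto simp: g_def)
  have "1 / (L i - L j) = (g i - g j) / (L i - L j)" using assms by (simp add: g_def)
  also have "\<dots> \<le> (\<Sum>k=1..<j. (g k - g j) / (L k - L j))"
    using assms term_nonneg by (intro member_le_sum[of i "{1..<j}" "\<lambda>k. (g k - g j) / (L k - L j)"]) auto
  also have "\<dots> \<le> (\<Sum>m=1..n. \<Sum>k=1..<m. (g k - g m) / (L k - L m))"
    using assms term_nonneg by (intro member_le_sum[of j "{1..n}" "\<lambda>m. \<Sum>k=1..<m. (g k - g m) / (L k - L m)"] sum_nonneg) auto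
  finally have "\<beta> * (1 / (L i - L j)) \<le> \<beta> * (\<Sum>m=1..n. \<Sum>k=1..<m. (g k - g m) / (L k - L m))"
    using \<beta> by (intro mult_left_mono) auto
  also have "\<dots> \<le> (\<Sum>k=1..n. g k) / 2"
  proof -
    have "0 \<le> \<kappa> * (\<Sum>k=1..n. g k / L k)"
      using \<kappa> L_pos by (intro mult_nonneg_nonneg sum_nonneg divide_nonneg_pos) (auto simp: g_def)
    then show ?thesis using weighted_balance[of g] by simp
  qed
  also have "\<dots> \<le> (\<Sum>k=1..n. 1) / 2" by (intro divide_right_mono sum_mono) (auto simp: g_def)
  finally have "\<beta> / (L i - L j) \<le> n / 2" by simp
  then show ?thesis using L_less[OF assms] assms \<beta> by (simp add: field_simps)
qed

text \<open>With \<open>l i = L i * exp (v i)\<close> and \<open>g i = L i * v i\<close>,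
  \<open>weighted_exp_tangent\<close> bounds each pair factor by an exponential of a difference
  quotient of \<open>g\<close>. Then \<open>weighted_balance\<close> turns the sum of all these
  exponents into one-particle terms; the terms \<open>\<kappa> * v i\<close> cancel against the
  weight, and the rest is the stated energy. It is nonnegative because
  \<open>ln r \<le> r - 1\<close>.\<close>

lemma kernel_concentration:
  assumes l: "decreasing n l" "\<And>i. i \<in> {1..n} \<Longrightarrow> l i > 0"
  shows "laguerre_kernel \<beta> 0 (\<kappa> + 1) n l \<le> laguerre_kernel \<beta> 0 (\<kappa> + 1) n L *
     exp (- (\<Sum>i=1..n. L i * (l i / L i - 1 - ln (l i / L i))) / 2)"
proof -
  define v where "v i = ln (l i / L i)" for i
  have ev: "L i * exp (v i) = l i" if "i \<in> {1..n}" for i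
    using that l(2)[OF that] L_pos[OF that] by (simp add: v_def)
  define g where "g i = L i * v i" for i
  have "pair_product \<beta> 0 n l \<le> pair_product \<beta> 0 n L * (\<Prod>j=1..n. \<Prod>i=1..<j. exp (\<beta> * ((g i - g j) / (L i - L j))))"
    unfolding pair_product_def prod.distrib[symmetric]
  proof (intro prod_mono conjI prod_nonneg ballI)
    fix i j assume j: "j \<in> {1..n}" and i: "i \<in> {1..<j}"
    have ij: "i \<in> {1..n}" "i < j" using i j by auto
    have lt: "L j < L i" "l j < l i" using L_less[OF ij(1) j ij(2)] l(1) ij j unfolding decreasing_def by auto
    have "(l i - l j) / (L i - L j) \<le> exp ((g i - g j) / (L i - L j))"
      using weighted_exp_tangent[of "L j" "L i" "v i" "v j"] lt L_pos[OF j] ev[OF ij(1)] ev[OF j]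
      by (simp add: g_def)
    then have "l i - l j \<le> (L i - L j) * exp ((g i - g j) / (L i - L j))"
      using lt by (simp add: field_simps)
    then have "(l i - l j) powr \<beta> \<le> ((L i - L j) * exp ((g i - g j) / (L i - L j))) powr \<beta>"
      using lt \<beta> by (intro powr_mono2) auto
    also have "\<dots> = (L i - L j) powr \<beta> * exp (\<beta> * ((g i - g j) / (L i - L j)))"
      using lt by (simp add: powr_mult exp_powr_real mult.commute)
    finally show "((l i - l j)\<^sup>2 + 0) powr (\<beta> / 2) \<le> ((L i - L j)\<^sup>2 + 0) powr (\<beta> / 2) * exp (\<beta> * ((g i - g j) / (L i - L j)))"
      using lt by (simp add: sq_powr_half)
  qed auto
  also have "(\<Prod>j=1..n. \<Prod>i=1..<j. exp (\<beta> * ((g i - g j) / (L i - L j)))) = exp (\<beta> * (\<Sum>j=1..n. \<Sum>i=1..<j. (g i - g j) / (L i - L j)))"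
    by (simp add: exp_sum[symmetric] sum_distrib_left)
  also have "\<beta> * (\<Sum>j=1..n. \<Sum>i=1..<j. (g i - g j) / (L i - L j)) = (\<Sum>i=1..n. g i) / 2 - \<kappa> * (\<Sum>i=1..n. v i)"
  proof -
    have "(\<Sum>i=1..n. g i / L i) = (\<Sum>i=1..n. v i)" using L_pos by (intro sum.cong) (auto simp: g_def less_imp_neq[symmetric])
    then show ?thesis using weighted_balance[of g] by simp
  qed
  finally have pp: "pair_product \<beta> 0 n l \<le> pair_product \<beta> 0 n L * exp ((\<Sum>i=1..n. g i) / 2 - \<kappa> * (\<Sum>i=1..n. v i))" .
  have w: "(\<Prod>i=1..n. laguerre_weight (\<kappa> + 1) (l i)) = (\<Prod>i=1..n. laguerre_weight (\<kappa> + 1) (L i)) * exp (\<kappa> * (\<Sum>i=1..n. v i) - (\<Sum>i=1..n. l i - L i) / 2)"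
  proof -
    have "(\<Prod>i=1..n. laguerre_weight (\<kappa> + 1) (l i)) = (\<Prod>i=1..n. laguerre_weight (\<kappa> + 1) (L i) * exp (\<kappa> * v i - (l i - L i) / 2))"
    proof (rule prod.cong[OF refl])
      fix i assume i: "i \<in> {1..n}"
      have A: "l i powr \<kappa> = L i powr \<kappa> * exp (\<kappa> * v i)"
        using L_pos[OF i] by (simp add: ev[OF i, symmetric] powr_mult exp_powr_real mult.commute)
      have B: "exp (- l i / 2) = exp (- L i / 2) * exp (- (l i - L i) / 2)" by (simp add: exp_add[symmetric] field_simps)
      have C: "exp (\<kappa> * v i - (l i - L i) / 2) = exp (\<kappa> * v i) * exp (- (l i - L i) / 2)"
        by (simp only: exp_add[symmetric]) (simp add: field_simps)
      have D: "laguerre_weight (\<kappa> + 1) (l i) = l i powr \<kappa> * exp (- l i / 2)" "laguerre_weight (\<kappa> + 1) (L i) = L i powr \<kappa> * exp (- L i / 2)"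
        using L_pos[OF i] l(2)[OF i] by (simp_all add: laguerre_weight_def)
      show "laguerre_weight (\<kappa> + 1) (l i) = laguerre_weight (\<kappa> + 1) (L i) * exp (\<kappa> * v i - (l i - L i) / 2)"
        unfolding D A B C by (simp only: mult_ac)
    qed
    then show ?thesis by (simp add: prod.distrib exp_sum[symmetric] sum_subtractf sum_distrib_left sum_divide_distrib[symmetric])
  qed
  have "laguerre_kernel \<beta> 0 (\<kappa> + 1) n l \<le> (pair_product \<beta> 0 n L * exp ((\<Sum>i=1..n. g i) / 2 - \<kappa> * (\<Sum>i=1..n. v i))) *
     ((\<Prod>i=1..n. laguerre_weight (\<kappa> + 1) (L i)) * exp (\<kappa> * (\<Sum>i=1..n. v i) - (\<Sum>i=1..n. l i - L i) / 2))"
    unfolding laguerre_kernel_def w by (intro mult_right_mono pp mult_nonneg_nonneg prod_nonneg) auto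
  also have "\<dots> = laguerre_kernel \<beta> 0 (\<kappa> + 1) n L * exp ((\<Sum>i=1..n. g i) / 2 - (\<Sum>i=1..n. l i - L i) / 2)"
    by (simp add: laguerre_kernel_def exp_add[symmetric] exp_diff)
  also have "(\<Sum>i=1..n. g i) / 2 - (\<Sum>i=1..n. l i - L i) / 2 = - (\<Sum>i=1..n. L i * (l i / L i - 1 - ln (l i / L i))) / 2"
  proof -
    have "(\<Sum>i=1..n. L i * (l i / L i - 1 - ln (l i / L i))) = (\<Sum>i=1..n. (l i - L i) - g i)"
    proof (rule sum.cong[OF refl])
      fix i assume "i \<in> {1..n}"
      then have "L i \<noteq> 0" using L_pos by force
      then show "L i * (l i / L i - 1 - ln (l i / L i)) = (l i - L i) - g i" by (simp add: g_def v_def field_simps)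
    qed
    then show ?thesis by (simp add: sum_subtractf diff_divide_distrib)
  qed
  finally show ?thesis .
qed

subsection \<open>The Riccati inequality for the Stieltjes transform\<close>

definition stieltjes :: "real \<Rightarrow> real" where
  "stieltjes z = (\<Sum>i=1..n. 1 / (z - L i))"

text \<open>The choice \<open>g i = L i / (z - L i)\<close>, whose difference quotients are
  \<open>z / ((z - L i) * (z - L j))\<close>. The right-hand side is \<open>- \<beta> * z\<close>
  times the derivative of the transform, so this is a Riccati equation; the estimates below exploit
  its sign.\<close>

lemma riccati:
  assumes "\<And>i. i \<in> {1..n} \<Longrightarrow> z > L i"
  shows "\<beta> * z * (stieltjes z)\<^sup>2 + (2 * \<kappa> - z) * stieltjes z + n = \<beta> * z * (\<Sum>i=1..n. 1 / (z - L i)\<^sup>2)"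
proof -
  define u where "u i = 1 / (z - L i)" for i
  have pos: "z - L i \<noteq> 0" if "i \<in> {1..n}" for i using assms[OF that] by simp
  define S where "S = (\<Sum>j=1..n. \<Sum>i=1..<j. u i * u j)"
  have pairs: "(\<Sum>j=1..n. \<Sum>i=1..<j. (L i * u i - L j * u j) / (L i - L j)) = z * S"
    unfolding S_def sum_distrib_left
  proof (intro sum.cong refl)
    fix i j assume j: "j \<in> {1..n}" and i: "i \<in> {1..<j}"
    have ij: "i \<in> {1..n}" "i < j" using i j by auto
    have d: "L i - L j \<noteq> 0" using L_less[OF ij(1) j ij(2)] by simp
    have "L i * u i - L j * u j = (z * (L i - L j)) / ((z - L i) * (z - L j))"
      using pos[OF ij(1)] pos[OF j] unfolding u_def by (simp add: field_simps)
    then show "(L i * u i - L j * u j) / (L i - L j) = z * (u i * u j)"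
      using d by (simp add: u_def)
  qed
  have 1: "(\<Sum>i=1..n. L i * u i / L i) = stieltjes z"
    unfolding stieltjes_def u_def
  proof (rule sum.cong[OF refl])
    fix i assume "i \<in> {1..n}"
    then have "L i \<noteq> 0" using L_pos by force
    then show "L i * (1 / (z - L i)) / L i = 1 / (z - L i)" by simp
  qed
  have 2: "(\<Sum>i=1..n. L i * u i) = z * stieltjes z - n"
  proof -
    have "(\<Sum>i=1..n. L i * u i) = (\<Sum>i=1..n. z * u i - 1)"
      by (intro sum.cong refl) (use pos in \<open>simp add: u_def field_simps\<close>)
    then show ?thesis by (simp add: sum_subtractf stieltjes_def u_def sum_distrib_left)
  qed
  have 3: "(stieltjes z)\<^sup>2 = (\<Sum>i=1..n. (u i)\<^sup>2) + 2 * S"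
  proof -
    have "(stieltjes z)\<^sup>2 = (\<Sum>i=1..n. \<Sum>j=1..n. u i * u j)"
      by (simp add: stieltjes_def u_def power2_eq_square sum_product)
    also have "\<dots> = (\<Sum>i=1..n. (u i)\<^sup>2 + (\<Sum>j\<in>{1..n}-{i}. u i * u j))"
      by (intro sum.cong refl) (simp add: power2_eq_square sum.remove)
    also have "\<dots> = (\<Sum>i=1..n. (u i)\<^sup>2) + (\<Sum>j=1..n. \<Sum>i=1..<j. u i * u j + u j * u i)"
      by (simp only: sum.distrib[of "\<lambda>i. (u i)\<^sup>2"] sum_pairs)
    also have "(\<Sum>j=1..n. \<Sum>i=1..<j. u i * u j + u j * u i) = 2 * S"
      unfolding S_def sum_distrib_left by (intro sum.cong refl) simp
    finally show ?thesis .
  qed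
  have "\<beta> * (z * S) + \<kappa> * stieltjes z = (z * stieltjes z - n) / 2"
    using weighted_balance[of "\<lambda>i. L i * u i"] unfolding pairs 1 2 .
  then have "\<beta> * z * (2 * S) + (2 * \<kappa> - z) * stieltjes z + n = 0" by (simp add: algebra_simps)
  moreover have "(\<Sum>i=1..n. 1 / (z - L i)\<^sup>2) = (\<Sum>i=1..n. (u i)\<^sup>2)" by (simp add: u_def power_divide)
  ultimately show ?thesis unfolding 3 by (simp add: algebra_simps)
qed

text \<open>The larger zero of the discriminant of the quadratic in \<open>riccati\<close>;
  \<open>lower_edge\<close> is the smaller one. For
  \<open>\<kappa> = \<beta> * (p - real n) / 2\<close> the first radicand is \<open>p\<close>, so
  these are \<open>n\<close> times the Marchenko--Pastur edges at ratio
  \<open>p / n\<close>.\<close>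

definition edge :: real where
  "edge = \<beta> * (sqrt (n + 2 * \<kappa> / \<beta>) + sqrt n)\<^sup>2"

definition lower_edge :: real where
  "lower_edge = \<beta> * (sqrt (n + 2 * \<kappa> / \<beta>) - sqrt n)\<^sup>2"

lemma discriminant: "(z - 2 * \<kappa>)\<^sup>2 - 4 * \<beta> * n * z = (z - lower_edge) * (z - edge)"
proof -
  define a b where "a = sqrt (n + 2 * \<kappa> / \<beta>)" and "b = sqrt (real n)"
  have ab: "\<beta> * a\<^sup>2 = \<beta> * n + 2 * \<kappa>" "b\<^sup>2 = n" using \<beta> \<kappa> by (simp_all add: a_def b_def distrib_left)
  have "(z - lower_edge) * (z - edge) = z\<^sup>2 - 2 * z * (\<beta> * a\<^sup>2 + \<beta> * b\<^sup>2) + (\<beta> * a\<^sup>2 - \<beta> * b\<^sup>2)\<^sup>2"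
    unfolding edge_def lower_edge_def a_def[symmetric] b_def[symmetric] by (simp add: power2_eq_square algebra_simps)
  also have "\<dots> = (z - 2 * \<kappa>)\<^sup>2 - 4 * \<beta> * n * z" unfolding ab by (simp add: power2_eq_square algebra_simps)
  finally show ?thesis by simp
qed

lemma edge_bounds: "lower_edge \<ge> 0" "lower_edge \<le> edge" "2 * \<kappa> \<le> edge" "edge > 0"
proof -
  have a: "sqrt (n + 2 * \<kappa> / \<beta>) > 0" using \<beta> \<kappa> by (simp add: add_nonneg_pos)
  have sq: "(a - b)\<^sup>2 \<le> (a + b)\<^sup>2" if "a \<ge> 0" "b \<ge> 0" for a b :: real
    using mult_nonneg_nonneg[OF that] by (simp add: power2_eq_square algebra_simps)
  show "lower_edge \<ge> 0" "lower_edge \<le> edge"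
    unfolding lower_edge_def edge_def using \<beta> a by (auto intro!: mult_left_mono sq simp: less_imp_le)
  have "2 * \<kappa> \<le> \<beta> * (sqrt (n + 2 * \<kappa> / \<beta>))\<^sup>2" using \<beta> \<kappa> by (simp add: distrib_left)
  also have "\<dots> \<le> edge" unfolding edge_def using \<beta> a by (intro mult_left_mono power_mono) auto
  finally show "2 * \<kappa> \<le> edge" .
  then show "edge > 0" using \<kappa> by linarith
qed

text \<open>The bound is the vertex of the quadratic in \<open>riccati\<close>. Beyond the edge the
  quadratic is negative at its vertex, whereas at the transform it is positive, so the transform
  never meets the vertex. At infinity it tends to 0 and the vertex to
  \<open>1 / (2 * \<beta>)\<close>, hence by continuity it lies below throughout.\<close>

lemma stieltjes_less_vertex:
  assumes n: "n \<ge> 1" and z: "z > edge" "z > L 1"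
  shows "stieltjes z < (z - 2 * \<kappa>) / (2 * \<beta> * z)"
proof (rule ccontr)
  assume "\<not> ?thesis"
  then have start: "(z - 2 * \<kappa>) / (2 * \<beta> * z) \<le> stieltjes z" by simp
  define f where "f y = stieltjes y - (y - 2 * \<kappa>) / (2 * \<beta> * y)" for y
  have Lz: "y > L i" if "i \<in> {1..n}" "y \<ge> z" for i y using L_le_first[OF that(1)] that z by linarith
  have "(stieltjes \<longlongrightarrow> (\<Sum>i=1..n. 0)) at_top"
    unfolding stieltjes_def by (intro tendsto_sum) real_asymp
  moreover have "((\<lambda>y. (y - 2 * \<kappa>) / (2 * \<beta> * y)) \<longlongrightarrow> inverse \<beta> / 2) at_top"
    using \<beta> by real_asymp
  ultimately have "(f \<longlongrightarrow> (\<Sum>i=1..n. 0) - inverse \<beta> / 2) at_top" unfolding f_def by (rule tendsto_diff)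
  then have "eventually (\<lambda>y. f y < 0) at_top" using \<beta> by (intro order_tendstoD(2)) auto
  then obtain y where y: "y \<ge> z" "f y < 0"
    using eventually_happens[OF eventually_conj[OF _ eventually_ge_at_top[of z]]] by (auto simp: trivial_limit_at_top_linorder)
  have "continuous_on {z..y} f"
    unfolding f_def stieltjes_def using Lz z edge_bounds(4) \<beta>
    by (intro continuous_intros) force+
  then obtain t where t: "t \<ge> z" "f t = 0"
    using IVT2'[of f y 0 z] y start by (auto simp: f_def)
  have tpos: "t > 0" using t z edge_bounds(4) by linarith
  have v: "stieltjes t = (t - 2 * \<kappa>) / (2 * \<beta> * t)" using t by (simp add: f_def)
  have "0 < \<beta> * t * (\<Sum>i=1..n. 1 / (t - L i)\<^sup>2)"
    using \<beta> tpos n Lz[OF _ t(1)] by (intro mult_pos_pos sum_pos) force+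
  also have "\<dots> = \<beta> * t * (stieltjes t)\<^sup>2 + (2 * \<kappa> - t) * stieltjes t + n"
    using riccati[of t] Lz[OF _ t(1)] by simp
  also have "\<dots> = - ((t - 2 * \<kappa>)\<^sup>2 - 4 * \<beta> * n * t) / (4 * \<beta> * t)"
    unfolding v using \<beta> tpos by (simp add: field_simps power2_eq_square)
  also have "\<dots> < 0"
    unfolding discriminant using t(1) z(1) edge_bounds \<beta> tpos by (auto intro!: divide_neg_pos mult_pos_pos)
  finally show False .
qed

text \<open>The quadratic is nonnegative at the transform, which lies to the left of the vertex
  \<open>m\<close>, so the transform is at most the smaller root. With
  \<open>\<beta> * m = 1 / 2 - \<kappa> / z\<close> this becomes the claim, whose left side is the
  logarithmic derivative of \<open>z powr \<kappa> * exp (- z / 2)\<close> times the \<beta>-th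
  power of the product of the \<open>z - L i\<close>.\<close>

lemma stieltjes_bound:
  assumes n: "n \<ge> 1" and z: "z > edge" "z > L 1"
  shows "\<beta> * stieltjes z + \<kappa> / z - 1 / 2 \<le> - sqrt ((1 - lower_edge / z) * (1 - edge / z)) / 2"
proof -
  have zp: "z > 0" using z(1) edge_bounds(4) by linarith
  define m where "m = (z - 2 * \<kappa>) / (2 * \<beta> * z)"
  define D where "D = (1 - lower_edge / z) * (1 - edge / z)"
  have D: "D * z\<^sup>2 = (z - 2 * \<kappa>)\<^sup>2 - 4 * \<beta> * n * z"
    unfolding discriminant D_def using zp by (simp add: power2_eq_square field_simps)
  have vm: "stieltjes z < m" unfolding m_def by (rule stieltjes_less_vertex[OF assms])
  have Lz: "z > L i" if "i \<in> {1..n}" for i using L_le_first[OF that(1)] z by linarith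
  have "0 \<le> \<beta> * z * (\<Sum>i=1..n. 1 / (z - L i)\<^sup>2)" using \<beta> zp by (intro mult_nonneg_nonneg sum_nonneg) auto
  also have "\<dots> = \<beta> * z * (stieltjes z)\<^sup>2 + (2 * \<kappa> - z) * stieltjes z + n" using riccati[of z] Lz by simp
  also have "\<dots> = \<beta> * z * (m - stieltjes z)\<^sup>2 - D * z / (4 * \<beta>)"
  proof -
    have A: "2 * \<kappa> - z = - 2 * \<beta> * z * m" unfolding m_def using \<beta> zp by (simp add: field_simps)
    have B: "real n = \<beta> * z * m\<^sup>2 - D * z / (4 * \<beta>)"
    proof -
      have "4 * \<beta> * z * (\<beta> * z * m\<^sup>2) = (2 * \<beta> * z * m)\<^sup>2" by (simp add: power2_eq_square)
      also have "\<dots> = (z - 2 * \<kappa>)\<^sup>2" unfolding m_def using \<beta> zp by simp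
      finally have "4 * \<beta> * z * (\<beta> * z * m\<^sup>2) = D * z\<^sup>2 + 4 * \<beta> * n * z" using D by simp
      then have "z * (4 * \<beta> * (\<beta> * z * m\<^sup>2)) = z * (D * z + 4 * \<beta> * n)"
        by (simp add: algebra_simps power2_eq_square)
      then have "4 * \<beta> * (\<beta> * z * m\<^sup>2) = D * z + 4 * \<beta> * n" using zp by simp
      then show ?thesis using \<beta> by (simp add: field_simps)
    qed
    show ?thesis by (simp only: A B) (simp add: power2_eq_square algebra_simps)
  qed
  finally have "0 \<le> \<beta> * (\<beta> * z * (m - stieltjes z)\<^sup>2 - D * z / (4 * \<beta>))"
    using \<beta> by (intro mult_nonneg_nonneg) auto
  also have "\<dots> = z * ((\<beta> * (m - stieltjes z))\<^sup>2 - D / 4)"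
    using \<beta> by (simp add: power_mult_distrib power2_eq_square algebra_simps)
  finally have "D / 4 \<le> (\<beta> * (m - stieltjes z))\<^sup>2" using zp by (simp add: zero_le_mult_iff)
  then have "sqrt (D / 4) \<le> \<beta> * (m - stieltjes z)" using vm \<beta> by (intro real_le_lsqrt) auto
  moreover have "sqrt (D / 4) = sqrt D / 2" by (simp add: real_sqrt_divide)
  moreover have "\<beta> * m = 1 / 2 - \<kappa> / z" unfolding m_def using \<beta> zp by (simp add: field_simps)
  ultimately show ?thesis unfolding D_def by (simp add: algebra_simps)
qed

text \<open>If \<open>L 1\<close> were beyond the edge, then at distance \<beta> to its right the
  largest particle alone would contribute \<open>1 / \<beta>\<close> to the transform, while the
  vertex bound is at most half of that.\<close>

lemma L_le_edge:
  assumes "i \<in> {1..n}"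
  shows "L i \<le> edge"
proof -
  have n: "n \<ge> 1" using assms by auto
  have "L 1 \<le> edge"
  proof (rule ccontr)
    assume "\<not> L 1 \<le> edge"
    then have z: "L 1 + \<beta> > edge" "L 1 + \<beta> > L 1" using \<beta> by auto
    have zp: "L 1 + \<beta> > 0" using z(1) edge_bounds(4) by linarith
    have "1 / \<beta> = 1 / ((L 1 + \<beta>) - L 1)" by simp
    also have "\<dots> \<le> stieltjes (L 1 + \<beta>)"
      unfolding stieltjes_def using n \<beta> L_le_first
      by (intro member_le_sum[of 1 "{1..n}" "\<lambda>i. 1 / ((L 1 + \<beta>) - L i)"]) (force simp: less_imp_le intro!: divide_nonneg_nonneg)+
    also have "\<dots> < (L 1 + \<beta> - 2 * \<kappa>) / (2 * \<beta> * (L 1 + \<beta>))" by (rule stieltjes_less_vertex[OF n z])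
    also have "\<dots> \<le> (L 1 + \<beta>) / (2 * \<beta> * (L 1 + \<beta>))" using \<beta> \<kappa> zp by (intro divide_right_mono) auto
    also have "\<dots> = 1 / (2 * \<beta>)" using zp by simp
    finally show False using \<beta> by (simp add: field_simps)
  qed
  then show ?thesis using L_le_first[OF assms] by linarith
qed

end


section \<open>Concentration around the equilibrium\<close>

text \<open>The function \<open>r - 1 - ln r\<close> is convex with minimum 0 at 1. Its tangents at
  \<open>1 + \<eta>\<close> and \<open>1 - \<eta>\<close> have slope of absolute value at least
  \<open>\<eta> / 2\<close>, which turns it into a linear bound up to the error \<eta>.\<close>

lemma abs_minus_one_le:
  fixes r \<eta> :: real
  assumes "r > 0" "0 < \<eta>" "\<eta> < 1"
  shows "\<bar>r - 1\<bar> \<le> \<eta> + 2 / \<eta> * (r - 1 - ln r)"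
proof -
  have tangent: "ln r \<le> r / m - 1 + ln m" if "m > 0" for m
    using ln_le_minus_one[of "r / m"] assms that by (simp add: ln_div)
  have psi: "r - 1 - ln r \<ge> 0" using ln_le_minus_one[OF assms(1)] by simp
  have up: "r - 1 \<le> \<eta> + 2 / \<eta> * (r - 1 - ln r)"
  proof -
    have "r - 1 - ln r \<ge> r - r / (1 + \<eta>) - \<eta>"
      using tangent[of "1 + \<eta>"] ln_le_minus_one[of "1 + \<eta>"] assms by simp
    then have "(1 + \<eta>) * (r - 1 - ln r) \<ge> (1 + \<eta>) * (r - r / (1 + \<eta>) - \<eta>)" using assms by (intro mult_left_mono) auto
    also have "(1 + \<eta>) * (r - r / (1 + \<eta>) - \<eta>) = \<eta> * (r - 1 - \<eta>)" using assms by (simp add: field_simps)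
    finally have "\<eta> * (r - 1 - \<eta>) \<le> 2 * (r - 1 - ln r)"
      using psi assms mult_right_mono[of "1 + \<eta>" 2 "r - 1 - ln r"] by linarith
    then show ?thesis using assms by (simp add: field_simps)
  qed
  have low: "1 - r \<le> \<eta> + 2 / \<eta> * (r - 1 - ln r)"
  proof -
    have "r - 1 - ln r \<ge> r - r / (1 - \<eta>) + \<eta>"
      using tangent[of "1 - \<eta>"] ln_le_minus_one[of "1 - \<eta>"] assms by simp
    then have "(1 - \<eta>) * (r - 1 - ln r) \<ge> (1 - \<eta>) * (r - r / (1 - \<eta>) + \<eta>)" using assms by (intro mult_left_mono) auto
    also have "(1 - \<eta>) * (r - r / (1 - \<eta>) + \<eta>) = \<eta> * (1 - \<eta> - r)" using assms by (simp add: field_simps)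
    finally have "\<eta> * (1 - \<eta> - r) \<le> 2 * (r - 1 - ln r)"
      using psi assms mult_right_mono[of "1 - \<eta>" 2 "r - 1 - ln r"] by linarith
    then show ?thesis using assms by (simp add: field_simps)
  qed
  show ?thesis using up low by linarith
qed

text \<open>Log-convexity between the two points 1 and 2, where Gamma equals 1.\<close>

lemma Gamma_one_plus_le_1:
  fixes c :: real
  assumes "0 \<le> c" "c \<le> 1"
  shows "Gamma (1 + c) \<le> 1"
proof -
  have "Gamma ((1 - c) * 1 + c * 2 + 0) \<le> Gamma (1 + 0) powr (1 - c) * Gamma (2 + 0) powr c"
    using log_convexD[OF log_convex_Gamma_shift[of 0], of 1 2 c] assms by simp
  moreover have "Gamma (2::real) = 1" using Gamma_fact[of 1, where 'a = real] by simp
  moreover have "(1 - c) * 1 + c * 2 + 0 = 1 + c" by simp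
  ultimately show ?thesis by (simp add: add.commute)
qed

text \<open>As \<open>t / m - 1 - ln (t / m) \<ge> 0\<close>, lowering the exponent from
  \<open>d\<close> to \<open>c\<close> enlarges the integrand and leaves a Gamma integral of shape
  \<open>c\<close>. The measure \<open>dt / t\<close> is scale invariant, so \<open>m\<close> drops
  out of the bound.\<close>

lemma nn_integral_gamma_shape:
  assumes c: "0 < c" "c \<le> d" "c \<le> 1" and m: "m > 0"
  shows "(\<integral>\<^sup>+t. ennreal (indicator {0<..} t * (1 / t * exp (- d * (t / m - 1 - ln (t / m))))) \<partial>lborel) \<le> ennreal (exp 2 / c)"
proof -
  have "(\<integral>\<^sup>+t. ennreal (indicator {0<..} t * (1 / t * exp (- d * (t / m - 1 - ln (t / m))))) \<partial>lborel)
     \<le> (\<integral>\<^sup>+t. ennreal (exp c * m powr (- c)) * ennreal (indicator {0<..} t * (t powr (c - 1) * exp (- (c / m) * t))) \<partial>lborel)"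
  proof (rule nn_integral_mono)
    fix t :: real
    show "ennreal (indicator {0<..} t * (1 / t * exp (- d * (t / m - 1 - ln (t / m)))))
       \<le> ennreal (exp c * m powr (- c)) * ennreal (indicator {0<..} t * (t powr (c - 1) * exp (- (c / m) * t)))"
    proof (cases "t > 0")
      case True
      have "t / m - 1 - ln (t / m) \<ge> 0" using True m ln_le_minus_one[of "t / m"] by simp
      then have "- d * (t / m - 1 - ln (t / m)) \<le> - c * (t / m - 1 - ln (t / m))"
        using c by (simp add: mult_right_mono)
      then have "exp (- d * (t / m - 1 - ln (t / m))) \<le> exp (- c * (t / m - 1 - ln (t / m)))" by simp
      also have "- c * (t / m - 1 - ln (t / m)) = c + (- c * ln m) + c * ln t + (- (c / m) * t)"
        using True m by (simp add: ln_div algebra_simps)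
      also have "exp (c + (- c * ln m) + c * ln t + (- (c / m) * t)) = exp c * m powr (- c) * (t powr c * exp (- (c / m) * t))"
        using True m by (simp only: exp_add powr_def) simp
      finally have "1 / t * exp (- d * (t / m - 1 - ln (t / m))) \<le> 1 / t * (exp c * m powr (- c) * (t powr c * exp (- (c / m) * t)))"
        using True by (intro mult_left_mono) auto
      also have "\<dots> = exp c * m powr (- c) * (t powr (c - 1) * exp (- (c / m) * t))"
        using True by (simp add: powr_diff)
      finally show ?thesis using True by (simp add: ennreal_mult'[symmetric] del: times_divide_eq_left)
    qed simp
  qed
  also have "\<dots> = ennreal (exp c * m powr (- c)) * ennreal (Gamma c / (c / m) powr c)"
    using nn_integral_powr_exp[of c "c / m"] c m by (subst nn_integral_cmult) auto
  also have "\<dots> = ennreal (exp c * m powr (- c) * (Gamma c / (c / m) powr c))"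
    by (rule ennreal_mult'[symmetric]) simp
  also have "\<dots> \<le> ennreal (exp 2 / c)"
  proof (rule ennreal_leI)
    have eq: "exp c * m powr (- c) * (Gamma c / (c / m) powr c) = exp c * (Gamma c * c powr (- c))"
      using c m by (simp add: powr_divide powr_minus field_simps)
    have p: "c powr (- c) \<le> exp 1"
    proof -
      have "ln (1 / c) \<le> 1 / c - 1" using c by (intro ln_le_minus_one) auto
      then have "c * ln (1 / c) \<le> c * (1 / c)" using c by (intro mult_left_mono) auto
      then have "- c * ln c \<le> 1" using c by (simp add: ln_div)
      then show ?thesis using c by (simp add: powr_def)
    qed
    have "c \<notin> \<int>\<^sub>\<le>\<^sub>0" using c by (auto elim: nonpos_Ints_cases)
    then have "c * Gamma c \<le> 1"
      using Gamma_plus1[of c] Gamma_one_plus_le_1[of c] c by (simp add: add.commute)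
    then have G: "Gamma c \<le> 1 / c" using c by (simp add: field_simps)
    have "exp c * (Gamma c * c powr (- c)) \<le> exp 1 * (1 / c * exp 1)"
      using c Gamma_real_pos[of c] by (intro mult_mono G p) auto
    also have "\<dots> = exp 2 / c" by (simp add: exp_add[symmetric])
    finally show "exp c * m powr (- c) * (Gamma c / (c / m) powr c) \<le> exp 2 / c"
      unfolding eq .
  qed
  finally show ?thesis .
qed

lemma fact_eq_ennreal: "(fact k :: ennreal) = ennreal (fact k)"
  by (metis ennreal_of_nat_eq_real_of_nat of_nat_fact)

context laguerre_equilibrium begin

text \<open>The excess energy of \<open>l\<close> over the equilibrium: the exponent gained in
  \<open>kernel_concentration\<close>.\<close>

definition tightness :: "(nat \<Rightarrow> real) \<Rightarrow> real" where
  "tightness l = (\<Sum>i=1..n. L i * (l i / L i - 1 - ln (l i / L i))) / 2"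

lemma measurable_tightness [measurable]: "tightness \<in> borel_measurable (lebesgue_on_indices {1..n})"
  unfolding tightness_def by measurable

lemma deviation_le_tightness:
  assumes "\<And>i. i \<in> {1..n} \<Longrightarrow> l i > 0" "0 < \<eta>" "\<eta> < 1"
  shows "(\<Sum>i=1..n. \<bar>l i - L i\<bar>) \<le> \<eta> * (\<Sum>i=1..n. L i) + 4 / \<eta> * tightness l"
proof -
  have "(\<Sum>i=1..n. \<bar>l i - L i\<bar>) \<le> (\<Sum>i=1..n. \<eta> * L i + 2 / \<eta> * (L i * (l i / L i - 1 - ln (l i / L i))))"
  proof (rule sum_mono)
    fix i assume i: "i \<in> {1..n}"
    have "\<bar>l i - L i\<bar> = L i * \<bar>l i / L i - 1\<bar>"
      using L_pos[OF i] by (simp add: abs_mult_pos' field_simps)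
    also have "\<dots> \<le> L i * (\<eta> + 2 / \<eta> * (l i / L i - 1 - ln (l i / L i)))"
      using assms L_pos[OF i] i by (intro mult_left_mono abs_minus_one_le) auto
    finally show "\<bar>l i - L i\<bar> \<le> \<eta> * L i + 2 / \<eta> * (L i * (l i / L i - 1 - ln (l i / L i)))"
      by (simp only: distrib_left mult_ac)
  qed
  also have "\<dots> = \<eta> * (\<Sum>i=1..n. L i) + 2 / \<eta> * (\<Sum>i=1..n. L i * (l i / L i - 1 - ln (l i / L i)))"
    by (simp only: sum.distrib sum_distrib_left)
  finally show ?thesis by (simp add: tightness_def)
qed

text \<open>A lower bound for every \<open>L i / 4\<close>, which follows from
  \<open>inverse_L_le\<close>, capped at 1 as \<open>nn_integral_gamma_shape\<close>
  requires.\<close>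

definition inverse_scale :: real where "inverse_scale = min 1 (\<kappa> / (2 * n))"

text \<open>Half of the decay in \<open>kernel_concentration\<close> pays for the exponential. The
  other half is a product over the coordinates, and the step from shape \<open>\<kappa> + 1\<close>
  back to \<kappa> supplies a factor \<open>1 / l i\<close> in each of them, so every coordinate
  contributes one integral as in \<open>nn_integral_gamma_shape\<close>.\<close>

lemma tightness_exponential:
  "(\<integral>\<^sup>+l. ennreal (laguerre_kernel \<beta> 0 \<kappa> n l * exp (tightness l / 2)) * indicator {l. decreasing n l} l \<partial>lebesgue_on_indices {1..n})
    \<le> ennreal (laguerre_kernel \<beta> 0 (\<kappa> + 1) n L * (exp 2 / inverse_scale) ^ n)"
proof -
  let ?\<Phi> = "laguerre_kernel \<beta> 0 (\<kappa> + 1) n L"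
  define f where "f i t = ennreal (indicator {0<..} t * (1 / t * exp (- (L i / 4) * (t / L i - 1 - ln (t / L i)))))" for i t
  have [measurable]: "f i \<in> borel_measurable borel" for i unfolding f_def by measurable
  have "(\<integral>\<^sup>+l. ennreal (laguerre_kernel \<beta> 0 \<kappa> n l * exp (tightness l / 2)) * indicator {l. decreasing n l} l \<partial>lebesgue_on_indices {1..n})
     \<le> (\<integral>\<^sup>+l. ennreal ?\<Phi> * (\<Prod>i=1..n. f i (l i)) \<partial>lebesgue_on_indices {1..n})"
  proof (rule nn_integral_mono)
    fix l
    show "ennreal (laguerre_kernel \<beta> 0 \<kappa> n l * exp (tightness l / 2)) * indicator {l. decreasing n l} l
        \<le> ennreal ?\<Phi> * (\<Prod>i=1..n. f i (l i))"
    proof (cases "decreasing n l \<and> (\<forall>i\<in>{1..n}. l i > 0)")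
      case True
      then have l: "decreasing n l" "\<And>i. i \<in> {1..n} \<Longrightarrow> l i > 0" by auto
      have "laguerre_kernel \<beta> 0 (\<kappa> + 1) n l * exp (tightness l / 2) \<le> (?\<Phi> * exp (- tightness l)) * exp (tightness l / 2)"
        using kernel_concentration[OF l] by (intro mult_right_mono) (auto simp: tightness_def)
      also have "\<dots> = ?\<Phi> * exp (- tightness l / 2)"
        by (simp add: exp_add[symmetric] mult.assoc)
      also have "exp (- tightness l / 2) = (\<Prod>i=1..n. exp (- (L i / 4) * (l i / L i - 1 - ln (l i / L i))))"
        unfolding tightness_def by (simp add: exp_sum[symmetric] sum_negf sum_divide_distrib)
      finally have "laguerre_kernel \<beta> 0 \<kappa> n l * (\<Prod>i=1..n. l i) * exp (tightness l / 2)
         \<le> ?\<Phi> * (\<Prod>i=1..n. exp (- (L i / 4) * (l i / L i - 1 - ln (l i / L i))))"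
        by (simp only: kernel_shift)
      then have "(\<Prod>i=1..n. 1 / l i) * (laguerre_kernel \<beta> 0 \<kappa> n l * (\<Prod>i=1..n. l i) * exp (tightness l / 2))
         \<le> (\<Prod>i=1..n. 1 / l i) * (?\<Phi> * (\<Prod>i=1..n. exp (- (L i / 4) * (l i / L i - 1 - ln (l i / L i)))))"
        using l(2) by (intro mult_left_mono prod_nonneg) (auto simp: less_imp_le)
      also have "(\<Prod>i=1..n. 1 / l i) * (laguerre_kernel \<beta> 0 \<kappa> n l * (\<Prod>i=1..n. l i) * exp (tightness l / 2))
         = laguerre_kernel \<beta> 0 \<kappa> n l * exp (tightness l / 2)"
      proof -
        have "(\<Prod>i=1..n. 1 / l i) * (\<Prod>i=1..n. l i) = 1"
          unfolding prod.distrib[symmetric] using l(2) by (intro prod.neutral) force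
        moreover have "A * (K * B * E) = (A * B) * (K * E)" for A B K E :: real by (simp only: mult_ac)
        ultimately show ?thesis by (simp only: mult_1)
      qed
      also have "(\<Prod>i=1..n. 1 / l i) * (?\<Phi> * (\<Prod>i=1..n. exp (- (L i / 4) * (l i / L i - 1 - ln (l i / L i)))))
        = ?\<Phi> * (\<Prod>i=1..n. 1 / l i * exp (- (L i / 4) * (l i / L i - 1 - ln (l i / L i))))"
        by (simp only: prod.distrib mult_ac)
      finally have "ennreal (laguerre_kernel \<beta> 0 \<kappa> n l * exp (tightness l / 2))
         \<le> ennreal (?\<Phi> * (\<Prod>i=1..n. 1 / l i * exp (- (L i / 4) * (l i / L i - 1 - ln (l i / L i)))))"
        by (rule ennreal_leI)
      also have "\<dots> = ennreal ?\<Phi> * ennreal (\<Prod>i=1..n. 1 / l i * exp (- (L i / 4) * (l i / L i - 1 - ln (l i / L i))))"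
        by (rule ennreal_mult') simp
      also have "ennreal (\<Prod>i=1..n. 1 / l i * exp (- (L i / 4) * (l i / L i - 1 - ln (l i / L i)))) = (\<Prod>i=1..n. f i (l i))"
      proof -
        have "(\<Prod>i=1..n. f i (l i)) = (\<Prod>i=1..n. ennreal (1 / l i * exp (- (L i / 4) * (l i / L i - 1 - ln (l i / L i)))))"
          using l(2) by (intro prod.cong) (auto simp: f_def)
        also have "\<dots> = ennreal (\<Prod>i=1..n. 1 / l i * exp (- (L i / 4) * (l i / L i - 1 - ln (l i / L i))))"
          using l(2) by (intro prod_ennreal) (auto simp: less_imp_le)
        finally show ?thesis by simp
      qed
      finally show ?thesis using l(1) by simp
    next
      case False
      then show ?thesis
      proof (cases "decreasing n l")
        case True
        then obtain i where i: "i \<in> {1..n}" "l i \<le> 0" using False by (auto simp: not_less)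
        show ?thesis unfolding laguerre_kernel_eq_0[of i n l, OF i] by simp
      qed simp
    qed
  qed
  also have "\<dots> = ennreal ?\<Phi> * (\<Prod>i=1..n. \<integral>\<^sup>+t. f i t \<partial>lborel)"
    by (subst nn_integral_cmult, measurable) (subst lborel_product.product_nn_integral_prod, auto)
  also have "\<dots> \<le> ennreal ?\<Phi> * (\<Prod>i=1..n. ennreal (exp 2 / inverse_scale))"
  proof (intro mult_left_mono prod_mono_ennreal)
    fix i assume i: "i \<in> {1..n}"
    have n: "n \<ge> 1" using i by auto
    have "\<kappa> / (2 * n) \<le> L i / 4"
      using inverse_L_le[OF i] L_pos[OF i] n by (simp add: field_simps)
    then show "(\<integral>\<^sup>+t. f i t \<partial>lborel) \<le> ennreal (exp 2 / inverse_scale)"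
      unfolding f_def using \<kappa> n L_pos[OF i] by (intro nn_integral_gamma_shape) (auto simp: inverse_scale_def)
  qed auto
  also have "\<dots> = ennreal (?\<Phi> * (exp 2 / inverse_scale) ^ n)"
    using \<kappa> by (simp add: ennreal_mult' ennreal_power inverse_scale_def)
  finally show ?thesis .
qed

text \<open>The minimal gap \<open>2 * \<beta> / n\<close> divided by \<open>2 * n\<close>:
  displacements of this size shrink a gap by a factor of at least
  \<open>1 - 1 / (2 * n)\<close>.\<close>

definition box_width :: real where "box_width = \<beta> / (real n)\<^sup>2"

text \<open>Each pair loses at most \<open>exp (- \<beta> / n)\<close>, and each \<open>j\<close>
  has fewer than \<open>n\<close> partners, which gives \<open>exp (- \<beta> * n)\<close> in total.
  The box lies to the right of \<open>L\<close>, so the powers \<open>l i powr \<kappa>\<close> do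
  not decrease. The factor \<open>1 / l i\<close> from the change of shape is bounded below through
  the sum of all \<open>L i\<close>.\<close>

lemma kernel_box_lower:
  assumes n: "n \<ge> 1" and l: "\<And>i. i \<in> {1..n} \<Longrightarrow> l i \<in> {L i<..<L i + box_width}"
  shows "decreasing n l"
    and "laguerre_kernel \<beta> 0 (\<kappa> + 1) n L * exp (- \<beta> * n) * (exp (- box_width / 2) / ((\<Sum>i=1..n. L i) + box_width)) ^ n
       \<le> laguerre_kernel \<beta> 0 \<kappa> n l"
proof -
  have w: "box_width > 0" using \<beta> n by (simp add: box_width_def)
  have wgap: "box_width \<le> 1 / (2 * n) * (L i - L j)" if "i \<in> {1..n}" "j \<in> {1..n}" "i < j" for i j
  proof -
    have "box_width = 1 / (2 * n) * (2 * \<beta> / n)" using n by (simp add: box_width_def power2_eq_square)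
    also have "\<dots> \<le> 1 / (2 * n) * (L i - L j)" using gap[OF that] by (intro mult_left_mono) auto
    finally show ?thesis .
  qed
  have contract: "(L i - L j) * (1 - 1 / (2 * n)) \<le> l i - l j" if "i \<in> {1..n}" "j \<in> {1..n}" "i < j" for i j
    using wgap[OF that] l[OF that(1)] l[OF that(2)] by (simp add: algebra_simps)
  have c: "0 < 1 - 1 / (2 * real n)" using n by (simp add: field_simps)
  have lt: "l j < l i" if "i \<in> {1..n}" "j \<in> {1..n}" "i < j" for i j
  proof -
    have "(L i - L j) * (1 - 1 / (2 * real n)) > 0" using L_less[OF that] c by (intro mult_pos_pos) auto
    then show ?thesis using contract[OF that] by simp
  qed
  then show "decreasing n l" unfolding decreasing_def by blast
  have e1: "exp (- 1 / n) \<le> 1 - 1 / (2 * real n)"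
  proof -
    have "1 - 1 / (2 * real n) \<ge> 1 / (1 + 1 / n)" using n by (simp add: field_simps)
    moreover have "exp (1 / n) \<ge> 1 + 1 / real n" by simp
    then have "1 / exp (1 / n) \<le> 1 / (1 + 1 / real n)" using n by (intro divide_left_mono) (auto simp: add_pos_nonneg)
    moreover have "exp (- 1 / real n) = 1 / exp (1 / real n)"
      by (simp add: exp_minus inverse_eq_divide minus_divide_left[symmetric])
    ultimately show ?thesis by linarith
  qed
  have pp: "pair_product \<beta> 0 n L * exp (- \<beta> * n) \<le> pair_product \<beta> 0 n l"
  proof -
    have "pair_product \<beta> 0 n L * (\<Prod>j=1..n. \<Prod>i=1..<j. exp (- \<beta> / n)) \<le> pair_product \<beta> 0 n l"
      unfolding pair_product_def prod.distrib[symmetric]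
    proof (intro prod_mono conjI prod_nonneg ballI)
      fix i j assume j: "j \<in> {1..n}" and i: "i \<in> {1..<j}"
      have ij: "i \<in> {1..n}" "i < j" using i j by auto
      have "exp (- \<beta> / n) = exp (- 1 / n) powr \<beta>" by (simp add: exp_powr_real mult.commute)
      also have "\<dots> \<le> (1 - 1 / (2 * real n)) powr \<beta>" using e1 \<beta> by (intro powr_mono2) auto
      finally have "((L i - L j)\<^sup>2 + 0) powr (\<beta> / 2) * exp (- \<beta> / n) \<le> (L i - L j) powr \<beta> * (1 - 1 / (2 * real n)) powr \<beta>"
        using L_less[OF ij(1) j ij(2)] by (simp add: sq_powr_half mult_left_mono)
      also have "\<dots> = ((L i - L j) * (1 - 1 / (2 * real n))) powr \<beta>" by (simp add: powr_mult)
      also have "\<dots> \<le> (l i - l j) powr \<beta>"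
        using contract[OF ij(1) j ij(2)] L_less[OF ij(1) j ij(2)] c \<beta> by (intro powr_mono2) auto
      finally show "((L i - L j)\<^sup>2 + 0) powr (\<beta> / 2) * exp (- \<beta> / n) \<le> ((l i - l j)\<^sup>2 + 0) powr (\<beta> / 2)"
        using lt[OF ij(1) j ij(2)] by (simp add: sq_powr_half)
    qed auto
    moreover have "exp (- \<beta> * n) \<le> (\<Prod>j=1..n. \<Prod>i=1..<j. exp (- \<beta> / n))"
    proof -
      have "exp (- \<beta> * n) = (\<Prod>j=1..n. exp (- \<beta>))" by (simp add: exp_of_nat_mult[symmetric] mult.commute)
      also have "\<dots> \<le> (\<Prod>j=1..n. \<Prod>i=1..<j. exp (- \<beta> / n))"
      proof (intro prod_mono conjI)
        fix j assume j: "j \<in> {1..n}"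
        have "real (j - 1) * \<beta> \<le> real n * \<beta>" using j \<beta> by (intro mult_right_mono) auto
        then have "- \<beta> \<le> real (j - 1) * (- \<beta> / n)" using n by (simp add: field_simps)
        then have "exp (- \<beta>) \<le> exp (real (j - 1) * (- \<beta> / n))" by simp
        then show "exp (- \<beta>) \<le> (\<Prod>i=1..<j. exp (- \<beta> / n))" by (simp only: exp_of_nat_mult prod_constant card_atLeastLessThan)
      qed auto
      finally show ?thesis .
    qed
    ultimately show ?thesis
      using mult_left_mono[of "exp (- \<beta> * n)" "\<Prod>j=1..n. \<Prod>i=1..<j. exp (- \<beta> / n)" "pair_product \<beta> 0 n L"] by simp
  qed
  define M where "M = (\<Sum>i=1..n. L i)"
  have LM: "L i \<le> M" if "i \<in> {1..n}" for i
    unfolding M_def using that L_pos by (intro member_le_sum) (auto simp: less_imp_le)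
  have Mw: "M + box_width > 0" using LM[of 1] L_pos[of 1] n w by simp
  have wt: "(\<Prod>i=1..n. laguerre_weight (\<kappa> + 1) (L i)) * (exp (- box_width / 2) / (M + box_width)) ^ n \<le> (\<Prod>i=1..n. laguerre_weight \<kappa> (l i))"
  proof -
    have "(\<Prod>i=1..n. laguerre_weight (\<kappa> + 1) (L i)) * (exp (- box_width / 2) / (M + box_width)) ^ n
        = (\<Prod>i=1..n. laguerre_weight (\<kappa> + 1) (L i) * (exp (- box_width / 2) / (M + box_width)))"
      by (simp only: prod.distrib prod_constant) simp
    also have "\<dots> \<le> (\<Prod>i=1..n. laguerre_weight \<kappa> (l i))"
    proof (intro prod_mono conjI)
      fix i assume i: "i \<in> {1..n}"
      have li: "L i < l i" "l i < L i + box_width" "l i > 0" using l[OF i] L_pos[OF i] by auto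
      have "L i powr \<kappa> * exp (- L i / 2) * (exp (- box_width / 2) / (M + box_width)) = L i powr \<kappa> * exp (- (L i + box_width) / 2) * (1 / (M + box_width))"
        by (simp add: exp_add[symmetric] add_divide_distrib)
      also have "\<dots> \<le> l i powr \<kappa> * exp (- l i / 2) * (1 / l i)"
        using li L_pos[OF i] \<kappa> LM[OF i] by (intro mult_mono powr_mono2 divide_left_mono) auto
      also have "\<dots> = l i powr (\<kappa> - 1) * exp (- l i / 2)" using li by (simp add: powr_diff)
      finally show "laguerre_weight (\<kappa> + 1) (L i) * (exp (- box_width / 2) / (M + box_width)) \<le> laguerre_weight \<kappa> (l i)"
        using li L_pos[OF i] by (simp add: laguerre_weight_def)
    qed (use Mw in auto)
    finally show ?thesis .
  qed
  have "(pair_product \<beta> 0 n L * exp (- \<beta> * n)) * ((\<Prod>i=1..n. laguerre_weight (\<kappa> + 1) (L i)) * (exp (- box_width / 2) / (M + box_width)) ^ n)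
      \<le> pair_product \<beta> 0 n l * (\<Prod>i=1..n. laguerre_weight \<kappa> (l i))"
    using Mw by (intro mult_mono pp wt mult_nonneg_nonneg prod_nonneg) auto
  then show "laguerre_kernel \<beta> 0 (\<kappa> + 1) n L * exp (- \<beta> * n) * (exp (- box_width / 2) / ((\<Sum>i=1..n. L i) + box_width)) ^ n
       \<le> laguerre_kernel \<beta> 0 \<kappa> n l"
    unfolding laguerre_kernel_def M_def by (simp only: mult_ac)
qed

lemma nn_integral_kernel: "(\<integral>\<^sup>+l. ennreal (laguerre_kernel \<beta> 0 \<kappa> n l) \<partial>lebesgue_on_indices {1..n}) = ennreal (laguerre_integral \<beta> \<kappa> n)"
  unfolding laguerre_integral_def
  by (rule nn_integral_eq_integral[OF integrable_kernel[OF \<beta> \<kappa>]]) simp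

lemma nn_integral_kernel_decreasing:
  "(\<integral>\<^sup>+l. ennreal (laguerre_kernel \<beta> 0 \<kappa> n l) * indicator {l. decreasing n l} l \<partial>lebesgue_on_indices {1..n}) * fact n
     = ennreal (laguerre_integral \<beta> \<kappa> n)"
proof -
  have "(\<lambda>l. ennreal (laguerre_kernel \<beta> 0 \<kappa> n l)) \<in> borel_measurable (lebesgue_on_indices {1..n})" by measurable
  from nn_integral_symmetric[OF this] show ?thesis
    by (simp only: laguerre_kernel_permute nn_integral_kernel mult.commute)
qed

text \<open>The contribution of one particle to the lower bound: its share of the losses in
  \<open>kernel_box_lower\<close> times the side of the box.\<close>

definition box_factor :: real where
  "box_factor = exp (- \<beta>) * (exp (- box_width / 2) / ((\<Sum>i=1..n. L i) + box_width)) * box_width"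

lemma laguerre_integral_lower:
  assumes n: "n \<ge> 1"
  shows "fact n * laguerre_kernel \<beta> 0 (\<kappa> + 1) n L * box_factor ^ n \<le> laguerre_integral \<beta> \<kappa> n"
proof -
  have w: "box_width > 0" using \<beta> n by (simp add: box_width_def)
  let ?\<Phi> = "laguerre_kernel \<beta> 0 (\<kappa> + 1) n L"
  define c where "c = ?\<Phi> * exp (- \<beta> * n) * (exp (- box_width / 2) / ((\<Sum>i=1..n. L i) + box_width)) ^ n"
  have M: "(\<Sum>i=1..n. L i) \<ge> 0" using L_pos by (intro sum_nonneg) (auto simp: less_imp_le)
  have c0: "c \<ge> 0" unfolding c_def using M w by (intro mult_nonneg_nonneg zero_le_power divide_nonneg_nonneg) auto
  let ?B = "\<Pi>\<^sub>E i\<in>{1..n}. {L i<..<L i + box_width}"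
  have Bs: "?B \<in> sets (lebesgue_on_indices {1..n})" by (intro sets_PiM_I_finite) auto
  have "ennreal c * (\<Prod>i=1..n. ennreal box_width) = ennreal c * emeasure (lebesgue_on_indices {1..n}) ?B"
    using w by (subst lborel_product.emeasure_PiM) (auto intro!: arg_cong2[where f="(*)"] prod.cong)
  also have "\<dots> = (\<integral>\<^sup>+l. ennreal c * indicator ?B l \<partial>lebesgue_on_indices {1..n})"
    using Bs by (simp add: nn_integral_cmult_indicator)
  also have "\<dots> \<le> (\<integral>\<^sup>+l. ennreal (laguerre_kernel \<beta> 0 \<kappa> n l) * indicator {l. decreasing n l} l \<partial>lebesgue_on_indices {1..n})"
  proof (rule nn_integral_mono)
    fix l
    show "ennreal c * indicator ?B l \<le> ennreal (laguerre_kernel \<beta> 0 \<kappa> n l) * indicator {l. decreasing n l} l"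
    proof (cases "l \<in> ?B")
      case True
      then have l: "l i \<in> {L i<..<L i + box_width}" if "i \<in> {1..n}" for i using that by (auto simp: PiE_iff)
      show ?thesis
        using kernel_box_lower[OF n l] True by (simp add: c_def ennreal_leI)
    qed simp
  qed
  finally have "ennreal c * (\<Prod>i=1..n. ennreal box_width) * fact n \<le> ennreal (laguerre_integral \<beta> \<kappa> n)"
    unfolding nn_integral_kernel_decreasing[symmetric] by (intro mult_right_mono) auto
  also have "ennreal c * (\<Prod>i=1..n. ennreal box_width) * fact n = ennreal (c * box_width ^ n * fact n)"
    using c0 w by (simp add: ennreal_mult ennreal_power fact_eq_ennreal)
  finally have "c * box_width ^ n * fact n \<le> laguerre_integral \<beta> \<kappa> n"
    using laguerre_integral_pos[OF \<beta> \<kappa>, of n] by (simp add: ennreal_le_iff less_imp_le)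
  moreover have "exp (- \<beta> * n) = exp (- \<beta>) ^ n" by (simp add: exp_of_nat_mult[symmetric] mult.commute)
  ultimately show ?thesis unfolding c_def box_factor_def power_mult_distrib by (simp only: mult_ac)
qed

text \<open>The price per particle for comparing \<open>tightness_exponential\<close> with the lower
  bound on the normalising integral. The maximum of the kernel cancels in this comparison.\<close>

definition entropy_factor :: real where
  "entropy_factor = exp 2 / inverse_scale / box_factor"

text \<open>By \<open>deviation_le_tightness\<close> the exponent is at most
  \<open>t * \<eta>\<close> times the sum of the \<open>L i\<close>, plus
  \<open>\<theta> = 4 * t / \<eta>\<close> times the tightness. Where the tightness is at most
  \<open>T\<close> this is bounded directly. Elsewhere \<open>\<theta> \<le> 1 / 4\<close> leaves
  \<open>exp (- T / 4)\<close> after half of the tightness has been spent in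
  \<open>tightness_exponential\<close>.\<close>

lemma concentration:
  assumes n: "n \<ge> 1" and t: "t \<ge> 0" and \<eta>: "0 < \<eta>" "\<eta> < 1" and t\<eta>: "4 * t / \<eta> \<le> 1 / 4" and T: "T \<ge> 0"
  shows "(\<integral>\<^sup>+l. ennreal (laguerre_kernel \<beta> 0 \<kappa> n l * exp (t * (\<Sum>i=1..n. \<bar>l i - L i\<bar>))) * indicator {l. decreasing n l} l \<partial>lebesgue_on_indices {1..n}) * fact n
    \<le> ennreal (laguerre_integral \<beta> \<kappa> n * (exp (t * \<eta> * (\<Sum>i=1..n. L i)) * (exp (4 * t / \<eta> * T) + exp (- T / 4) * entropy_factor ^ n)))"
proof -
  define M where "M = (\<Sum>i=1..n. L i)"
  define \<theta> where "\<theta> = 4 * t / \<eta>"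
  have \<theta>: "\<theta> \<ge> 0" "\<theta> \<le> 1 / 4" using t \<eta> t\<eta> by (auto simp: \<theta>_def)
  have w: "box_width > 0" using \<beta> n by (simp add: box_width_def)
  have M0: "M > 0" unfolding M_def using L_pos n by (intro sum_pos) auto
  have bf: "box_factor > 0" unfolding box_factor_def M_def[symmetric] using w M0 by (intro mult_pos_pos divide_pos_pos) auto
  have is0: "inverse_scale > 0" using \<kappa> n by (simp add: inverse_scale_def)
  let ?K = "laguerre_kernel \<beta> 0 \<kappa> n" and ?\<Phi> = "laguerre_kernel \<beta> 0 (\<kappa> + 1) n L"
  let ?D = "\<lambda>l. indicator {l. decreasing n l} l :: ennreal"
  have "(\<integral>\<^sup>+l. ennreal (?K l * exp (t * (\<Sum>i=1..n. \<bar>l i - L i\<bar>))) * ?D l \<partial>lebesgue_on_indices {1..n})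
     \<le> (\<integral>\<^sup>+l. ennreal (exp (t * \<eta> * M) * exp (\<theta> * T)) * (ennreal (?K l) * ?D l) + ennreal (exp (t * \<eta> * M) * exp (- T / 4)) * (ennreal (?K l * exp (tightness l / 2)) * ?D l) \<partial>lebesgue_on_indices {1..n})"
  proof (rule nn_integral_mono)
    fix l
    show "ennreal (?K l * exp (t * (\<Sum>i=1..n. \<bar>l i - L i\<bar>))) * ?D l
      \<le> ennreal (exp (t * \<eta> * M) * exp (\<theta> * T)) * (ennreal (?K l) * ?D l) + ennreal (exp (t * \<eta> * M) * exp (- T / 4)) * (ennreal (?K l * exp (tightness l / 2)) * ?D l)"
    proof (cases "\<forall>i\<in>{1..n}. l i > 0")
      case False
      then obtain i where i: "i \<in> {1..n}" "l i \<le> 0" by (auto simp: not_less)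
      show ?thesis unfolding laguerre_kernel_eq_0[of i n l, OF i] by simp
    next
      case True
      have "t * (\<Sum>i=1..n. \<bar>l i - L i\<bar>) \<le> t * (\<eta> * M + 4 / \<eta> * tightness l)"
        unfolding M_def using True \<eta> t by (intro mult_left_mono deviation_le_tightness) auto
      then have "exp (t * (\<Sum>i=1..n. \<bar>l i - L i\<bar>)) \<le> exp (t * \<eta> * M + \<theta> * tightness l)"
        by (simp add: \<theta>_def algebra_simps)
      also have "\<dots> = exp (t * \<eta> * M) * exp (\<theta> * tightness l)" by (rule exp_add)
      also have "exp (\<theta> * tightness l) \<le> exp (\<theta> * T) + exp (- T / 4) * exp (tightness l / 2)"
      proof (cases "tightness l \<le> T")
        case True
        then have "exp (\<theta> * tightness l) \<le> exp (\<theta> * T)" using \<theta> by (simp add: mult_left_mono)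
        then show ?thesis by (smt (verit) exp_gt_zero mult_pos_pos)
      next
        case False
        then have "\<theta> * tightness l \<le> 1 / 4 * tightness l" using \<theta> T by (intro mult_right_mono) auto
        also have "\<dots> \<le> - T / 4 + tightness l / 2" using False by simp
        finally have "exp (\<theta> * tightness l) \<le> exp (- T / 4 + tightness l / 2)" by simp
        also have "\<dots> = exp (- T / 4) * exp (tightness l / 2)" by (rule exp_add)
        finally show ?thesis by (smt (verit) exp_gt_zero)
      qed
      finally have "?K l * exp (t * (\<Sum>i=1..n. \<bar>l i - L i\<bar>)) \<le> ?K l * (exp (t * \<eta> * M) * (exp (\<theta> * T) + exp (- T / 4) * exp (tightness l / 2)))"
        by (simp add: mult_left_mono)
      also have "\<dots> = exp (t * \<eta> * M) * exp (\<theta> * T) * ?K l + exp (t * \<eta> * M) * exp (- T / 4) * (?K l * exp (tightness l / 2))"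
        by (simp add: algebra_simps)
      finally have "ennreal (?K l * exp (t * (\<Sum>i=1..n. \<bar>l i - L i\<bar>)))
        \<le> ennreal (exp (t * \<eta> * M) * exp (\<theta> * T) * ?K l + exp (t * \<eta> * M) * exp (- T / 4) * (?K l * exp (tightness l / 2)))"
        by (rule ennreal_leI)
      also have "\<dots> = ennreal (exp (t * \<eta> * M) * exp (\<theta> * T)) * ennreal (?K l) + ennreal (exp (t * \<eta> * M) * exp (- T / 4)) * ennreal (?K l * exp (tightness l / 2))"
        by (simp only: ennreal_plus[symmetric] ennreal_mult'[symmetric] mult_nonneg_nonneg exp_ge_zero laguerre_kernel_nonneg)
      finally show ?thesis by (cases "decreasing n l") (simp_all only: indicator_simps mem_Collect_eq mult_1_right mult_zero_right if_True if_False not_False_eq_True zero_le)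
    qed
  qed
  also have "\<dots> = ennreal (exp (t * \<eta> * M) * exp (\<theta> * T)) * (\<integral>\<^sup>+l. ennreal (?K l) * ?D l \<partial>lebesgue_on_indices {1..n})
     + ennreal (exp (t * \<eta> * M) * exp (- T / 4)) * (\<integral>\<^sup>+l. ennreal (?K l * exp (tightness l / 2)) * ?D l \<partial>lebesgue_on_indices {1..n})"
  proof -
    have [measurable]: "?D \<in> borel_measurable (lebesgue_on_indices {1..n})"
    proof -
      have "(\<lambda>l. if decreasing n l then 1 else 0) \<in> borel_measurable (lebesgue_on_indices {1..n})" by measurable
      then show ?thesis by (rule measurable_cong[THEN iffD1, rotated]) (auto simp: indicator_def)
    qed
    show ?thesis by (subst nn_integral_add, measurable) (subst nn_integral_cmult, measurable)+
  qed
  also have "\<dots> \<le> ennreal (exp (t * \<eta> * M) * exp (\<theta> * T)) * (\<integral>\<^sup>+l. ennreal (?K l) * ?D l \<partial>lebesgue_on_indices {1..n})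
     + ennreal (exp (t * \<eta> * M) * exp (- T / 4)) * ennreal (?\<Phi> * (exp 2 / inverse_scale) ^ n)"
    by (intro add_left_mono mult_left_mono tightness_exponential) auto
  finally have "(\<integral>\<^sup>+l. ennreal (?K l * exp (t * (\<Sum>i=1..n. \<bar>l i - L i\<bar>))) * ?D l \<partial>lebesgue_on_indices {1..n}) * fact n
    \<le> (ennreal (exp (t * \<eta> * M) * exp (\<theta> * T)) * (\<integral>\<^sup>+l. ennreal (?K l) * ?D l \<partial>lebesgue_on_indices {1..n})
     + ennreal (exp (t * \<eta> * M) * exp (- T / 4)) * ennreal (?\<Phi> * (exp 2 / inverse_scale) ^ n)) * fact n"
    by (intro mult_right_mono) auto
  also have "\<dots> = ennreal (exp (t * \<eta> * M) * exp (\<theta> * T)) * ((\<integral>\<^sup>+l. ennreal (?K l) * ?D l \<partial>lebesgue_on_indices {1..n}) * fact n)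
     + ennreal (exp (t * \<eta> * M) * exp (- T / 4)) * (ennreal (?\<Phi> * (exp 2 / inverse_scale) ^ n) * fact n)"
    by (simp only: distrib_right mult.assoc)
  also have "\<dots> \<le> ennreal (exp (t * \<eta> * M) * exp (\<theta> * T)) * ennreal (laguerre_integral \<beta> \<kappa> n)
     + ennreal (exp (t * \<eta> * M) * exp (- T / 4)) * ennreal (laguerre_integral \<beta> \<kappa> n * entropy_factor ^ n)"
  proof -
    have "?\<Phi> * (exp 2 / inverse_scale) ^ n * fact n = (fact n * ?\<Phi> * box_factor ^ n) * entropy_factor ^ n"
      unfolding entropy_factor_def using bf by (simp add: power_divide power_mult_distrib)
    also have "\<dots> \<le> laguerre_integral \<beta> \<kappa> n * entropy_factor ^ n"
      using laguerre_integral_lower[OF n] bf is0 by (intro mult_right_mono zero_le_power) (auto simp: entropy_factor_def)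
    finally have "ennreal (?\<Phi> * (exp 2 / inverse_scale) ^ n) * fact n \<le> ennreal (laguerre_integral \<beta> \<kappa> n * entropy_factor ^ n)"
      using is0 by (simp add: fact_eq_ennreal ennreal_mult[symmetric] ennreal_leI)
    then show ?thesis unfolding nn_integral_kernel_decreasing by (intro add_left_mono mult_left_mono) auto
  qed
  also have "\<dots> = ennreal (laguerre_integral \<beta> \<kappa> n * (exp (t * \<eta> * M) * (exp (\<theta> * T) + exp (- T / 4) * entropy_factor ^ n)))"
  proof -
    have Z: "laguerre_integral \<beta> \<kappa> n \<ge> 0" using laguerre_integral_pos[OF \<beta> \<kappa>, of n] by simp
    have e: "entropy_factor ^ n \<ge> 0" using bf is0 by (simp add: entropy_factor_def)
    have "ennreal (exp (t * \<eta> * M) * exp (\<theta> * T)) * ennreal (laguerre_integral \<beta> \<kappa> n)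
      + ennreal (exp (t * \<eta> * M) * exp (- T / 4)) * ennreal (laguerre_integral \<beta> \<kappa> n * entropy_factor ^ n)
      = ennreal (exp (t * \<eta> * M) * exp (\<theta> * T) * laguerre_integral \<beta> \<kappa> n + exp (t * \<eta> * M) * exp (- T / 4) * (laguerre_integral \<beta> \<kappa> n * entropy_factor ^ n))"
      using Z e by (simp only: ennreal_plus ennreal_mult mult_nonneg_nonneg exp_ge_zero)
    then show ?thesis by (simp only: distrib_left mult_ac)
  qed
  finally show ?thesis unfolding M_def \<theta>_def .
qed

end


section \<open>The characteristic polynomial\<close>

lemma ex_permutation_onto:
  assumes "B \<subseteq> {1..n}"
  obtains s where "s permutes {1..n}" "s ` {1..card B} = B"
proof -
  have fin: "finite B" "finite ({1..n} - B)" using assms finite_subset by auto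
  have cB: "card B \<le> n" using card_mono[OF _ assms] by simp
  obtain f where f: "bij_betw f {1..card B} B"
    using finite_same_card_bij[of "{1..card B}" B] fin by auto
  have "card {card B + 1..n} = card ({1..n} - B)" using assms fin by (simp add: card_Diff_subset)
  then obtain g where g: "bij_betw g {card B + 1..n} ({1..n} - B)"
    using finite_same_card_bij[of "{card B + 1..n}" "{1..n} - B"] fin by auto
  define s where "s i = (if i \<in> {1..card B} then f i else if i \<in> {1..n} then g i else i)" for i
  have 1: "bij_betw s {1..card B} B"
    using f by (rule bij_betw_cong[THEN iffD1, rotated]) (simp add: s_def)
  have 2: "bij_betw s {card B + 1..n} ({1..n} - B)"
    using g by (rule bij_betw_cong[THEN iffD1, rotated]) (auto simp: s_def)
  have "bij_betw s ({1..card B} \<union> {card B + 1..n}) (B \<union> ({1..n} - B))"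
    by (rule bij_betw_combine[OF 1 2]) auto
  moreover have "{1..card B} \<union> {card B + 1..n} = {1..n}" using cB by auto
  moreover have "B \<union> ({1..n} - B) = {1..n}" using assms by auto
  ultimately have "s permutes {1..n}" by (intro bij_imp_permutes) (auto simp: s_def)
  moreover have "s ` {1..card B} = B" using 1 by (simp add: bij_betw_def)
  ultimately show ?thesis by (rule that)
qed

lemma sum_Pow_card:
  fixes h :: "nat \<Rightarrow> real"
  shows "(\<Sum>B\<in>Pow {1..n}. h (card B)) = (\<Sum>k\<le>n. real (n choose k) * h k)"
proof -
  have "(\<Sum>B\<in>Pow {1..n}. h (card B)) = (\<Sum>k\<le>n. \<Sum>B\<in>{B\<in>Pow {1..n}. card B = k}. h (card B))"
  proof (rule sum.group[symmetric])
    show "card ` Pow {1..n} \<subseteq> {..n}"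
      using card_mono[of "{1..n}"] by fastforce
  qed auto
  also have "\<dots> = (\<Sum>k\<le>n. \<Sum>B\<in>{B. B \<subseteq> {1..n} \<and> card B = k}. h k)"
    by (intro sum.cong) auto
  finally show ?thesis by (simp add: n_subsets)
qed

section \<open>The polynomial with the equilibrium points as roots\<close>

context laguerre_equilibrium begin

definition equilibrium_poly :: "real poly" where
  "equilibrium_poly = (\<Prod>i=1..n. [:- L i, 1:])"

lemma poly_equilibrium_poly: "poly equilibrium_poly z = (\<Prod>i=1..n. z - L i)"
  by (simp add: equilibrium_poly_def poly_prod)

lemma degree_equilibrium_poly: "degree equilibrium_poly = n"
  unfolding equilibrium_poly_def by (subst degree_prod_eq_sum_degree) auto

lemma coeff_equilibrium_poly_top: "coeff equilibrium_poly n = 1"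
proof -
  have "lead_coeff equilibrium_poly = 1"
    unfolding equilibrium_poly_def lead_coeff_prod by simp
  then show ?thesis by (simp add: degree_equilibrium_poly)
qed

text \<open>Writing the polynomial as \<open>(X - L i) * Q\<close>, its first derivative at
  \<open>L i\<close> is \<open>Q (L i)\<close> and its second is twice the derivative of
  \<open>Q\<close> there. The sum is the logarithmic derivative of \<open>Q\<close>.\<close>

lemma equilibrium_poly_root_derivatives:
  assumes "i \<in> {1..n}"
  shows "poly (pderiv (pderiv equilibrium_poly)) (L i)
     = 2 * (\<Sum>j\<in>{1..n}-{i}. 1 / (L i - L j)) * poly (pderiv equilibrium_poly) (L i)"
proof -
  define Q where "Q = (\<Prod>j\<in>{1..n}-{i}. [:- L j, 1:])"
  have Y: "equilibrium_poly = [:- L i, 1:] * Q"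
    unfolding equilibrium_poly_def Q_def using assms by (intro prod.remove) auto
  have neq: "L i \<noteq> L j" if "j \<in> {1..n} - {i}" for j
    using inj_onD[OF decreasing_inj_on[OF L_decreasing], of j i] that assms by auto
  have p1: "pderiv [:- L i, 1:] = 1" by (simp add: pderiv_pCons)
  have Y1: "pderiv equilibrium_poly = [:- L i, 1:] * pderiv Q + Q"
    unfolding Y by (simp only: pderiv_mult p1 mult_1_right)
  have Y2: "pderiv (pderiv equilibrium_poly) = [:- L i, 1:] * pderiv (pderiv Q) + 2 * pderiv Q"
    unfolding Y1 by (simp only: pderiv_mult pderiv_add p1 mult_1_right mult_2 add.assoc)
  have "poly (pderiv Q) (L i) = (\<Sum>j\<in>{1..n}-{i}. \<Prod>k\<in>{1..n}-{i}-{j}. L i - L k)"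
    unfolding Q_def by (simp add: pderiv_prod poly_sum poly_prod pderiv_pCons)
  also have "\<dots> = (\<Sum>j\<in>{1..n}-{i}. poly Q (L i) * (1 / (L i - L j)))"
  proof (rule sum.cong[OF refl])
    fix j assume j: "j \<in> {1..n}-{i}"
    have "poly Q (L i) = (L i - L j) * (\<Prod>k\<in>{1..n}-{i}-{j}. L i - L k)"
      unfolding Q_def poly_prod using j by (subst prod.remove[of _ j]) auto
    then show "(\<Prod>k\<in>{1..n}-{i}-{j}. L i - L k) = poly Q (L i) * (1 / (L i - L j))"
      using neq[OF j] by simp
  qed
  finally have "poly (pderiv Q) (L i) = poly Q (L i) * (\<Sum>j\<in>{1..n}-{i}. 1 / (L i - L j))"
    by (simp add: sum_distrib_left)
  moreover have "poly (pderiv equilibrium_poly) (L i) = poly Q (L i)" unfolding Y1 by simp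
  moreover have "poly (pderiv (pderiv equilibrium_poly)) (L i) = 2 * poly (pderiv Q) (L i)" unfolding Y2 by simp
  ultimately show ?thesis by (simp only: mult_ac)
qed

text \<open>Multiplied by \<open>2 y'(L i)\<close>, the force balance says that the polynomial below vanishes at
  each of the \<open>n\<close> roots; its degree is less than \<open>n\<close>.\<close>

lemma equilibrium_poly_ode:
  "smult \<beta> ([:0, 1:] * pderiv (pderiv equilibrium_poly)) + [:2 * \<kappa>, -1:] * pderiv equilibrium_poly + smult (real n) equilibrium_poly = 0"
  (is "?P = 0")
proof (rule ccontr)
  assume P: "?P \<noteq> 0"
  define Y where "Y = equilibrium_poly"
  have Yn: "coeff Y m = 0" if "m > n" for m
    using that degree_equilibrium_poly by (simp add: Y_def coeff_eq_0)
  have c: "coeff ?P m = \<beta> * (if m = 0 then 0 else real (m * (m + 1)) * coeff Y (m + 1)) + 2 * \<kappa> * real (m + 1) * coeff Y (m + 1)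
      - real m * coeff Y m + real n * coeff Y m" for m
    unfolding Y_def[symmetric] by (cases m) (simp_all add: coeff_pderiv coeff_pCons algebra_simps)
  have n: "n \<noteq> 0"
  proof
    assume "n = 0"
    then have "pderiv equilibrium_poly = 0" using degree_equilibrium_poly by (simp add: pderiv_eq_0_iff)
    then show False using P \<open>n = 0\<close> by simp
  qed
  have "degree ?P \<le> n - 1"
  proof (rule degree_le, intro allI impI)
    fix m assume "m > n - 1"
    then show "coeff ?P m = 0" unfolding c using Yn[of m] Yn[of "m + 1"] by (cases "m = n") auto
  qed
  then have deg: "degree ?P < n" using n by simp
  have roots: "L ` {1..n} \<subseteq> {x. poly ?P x = 0}"
  proof (rule image_subsetI)
    fix i assume i: "i \<in> {1..n}"
    define S where "S = (\<Sum>j\<in>{1..n}-{i}. 1 / (L i - L j))"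
    have Y0: "poly equilibrium_poly (L i) = 0"
      unfolding poly_equilibrium_poly by (rule prod_zero) (use i in auto)
    have "\<beta> * S * L i + \<kappa> = L i / 2"
      using force_balance[OF i] L_pos[OF i] unfolding S_def[symmetric] by (simp add: field_simps)
    then have fb: "2 * \<beta> * S * L i + 2 * \<kappa> - L i = 0" by simp
    have "poly ?P (L i) = \<beta> * (L i * poly (pderiv (pderiv equilibrium_poly)) (L i)) + (2 * \<kappa> - L i) * poly (pderiv equilibrium_poly) (L i)"
      using Y0 by (simp add: left_diff_distrib)
    also have "\<dots> = (2 * \<beta> * S * L i + 2 * \<kappa> - L i) * poly (pderiv equilibrium_poly) (L i)"
      unfolding equilibrium_poly_root_derivatives[OF i] S_def[symmetric] by (simp only: algebra_simps)
    finally have "poly ?P (L i) = (2 * \<beta> * S * L i + 2 * \<kappa> - L i) * poly (pderiv equilibrium_poly) (L i)" .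
    then show "L i \<in> {x. poly ?P x = 0}" unfolding fb by simp
  qed
  have "n = card (L ` {1..n})" using decreasing_inj_on[OF L_decreasing] by (simp add: card_image)
  also have "\<dots> \<le> card {x. poly ?P x = 0}" using roots P by (intro card_mono poly_roots_finite)
  also have "\<dots> \<le> degree ?P" using P by (rule card_poly_roots_bound)
  finally show False using deg by simp
qed

text \<open>Comparing coefficients in the differential equation links two neighbouring coefficients.
  Apart from the sign and the binomial ratio, the step carries the factor
  \<open>2 * \<kappa> + \<beta> * (n - 1 - k)\<close> of Aomoto's recursion.\<close>

lemma coeff_equilibrium_poly:
  assumes "k \<le> n"
  shows "coeff equilibrium_poly (n - k) = (-1) ^ k * real (n choose k) * (\<Prod>j<k. 2 * \<kappa> + \<beta> * (real n - 1 - real j))"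
  using assms
proof (induction k)
  case 0
  then show ?case by (simp add: coeff_equilibrium_poly_top)
next
  case (Suc k)
  define m where "m = n - Suc k"
  have m: "n - k = m + 1" "real m = real n - 1 - real k" using Suc.prems by (auto simp: m_def)
  let ?Y = equilibrium_poly
  have c: "coeff (smult \<beta> ([:0, 1:] * pderiv (pderiv ?Y)) + [:2 * \<kappa>, -1:] * pderiv ?Y + smult (real n) ?Y) m
     = \<beta> * (if m = 0 then 0 else real (m * (m + 1)) * coeff ?Y (m + 1)) + 2 * \<kappa> * real (m + 1) * coeff ?Y (m + 1)
      - real m * coeff ?Y m + real n * coeff ?Y m"
    by (cases m) (simp_all add: coeff_pderiv coeff_pCons algebra_simps)
  have "\<beta> * (real (m * (m + 1)) * coeff ?Y (m + 1)) + 2 * \<kappa> * real (m + 1) * coeff ?Y (m + 1)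
      - real m * coeff ?Y m + real n * coeff ?Y m = 0"
    using c unfolding equilibrium_poly_ode by (cases "m = 0") auto
  moreover have nm: "real n - real m = real (Suc k)" using m(2) by simp
  ultimately have rec: "real (Suc k) * coeff ?Y m = - (real (n - k) * (2 * \<kappa> + \<beta> * real m) * coeff ?Y (n - k))"
    unfolding m(1) nm[symmetric] by (simp add: algebra_simps)
  have "Suc k * (n choose Suc k) = (n - k) * (n choose k)"
    using choose_mult_lemma binomial_absorb_comp[of n k] binomial_absorption[of k n] Suc.prems
    by (metis Suc_times_binomial_eq binomial_absorb_comp mult.commute)
  then have binom: "real (Suc k) * real (n choose Suc k) = real (n - k) * real (n choose k)"
    by (metis of_nat_mult)
  have IH: "coeff ?Y (n - k) = (-1) ^ k * real (n choose k) * (\<Prod>j<k. 2 * \<kappa> + \<beta> * (real n - 1 - real j))"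
    using Suc by simp
  define Mk where "Mk = (\<Prod>j<k. 2 * \<kappa> + \<beta> * (real n - 1 - real j))"
  have "real (Suc k) * coeff ?Y m = - ((real (n - k) * real (n choose k)) * ((-1) ^ k * Mk * (2 * \<kappa> + \<beta> * real m)))"
    unfolding rec IH Mk_def by (simp only: mult_ac)
  also have "\<dots> = real (Suc k) * ((-1) ^ Suc k * real (n choose Suc k) * (Mk * (2 * \<kappa> + \<beta> * (real n - 1 - real k))))"
    unfolding binom[symmetric] m(2) by simp
  finally have "coeff ?Y m = (-1) ^ Suc k * real (n choose Suc k) * (Mk * (2 * \<kappa> + \<beta> * (real n - 1 - real k)))"
    by (simp only: mult_cancel_left of_nat_eq_0_iff) simp
  then show ?case unfolding m_def Mk_def by simp
qed

lemma equilibrium_poly_expand: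
  "(\<Prod>i=1..n. z - L i) = (\<Sum>k\<le>n. real (n choose k) * ((-1) ^ k * z ^ (n - k) * (\<Prod>j<k. 2 * \<kappa> + \<beta> * (real n - 1 - real j))))"
proof -
  have "(\<Prod>i=1..n. z - L i) = (\<Sum>m\<le>n. coeff equilibrium_poly m * z ^ m)"
    using poly_equilibrium_poly[of z] by (simp add: poly_altdef degree_equilibrium_poly)
  also have "\<dots> = (\<Sum>k\<le>n. coeff equilibrium_poly (n - k) * z ^ (n - k))"
    by (rule sum.reindex_bij_witness[of _ "\<lambda>k. n - k" "\<lambda>k. n - k"]) auto
  also have "\<dots> = (\<Sum>k\<le>n. real (n choose k) * ((-1) ^ k * z ^ (n - k) * (\<Prod>j<k. 2 * \<kappa> + \<beta> * (real n - 1 - real j))))"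
    by (intro sum.cong refl) (simp add: coeff_equilibrium_poly mult_ac)
  finally show ?thesis .
qed

lemma subset_monomial_integral:
  assumes "B \<subseteq> {1..n}"
  shows "integrable (lebesgue_on_indices {1..n}) (\<lambda>l. laguerre_kernel \<beta> 0 \<kappa> n l * (\<Prod>i\<in>B. l i))"
    and "(\<integral>l. laguerre_kernel \<beta> 0 \<kappa> n l * (\<Prod>i\<in>B. l i) \<partial>lebesgue_on_indices {1..n})
     = (\<Prod>j<card B. 2 * \<kappa> + \<beta> * (real n - 1 - real j)) * laguerre_integral \<beta> \<kappa> n"
proof -
  obtain s where s: "s permutes {1..n}" "s ` {1..card B} = B" using ex_permutation_onto[OF assms] .
  have cB: "card B \<le> n" using card_mono[OF _ assms] by simp
  let ?g = "\<lambda>l. laguerre_kernel \<beta> 0 \<kappa> n l * (\<Prod>i=1..card B. l i)"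
  have g: "?g (\<lambda>i. l (s i)) = laguerre_kernel \<beta> 0 \<kappa> n l * (\<Prod>i\<in>B. l i)" for l
  proof -
    have "(\<Prod>i\<in>B. l i) = (\<Prod>i=1..card B. l (s i))"
      by (subst s(2)[symmetric], subst prod.reindex) (auto intro: permutes_inj_on[OF s(1)])
    then show ?thesis by (simp only: laguerre_kernel_permute[OF s(1)])
  qed
  have int: "integrable (lebesgue_on_indices {1..n}) ?g"
  proof (cases n)
    case 0
    then show ?thesis using integrable_kernel[OF \<beta> \<kappa>, of 0] cB by simp
  next
    case (Suc m)
    then show ?thesis using integrable_kernel_monomial[OF \<beta> \<kappa>, of 0 "card B" m] cB by simp
  qed
  then have "integrable (distr (lebesgue_on_indices {1..n}) (lebesgue_on_indices {1..n}) (\<lambda>l i. l (s i))) ?g"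
    by (subst distr_lebesgue_permute[OF _ s(1)]) auto
  from integrable_distr[OF measurable_permute_coordinates[OF s(1)] this]
  show "integrable (lebesgue_on_indices {1..n}) (\<lambda>l. laguerre_kernel \<beta> 0 \<kappa> n l * (\<Prod>i\<in>B. l i))"
    unfolding g .
  have "(\<integral>l. ?g (\<lambda>i. l (s i)) \<partial>lebesgue_on_indices {1..n}) = (\<integral>l. ?g l \<partial>lebesgue_on_indices {1..n})"
    using int by (intro integral_lebesgue_permute s(1)) auto
  then show "(\<integral>l. laguerre_kernel \<beta> 0 \<kappa> n l * (\<Prod>i\<in>B. l i) \<partial>lebesgue_on_indices {1..n})
     = (\<Prod>j<card B. 2 * \<kappa> + \<beta> * (real n - 1 - real j)) * laguerre_integral \<beta> \<kappa> n"
    unfolding g monomial_integral[OF \<beta> \<kappa> cB] .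
qed

text \<open>Expanding the product over subsets of indices leaves integrals of monomials, which by
  symmetry depend only on the size of the subset. Aomoto's recursion evaluates them to exactly the
  factors found in \<open>coeff_equilibrium_poly\<close>.\<close>

theorem expected_characteristic_polynomial:
  "(\<integral>l. laguerre_kernel \<beta> 0 \<kappa> n l * (\<Prod>i=1..n. z - l i) \<partial>lebesgue_on_indices {1..n})
     = laguerre_integral \<beta> \<kappa> n * (\<Prod>i=1..n. z - L i)"
proof -
  have expand: "(\<Prod>i=1..n. z - l i) = (\<Sum>B\<in>Pow {1..n}. ((-1) ^ card B * z ^ (n - card B)) * (\<Prod>i\<in>B. l i))" for l :: "nat \<Rightarrow> real"
  proof -
    have "(\<Prod>i=1..n. z - l i) = (\<Prod>i=1..n. - l i + z)" by simp
    also have "\<dots> = (\<Sum>B\<in>Pow {1..n}. (\<Prod>i\<in>B. - l i) * (\<Prod>i\<in>{1..n}-B. z))"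
      by (rule prod_add) simp
    also have "\<dots> = (\<Sum>B\<in>Pow {1..n}. ((-1) ^ card B * z ^ (n - card B)) * (\<Prod>i\<in>B. l i))"
    proof (rule sum.cong[OF refl])
      fix B assume "B \<in> Pow {1..n}"
      then have sub: "B \<subseteq> {1..n}" and fB: "finite B" using finite_subset[of B "{1..n}"] by auto
      have B: "card ({1..n} - B) = n - card B" using card_Diff_subset[OF fB sub] by simp
      have "(\<Prod>i\<in>B. - l i) = (-1) ^ card B * (\<Prod>i\<in>B. l i)"
        using prod.distrib[of "\<lambda>_. -1" l B] by simp
      then show "(\<Prod>i\<in>B. - l i) * (\<Prod>i\<in>{1..n}-B. z) = ((-1) ^ card B * z ^ (n - card B)) * (\<Prod>i\<in>B. l i)"
        using B by simp
    qed
    finally show ?thesis .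
  qed
  have "(\<integral>l. laguerre_kernel \<beta> 0 \<kappa> n l * (\<Prod>i=1..n. z - l i) \<partial>lebesgue_on_indices {1..n})
     = (\<integral>l. (\<Sum>B\<in>Pow {1..n}. ((-1) ^ card B * z ^ (n - card B)) * (laguerre_kernel \<beta> 0 \<kappa> n l * (\<Prod>i\<in>B. l i))) \<partial>lebesgue_on_indices {1..n})"
    unfolding expand by (simp add: sum_distrib_left mult_ac)
  also have "\<dots> = (\<Sum>B\<in>Pow {1..n}. \<integral>l. ((-1) ^ card B * z ^ (n - card B)) * (laguerre_kernel \<beta> 0 \<kappa> n l * (\<Prod>i\<in>B. l i)) \<partial>lebesgue_on_indices {1..n})"
    by (intro Bochner_Integration.integral_sum integrable_mult_right subset_monomial_integral(1)) auto
  also have "\<dots> = (\<Sum>B\<in>Pow {1..n}. ((-1) ^ card B * z ^ (n - card B)) * ((\<Prod>j<card B. 2 * \<kappa> + \<beta> * (real n - 1 - real j)) * laguerre_integral \<beta> \<kappa> n))"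
    by (intro sum.cong refl) (simp only: integral_mult_right_zero subset_monomial_integral(2) Pow_iff)
  also have "\<dots> = (\<Sum>k\<le>n. real (n choose k) * (((-1) ^ k * z ^ (n - k)) * ((\<Prod>j<k. 2 * \<kappa> + \<beta> * (real n - 1 - real j)) * laguerre_integral \<beta> \<kappa> n)))"
    by (rule sum_Pow_card)
  also have "\<dots> = laguerre_integral \<beta> \<kappa> n * (\<Prod>i=1..n. z - L i)"
    unfolding equilibrium_poly_expand by (simp add: sum_distrib_left mult_ac)
  finally show ?thesis .
qed

subsection \<open>Moments of the characteristic polynomial\<close>

definition char_moment :: "real \<Rightarrow> real \<Rightarrow> real" where
  "char_moment z s = (\<integral>l. laguerre_kernel \<beta> 0 \<kappa> n l * (\<Prod>i=1..n. \<bar>z - l i\<bar> powr s) \<partial>lebesgue_on_indices {1..n})"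

lemma integrable_char_moment:
  assumes "s \<ge> 0"
  shows "integrable (lebesgue_on_indices {1..n}) (\<lambda>l. laguerre_kernel \<beta> 0 \<kappa> n l * (\<Prod>i=1..n. \<bar>z - l i\<bar> powr s))"
proof (rule integrable_laguerre_kernel[where C = "((1 + \<bar>z\<bar>) powr s) ^ n" and b = s])
  fix l :: "nat \<Rightarrow> real" assume l: "\<And>i. i \<in> {1..n} \<Longrightarrow> l i > 0"
  have "(\<Prod>i=1..n. \<bar>z - l i\<bar> powr s) \<le> (\<Prod>i=1..n. (1 + \<bar>z\<bar>) powr s * (1 + l i) powr s)"
  proof (intro prod_mono conjI)
    fix i assume i: "i \<in> {1..n}"
    have "\<bar>z - l i\<bar> \<le> (1 + \<bar>z\<bar>) * (1 + l i)"
    proof -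
      have "0 \<le> \<bar>z\<bar> * l i" using l[OF i] by simp
      moreover have "\<bar>z - l i\<bar> \<le> \<bar>z\<bar> + l i" using l[OF i] by linarith
      ultimately show ?thesis by (simp add: algebra_simps)
    qed
    then have "\<bar>z - l i\<bar> powr s \<le> ((1 + \<bar>z\<bar>) * (1 + l i)) powr s" using assms by (intro powr_mono2) auto
    then show "\<bar>z - l i\<bar> powr s \<le> (1 + \<bar>z\<bar>) powr s * (1 + l i) powr s" by (simp add: powr_mult)
  qed auto
  also have "\<dots> = ((1 + \<bar>z\<bar>) powr s) ^ n * (\<Prod>i=1..n. (1 + l i) powr s)" by (simp add: prod.distrib)
  finally show "\<bar>\<Prod>i=1..n. \<bar>z - l i\<bar> powr s\<bar> \<le> ((1 + \<bar>z\<bar>) powr s) ^ n * (\<Prod>i=1..n. (1 + l i) powr s)"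
    by (subst abs_of_nonneg) (auto intro: prod_nonneg)
qed (use \<beta> \<kappa> in auto)

lemma char_moment_nonneg: "char_moment z s \<ge> 0"
  unfolding char_moment_def by (intro integral_nonneg_AE AE_I2 mult_nonneg_nonneg prod_nonneg) auto

lemma char_moment_decreasing:
  assumes "s \<ge> 0"
  shows "ennreal (char_moment z s) = (\<integral>\<^sup>+l. ennreal (laguerre_kernel \<beta> 0 \<kappa> n l * (\<Prod>i=1..n. \<bar>z - l i\<bar> powr s)) * indicator {l. decreasing n l} l \<partial>lebesgue_on_indices {1..n}) * fact n"
proof -
  let ?f = "\<lambda>l. ennreal (laguerre_kernel \<beta> 0 \<kappa> n l * (\<Prod>i=1..n. \<bar>z - l i\<bar> powr s))"
  have m: "?f \<in> borel_measurable (lebesgue_on_indices {1..n})" by measurable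
  have sym: "?f (\<lambda>i. l (p i)) = ?f l" if "p permutes {1..n}" for l p
    using prod.permute[OF that, of "\<lambda>i. \<bar>z - l i\<bar> powr s"] by (simp add: laguerre_kernel_permute[OF that] o_def)
  have "ennreal (char_moment z s) = (\<integral>\<^sup>+l. ?f l \<partial>lebesgue_on_indices {1..n})"
    unfolding char_moment_def
    by (rule nn_integral_eq_integral[symmetric, OF integrable_char_moment[OF assms]]) (auto intro!: AE_I2 mult_nonneg_nonneg prod_nonneg)
  also have "\<dots> = fact n * (\<integral>\<^sup>+l. ?f l * indicator {l. decreasing n l} l \<partial>lebesgue_on_indices {1..n})"
    by (rule nn_integral_symmetric[OF m sym])
  finally show ?thesis by (simp only: mult.commute)
qed

text \<open>The sum of the \<open>\<bar>l i - L i\<bar>\<close> measures closeness only for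
  configurations sorted like \<open>L\<close>, hence the indicator; \<open>fact n\<close> restores
  the mass of the unordered kernel. The constant \<open>C\<close> is relative to the normalising
  integral.\<close>

definition concentrated :: "real \<Rightarrow> real \<Rightarrow> bool" where
  "concentrated t C \<longleftrightarrow> (\<integral>\<^sup>+l. ennreal (laguerre_kernel \<beta> 0 \<kappa> n l * exp (t * (\<Sum>i=1..n. \<bar>l i - L i\<bar>))) * indicator {l. decreasing n l} l \<partial>lebesgue_on_indices {1..n}) * fact n
    \<le> ennreal (laguerre_integral \<beta> \<kappa> n * C)"

text \<open>At distance \<rho> from all \<open>L i\<close>, each factor satisfies \<open>\<bar>z - l
  i\<bar> \<le> (z - L i) * exp (\<bar>l i - L i\<bar> / \<rho>)\<close>. The moment is therefore at
  most the equilibrium value times an exponential moment of the deviation with parameter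
  \<open>s / \<rho>\<close>.\<close>

lemma char_moment_upper:
  assumes s: "s \<ge> 0" and \<rho>: "\<rho> > 0" "\<And>i. i \<in> {1..n} \<Longrightarrow> z - L i \<ge> \<rho>"
    and C: "concentrated (s / \<rho>) C" "C \<ge> 0"
  shows "char_moment z s \<le> laguerre_integral \<beta> \<kappa> n * ((\<Prod>i=1..n. z - L i) powr s * C)"
proof -
  let ?CH = "(\<Prod>i=1..n. z - L i) powr s"
  let ?K = "laguerre_kernel \<beta> 0 \<kappa> n" and ?D = "\<lambda>l. indicator {l. decreasing n l} l :: ennreal"
  have ch: "?CH = (\<Prod>i=1..n. (z - L i) powr s)" by (rule prod_powr_distrib)
  have ptw: "(\<Prod>i=1..n. \<bar>z - l i\<bar> powr s) \<le> ?CH * exp (s / \<rho> * (\<Sum>i=1..n. \<bar>l i - L i\<bar>))" for l :: "nat \<Rightarrow> real"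
  proof -
    have "(\<Prod>i=1..n. \<bar>z - l i\<bar> powr s) \<le> (\<Prod>i=1..n. (z - L i) powr s * exp (s / \<rho> * \<bar>l i - L i\<bar>))"
    proof (intro prod_mono conjI)
      fix i assume i: "i \<in> {1..n}"
      have zL: "z - L i > 0" using \<rho>(1) \<rho>(2)[OF i] by linarith
      have "\<bar>z - l i\<bar> \<le> (z - L i) + \<bar>l i - L i\<bar>" using zL by linarith
      also have "\<dots> = (z - L i) * (1 + \<bar>l i - L i\<bar> / (z - L i))" using zL by (simp add: field_simps)
      also have "\<dots> \<le> (z - L i) * (1 + \<bar>l i - L i\<bar> / \<rho>)"
        using zL \<rho>(1) \<rho>(2)[OF i] by (intro mult_left_mono add_left_mono divide_left_mono) auto
      also have "\<dots> \<le> (z - L i) * exp (\<bar>l i - L i\<bar> / \<rho>)" using zL by (intro mult_left_mono exp_ge_add_one_self) auto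
      finally have "\<bar>z - l i\<bar> powr s \<le> ((z - L i) * exp (\<bar>l i - L i\<bar> / \<rho>)) powr s" using s by (intro powr_mono2) auto
      also have "\<dots> = (z - L i) powr s * exp (s / \<rho> * \<bar>l i - L i\<bar>)"
        by (simp add: powr_mult exp_powr_real mult.commute)
      finally show "\<bar>z - l i\<bar> powr s \<le> (z - L i) powr s * exp (s / \<rho> * \<bar>l i - L i\<bar>)" .
    qed auto
    then show ?thesis unfolding ch by (simp add: prod.distrib exp_sum[symmetric] sum_distrib_left)
  qed
  have "ennreal (char_moment z s) = (\<integral>\<^sup>+l. ennreal (?K l * (\<Prod>i=1..n. \<bar>z - l i\<bar> powr s)) * ?D l \<partial>lebesgue_on_indices {1..n}) * fact n"
    by (rule char_moment_decreasing[OF s])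
  also have "\<dots> \<le> (\<integral>\<^sup>+l. ennreal ?CH * (ennreal (?K l * exp (s / \<rho> * (\<Sum>i=1..n. \<bar>l i - L i\<bar>))) * ?D l) \<partial>lebesgue_on_indices {1..n}) * fact n"
  proof (intro mult_right_mono nn_integral_mono)
    fix l
    have "?K l * (\<Prod>i=1..n. \<bar>z - l i\<bar> powr s) \<le> ?K l * (?CH * exp (s / \<rho> * (\<Sum>i=1..n. \<bar>l i - L i\<bar>)))"
      by (intro mult_left_mono ptw) auto
    then have "ennreal (?K l * (\<Prod>i=1..n. \<bar>z - l i\<bar> powr s)) \<le> ennreal ?CH * ennreal (?K l * exp (s / \<rho> * (\<Sum>i=1..n. \<bar>l i - L i\<bar>)))"
      by (subst ennreal_mult'[symmetric]) (auto intro!: ennreal_leI simp: mult_ac)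
    then show "ennreal (?K l * (\<Prod>i=1..n. \<bar>z - l i\<bar> powr s)) * ?D l \<le> ennreal ?CH * (ennreal (?K l * exp (s / \<rho> * (\<Sum>i=1..n. \<bar>l i - L i\<bar>))) * ?D l)"
      by (simp only: mult.assoc[symmetric] mult_right_mono zero_le)
  qed auto
  also have "\<dots> = ennreal ?CH * ((\<integral>\<^sup>+l. ennreal (?K l * exp (s / \<rho> * (\<Sum>i=1..n. \<bar>l i - L i\<bar>))) * ?D l \<partial>lebesgue_on_indices {1..n}) * fact n)"
  proof -
    have [measurable]: "?D \<in> borel_measurable (lebesgue_on_indices {1..n})"
    proof -
      have "(\<lambda>l. if decreasing n l then 1 else 0) \<in> borel_measurable (lebesgue_on_indices {1..n})" by measurable
      then show ?thesis by (rule measurable_cong[THEN iffD1, rotated]) (auto simp: indicator_def)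
    qed
    show ?thesis by (subst nn_integral_cmult, measurable) (simp only: mult.assoc)
  qed
  also have "\<dots> \<le> ennreal ?CH * ennreal (laguerre_integral \<beta> \<kappa> n * C)"
    using C(1) unfolding concentrated_def by (intro mult_left_mono) auto
  also have "\<dots> = ennreal (laguerre_integral \<beta> \<kappa> n * (?CH * C))"
    by (subst ennreal_mult'[symmetric]) (auto simp: mult_ac)
  finally show ?thesis
    using laguerre_integral_pos[OF \<beta> \<kappa>, of n] C(2) by (subst (asm) ennreal_le_iff) auto
qed

text \<open>The expected characteristic polynomial bounds the first absolute moment from below; a
  Paley--Zygmund argument with the second moment transfers this to the moment of order \<open>\<beta>\<close>.\<close>

lemma char_moment_lower:
  assumes \<rho>: "\<rho> > 0" "\<And>i. i \<in> {1..n} \<Longrightarrow> z - L i \<ge> \<rho>"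
    and C: "concentrated (2 / \<rho>) C" "C > 0"
  shows "laguerre_integral \<beta> \<kappa> n * ((\<Prod>i=1..n. z - L i) powr \<beta> / (4 * 2 powr \<beta> * C)) \<le> char_moment z \<beta>"
proof -
  define Z where "Z = laguerre_integral \<beta> \<kappa> n"
  define ch where "ch = (\<Prod>i=1..n. z - L i)"
  have Z: "Z > 0" unfolding Z_def by (rule laguerre_integral_pos[OF \<beta> \<kappa>])
  have ch: "ch > 0" unfolding ch_def using \<rho> by (intro prod_pos) force
  let ?K = "laguerre_kernel \<beta> 0 \<kappa> n"
  define X where "X l = (\<Prod>i=1..n. \<bar>z - l i\<bar>)" for l :: "nat \<Rightarrow> real"
  have X0: "X l \<ge> 0" for l unfolding X_def by (intro prod_nonneg) auto
  have Xp: "(\<Prod>i=1..n. \<bar>z - l i\<bar> powr s) = X l powr s" for l :: "nat \<Rightarrow> real" and s unfolding X_def by (rule prod_powr_distrib[symmetric])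
  have int: "integrable (lebesgue_on_indices {1..n}) (\<lambda>l. ?K l * X l powr s)" if "s \<ge> 0" for s
    using integrable_char_moment[OF that, of z] unfolding Xp .
  have mom: "char_moment z s = (\<integral>l. ?K l * X l powr s \<partial>lebesgue_on_indices {1..n})" for s
    unfolding char_moment_def Xp ..
  have second: "char_moment z 2 \<le> Z * (ch\<^sup>2 * C)"
    using char_moment_upper[OF _ \<rho>, where s = 2 and C = C] C ch unfolding Z_def ch_def by simp
  \<comment> \<open>For \<open>y = X l / ch\<close>, either \<open>y \<le> 1 / 2\<close>, or
    \<open>(2 * y) powr \<beta> \<ge> 1\<close> and
    \<open>y \<le> \<tau> * y\<^sup>2 + 1 / (4 * \<tau>)\<close>. With this \<tau> the second moment
    contributes at most a quarter of \<open>Z * ch\<close> and the constant a half, so a quarter is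
    left for the moment of order \<beta>.\<close>
  define \<tau> where "\<tau> = 1 / (4 * C)"
  have \<tau>: "\<tau> > 0" using C by (simp add: \<tau>_def)
  have ptw: "X l \<le> ch / 2 + \<tau> / ch * (X l powr 2) + 2 powr \<beta> * ch / (4 * \<tau> * ch powr \<beta>) * X l powr \<beta>" for l
  proof -
    define y where "y = X l / ch"
    have y0: "y \<ge> 0" using X0 ch by (simp add: y_def)
    have "y \<le> 1 / 2 + \<tau> * y\<^sup>2 + 2 powr \<beta> / (4 * \<tau>) * y powr \<beta>"
    proof (cases "y \<le> 1 / 2")
      case True
      have "0 \<le> \<tau> * y\<^sup>2" "0 \<le> 2 powr \<beta> / (4 * \<tau>) * y powr \<beta>" using \<tau> by auto
      then show ?thesis using True by linarith
    next
      case False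
      have "1 \<le> (2 * y) powr \<beta>" using False \<beta> by (intro ge_one_powr_ge_zero) auto
      then have "1 / (4 * \<tau>) \<le> 1 / (4 * \<tau>) * (2 * y) powr \<beta>" using \<tau> mult_left_mono[of 1 "(2 * y) powr \<beta>" "1 / (4 * \<tau>)"] by simp
      then have "1 / (4 * \<tau>) \<le> 2 powr \<beta> / (4 * \<tau>) * y powr \<beta>" using y0 by (simp add: powr_mult mult_ac)
      moreover have "y \<le> \<tau> * y\<^sup>2 + 1 / (4 * \<tau>)"
      proof -
        have "0 \<le> (2 * \<tau> * y - 1)\<^sup>2 / (4 * \<tau>)" using \<tau> by simp
        also have "\<dots> = \<tau> * y\<^sup>2 + 1 / (4 * \<tau>) - y" using \<tau> by (simp add: power2_eq_square field_simps)
        finally show ?thesis by simp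
      qed
      ultimately show ?thesis by linarith
    qed
    then have "ch * y \<le> ch * (1 / 2 + \<tau> * y\<^sup>2 + 2 powr \<beta> / (4 * \<tau>) * y powr \<beta>)" using ch by (intro mult_left_mono) auto
    moreover have "ch * y = X l" using ch by (simp add: y_def)
    moreover have "ch * (1 / 2 + \<tau> * y\<^sup>2 + 2 powr \<beta> / (4 * \<tau>) * y powr \<beta>)
       = ch / 2 + \<tau> / ch * (X l powr 2) + 2 powr \<beta> * ch / (4 * \<tau> * ch powr \<beta>) * X l powr \<beta>"
    proof -
      have "X l powr 2 = (X l)\<^sup>2" using X0[of l] by (cases "X l = 0") auto
      moreover have "y powr \<beta> = X l powr \<beta> / ch powr \<beta>" unfolding y_def using ch X0 by (simp add: powr_divide)
      moreover have "ch * (\<tau> * y\<^sup>2) = \<tau> / ch * (X l)\<^sup>2" unfolding y_def using ch by (simp add: power2_eq_square)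
      ultimately show ?thesis by (simp add: distrib_left mult_ac)
    qed
    ultimately show ?thesis by simp
  qed
  have "Z * ch = (\<integral>l. ?K l * (\<Prod>i=1..n. z - l i) \<partial>lebesgue_on_indices {1..n})"
    unfolding Z_def ch_def by (rule expected_characteristic_polynomial[symmetric])
  also have "\<dots> \<le> (\<integral>l. ch / 2 * ?K l + \<tau> / ch * (?K l * X l powr 2) + 2 powr \<beta> * ch / (4 * \<tau> * ch powr \<beta>) * (?K l * X l powr \<beta>) \<partial>lebesgue_on_indices {1..n})"
  proof (rule integral_mono')
    show "integrable (lebesgue_on_indices {1..n}) (\<lambda>l. ch / 2 * ?K l + \<tau> / ch * (?K l * X l powr 2) + 2 powr \<beta> * ch / (4 * \<tau> * ch powr \<beta>) * (?K l * X l powr \<beta>))"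
      using \<beta> by (intro Bochner_Integration.integrable_add integrable_mult_right int integrable_kernel \<kappa>) auto
    fix l
    have "(\<Prod>i=1..n. z - l i) \<le> \<bar>\<Prod>i=1..n. z - l i\<bar>" by simp
    also have "\<dots> = X l" by (simp add: X_def abs_prod)
    finally have "?K l * (\<Prod>i=1..n. z - l i) \<le> ?K l * (ch / 2 + \<tau> / ch * (X l powr 2) + 2 powr \<beta> * ch / (4 * \<tau> * ch powr \<beta>) * X l powr \<beta>)"
      using ptw[of l] by (intro mult_left_mono) auto
    also have "\<dots> = ch / 2 * ?K l + \<tau> / ch * (?K l * X l powr 2) + 2 powr \<beta> * ch / (4 * \<tau> * ch powr \<beta>) * (?K l * X l powr \<beta>)"
      by (simp add: distrib_left mult_ac)
    finally show "?K l * (\<Prod>i=1..n. z - l i) \<le> ch / 2 * ?K l + \<tau> / ch * (?K l * X l powr 2) + 2 powr \<beta> * ch / (4 * \<tau> * ch powr \<beta>) * (?K l * X l powr \<beta>)" .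
    show "0 \<le> ch / 2 * ?K l + \<tau> / ch * (?K l * X l powr 2) + 2 powr \<beta> * ch / (4 * \<tau> * ch powr \<beta>) * (?K l * X l powr \<beta>)"
      using ch \<tau> by (intro add_nonneg_nonneg mult_nonneg_nonneg) auto
  qed
  also have "\<dots> = ch / 2 * Z + \<tau> / ch * char_moment z 2 + 2 powr \<beta> * ch / (4 * \<tau> * ch powr \<beta>) * char_moment z \<beta>"
    unfolding mom Z_def laguerre_integral_def
    using int[of 2] int[of \<beta>] \<beta> integrable_kernel[OF \<beta> \<kappa>, of n] by (simp add: Bochner_Integration.integral_add)
  also have "\<tau> / ch * char_moment z 2 \<le> \<tau> / ch * (Z * (ch\<^sup>2 * C))" using second \<tau> ch by (intro mult_left_mono) auto
  also have "\<tau> / ch * (Z * (ch\<^sup>2 * C)) = Z * ch / 4" using ch C by (simp add: \<tau>_def power2_eq_square)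
  finally have "Z * ch / 4 \<le> 2 powr \<beta> * ch / (4 * \<tau> * ch powr \<beta>) * char_moment z \<beta>" by (simp add: field_simps)
  also have "2 powr \<beta> * ch / (4 * \<tau> * ch powr \<beta>) = ch * (2 powr \<beta> * C / ch powr \<beta>)" using C by (simp add: \<tau>_def)
  finally have "ch * (Z / 4) \<le> ch * (2 powr \<beta> * C / ch powr \<beta> * char_moment z \<beta>)" by (simp only: mult_ac times_divide_eq_right)
  then have "Z / 4 \<le> 2 powr \<beta> * C / ch powr \<beta> * char_moment z \<beta>" by (rule mult_left_le_imp_le[OF _ ch])
  then have "Z * ch powr \<beta> \<le> 4 * 2 powr \<beta> * C * char_moment z \<beta>" using ch by (simp add: field_simps)
  then show ?thesis unfolding Z_def[symmetric] ch_def[symmetric] using C by (simp add: field_simps)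
qed

end


section \<open>The Stieltjes transform of the Marchenko--Pastur law\<close>

text \<open>With \<open>R = sqrt (d\<^sup>2 - u\<^sup>2)\<close> the integrand is
  \<open>(u + w) / R - (w\<^sup>2 - d\<^sup>2) / ((w - u) * R)\<close>, and the three terms
  integrate separately. The boundary case \<open>w = d\<close>, in which the last term has
  coefficient 0, serves the ratio \<open>\<gamma> = 1\<close>.\<close>

lemma semicircle_stieltjes_deriv:
  fixes d w u :: real
  assumes d: "d > 0" and w: "w \<ge> d" and u: "- d < u" "u < d"
  shows "((\<lambda>u. - sqrt (d\<^sup>2 - u\<^sup>2) + w * arcsin (u / d) - sqrt (w\<^sup>2 - d\<^sup>2) * arcsin ((w * u - d\<^sup>2) / (d * (w - u))))
     has_real_derivative sqrt (d\<^sup>2 - u\<^sup>2) / (w - u)) (at u)"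
proof -
  define R where "R = sqrt (d\<^sup>2 - u\<^sup>2)"
  have d2: "d\<^sup>2 - u\<^sup>2 > 0" 
  proof -
    have "d\<^sup>2 - u\<^sup>2 = (d - u) * (d + u)" by (simp add: power2_eq_square algebra_simps)
    also have "\<dots> > 0" using u by (intro mult_pos_pos) auto
    finally show ?thesis .
  qed
  have R: "R > 0" "R\<^sup>2 = d\<^sup>2 - u\<^sup>2" using d2 by (auto simp: R_def)
  have wu: "w - u > 0" using w u by simp
  have 1: "((\<lambda>u. - sqrt (d\<^sup>2 - u\<^sup>2)) has_real_derivative u / R) (at u)"
    using d2 unfolding R_def by (auto intro!: derivative_eq_intros simp: field_simps)
  have 2: "((\<lambda>u. arcsin (u / d)) has_real_derivative 1 / R) (at u)"
  proof -
    have "sqrt (1 - (u / d)\<^sup>2) = R / d"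

    proof (rule real_sqrt_unique)
      show "(R / d)\<^sup>2 = 1 - (u / d)\<^sup>2" unfolding power_divide R(2) using d by (simp add: field_simps)
    qed (use R d in simp)
    moreover have "((\<lambda>u. arcsin (u / d)) has_real_derivative inverse (sqrt (1 - (u / d)\<^sup>2)) * (1 / d)) (at u)"
      using u d by (intro DERIV_chain2[OF DERIV_arcsin] derivative_eq_intros) (auto simp: field_simps)
    ultimately show ?thesis using d by (simp add: field_simps)
  qed
  have 3: "((\<lambda>u. sqrt (w\<^sup>2 - d\<^sup>2) * arcsin ((w * u - d\<^sup>2) / (d * (w - u)))) has_real_derivative (w\<^sup>2 - d\<^sup>2) / ((w - u) * R)) (at u)"
  proof (cases "w = d")
    case False
    then have wd: "w > d" "w\<^sup>2 - d\<^sup>2 > 0" using w d by (auto simp: power_strict_mono)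
    define S where "S = sqrt (w\<^sup>2 - d\<^sup>2)"
    have S: "S > 0" "S\<^sup>2 = w\<^sup>2 - d\<^sup>2" using wd by (auto simp: S_def)
    define s where "s = (w * u - d\<^sup>2) / (d * (w - u))"
    have ds: "((\<lambda>u. (w * u - d\<^sup>2) / (d * (w - u))) has_real_derivative S\<^sup>2 / (d * (w - u)\<^sup>2)) (at u)"
    proof -
      have "((\<lambda>u. (w * u - d\<^sup>2) / (d * (w - u))) has_real_derivative (w * (d * (w - u)) - (w * u - d\<^sup>2) * (- d)) / (d * (w - u) * (d * (w - u)))) (at u)"
        using d wu by (auto intro!: derivative_eq_intros)
      also have "(w * (d * (w - u)) - (w * u - d\<^sup>2) * (- d)) = d * S\<^sup>2" unfolding S by (simp add: power2_eq_square algebra_simps)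
      finally show ?thesis using d by (simp add: power2_eq_square mult_ac)
    qed
    have s2: "1 - s\<^sup>2 = (S * R / (d * (w - u)))\<^sup>2"
    proof -
      have "1 - s\<^sup>2 = ((d * (w - u))\<^sup>2 - (w * u - d\<^sup>2)\<^sup>2) / (d * (w - u))\<^sup>2"
        unfolding s_def power_divide using d wu by (simp only: diff_divide_distrib) simp
      also have "(d * (w - u))\<^sup>2 - (w * u - d\<^sup>2)\<^sup>2 = S\<^sup>2 * R\<^sup>2"
        unfolding S R by (simp add: power2_eq_square algebra_simps)
      finally show ?thesis by (simp add: power_divide power_mult_distrib)
    qed
    have pos: "S * R / (d * (w - u)) > 0" using S R d wu by simp
    then have "s\<^sup>2 < 1" using s2 by (smt (verit) zero_less_power)
    then have sb: "- 1 < s" "s < 1" by (auto simp: abs_square_less_1 abs_less_iff)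
    have "((\<lambda>u. arcsin ((w * u - d\<^sup>2) / (d * (w - u)))) has_real_derivative inverse (sqrt (1 - s\<^sup>2)) * (S\<^sup>2 / (d * (w - u)\<^sup>2))) (at u)"
      using DERIV_chain2[OF DERIV_arcsin[OF sb, unfolded s_def] ds] unfolding s_def .
    also have "inverse (sqrt (1 - s\<^sup>2)) * (S\<^sup>2 / (d * (w - u)\<^sup>2)) = S / ((w - u) * R)"
    proof -
      have "sqrt (1 - s\<^sup>2) = S * R / (d * (w - u))" unfolding s2 by (rule real_sqrt_unique[OF refl less_imp_le[OF pos]])
      then show ?thesis using S(1) R(1) d wu by (simp add: power2_eq_square)
    qed
    finally have "((\<lambda>u. S * arcsin ((w * u - d\<^sup>2) / (d * (w - u)))) has_real_derivative S * (S / ((w - u) * R))) (at u)"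
      by (rule DERIV_cmult)
    moreover have "S * (S / ((w - u) * R)) = (w\<^sup>2 - d\<^sup>2) / ((w - u) * R)" unfolding S(2)[symmetric] by (simp add: power2_eq_square)
    ultimately show ?thesis unfolding S_def by (simp only:)
  qed simp
  have "((\<lambda>u. - sqrt (d\<^sup>2 - u\<^sup>2) + w * arcsin (u / d) - sqrt (w\<^sup>2 - d\<^sup>2) * arcsin ((w * u - d\<^sup>2) / (d * (w - u))))
     has_real_derivative u / R + w * (1 / R) - (w\<^sup>2 - d\<^sup>2) / ((w - u) * R)) (at u)"
    by (intro DERIV_add DERIV_diff 1 DERIV_cmult 2 3)
  moreover have "u / R + w * (1 / R) - (w\<^sup>2 - d\<^sup>2) / ((w - u) * R) = R / (w - u)"
  proof -
    have "u / R + w * (1 / R) - (w\<^sup>2 - d\<^sup>2) / ((w - u) * R) = ((u + w) * (w - u) - (w\<^sup>2 - d\<^sup>2)) / ((w - u) * R)"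
      using R(1) wu by (simp add: field_simps)
    also have "(u + w) * (w - u) - (w\<^sup>2 - d\<^sup>2) = R\<^sup>2" unfolding R(2) by (simp add: power2_eq_square algebra_simps)
    finally show ?thesis using R(1) by (simp add: power2_eq_square)
  qed
  ultimately show ?thesis by (simp add: R_def)
qed

lemma semicircle_stieltjes:
  fixes d w :: real
  assumes d: "d > 0" and w: "w \<ge> d"
  shows "(\<integral>\<^sup>+u. ennreal (indicator {- d..d} u * (sqrt (d\<^sup>2 - u\<^sup>2) / (w - u))) \<partial>lborel) = ennreal (pi * (w - sqrt (w\<^sup>2 - d\<^sup>2)))"
proof -
  let ?F = "\<lambda>u. - sqrt (d\<^sup>2 - u\<^sup>2) + w * arcsin (u / d) - sqrt (w\<^sup>2 - d\<^sup>2) * arcsin ((w * u - d\<^sup>2) / (d * (w - u)))"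
  have cont3: "continuous_on {- d..d} (\<lambda>u. sqrt (w\<^sup>2 - d\<^sup>2) * arcsin ((w * u - d\<^sup>2) / (d * (w - u))))"
  proof (cases "w = d")
    case False
    then have wd: "w > d" using w by simp
    have b: "- 1 \<le> (w * u - d\<^sup>2) / (d * (w - u)) \<and> (w * u - d\<^sup>2) / (d * (w - u)) \<le> 1" if "u \<in> {- d..d}" for u
    proof -
      have p: "d * (w - u) > 0" using that wd d by simp
      have "0 \<le> (w - d) * (u + d)" "0 \<le> (w + d) * (d - u)" using that wd d by auto
      then have "- (d * (w - u)) \<le> w * u - d\<^sup>2" "w * u - d\<^sup>2 \<le> d * (w - u)"
        by (simp_all add: power2_eq_square algebra_simps)
      then show ?thesis using p by (simp add: pos_le_divide_eq pos_divide_le_eq)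
    qed
    have nz: "\<forall>u\<in>{- d..d}. d * (w - u) \<noteq> 0" using wd d by auto
    show ?thesis
      using b by (intro continuous_on_mult continuous_on_const continuous_on_arcsin continuous_on_divide nz) (auto intro!: continuous_intros)
  qed simp
  have hi: "((\<lambda>u. sqrt (d\<^sup>2 - u\<^sup>2) / (w - u)) has_integral (?F d - ?F (- d))) {- d..d}"
  proof (rule fundamental_theorem_of_calculus_interior)
    show "continuous_on {- d..d} ?F"
      using d by (intro continuous_on_diff continuous_on_add cont3 continuous_intros) (auto simp: field_simps)
    show "(?F has_vector_derivative sqrt (d\<^sup>2 - u\<^sup>2) / (w - u)) (at u)" if "u \<in> {- d<..<d}" for u
      using semicircle_stieltjes_deriv[OF d w, of u] that by (simp add: has_real_derivative_iff_has_vector_derivative)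
  qed (use d in simp)
  have "?F d - ?F (- d) = pi * (w - sqrt (w\<^sup>2 - d\<^sup>2))"
  proof (cases "w = d")
    case True
    then show ?thesis using d by (simp add: arcsin_minus)
  next
    case False
    then have wd: "w > d" using w by simp
    have "(w * d - d\<^sup>2) / (d * (w - d)) = 1" using wd d by (simp add: power2_eq_square field_simps)
    moreover have "(w * (- d) - d\<^sup>2) / (d * (w - - d)) = - 1"
    proof -
      have "d * (w - - d) \<noteq> 0" using wd d by simp
      moreover have "w * (- d) - d\<^sup>2 = - (d * (w - - d))" by (simp add: power2_eq_square algebra_simps)
      ultimately show ?thesis by (metis divide_minus_left divide_self)
    qed
    moreover have "- d / d = - 1" using d by simp
    ultimately show ?thesis using d by (simp only: power2_minus) (simp add: algebra_simps)
  qed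
  with hi have "((\<lambda>u. sqrt (d\<^sup>2 - u\<^sup>2) / (w - u)) has_integral (pi * (w - sqrt (w\<^sup>2 - d\<^sup>2)))) {- d..d}" by simp
  then have hi': "((\<lambda>u. indicator {- d..d} u * (sqrt (d\<^sup>2 - u\<^sup>2) / (w - u))) has_integral (pi * (w - sqrt (w\<^sup>2 - d\<^sup>2)))) UNIV"
    unfolding has_integral_restrict_UNIV[of "{- d..d}", symmetric] by (rule has_integral_eq[rotated]) auto
  have nn: "0 \<le> indicator {- d..d} u * (sqrt (d\<^sup>2 - u\<^sup>2) / (w - u))" for u
  proof (cases "u \<in> {- d..d}")
    case True
    then have "u\<^sup>2 \<le> d\<^sup>2" using d by (auto simp: abs_le_square_iff[symmetric])
    then show ?thesis using True w by simp
  qed simp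
  have meas: "(\<lambda>u. indicator {- d..d} u * (sqrt (d\<^sup>2 - u\<^sup>2) / (w - u))) \<in> borel_measurable borel" by measurable
  show ?thesis by (rule nn_integral_has_integral_lborel[OF meas nn hi'])
qed

text \<open>Partial fractions split \<open>1 / (y * (z - y))\<close> into poles at 0 and at
  \<open>z\<close>. After centring at \<open>c\<close> both are semicircle integrals of radius
  \<open>d\<close>: the first, reflected, has its pole at distance \<open>c\<close> from the centre,
  the second at distance \<open>z - c\<close>. The term \<open>\<beta> * (\<gamma> - 1)\<close> is
  the square root \<open>sqrt (c\<^sup>2 - d\<^sup>2)\<close> from the first.\<close>

theorem marchenko_pastur_stieltjes:
  assumes \<beta>: "\<beta> > 0" and \<gamma>: "\<gamma> \<ge> 1" and z: "z > mp_upper \<beta> \<gamma>"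
  shows "(\<integral>y. 1 / (z - y) \<partial>marchenko_pastur \<beta> \<gamma>)
    = (z - \<beta> * (\<gamma> - 1) - sqrt ((z - mp_lower \<beta> \<gamma>) * (z - mp_upper \<beta> \<gamma>))) / (2 * \<beta> * z)"
proof -
  define a b c d where "a = mp_lower \<beta> \<gamma>" and "b = mp_upper \<beta> \<gamma>" and "c = \<beta> * (\<gamma> + 1)" and "d = 2 * \<beta> * sqrt \<gamma>"
  have ab: "a = c - d" "b = c + d"
    using \<gamma> by (simp_all add: a_def b_def c_def d_def mp_lower_def mp_upper_def power2_eq_square algebra_simps)
  have d0: "d > 0" using \<beta> \<gamma> by (simp add: d_def)
  have a0: "a \<ge> 0" using \<beta> by (simp add: a_def mp_lower_def)
  have cd: "c \<ge> d" using a0 ab by simp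
  have z0: "z > 0" using z a0 ab d0 by (simp add: b_def[symmetric])
  have zc: "z - c \<ge> d" using z ab by (simp add: b_def[symmetric])
  have c2: "sqrt (c\<^sup>2 - d\<^sup>2) = \<beta> * (\<gamma> - 1)"
  proof -
    have "c\<^sup>2 - d\<^sup>2 = (\<beta> * (\<gamma> - 1))\<^sup>2"
      using \<gamma> unfolding c_def d_def by (simp add: power_mult_distrib power2_eq_square algebra_simps)
    then show ?thesis using \<beta> \<gamma> by simp
  qed
  have w2: "(z - c)\<^sup>2 - d\<^sup>2 = (z - a) * (z - b)" unfolding ab by (simp add: power2_eq_square algebra_simps)
  define R where "R y = indicator {a..b} y * sqrt ((y - a) * (b - y))" for y
  have R_meas [measurable]: "R \<in> borel_measurable borel" unfolding R_def by measurable
  have R0: "R y \<ge> 0" for y by (cases "y \<in> {a..b}") (auto simp: R_def)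
  have Rsupp: "R y = 0" if "y \<le> a \<or> y \<ge> b" for y using that by (auto simp: R_def indicator_def)
  have Ru: "R (c + u) = indicator {- d..d} u * sqrt (d\<^sup>2 - u\<^sup>2)" for u
  proof -
    have "(c + u - a) * (b - (c + u)) = d\<^sup>2 - u\<^sup>2" unfolding ab by (simp add: power2_eq_square algebra_simps)
    moreover have "indicator {a..b} (c + u) = (indicator {- d..d} u :: real)" unfolding ab by (auto simp: indicator_def)
    ultimately show ?thesis by (simp add: R_def)
  qed
  have I1: "(\<integral>\<^sup>+y. ennreal (R y / (z - y)) \<partial>lborel) = ennreal (pi * (z - c - sqrt ((z - a) * (z - b))))"
  proof -
    have "(\<integral>\<^sup>+y. ennreal (R y / (z - y)) \<partial>lborel) = ennreal \<bar>1\<bar> * (\<integral>\<^sup>+u. ennreal (R (c + 1 * u) / (z - (c + 1 * u))) \<partial>lborel)"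
      by (rule nn_integral_real_affine) auto
    also have "\<dots> = (\<integral>\<^sup>+u. ennreal (indicator {- d..d} u * (sqrt (d\<^sup>2 - u\<^sup>2) / ((z - c) - u))) \<partial>lborel)"
      by (simp add: Ru diff_diff_eq)
    also have "\<dots> = ennreal (pi * (z - c - sqrt ((z - a) * (z - b))))"
      unfolding semicircle_stieltjes[OF d0 zc] w2 ..
    finally show ?thesis .
  qed
  have I2: "(\<integral>\<^sup>+y. ennreal (R y / y) \<partial>lborel) = ennreal (pi * (c - \<beta> * (\<gamma> - 1)))"
  proof -
    have "(\<integral>\<^sup>+y. ennreal (R y / y) \<partial>lborel) = ennreal \<bar>- 1\<bar> * (\<integral>\<^sup>+u. ennreal (R (c + - 1 * u) / (c + - 1 * u)) \<partial>lborel)"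
      by (rule nn_integral_real_affine) auto
    also have "\<dots> = (\<integral>\<^sup>+u. ennreal (indicator {- d..d} u * (sqrt (d\<^sup>2 - u\<^sup>2) / (c - u))) \<partial>lborel)"
    proof -
      have "R (c + - 1 * u) / (c + - 1 * u) = indicator {- d..d} u * (sqrt (d\<^sup>2 - u\<^sup>2) / (c - u))" for u
        using Ru[of "- u"] by (auto simp: indicator_def)
      then show ?thesis by (simp only: abs_minus_cancel abs_one ennreal_1 mult_1)
    qed
    also have "\<dots> = ennreal (pi * (c - \<beta> * (\<gamma> - 1)))"
      unfolding semicircle_stieltjes[OF d0 cd] c2 ..
    finally show ?thesis .
  qed
  define K where "K = 1 / (2 * pi * \<beta> * z)"
  have K0: "K \<ge> 0" using \<beta> z0 by (simp add: K_def)
  define g where "g y = sqrt ((y - a) * (b - y)) / (2 * pi * \<beta> * y) * indicator {a..b} y" for y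
  have g_meas [measurable]: "g \<in> borel_measurable borel" unfolding g_def by measurable
  have g0: "g y \<ge> 0" for y
    using a0 \<beta> by (cases "y \<in> {a..b}") (auto simp: g_def intro!: divide_nonneg_nonneg mult_nonneg_nonneg)
  have split: "g y * (1 / (z - y)) = K * (R y / y + R y / (z - y))" for y
  proof (cases "a < y \<and> y < b")
    case True
    then have y: "y > 0" "z - y > 0" using a0 z by (auto simp: b_def)
    have "1 / y + 1 / (z - y) = z / (y * (z - y))" using y by (simp add: field_simps)
    then have "K * (R y / y + R y / (z - y)) = K * (R y * (z / (y * (z - y))))"
      by (metis (no_types, opaque_lifting) distrib_left mult.right_neutral times_divide_eq_right)
    also have "\<dots> = g y * (1 / (z - y))" unfolding K_def g_def R_def using z0 by (simp add: mult_ac)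
    finally show ?thesis by simp
  next
    case False
    then have "g y = 0" by (auto simp: g_def indicator_def)
    moreover have "R y = 0" using False by (intro Rsupp) auto
    ultimately show ?thesis by simp
  qed
  have Rq0: "R y / y \<ge> 0" "R y / (z - y) \<ge> 0" for y
  proof -
    show "R y / y \<ge> 0" using Rsupp[of y] R0[of y] a0 by (cases "y \<le> a") (auto intro!: divide_nonneg_nonneg)
    show "R y / (z - y) \<ge> 0" using Rsupp[of y] R0[of y] z by (cases "y \<ge> b") (auto intro!: divide_nonneg_nonneg simp: b_def)
  qed
  have "(\<integral>y. 1 / (z - y) \<partial>marchenko_pastur \<beta> \<gamma>) = (\<integral>y. g y *\<^sub>R (1 / (z - y)) \<partial>lborel)"
    unfolding marchenko_pastur_def a_def[symmetric] b_def[symmetric]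
      g_def[symmetric]
    by (rule integral_density) (auto simp: g0)
  also have "\<dots> = (\<integral>y. K * (R y / y + R y / (z - y)) \<partial>lborel)" by (simp only: split real_scaleR_def)
  also have "\<dots> = enn2real (\<integral>\<^sup>+y. ennreal (K * (R y / y + R y / (z - y))) \<partial>lborel)"
    using K0 Rq0 by (intro integral_eq_nn_integral) (auto intro!: AE_I2 mult_nonneg_nonneg add_nonneg_nonneg)
  also have "(\<integral>\<^sup>+y. ennreal (K * (R y / y + R y / (z - y))) \<partial>lborel)
     = (\<integral>\<^sup>+y. ennreal K * (ennreal (R y / y) + ennreal (R y / (z - y))) \<partial>lborel)"
    using K0 Rq0 by (intro nn_integral_cong) (simp only: ennreal_mult' ennreal_plus)
  also have "\<dots> = ennreal K * (ennreal (pi * (c - \<beta> * (\<gamma> - 1))) + ennreal (pi * (z - c - sqrt ((z - a) * (z - b)))))"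
    by (subst nn_integral_cmult, measurable) (subst nn_integral_add, auto simp: I1 I2)
  also have "\<dots> = ennreal (K * (pi * (c - \<beta> * (\<gamma> - 1)) + pi * (z - c - sqrt ((z - a) * (z - b)))))"
  proof -
    have "0 \<le> c - \<beta> * (\<gamma> - 1)" unfolding c_def using \<beta> by (simp add: algebra_simps)
    moreover have "sqrt ((z - c)\<^sup>2 - d\<^sup>2) \<le> sqrt ((z - c)\<^sup>2)" by (rule real_sqrt_le_mono) simp
    then have "0 \<le> z - c - sqrt ((z - a) * (z - b))" unfolding w2 using zc d0 by simp
    ultimately show ?thesis using K0 by (simp add: ennreal_mult' ennreal_plus)
  qed
  also have "enn2real \<dots> = K * (pi * (c - \<beta> * (\<gamma> - 1)) + pi * (z - c - sqrt ((z - a) * (z - b))))"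
  proof (rule enn2real_ennreal)
    have "0 \<le> c - \<beta> * (\<gamma> - 1)" unfolding c_def using \<beta> by (simp add: algebra_simps)
    moreover have "sqrt ((z - c)\<^sup>2 - d\<^sup>2) \<le> sqrt ((z - c)\<^sup>2)" by (rule real_sqrt_le_mono) simp
    then have "0 \<le> z - c - sqrt ((z - a) * (z - b))" unfolding w2 using zc d0 by simp
    ultimately show "0 \<le> K * (pi * (c - \<beta> * (\<gamma> - 1)) + pi * (z - c - sqrt ((z - a) * (z - b))))"
      using K0 by (intro mult_nonneg_nonneg add_nonneg_nonneg) auto
  qed
  also have "\<dots> = (z - \<beta> * (\<gamma> - 1) - sqrt ((z - a) * (z - b))) / (2 * \<beta> * z)"
    unfolding K_def using \<beta> z0 by (simp add: field_simps)
  finally show ?thesis unfolding a_def b_def .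
qed


section \<open>The importance sampling measure\<close>

lemma laguerre_density_eq:
  "laguerre_density n p \<beta> l = laguerre_const n p \<beta> * laguerre_kernel \<beta> 0 (\<beta> * (p - real n + 1) / 2) n l"
proof (cases "\<forall>i\<in>{1..n}. 0 < l i")
  case True
  define \<kappa> where "\<kappa> = \<beta> * (p - real n + 1) / 2"
  have w: "(\<Prod>i=1..n. laguerre_weight \<kappa> (l i)) = (\<Prod>i=1..n. l i powr (\<kappa> - 1)) * exp (- (1 / 2) * (\<Sum>i=1..n. l i))"
  proof -
    have "(\<Prod>i=1..n. laguerre_weight \<kappa> (l i)) = (\<Prod>i=1..n. l i powr (\<kappa> - 1) * exp (- (1 / 2) * l i))"
      using True by (intro prod.cong) (auto simp: laguerre_weight_def)
    then show ?thesis by (simp only: prod.distrib exp_sum[symmetric, OF finite_atLeastAtMost] sum_distrib_left)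
  qed
  have "laguerre_density n p \<beta> l = laguerre_const n p \<beta> * pair_product \<beta> 0 n l * (\<Prod>i=1..n. l i powr (\<kappa> - 1)) * exp (- (1 / 2) * (\<Sum>i=1..n. l i))"
    unfolding laguerre_density_def \<kappa>_def pair_product_def add_0_right sq_powr_half if_P[OF True] by (simp only: mult_ac)
  then show ?thesis unfolding laguerre_kernel_def w[symmetric] \<kappa>_def[symmetric] by (simp only: w mult.assoc)
next
  case False
  then obtain i where i: "i \<in> {1..n}" "l i \<le> 0" by force
  have "laguerre_density n p \<beta> l = 0" unfolding laguerre_density_def if_not_P[OF False] ..
  then show ?thesis using laguerre_kernel_eq_0[of i n l, OF i] by (simp only: mult_zero_right)
qed

lemma ordered_laguerre_density_eq:
  "ordered_laguerre_density n p \<beta> l = (if decreasing n l then fact n * laguerre_density n p \<beta> l else 0)"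
  by (simp add: ordered_laguerre_density_def decreasing_def)

lemma laguerre_kernel_cong: "(\<And>i. i \<in> {1..n} \<Longrightarrow> l i = l' i) \<Longrightarrow> laguerre_kernel \<beta> e \<kappa> n l = laguerre_kernel \<beta> e \<kappa> n l'"
  unfolding laguerre_kernel_def by (intro arg_cong2[where f = "(*)"] pair_product_cong prod.cong) auto

lemma decreasing_cong: "(\<And>i. i \<in> {1..n} \<Longrightarrow> l i = l' i) \<Longrightarrow> decreasing n l \<longleftrightarrow> decreasing n l'"
  by (simp add: decreasing_def)

lemma prod_first: "(\<Prod>i=1..Suc n. g i) = (g 1 :: real) * (\<Prod>i=1..n. g (Suc i))"
  using prod.atLeast_Suc_atMost[of 1 "Suc n" g] prod.shift_bounds_cl_Suc_ivl[of g 1 n] by simp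

text \<open>Splits off the first index, which carries the largest eigenvalue of an ordered
  configuration, where \<open>pair_product_Suc\<close> splits off the last.\<close>

lemma pair_product_first:
  "pair_product \<beta> e (Suc n) l = (\<Prod>i=1..n. ((l 1 - l (Suc i))\<^sup>2 + e) powr (\<beta> / 2)) * pair_product \<beta> e n (\<lambda>i. l (Suc i))"
proof (induction n)
  case 0
  then show ?case by (simp add: pair_product_def)
next
  case (Suc n)
  let ?h = "\<lambda>i j. ((l i - l j)\<^sup>2 + e) powr (\<beta> / 2)"
  have "pair_product \<beta> e (Suc (Suc n)) l = pair_product \<beta> e (Suc n) l * (?h 1 (Suc (Suc n)) * (\<Prod>i=1..n. ?h (Suc i) (Suc (Suc n))))"
    unfolding pair_product_Suc[of \<beta> e "Suc n"] prod_first ..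
  also have "\<dots> = ((\<Prod>i=1..n. ?h 1 (Suc i)) * ?h 1 (Suc (Suc n))) * (pair_product \<beta> e n (\<lambda>i. l (Suc i)) * (\<Prod>i=1..n. ?h (Suc i) (Suc (Suc n))))"
    unfolding Suc.IH by (simp only: mult_ac)
  also have "(\<Prod>i=1..n. ?h 1 (Suc i)) * ?h 1 (Suc (Suc n)) = (\<Prod>i=1..Suc n. ?h 1 (Suc i))"
    by (simp only: prod.atLeastLessThan_Suc prod.cl_ivl_Suc) simp
  finally show ?case unfolding pair_product_Suc[of \<beta> e n "\<lambda>i. l (Suc i)"] .
qed

lemma laguerre_kernel_first:
  "laguerre_kernel \<beta> 0 \<kappa> (Suc n) l = laguerre_kernel \<beta> 0 \<kappa> n (\<lambda>i. l (Suc i)) *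
     (laguerre_weight \<kappa> (l 1) * (\<Prod>i=1..n. \<bar>l 1 - l (Suc i)\<bar> powr \<beta>))"
  unfolding laguerre_kernel_def pair_product_first prod_first add_0_right sq_powr_half by (simp only: mult_ac)

lemma decreasing_first:
  assumes "n \<ge> 1"
  shows "decreasing (Suc n) l \<longleftrightarrow> decreasing n (\<lambda>i. l (Suc i)) \<and> l 2 < l 1"
proof
  assume l: "decreasing (Suc n) l"
  then show "decreasing n (\<lambda>i. l (Suc i)) \<and> l 2 < l 1"
    unfolding decreasing_def using assms by auto
next
  assume l: "decreasing n (\<lambda>i. l (Suc i)) \<and> l 2 < l 1"
  show "decreasing (Suc n) l"
    unfolding decreasing_def
  proof (intro ballI impI)
    fix i j assume ij: "i \<in> {1..Suc n}" "j \<in> {1..Suc n}" "i < j"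
    then obtain j' where j': "j = Suc j'" "j' \<in> {1..n}" by (cases j) auto
    have dec: "l (Suc b) < l (Suc a)" if "a \<in> {1..n}" "b \<in> {1..n}" "a < b" for a b
      using l that unfolding decreasing_def by blast
    show "l j < l i"
    proof (cases "i = 1")
      case True
      have "l j \<le> l 2" using dec[of 1 j'] j' assms by (cases "j' = 1") (auto simp: numeral_2_eq_2)
      then show ?thesis using l True by simp
    next
      case False
      then obtain i' where "i = Suc i'" "i' \<in> {1..n}" using ij by (cases i) auto
      then show ?thesis using dec[of i' j'] j' ij by simp
    qed
  qed
qed

lemma Max_decreasing:
  assumes "decreasing n l" "n \<ge> 1"
  shows "Max (l ` {1..n}) = l 1"
proof (rule Max_eqI)
  fix y assume "y \<in> l ` {1..n}"
  then obtain i where i: "i \<in> {1..n}" "y = l i" by auto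
  have "i = 1 \<or> l i < l 1" using decreasing_less_iff[OF assms(1) i(1), of 1] i(1) by (cases "i = 1") auto
  then show "y \<le> l 1" using i by auto
qed (use assms in auto)

lemma measurable_shifted_exponential_density:
  "(\<lambda>t. ennreal (J * exp (- J * (t - a)) * indicator {a<..} t)) \<in> borel_measurable lborel" for J a :: real
  by measurable

lemma nn_integral_shifted_exponential:
  assumes "J > 0" and [measurable]: "f \<in> borel_measurable borel"
  shows "(\<integral>\<^sup>+t. f t \<partial>shifted_exponential J a) = (\<integral>\<^sup>+t. ennreal (J * exp (- J * (t - a)) * indicator {a<..} t) * f t \<partial>lborel)"
  unfolding shifted_exponential_def by (rule nn_integral_density) auto

lemma prob_space_shifted_exponential:
  assumes J: "J > 0"
  shows "prob_space (shifted_exponential J a)"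
proof
  have sp: "space (shifted_exponential J a) = UNIV" by (simp add: shifted_exponential_def)
  have "emeasure (shifted_exponential J a) UNIV = (\<integral>\<^sup>+t. ennreal (J * exp (- J * (t - a)) * indicator {a<..} t) \<partial>lborel)"
    unfolding shifted_exponential_def by (subst emeasure_density) auto
  also have "\<dots> = ennreal \<bar>1\<bar> * (\<integral>\<^sup>+t. ennreal (J * exp (- J * (a + 1 * t - a)) * indicator {a<..} (a + 1 * t)) \<partial>lborel)"
    by (rule nn_integral_real_affine) auto
  also have "\<dots> = (\<integral>\<^sup>+t. ennreal J * ennreal (indicator {0<..} t * (t powr (1 - 1) * exp (- J * t))) \<partial>lborel)"
    using J by (simp, intro nn_integral_cong) (auto simp: indicator_def ennreal_mult)
  also have "\<dots> = ennreal J * ennreal (Gamma 1 / J powr 1)"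
    unfolding nn_integral_powr_exp[OF zero_less_one J, symmetric] by (rule nn_integral_cmult) measurable
  also have "\<dots> = 1" using J by (simp add: ennreal_mult'[symmetric])
  finally show "emeasure (shifted_exponential J a) (space (shifted_exponential J a)) = 1" unfolding sp .
qed

lemma measurable_shifted_exponential:
  assumes J: "J > 0" and [measurable]: "a \<in> borel_measurable M"
  shows "(\<lambda>l. shifted_exponential J (a l)) \<in> measurable M (subprob_algebra lborel)"
proof (rule measurable_subprob_algebra)
  fix A :: "real set" assume [measurable]: "A \<in> sets lborel"
  have "emeasure (shifted_exponential J (a l)) A = (\<integral>\<^sup>+t. ennreal (J * exp (- J * (t - a l)) * (if a l < t then 1 else 0)) * indicator A t \<partial>lborel)" for l
    unfolding shifted_exponential_def using \<open>A \<in> sets lborel\<close> by (subst emeasure_density) (auto intro!: nn_integral_cong simp: indicator_def)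
  then show "(\<lambda>l. emeasure (shifted_exponential J (a l)) A) \<in> borel_measurable M" by simp
next
  fix l
  show "subprob_space (shifted_exponential J (a l))"
    by (rule prob_space_imp_subprob_space[OF prob_space_shifted_exponential[OF J]])
qed (simp add: shifted_exponential_def)

lemma insert_first: "{1..Suc n} = insert 1 {2..Suc n}" by auto

lemma measurable_importance_kernel:
  assumes J: "J > 0" and n: "n \<ge> 1"
  shows "(\<lambda>l. distr (shifted_exponential J (max y (l 2))) (\<Pi>\<^sub>M i\<in>{1..Suc n}. lborel) (\<lambda>t. l(1 := t)))
    \<in> measurable (lebesgue_on_indices {2..Suc n}) (subprob_algebra (lebesgue_on_indices {1..Suc n}))"
proof (rule measurable_distr2)
  show "(\<lambda>(l, t). l(1 := t)) \<in> measurable (lebesgue_on_indices {2..Suc n} \<Otimes>\<^sub>M lborel) (lebesgue_on_indices {1..Suc n})"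
    unfolding insert_first by (rule measurable_add_dim)
  have [measurable]: "(\<lambda>l. l 2) \<in> borel_measurable (lebesgue_on_indices {2..Suc n})"
    using n by (intro measurable_coordinate) simp
  show "(\<lambda>l. shifted_exponential J (max y (l 2))) \<in> measurable (lebesgue_on_indices {2..Suc n}) (subprob_algebra lborel)"
    by (rule measurable_shifted_exponential[OF J]) measurable
qed

lemma measurable_shift_coordinates:
  "(\<lambda>l. \<lambda>i\<in>{1..n}. l (Suc i)) \<in> measurable (lebesgue_on_indices {2..Suc n}) (lebesgue_on_indices {1..n})"
  "(\<lambda>l. \<lambda>i\<in>{1..n}. l (Suc i)) \<in> measurable (lebesgue_on_indices {1..Suc n}) (lebesgue_on_indices {1..n})"
  by (rule measurable_restrict, rule measurable_component_singleton, auto)+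

lemma nn_integral_shift_coordinates:
  assumes "g \<in> borel_measurable (lebesgue_on_indices {1..n})"
  shows "(\<integral>\<^sup>+l. g (\<lambda>i\<in>{1..n}. l (Suc i)) \<partial>lebesgue_on_indices {2..Suc n}) = (\<integral>\<^sup>+l. g l \<partial>lebesgue_on_indices {1..n})"
proof (rule nn_integral_lebesgue_reindex[OF _ _ assms])
  show "bij_betw Suc {1..n} {2..Suc n}"
    by (rule bij_betwI[where g = "\<lambda>i. i - 1"]) auto
qed simp

text \<open>Here \<open>n\<close> counts the lower eigenvalues, so the ensemble under study has size
  \<open>Suc n\<close>. The parameter pairs \<open>(Suc n, p)\<close> and \<open>(n, p - 1)\<close>
  lead to the same shape \<kappa>, and the equilibrium is that of the lower eigenvalues.\<close>

locale laguerre_sampling = laguerre_equilibrium +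
  fixes p x J :: real
  assumes n: "n \<ge> 1" and J: "J > 0" and x: "x > 0" and p_ge: "real (Suc n) \<le> p" and \<kappa>_eq: "\<kappa> = \<beta> * (p - real n) / 2"
begin

definition const_ratio :: real where
  "const_ratio = laguerre_const (Suc n) p \<beta> / laguerre_const n (p - 1) \<beta>"

definition lower_density :: "(nat \<Rightarrow> real) \<Rightarrow> real" where
  "lower_density m = (if decreasing n m then fact n * (laguerre_kernel \<beta> 0 \<kappa> n m / laguerre_integral \<beta> \<kappa> n) else 0)"

definition normalized_moment :: "real \<Rightarrow> real \<Rightarrow> real" where
  "normalized_moment t s = char_moment t s / laguerre_integral \<beta> \<kappa> n"

lemma const_eq:
  "laguerre_const (Suc n) p \<beta> = 1 / laguerre_integral \<beta> \<kappa> (Suc n)"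
  "laguerre_const n (p - 1) \<beta> = 1 / laguerre_integral \<beta> \<kappa> n"
proof -
  have k: "\<beta> * (p - real (Suc n) + 1) / 2 = \<kappa>" "\<beta> * (p - 1 - real n + 1) / 2 = \<kappa>"
    unfolding \<kappa>_eq by simp_all
  have p: "p \<ge> real (Suc n)" "p - 1 \<ge> real n" using p_ge by simp_all
  have Z: "laguerre_integral \<beta> \<kappa> n \<noteq> 0" "laguerre_integral \<beta> \<kappa> (Suc n) \<noteq> 0"
    using laguerre_integral_pos[OF \<beta> \<kappa>] by (metis less_irrefl)+
  show "laguerre_const (Suc n) p \<beta> = 1 / laguerre_integral \<beta> \<kappa> (Suc n)"
    using laguerre_const_eq[OF \<beta> p(1)] unfolding k by (simp only: nonzero_eq_divide_eq[OF Z(2)])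
  show "laguerre_const n (p - 1) \<beta> = 1 / laguerre_integral \<beta> \<kappa> n"
    using laguerre_const_eq[OF \<beta> p(2)] unfolding k by (simp only: nonzero_eq_divide_eq[OF Z(1)])
qed

lemma const_ratio_eq: "const_ratio = laguerre_integral \<beta> \<kappa> n / laguerre_integral \<beta> \<kappa> (Suc n)"
  unfolding const_ratio_def const_eq by simp

lemma const_ratio_pos: "const_ratio > 0"
  unfolding const_ratio_eq using laguerre_integral_pos[OF \<beta> \<kappa>] by simp

lemma lower_density_nonneg: "lower_density m \<ge> 0"
  using laguerre_integral_pos[OF \<beta> \<kappa>, of n] by (simp add: lower_density_def)

lemma measurable_lower_density [measurable]: "lower_density \<in> borel_measurable (lebesgue_on_indices {1..n})"
  unfolding lower_density_def[abs_def] by measurable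

lemma laguerre_density_Suc: "laguerre_density (Suc n) p \<beta> l = laguerre_kernel \<beta> 0 \<kappa> (Suc n) l / laguerre_integral \<beta> \<kappa> (Suc n)"
proof -
  have "\<beta> * (p - real (Suc n) + 1) / 2 = \<kappa>" unfolding \<kappa>_eq by simp
  then show ?thesis unfolding laguerre_density_eq const_eq by simp
qed

lemma ordered_lower_density:
  "ordered_laguerre_density n (p - 1) \<beta> (\<lambda>i. l (i + 1)) = lower_density (\<lambda>i\<in>{1..n}. l (Suc i))"
proof -
  have "\<beta> * (p - 1 - real n + 1) / 2 = \<kappa>" unfolding \<kappa>_eq by simp
  moreover have "laguerre_kernel \<beta> 0 \<kappa> n (\<lambda>i. l (i + 1)) = laguerre_kernel \<beta> 0 \<kappa> n (\<lambda>i\<in>{1..n}. l (Suc i))"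
    by (rule laguerre_kernel_cong) simp
  moreover have "decreasing n (\<lambda>i. l (i + 1)) = decreasing n (\<lambda>i\<in>{1..n}. l (Suc i))"
    by (rule decreasing_cong) simp
  ultimately show ?thesis
    unfolding ordered_laguerre_density_eq lower_density_def laguerre_density_eq const_eq by simp
qed

abbreviation lower_part :: "(nat \<Rightarrow> real) \<Rightarrow> nat \<Rightarrow> real" where
  "lower_part l \<equiv> (\<lambda>i\<in>{1..n}. l (Suc i))"

abbreviation sampling_density :: "(nat \<Rightarrow> real) \<Rightarrow> real \<Rightarrow> real" where
  "sampling_density l t \<equiv> J * exp (- J * (t - max (p * x) (l 2))) * indicator {max (p * x) (l 2)<..} t"

lemma lower_part_upd: "lower_part (l(1 := t)) = lower_part l" by (auto simp: fun_eq_iff)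

lemma measurable_lower_density_lower_part [measurable]:
  "(\<lambda>l. lower_density (lower_part l)) \<in> borel_measurable (lebesgue_on_indices {2..Suc n})"
  "(\<lambda>l. lower_density (lower_part l)) \<in> borel_measurable (lebesgue_on_indices {1..Suc n})"
  by (rule measurable_compose[OF measurable_shift_coordinates(1) measurable_lower_density],
      rule measurable_compose[OF measurable_shift_coordinates(2) measurable_lower_density])

lemma lower_eigenvalues_eq:
  "lower_eigenvalues (Suc n) p \<beta> = density (lebesgue_on_indices {2..Suc n}) (\<lambda>l. ennreal (lower_density (lower_part l)))"
  unfolding lower_eigenvalues_def diff_Suc_1 ordered_lower_density ..

lemma importance_kernel:
  "(\<lambda>l. distr (shifted_exponential J (max (p * x) (l 2))) (lebesgue_on_indices {1..Suc n}) (\<lambda>t. l(1 := t)))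
    \<in> measurable (lower_eigenvalues (Suc n) p \<beta>) (subprob_algebra (lebesgue_on_indices {1..Suc n}))"
proof -
  have "sets (lower_eigenvalues (Suc n) p \<beta>) = sets (lebesgue_on_indices {2..Suc n})"
    unfolding lower_eigenvalues_eq by (rule sets_density)
  from measurable_cong_sets[OF this refl] measurable_importance_kernel[OF J n, of "p * x"]
  show ?thesis by blast
qed

lemma space_lower_eigenvalues: "space (lower_eigenvalues (Suc n) p \<beta>) \<noteq> {}"
proof -
  have "space (lower_eigenvalues (Suc n) p \<beta>) = (\<Pi>\<^sub>E i\<in>{2..Suc n}. UNIV)"
    unfolding lower_eigenvalues_eq space_density space_PiM by simp
  then show ?thesis by (simp add: PiE_eq_empty_iff)
qed

lemma sets_importance_measure [measurable_cong]: "sets (importance_measure (Suc n) p \<beta> x J) = sets (lebesgue_on_indices {1..Suc n})"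
  unfolding importance_measure_def by (rule sets_bind_measurable[OF importance_kernel space_lower_eigenvalues])

lemma nn_integral_importance_iterated:
  assumes [measurable]: "f \<in> borel_measurable (lebesgue_on_indices {1..Suc n})"
  shows "(\<integral>\<^sup>+l. f l \<partial>importance_measure (Suc n) p \<beta> x J) =
    (\<integral>\<^sup>+l. ennreal (lower_density (lower_part l)) * (\<integral>\<^sup>+t. ennreal (sampling_density l t) * f (l(1 := t)) \<partial>lborel) \<partial>lebesgue_on_indices {2..Suc n})"
proof -
  let ?D = "\<lambda>l. distr (shifted_exponential J (max (p * x) (l 2))) (lebesgue_on_indices {1..Suc n}) (\<lambda>t. l(1 := t))"
  let ?I = "\<lambda>l. \<integral>\<^sup>+t. ennreal (sampling_density l t) * f (l(1 := t)) \<partial>lborel"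
  have [measurable]: "(\<lambda>l. l 2) \<in> borel_measurable (lebesgue_on_indices {2..Suc n})"
    using n by (intro measurable_coordinate) simp
  have upd [measurable]: "(\<lambda>(l, t). f (l(1 := t))) \<in> borel_measurable (lebesgue_on_indices {2..Suc n} \<Otimes>\<^sub>M lborel)"
    using measurable_compose[OF measurable_add_dim assms[unfolded insert_first]] by (simp add: case_prod_beta')
  have inner: "(\<integral>\<^sup>+y. f y \<partial>?D l) = ?I l" if l: "l \<in> space (lebesgue_on_indices {2..Suc n})" for l
  proof -
    have u [measurable]: "(\<lambda>t. l(1 := t)) \<in> measurable borel (lebesgue_on_indices {1..Suc n})"
      unfolding insert_first using measurable_component_update[OF l, of 1] by simp
    have "(\<integral>\<^sup>+y. f y \<partial>?D l) = (\<integral>\<^sup>+t. f (l(1 := t)) \<partial>shifted_exponential J (max (p * x) (l 2)))"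
    proof (rule nn_integral_distr)
      show "f \<in> borel_measurable (distr (shifted_exponential J (max (p * x) (l 2))) (lebesgue_on_indices {1..Suc n}) (\<lambda>t. l(1 := t)))"
        unfolding measurable_distr_eq1 by (rule assms)
    qed (use u in \<open>simp add: shifted_exponential_def\<close>)
    also have "\<dots> = ?I l" by (rule nn_integral_shifted_exponential[OF J]) measurable
    finally show ?thesis .
  qed
  have "(\<integral>\<^sup>+l. f l \<partial>importance_measure (Suc n) p \<beta> x J) = (\<integral>\<^sup>+l. \<integral>\<^sup>+y. f y \<partial>?D l \<partial>lower_eigenvalues (Suc n) p \<beta>)"
    unfolding importance_measure_def by (rule nn_integral_bind[OF assms importance_kernel])
  also have "\<dots> = (\<integral>\<^sup>+l. ?I l \<partial>lower_eigenvalues (Suc n) p \<beta>)"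
    by (rule nn_integral_cong, rule inner) (simp add: lower_eigenvalues_eq)
  also have "\<dots> = (\<integral>\<^sup>+l. ennreal (lower_density (lower_part l)) * ?I l \<partial>lebesgue_on_indices {2..Suc n})"
    unfolding lower_eigenvalues_eq
  proof (rule nn_integral_density)
    have "?I l = (\<integral>\<^sup>+t. ennreal (J * exp (- J * (t - max (p * x) (l 2))) * (if max (p * x) (l 2) < t then 1 else 0)) * f (l(1 := t)) \<partial>lborel)" for l
      by (intro nn_integral_cong) (simp add: indicator_def)
    moreover have "(\<lambda>l. \<integral>\<^sup>+t. ennreal (J * exp (- J * (t - max (p * x) (l 2))) * (if max (p * x) (l 2) < t then 1 else 0)) * f (l(1 := t)) \<partial>lborel)
      \<in> borel_measurable (lebesgue_on_indices {2..Suc n})"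
      by measurable
    ultimately show "?I \<in> borel_measurable (lebesgue_on_indices {2..Suc n})" by simp
  qed measurable
  finally show ?thesis .
qed

lemma nn_integral_importance:
  assumes [measurable]: "f \<in> borel_measurable (lebesgue_on_indices {1..Suc n})"
  shows "(\<integral>\<^sup>+l. f l \<partial>importance_measure (Suc n) p \<beta> x J) =
    (\<integral>\<^sup>+l. ennreal (lower_density (lower_part l) * sampling_density l (l 1)) * f l \<partial>lebesgue_on_indices {1..Suc n})"
proof -
  let ?F = "\<lambda>l. ennreal (lower_density (lower_part l) * sampling_density l (l 1)) * f l"
  have [measurable]: "(\<lambda>l. l 2) \<in> borel_measurable (lebesgue_on_indices {1..Suc n})"
    "(\<lambda>l. l 1) \<in> borel_measurable (lebesgue_on_indices {1..Suc n})"
    using n by (intro measurable_coordinate; simp)+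
  have "(\<lambda>l. ennreal (lower_density (lower_part l) * (J * exp (- J * (l 1 - max (p * x) (l 2))) * (if max (p * x) (l 2) < l 1 then 1 else 0))) * f l)
     \<in> borel_measurable (lebesgue_on_indices {1..Suc n})"
    by measurable
  then have m: "?F \<in> borel_measurable (lebesgue_on_indices {1..Suc n})"
    by (simp add: indicator_def of_bool_def)
  have upd [measurable]: "(\<lambda>t. f (l(1 := t))) \<in> borel_measurable borel" if "l \<in> space (lebesgue_on_indices {2..Suc n})" for l
    using measurable_compose[OF measurable_component_update[OF that, of 1] assms[unfolded insert_first]] by simp
  have "(\<integral>\<^sup>+l. ?F l \<partial>lebesgue_on_indices {1..Suc n}) = (\<integral>\<^sup>+l. \<integral>\<^sup>+t. ?F (l(1 := t)) \<partial>lborel \<partial>lebesgue_on_indices {2..Suc n})"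
    unfolding insert_first by (rule lborel_product.product_nn_integral_insert[OF _ _ m[unfolded insert_first]]) auto
  also have "\<dots> = (\<integral>\<^sup>+l. ennreal (lower_density (lower_part l)) * (\<integral>\<^sup>+t. ennreal (sampling_density l t) * f (l(1 := t)) \<partial>lborel) \<partial>lebesgue_on_indices {2..Suc n})"
  proof (rule nn_integral_cong)
    fix l assume l: "l \<in> space (lebesgue_on_indices {2..Suc n})"
    have "?F (l(1 := t)) = ennreal (lower_density (lower_part l)) * (ennreal (sampling_density l t) * f (l(1 := t)))" for t
      unfolding lower_part_upd using lower_density_nonneg[of "lower_part l"] by (simp add: ennreal_mult' mult.assoc)
    moreover have "(\<lambda>t. ennreal (sampling_density l t)) \<in> borel_measurable lborel" by (rule measurable_shifted_exponential_density)
    then have "(\<lambda>t. ennreal (sampling_density l t) * f (l(1 := t))) \<in> borel_measurable lborel"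
      by (rule borel_measurable_times_ennreal) (use upd[OF l] in simp)
    ultimately show "(\<integral>\<^sup>+t. ?F (l(1 := t)) \<partial>lborel) = ennreal (lower_density (lower_part l)) * (\<integral>\<^sup>+t. ennreal (sampling_density l t) * f (l(1 := t)) \<partial>lborel)"
      by (simp only: nn_integral_cmult)
  qed
  finally show ?thesis unfolding nn_integral_importance_iterated[OF assms] ..
qed

lemma prod_lower_part: "(\<Prod>i=2..Suc n. g (l i)) = (\<Prod>i=1..n. g (lower_part l i) :: real)"
proof -
  have "(\<Prod>i=2..Suc n. g (l i)) = (\<Prod>i=1..n. g (l (Suc i)))"
    using prod.shift_bounds_cl_Suc_ivl[of "\<lambda>i. g (l i)" 1 n] by (simp add: numeral_2_eq_2)
  also have "\<dots> = (\<Prod>i=1..n. g (lower_part l i))" by (rule prod.cong) simp_all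
  finally show ?thesis .
qed

lemma lower_part_le:
  assumes "decreasing n (lower_part l)" "i \<in> {1..n}"
  shows "lower_part l i \<le> l 2"
proof -
  have one: "1 \<in> {1..n}" using n by simp
  have "lower_part l i \<le> lower_part l 1"
  proof (cases "i = 1")
    case False
    then have "1 < i" using assms(2) by simp
    then show ?thesis using decreasing_less_iff[OF assms(1) assms(2) one] by (simp only: less_imp_le)
  qed simp
  also have "lower_part l 1 = l 2" using one by (simp add: numeral_2_eq_2)
  finally show ?thesis .
qed

lemma importance_estimator_eq:
  assumes l: "decreasing n (lower_part l)" "max (p * x) (l 2) < l 1"
  shows "importance_estimator (Suc n) p \<beta> x J l = real (Suc n) * const_ratio * (laguerre_weight \<kappa> (l 1) * (\<Prod>i=1..n. \<bar>l 1 - lower_part l i\<bar> powr \<beta>))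
     / (J * exp (- J * (l 1 - max (p * x) (l 2))))"
proof -
  have px: "p * x > 0" using p_ge x by simp
  have k: "\<beta> * (p - real (Suc n) + 1) / 2 = \<kappa>" unfolding \<kappa>_eq by simp
  have "(\<Prod>i=2..Suc n. (l 1 - l i) powr \<beta>) = (\<Prod>i=1..n. (l 1 - lower_part l i) powr \<beta>)"
    by (rule prod_lower_part[of "\<lambda>y. (l 1 - y) powr \<beta>"])
  also have "\<dots> = (\<Prod>i=1..n. \<bar>l 1 - lower_part l i\<bar> powr \<beta>)"
  proof (rule prod.cong)
    fix i assume "i \<in> {1..n}"
    from lower_part_le[OF l(1) this] l(2) show "(l 1 - lower_part l i) powr \<beta> = \<bar>l 1 - lower_part l i\<bar> powr \<beta>" by simp
  qed simp
  finally have pr: "(\<Prod>i=2..Suc n. (l 1 - l i) powr \<beta>) = (\<Prod>i=1..n. \<bar>l 1 - lower_part l i\<bar> powr \<beta>)" .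
  have w: "l 1 powr (\<kappa> - 1) * exp (- (1 / 2) * l 1) = laguerre_weight \<kappa> (l 1)"
    using px l(2) by (simp add: laguerre_weight_def)
  show ?thesis
    unfolding importance_estimator_def k pr diff_Suc_1 const_ratio_def[symmetric] w[symmetric] by (simp only: mult_ac)
qed

lemma measurable_importance_estimator: "importance_estimator (Suc n) p \<beta> x J \<in> borel_measurable (lebesgue_on_indices {1..Suc n})"
proof -
  have [measurable]: "(\<lambda>l. l 2) \<in> borel_measurable (lebesgue_on_indices {1..Suc n})"
    "(\<lambda>l. l 1) \<in> borel_measurable (lebesgue_on_indices {1..Suc n})"
    using n by (intro measurable_coordinate; simp)+
  have "(\<lambda>l. (l 1 - l i) powr \<beta>) \<in> borel_measurable (lebesgue_on_indices {1..Suc n})" if "i \<in> {2..Suc n}" for i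
  proof -
    have [measurable]: "(\<lambda>l. l i) \<in> borel_measurable (lebesgue_on_indices {1..Suc n})"
      using that by (intro measurable_coordinate) simp
    show ?thesis by measurable
  qed
  then have [measurable]: "(\<lambda>l. \<Prod>i=2..Suc n. (l 1 - l i) powr \<beta>) \<in> borel_measurable (lebesgue_on_indices {1..Suc n})"
    by (rule borel_measurable_prod)
  show ?thesis unfolding importance_estimator_def[abs_def] by measurable
qed

lemma importance_estimator_nonneg: "importance_estimator (Suc n) p \<beta> x J l \<ge> 0"
proof -
  have "0 \<le> const_ratio" using const_ratio_pos by simp
  then show ?thesis unfolding importance_estimator_def diff_Suc_1 const_ratio_def[symmetric]
    using J by (intro divide_nonneg_nonneg mult_nonneg_nonneg prod_nonneg) auto
qed

definition tail :: "real \<Rightarrow> real" where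
  "tail y = largest_eigenvalue_tail (Suc n) p \<beta> y"

lemma emeasure_tail:
  "ennreal (tail y) = (\<integral>\<^sup>+l. ennreal (laguerre_kernel \<beta> 0 \<kappa> (Suc n) l / laguerre_integral \<beta> \<kappa> (Suc n)) * indicator {l. \<exists>i\<in>{1..Suc n}. y < l i} l \<partial>lebesgue_on_indices {1..Suc n})"
  (is "_ = ?R")
  and tail_le_1: "tail y \<le> 1"
proof -
  let ?E = "laguerre_ensemble (Suc n) p \<beta>" and ?Z = "laguerre_integral \<beta> \<kappa> (Suc n)"
  let ?f = "\<lambda>l. ennreal (laguerre_kernel \<beta> 0 \<kappa> (Suc n) l / ?Z)"
  have Z: "?Z > 0" by (rule laguerre_integral_pos[OF \<beta> \<kappa>])
  have E: "?E = density (lebesgue_on_indices {1..Suc n}) ?f"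
    unfolding laguerre_ensemble_def laguerre_density_Suc ..
  have fm [measurable]: "?f \<in> borel_measurable (lebesgue_on_indices {1..Suc n})" by measurable
  have coord: "(\<lambda>l. l i) \<in> borel_measurable (lebesgue_on_indices {1..Suc n})" if "i \<in> {1..Suc n}" for i
    using that by (rule measurable_coordinate)
  have set: "{l \<in> space ?E. Max (l ` {1..Suc n}) > y} = {l \<in> space (lebesgue_on_indices {1..Suc n}). \<exists>i\<in>{1..Suc n}. y < l i}"
    unfolding E space_density by (subst Max_gr_iff) auto
  have sm: "{l \<in> space (lebesgue_on_indices {1..Suc n}). \<exists>i\<in>{1..Suc n}. y < l i} \<in> sets (lebesgue_on_indices {1..Suc n})"
    using coord by (intro sets.sets_Collect_finite_Ex borel_measurable_less) auto
  have em: "emeasure ?E {l \<in> space ?E. Max (l ` {1..Suc n}) > y} = ?R"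
    unfolding set unfolding E emeasure_density[OF fm sm]
    by (rule nn_integral_cong) (simp add: indicator_def)
  have "?R \<le> (\<integral>\<^sup>+l. ?f l \<partial>lebesgue_on_indices {1..Suc n})"
    by (rule nn_integral_mono) (simp add: indicator_def)
  also have "\<dots> = (\<integral>\<^sup>+l. ennreal (1 / ?Z) * ennreal (laguerre_kernel \<beta> 0 \<kappa> (Suc n) l) \<partial>lebesgue_on_indices {1..Suc n})"
    using Z by (intro nn_integral_cong) (simp add: ennreal_mult'[symmetric])
  also have "\<dots> = ennreal (1 / ?Z) * ennreal ?Z"
    by (subst nn_integral_cmult, measurable) (subst nn_integral_eq_integral[OF integrable_kernel[OF \<beta> \<kappa>]], auto simp: laguerre_integral_def)
  also have "\<dots> = 1" using Z by (simp add: ennreal_mult'[symmetric])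
  finally have R1: "?R \<le> 1" .
  have t: "tail y = enn2real ?R"
    unfolding tail_def largest_eigenvalue_tail_def measure_def em ..
  show "ennreal (tail y) = ?R"
    unfolding t using R1 by (intro ennreal_enn2real) (auto simp: top_unique order_le_less_trans)
  show "tail y \<le> 1" unfolding t using enn2real_mono[OF R1] by simp
qed

lemma tail_nonneg: "tail y \<ge> 0"
  unfolding tail_def largest_eigenvalue_tail_def by simp

text \<open>On ordered configurations the largest eigenvalue is \<open>l 1\<close>. Of the factor
  \<open>fact (Suc n)\<close> from the ordering, \<open>fact n\<close> normalises the lower
  eigenvalues and \<open>Suc n\<close> stays in front, as in the estimator.\<close>

lemma nn_integral_tail_decreasing:
  "ennreal (tail y) = (\<integral>\<^sup>+l. ennreal (lower_density (lower_part l) * indicator {max y (l 2)<..} (l 1) *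
     (real (Suc n) * const_ratio * (laguerre_weight \<kappa> (l 1) * (\<Prod>i=1..n. \<bar>l 1 - lower_part l i\<bar> powr \<beta>)))) \<partial>lebesgue_on_indices {1..Suc n})"
proof -
  let ?Z = "laguerre_integral \<beta> \<kappa> (Suc n)" and ?Zn = "laguerre_integral \<beta> \<kappa> n"
  let ?f = "\<lambda>l. ennreal (laguerre_kernel \<beta> 0 \<kappa> (Suc n) l / ?Z) * indicator {l. \<exists>i\<in>{1..Suc n}. y < l i} l"
  have Z: "?Z > 0" "?Zn > 0" by (rule laguerre_integral_pos[OF \<beta> \<kappa>])+
  have coord: "(\<lambda>l. l i) \<in> borel_measurable (lebesgue_on_indices {1..Suc n})" if "i \<in> {1..Suc n}" for i
    using that by (rule measurable_coordinate)
  have sm: "{l \<in> space (lebesgue_on_indices {1..Suc n}). \<exists>i\<in>{1..Suc n}. y < l i} \<in> sets (lebesgue_on_indices {1..Suc n})"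
    using coord by (intro sets.sets_Collect_finite_Ex borel_measurable_less) auto
  have "(\<lambda>l. ennreal (laguerre_kernel \<beta> 0 \<kappa> (Suc n) l / ?Z) * indicator {l \<in> space (lebesgue_on_indices {1..Suc n}). \<exists>i\<in>{1..Suc n}. y < l i} l) \<in> borel_measurable (lebesgue_on_indices {1..Suc n})"
    using sm by (intro borel_measurable_times_ennreal borel_measurable_indicator) measurable
  then have fm: "?f \<in> borel_measurable (lebesgue_on_indices {1..Suc n})"
    by (rule measurable_cong[THEN iffD1, rotated]) (simp add: indicator_def)
  have sym: "?f (\<lambda>i. l (s i)) = ?f l" if s: "s permutes {1..Suc n}" for l s
  proof -
    have "(\<exists>i\<in>{1..Suc n}. y < l (s i)) \<longleftrightarrow> (\<exists>i\<in>s ` {1..Suc n}. y < l i)" by blast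
    then have "(\<exists>i\<in>{1..Suc n}. y < l (s i)) \<longleftrightarrow> (\<exists>i\<in>{1..Suc n}. y < l i)" unfolding permutes_image[OF s] .
    then show ?thesis unfolding laguerre_kernel_permute[OF s] by (simp only: indicator_def mem_Collect_eq)
  qed
  have "ennreal (tail y) = fact (Suc n) * (\<integral>\<^sup>+l. ?f l * indicator {l. decreasing (Suc n) l} l \<partial>lebesgue_on_indices {1..Suc n})"
    unfolding emeasure_tail by (rule nn_integral_symmetric[OF fm sym])
  also have "\<dots> = (\<integral>\<^sup>+l. fact (Suc n) * (?f l * indicator {l. decreasing (Suc n) l} l) \<partial>lebesgue_on_indices {1..Suc n})"
  proof (rule nn_integral_cmult[symmetric])
    have "(\<lambda>l. if decreasing (Suc n) l then 1 else 0 :: ennreal) \<in> borel_measurable (lebesgue_on_indices {1..Suc n})" by measurable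
    then have "(\<lambda>l. indicator {l. decreasing (Suc n) l} l :: ennreal) \<in> borel_measurable (lebesgue_on_indices {1..Suc n})"
      by (rule measurable_cong[THEN iffD1, rotated]) (auto simp: indicator_def)
    then show "(\<lambda>l. ?f l * indicator {l. decreasing (Suc n) l} l) \<in> borel_measurable (lebesgue_on_indices {1..Suc n})"
      by (rule borel_measurable_times_ennreal[OF fm])
  qed
  also have "\<dots> = (\<integral>\<^sup>+l. ennreal (lower_density (lower_part l) * indicator {max y (l 2)<..} (l 1) *
     (real (Suc n) * const_ratio * (laguerre_weight \<kappa> (l 1) * (\<Prod>i=1..n. \<bar>l 1 - lower_part l i\<bar> powr \<beta>)))) \<partial>lebesgue_on_indices {1..Suc n})"
  proof (rule nn_integral_cong)
    fix l
    have dl: "decreasing n (\<lambda>i. l (Suc i)) = decreasing n (lower_part l)" by (rule decreasing_cong) simp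
    have kl: "laguerre_kernel \<beta> 0 \<kappa> n (\<lambda>i. l (Suc i)) = laguerre_kernel \<beta> 0 \<kappa> n (lower_part l)" by (rule laguerre_kernel_cong) simp
    have pl: "(\<Prod>i=1..n. \<bar>l 1 - l (Suc i)\<bar> powr \<beta>) = (\<Prod>i=1..n. \<bar>l 1 - lower_part l i\<bar> powr \<beta>)" by (rule prod.cong) simp_all
    show "fact (Suc n) * (?f l * indicator {l. decreasing (Suc n) l} l) = ennreal (lower_density (lower_part l) * indicator {max y (l 2)<..} (l 1) *
     (real (Suc n) * const_ratio * (laguerre_weight \<kappa> (l 1) * (\<Prod>i=1..n. \<bar>l 1 - lower_part l i\<bar> powr \<beta>))))"
    proof (cases "decreasing (Suc n) l \<and> y < l 1")
      case True
      then have d: "decreasing n (lower_part l)" "l 2 < l 1" using decreasing_first[OF n, of l] dl by auto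
      have "fact (Suc n) * (?f l * indicator {l. decreasing (Suc n) l} l) = ennreal (fact (Suc n) * (laguerre_kernel \<beta> 0 \<kappa> (Suc n) l / ?Z))"
        using True unfolding fact_eq_ennreal by (subst ennreal_mult') (auto simp: indicator_def)
      also have "fact (Suc n) * (laguerre_kernel \<beta> 0 \<kappa> (Suc n) l / ?Z) = fact n * (laguerre_kernel \<beta> 0 \<kappa> n (lower_part l) / ?Zn) *
         (real (Suc n) * const_ratio * (laguerre_weight \<kappa> (l 1) * (\<Prod>i=1..n. \<bar>l 1 - lower_part l i\<bar> powr \<beta>)))"
        unfolding laguerre_kernel_first kl pl const_ratio_eq fact_Suc using Z by (simp add: field_simps)
      finally show ?thesis using d True by (simp only: lower_density_def if_True) simp
    next
      case False
      have "fact (Suc n) * (?f l * indicator {l. decreasing (Suc n) l} l) = 0"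
      proof (cases "decreasing (Suc n) l")
        case True
        then have "l i \<le> l 1" if "i \<in> {1..Suc n}" for i
          using Max_decreasing[OF True] that Max_ge[of "l ` {1..Suc n}" "l i"] by auto
        then have "\<not> (\<exists>i\<in>{1..Suc n}. y < l i)" using True False by force
        then show ?thesis by (simp only: indicator_def mem_Collect_eq) simp
      qed (simp add: indicator_def)
      moreover have "lower_density (lower_part l) * indicator {max y (l 2)<..} (l 1) = 0"
        using False dl decreasing_first[OF n, of l] by (auto simp: lower_density_def indicator_def)
      ultimately show ?thesis by (simp only: mult_zero_left ennreal_0)
    qed
  qed
  finally show ?thesis .
qed

text \<open>Where the sampling density is positive it cancels the denominator of the estimator;
  elsewhere both integrands vanish.\<close>

lemma nn_integral_importance_estimator:
  "(\<integral>\<^sup>+l. ennreal (importance_estimator (Suc n) p \<beta> x J l) \<partial>importance_measure (Suc n) p \<beta> x J) = ennreal (tail (p * x))"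
  unfolding nn_integral_tail_decreasing
proof (subst nn_integral_importance)
  show "(\<lambda>l. ennreal (importance_estimator (Suc n) p \<beta> x J l)) \<in> borel_measurable (lebesgue_on_indices {1..Suc n})"
    by (rule measurable_compose[OF measurable_importance_estimator measurable_ennreal])
  show "(\<integral>\<^sup>+l. ennreal (lower_density (lower_part l) * sampling_density l (l 1)) * ennreal (importance_estimator (Suc n) p \<beta> x J l) \<partial>lebesgue_on_indices {1..Suc n})
     = (\<integral>\<^sup>+l. ennreal (lower_density (lower_part l) * indicator {max (p * x) (l 2)<..} (l 1) *
     (real (Suc n) * const_ratio * (laguerre_weight \<kappa> (l 1) * (\<Prod>i=1..n. \<bar>l 1 - lower_part l i\<bar> powr \<beta>)))) \<partial>lebesgue_on_indices {1..Suc n})"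
  proof (rule nn_integral_cong)
    fix l
    show "ennreal (lower_density (lower_part l) * sampling_density l (l 1)) * ennreal (importance_estimator (Suc n) p \<beta> x J l)
     = ennreal (lower_density (lower_part l) * indicator {max (p * x) (l 2)<..} (l 1) *
     (real (Suc n) * const_ratio * (laguerre_weight \<kappa> (l 1) * (\<Prod>i=1..n. \<bar>l 1 - lower_part l i\<bar> powr \<beta>))))"
    proof (cases "decreasing n (lower_part l) \<and> max (p * x) (l 2) < l 1")
      case True
      then have d: "decreasing n (lower_part l)" "max (p * x) (l 2) < l 1" by auto
      define e where "e = J * exp (- J * (l 1 - max (p * x) (l 2)))"
      have e: "e > 0" using J by (simp add: e_def)
      have ind: "indicator {max (p * x) (l 2)<..} (l 1) = (1 :: real)" using d(2) by (simp add: indicator_def)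
      have "lower_density (lower_part l) * (e * 1) * (B / e) = lower_density (lower_part l) * 1 * B" for B using e by simp
      then show ?thesis
        unfolding importance_estimator_eq[OF d] e_def[symmetric] ind
        using importance_estimator_nonneg[of l, unfolded importance_estimator_eq[OF d] e_def[symmetric]]
        by (subst ennreal_mult''[symmetric]) (simp_all only:)
    next
      case False
      then have "lower_density (lower_part l) = 0 \<or> indicator {max (p * x) (l 2)<..} (l 1) = (0 :: real)"
        by (auto simp: lower_density_def indicator_def)
      then show ?thesis by auto
    qed
  qed
qed

theorem expectation_importance_estimator:
  "(\<integral>l. importance_estimator (Suc n) p \<beta> x J l \<partial>importance_measure (Suc n) p \<beta> x J) = tail (p * x)"
proof -
  have "(\<integral>l. importance_estimator (Suc n) p \<beta> x J l \<partial>importance_measure (Suc n) p \<beta> x J)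
     = enn2real (\<integral>\<^sup>+l. ennreal (importance_estimator (Suc n) p \<beta> x J l) \<partial>importance_measure (Suc n) p \<beta> x J)"
  proof (rule integral_eq_nn_integral)
    show "importance_estimator (Suc n) p \<beta> x J \<in> borel_measurable (importance_measure (Suc n) p \<beta> x J)"
      unfolding measurable_cong_sets[OF sets_importance_measure refl] by (rule measurable_importance_estimator)
  qed (simp add: importance_estimator_nonneg)
  then show ?thesis unfolding nn_integral_importance_estimator using tail_nonneg by simp
qed

end


section \<open>Reduction to integrals over the largest eigenvalue\<close>

context laguerre_sampling begin

lemma measurable_lower_moment:
  "(\<lambda>m. ennreal (lower_density m * (\<Prod>i=1..n. \<bar>t - m i\<bar> powr s))) \<in> borel_measurable (lebesgue_on_indices {1..n})"
  by measurable

lemma nn_integral_lower_moment: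
  assumes "s \<ge> 0"
  shows "(\<integral>\<^sup>+m. ennreal (lower_density m * (\<Prod>i=1..n. \<bar>t - m i\<bar> powr s)) \<partial>lebesgue_on_indices {1..n}) = ennreal (normalized_moment t s)"
proof -
  let ?Z = "laguerre_integral \<beta> \<kappa> n"
  let ?g = "\<lambda>m. ennreal (laguerre_kernel \<beta> 0 \<kappa> n m * (\<Prod>i=1..n. \<bar>t - m i\<bar> powr s)) * indicator {l. decreasing n l} m"
  have Z: "?Z > 0" by (rule laguerre_integral_pos[OF \<beta> \<kappa>])
  have "(\<lambda>l. if decreasing n l then 1 else 0 :: ennreal) \<in> borel_measurable (lebesgue_on_indices {1..n})" by measurable
  then have i: "(\<lambda>l. indicator {l. decreasing n l} l :: ennreal) \<in> borel_measurable (lebesgue_on_indices {1..n})"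
    by (rule measurable_cong[THEN iffD1, rotated]) (auto simp: indicator_def)
  have g: "?g \<in> borel_measurable (lebesgue_on_indices {1..n})"
    by (rule borel_measurable_times_ennreal[OF _ i]) measurable
  have "(\<integral>\<^sup>+m. ennreal (lower_density m * (\<Prod>i=1..n. \<bar>t - m i\<bar> powr s)) \<partial>lebesgue_on_indices {1..n})
     = (\<integral>\<^sup>+m. ennreal (1 / ?Z) * (?g m * fact n) \<partial>lebesgue_on_indices {1..n})"
  proof (rule nn_integral_cong)
    fix m
    have "lower_density m * (\<Prod>i=1..n. \<bar>t - m i\<bar> powr s) = 1 / ?Z * (laguerre_kernel \<beta> 0 \<kappa> n m * (\<Prod>i=1..n. \<bar>t - m i\<bar> powr s) * fact n)" if "decreasing n m"
      using that unfolding lower_density_def by (simp only: if_True) simp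
    moreover have "ennreal (1 / ?Z * (laguerre_kernel \<beta> 0 \<kappa> n m * (\<Prod>i=1..n. \<bar>t - m i\<bar> powr s) * fact n))
       = ennreal (1 / ?Z) * (ennreal (laguerre_kernel \<beta> 0 \<kappa> n m * (\<Prod>i=1..n. \<bar>t - m i\<bar> powr s)) * fact n)"
      unfolding fact_eq_ennreal using Z by (subst ennreal_mult', simp) (subst ennreal_mult'', simp_all)
    moreover have "?g m = (if decreasing n m then ennreal (laguerre_kernel \<beta> 0 \<kappa> n m * (\<Prod>i=1..n. \<bar>t - m i\<bar> powr s)) else 0)"
      by (simp add: indicator_def)
    moreover have "lower_density m = 0" if "\<not> decreasing n m" using that by (simp add: lower_density_def)
    ultimately show "ennreal (lower_density m * (\<Prod>i=1..n. \<bar>t - m i\<bar> powr s)) = ennreal (1 / ?Z) * (?g m * fact n)"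
      by (cases "decreasing n m") (simp_all only: if_True if_False mult_zero_left mult_zero_right ennreal_0 simp_thms)
  qed
  also have "\<dots> = ennreal (1 / ?Z) * ((\<integral>\<^sup>+m. ?g m \<partial>lebesgue_on_indices {1..n}) * fact n)"
    using g by (subst nn_integral_cmult) (simp_all add: nn_integral_multc)
  also have "\<dots> = ennreal (1 / ?Z) * ennreal (char_moment t s)"
    unfolding char_moment_decreasing[OF assms] ..
  also have "\<dots> = ennreal (normalized_moment t s)"
    unfolding normalized_moment_def using Z by (subst ennreal_mult'[symmetric]) auto
  finally show ?thesis .
qed

lemma nn_integral_first_coordinate:
  assumes s: "s \<ge> 0" and \<psi> [measurable]: "\<psi> \<in> borel_measurable borel" and \<psi>0: "\<And>t. \<psi> t \<ge> 0"
  shows "(\<integral>\<^sup>+l. ennreal (lower_density (lower_part l) * (\<psi> (l 1) * (\<Prod>i=1..n. \<bar>l 1 - lower_part l i\<bar> powr s))) \<partial>lebesgue_on_indices {1..Suc n})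
    = (\<integral>\<^sup>+t. ennreal (\<psi> t * normalized_moment t s) \<partial>lborel)"
proof -
  let ?F = "\<lambda>l. ennreal (lower_density (lower_part l) * (\<psi> (l 1) * (\<Prod>i=1..n. \<bar>l 1 - lower_part l i\<bar> powr s)))"
  have [measurable]: "(\<lambda>l. l 1) \<in> borel_measurable (lebesgue_on_indices {1..Suc n})"
    by (intro measurable_coordinate) simp
  have "(\<lambda>l. \<bar>l 1 - lower_part l i\<bar> powr s) \<in> borel_measurable (lebesgue_on_indices {1..Suc n})" if "i \<in> {1..n}" for i
  proof -
    have [measurable]: "(\<lambda>l. lower_part l i) \<in> borel_measurable (lebesgue_on_indices {1..Suc n})"
      using measurable_coordinate[of "Suc i" "{1..Suc n}"] that by simp
    show ?thesis by measurable
  qed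
  then have [measurable]: "(\<lambda>l. \<Prod>i=1..n. \<bar>l 1 - lower_part l i\<bar> powr s) \<in> borel_measurable (lebesgue_on_indices {1..Suc n})"
    by (rule borel_measurable_prod)
  have m: "?F \<in> borel_measurable (lebesgue_on_indices {1..Suc n})" by measurable
  have "(\<integral>\<^sup>+l. ?F l \<partial>lebesgue_on_indices {1..Suc n}) = (\<integral>\<^sup>+t. \<integral>\<^sup>+l. ?F (l(1 := t)) \<partial>lebesgue_on_indices {2..Suc n} \<partial>lborel)"
    unfolding insert_first by (rule lborel_product.product_nn_integral_insert_rev[OF _ _ m[unfolded insert_first]]) auto
  also have "\<dots> = (\<integral>\<^sup>+t. ennreal (\<psi> t * normalized_moment t s) \<partial>lborel)"
  proof (rule nn_integral_cong)
    fix t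
    let ?g = "\<lambda>m. ennreal (lower_density m * (\<Prod>i=1..n. \<bar>t - m i\<bar> powr s))"
    have g: "?g \<in> borel_measurable (lebesgue_on_indices {1..n})" by (rule measurable_lower_moment)
    have "?F (l(1 := t)) = ennreal (\<psi> t) * ?g (lower_part l)" for l
      unfolding lower_part_upd fun_upd_same using \<psi>0[of t] by (subst ennreal_mult'[symmetric]) (simp_all only: mult_ac)
    then have "(\<integral>\<^sup>+l. ?F (l(1 := t)) \<partial>lebesgue_on_indices {2..Suc n}) = ennreal (\<psi> t) * (\<integral>\<^sup>+l. ?g (lower_part l) \<partial>lebesgue_on_indices {2..Suc n})"
      by (simp only: nn_integral_cmult[OF measurable_compose[OF measurable_shift_coordinates(1) g]])
    also have "\<dots> = ennreal (\<psi> t) * ennreal (normalized_moment t s)"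
      unfolding nn_integral_shift_coordinates[OF g] nn_integral_lower_moment[OF s] ..
    also have "\<dots> = ennreal (\<psi> t * normalized_moment t s)" using \<psi>0[of t] by (simp add: ennreal_mult')
    finally show "(\<integral>\<^sup>+l. ?F (l(1 := t)) \<partial>lebesgue_on_indices {2..Suc n}) = ennreal (\<psi> t * normalized_moment t s)" .
  qed
  finally show ?thesis .
qed

text \<open>Dropping the constraint \<open>l 2 < l 1\<close> decouples \<open>l 1\<close> from the
  lower eigenvalues. In effect this is the union bound over \<open>Suc n\<close> particles.\<close>

lemma tail_upper:
  "ennreal (tail y) \<le> (\<integral>\<^sup>+t. ennreal (indicator {y<..} t * (real (Suc n) * const_ratio * laguerre_weight \<kappa> t) * normalized_moment t \<beta>) \<partial>lborel)"
proof -
  have "ennreal (tail y) \<le> (\<integral>\<^sup>+l. ennreal (lower_density (lower_part l) * (indicator {y<..} (l 1) * (real (Suc n) * const_ratio * laguerre_weight \<kappa> (l 1)) * (\<Prod>i=1..n. \<bar>l 1 - lower_part l i\<bar> powr \<beta>))) \<partial>lebesgue_on_indices {1..Suc n})"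
    unfolding nn_integral_tail_decreasing
  proof (intro nn_integral_mono ennreal_leI)
    fix l :: "nat \<Rightarrow> real"
    have "indicator {max y (l 2)<..} (l 1) \<le> (indicator {y<..} (l 1) :: real)" by (simp add: indicator_def)
    then show "lower_density (lower_part l) * indicator {max y (l 2)<..} (l 1) * (real (Suc n) * const_ratio * (laguerre_weight \<kappa> (l 1) * (\<Prod>i=1..n. \<bar>l 1 - lower_part l i\<bar> powr \<beta>)))
      \<le> lower_density (lower_part l) * (indicator {y<..} (l 1) * (real (Suc n) * const_ratio * laguerre_weight \<kappa> (l 1)) * (\<Prod>i=1..n. \<bar>l 1 - lower_part l i\<bar> powr \<beta>))"
      unfolding mult.assoc using less_imp_le[OF const_ratio_pos]
      by (intro mult_left_mono mult_right_mono lower_density_nonneg mult_nonneg_nonneg prod_nonneg) auto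
  qed
  also have "\<dots> = (\<integral>\<^sup>+t. ennreal (indicator {y<..} t * (real (Suc n) * const_ratio * laguerre_weight \<kappa> t) * normalized_moment t \<beta>) \<partial>lborel)"
    using \<beta> less_imp_le[OF const_ratio_pos] by (intro nn_integral_first_coordinate) (auto intro!: mult_nonneg_nonneg)
  finally show ?thesis .
qed

text \<open>The event contains the event that one fixed particle of the unordered ensemble exceeds
  \<open>y\<close>, hence no factor \<open>Suc n\<close>.\<close>

lemma tail_lower:
  "(\<integral>\<^sup>+t. ennreal (indicator {y<..} t * (const_ratio * laguerre_weight \<kappa> t * normalized_moment t \<beta>)) \<partial>lborel) \<le> ennreal (tail y)"
proof -
  let ?Z = "laguerre_integral \<beta> \<kappa> (Suc n)" and ?Zn = "laguerre_integral \<beta> \<kappa> n"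
  have Z: "?Z > 0" "?Zn > 0" by (rule laguerre_integral_pos[OF \<beta> \<kappa>])+
  let ?F = "\<lambda>l. ennreal (indicator {y<..} (l (Suc n)) * (laguerre_kernel \<beta> 0 \<kappa> (Suc n) l / ?Z))"
  have [measurable]: "(\<lambda>l. l (Suc n)) \<in> borel_measurable (lebesgue_on_indices {1..Suc n})"
    by (intro measurable_coordinate) simp
  have m: "?F \<in> borel_measurable (lebesgue_on_indices {1..Suc n})" by measurable
  have ins: "{1..Suc n} = insert (Suc n) {1..n}" by auto
  have "(\<integral>\<^sup>+t. ennreal (indicator {y<..} t * (const_ratio * laguerre_weight \<kappa> t * normalized_moment t \<beta>)) \<partial>lborel)
     = (\<integral>\<^sup>+t. \<integral>\<^sup>+l. ?F (l(Suc n := t)) \<partial>lebesgue_on_indices {1..n} \<partial>lborel)"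
  proof (rule nn_integral_cong)
    fix t
    let ?g = "\<lambda>l. laguerre_kernel \<beta> 0 \<kappa> n l * (\<Prod>i=1..n. \<bar>t - l i\<bar> powr \<beta>)"
    let ?c = "indicator {y<..} t * (laguerre_weight \<kappa> t / ?Z)"
    have c0: "?c \<ge> 0" using Z by simp
    have "?F (l(Suc n := t)) = ennreal ?c * ennreal (?g l)" for l
    proof -
      have "(\<Prod>i=1..n. ((l i - t)\<^sup>2 + 0) powr (\<beta> / 2)) = (\<Prod>i=1..n. \<bar>t - l i\<bar> powr \<beta>)"
        unfolding add_0_right sq_powr_half by (simp only: abs_minus_commute)
      then have "laguerre_kernel \<beta> 0 \<kappa> (Suc n) (l(Suc n := t)) = laguerre_weight \<kappa> t * ?g l"
        unfolding laguerre_kernel_Suc by (simp only: mult_ac)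
      then have "indicator {y<..} t * (laguerre_kernel \<beta> 0 \<kappa> (Suc n) (l(Suc n := t)) / ?Z) = ?c * ?g l" by (simp only: times_divide_eq_right times_divide_eq_left mult.assoc)
      then show ?thesis unfolding fun_upd_same by (simp only: ennreal_mult'[OF c0])
    qed
    then have "(\<integral>\<^sup>+l. ?F (l(Suc n := t)) \<partial>lebesgue_on_indices {1..n}) = ennreal ?c * (\<integral>\<^sup>+l. ennreal (?g l) \<partial>lebesgue_on_indices {1..n})"
      using borel_measurable_integrable[OF integrable_char_moment[of \<beta> t]] \<beta> by (simp only: nn_integral_cmult[OF measurable_compose[OF _ measurable_ennreal]] less_imp_le)
    also have "(\<integral>\<^sup>+l. ennreal (?g l) \<partial>lebesgue_on_indices {1..n}) = ennreal (char_moment t \<beta>)"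
      unfolding char_moment_def using \<beta>
      by (intro nn_integral_eq_integral integrable_char_moment) (auto intro!: AE_I2 mult_nonneg_nonneg prod_nonneg)
    also have "ennreal ?c * ennreal (char_moment t \<beta>) = ennreal (indicator {y<..} t * (const_ratio * laguerre_weight \<kappa> t * normalized_moment t \<beta>))"
      using c0 Z unfolding const_ratio_eq normalized_moment_def by (subst ennreal_mult'[symmetric]) (auto simp: mult.assoc)
    finally show "ennreal (indicator {y<..} t * (const_ratio * laguerre_weight \<kappa> t * normalized_moment t \<beta>)) = (\<integral>\<^sup>+l. ?F (l(Suc n := t)) \<partial>lebesgue_on_indices {1..n})" ..
  qed
  also have "\<dots> = (\<integral>\<^sup>+l. ?F l \<partial>lebesgue_on_indices {1..Suc n})"
    unfolding ins by (rule lborel_product.product_nn_integral_insert_rev[OF _ _ m[unfolded ins], symmetric]) auto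
  also have "\<dots> \<le> ennreal (tail y)"
    unfolding emeasure_tail
    by (rule nn_integral_mono) (auto simp: indicator_def)
  finally show ?thesis .
qed

text \<open>One power of the sampling density cancels, and its remaining reciprocal grows when
  \<open>max (p * x) (l 2)\<close> is replaced by \<open>p * x\<close>. After that
  \<open>l 2\<close> occurs only through the product, and the lower eigenvalues integrate to a
  moment of order \<open>2 * \<beta>\<close>.\<close>

lemma second_moment_upper:
  "(\<integral>\<^sup>+l. ennreal ((importance_estimator (Suc n) p \<beta> x J l)\<^sup>2) \<partial>importance_measure (Suc n) p \<beta> x J)
   \<le> (\<integral>\<^sup>+t. ennreal (indicator {p * x<..} t * ((real (Suc n) * const_ratio)\<^sup>2 / J * (laguerre_weight \<kappa> t)\<^sup>2 * exp (J * (t - p * x))) * normalized_moment t (2 * \<beta>)) \<partial>lborel)"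
proof -
  let ?\<psi> = "\<lambda>t. indicator {p * x<..} t * ((real (Suc n) * const_ratio)\<^sup>2 / J * (laguerre_weight \<kappa> t)\<^sup>2 * exp (J * (t - p * x)))"
  have \<psi>0: "?\<psi> t \<ge> 0" for t using J by (intro mult_nonneg_nonneg) auto
  have m: "(\<lambda>l. ennreal ((importance_estimator (Suc n) p \<beta> x J l)\<^sup>2)) \<in> borel_measurable (lebesgue_on_indices {1..Suc n})"
    by (intro measurable_compose[OF _ measurable_ennreal] borel_measurable_power measurable_importance_estimator)
  have "(\<integral>\<^sup>+l. ennreal ((importance_estimator (Suc n) p \<beta> x J l)\<^sup>2) \<partial>importance_measure (Suc n) p \<beta> x J)
     = (\<integral>\<^sup>+l. ennreal (lower_density (lower_part l) * sampling_density l (l 1)) * ennreal ((importance_estimator (Suc n) p \<beta> x J l)\<^sup>2) \<partial>lebesgue_on_indices {1..Suc n})"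
    by (rule nn_integral_importance[OF m])
  also have "\<dots> \<le> (\<integral>\<^sup>+l. ennreal (lower_density (lower_part l) * (?\<psi> (l 1) * (\<Prod>i=1..n. \<bar>l 1 - lower_part l i\<bar> powr (2 * \<beta>)))) \<partial>lebesgue_on_indices {1..Suc n})"
  proof (rule nn_integral_mono)
    fix l
    show "ennreal (lower_density (lower_part l) * sampling_density l (l 1)) * ennreal ((importance_estimator (Suc n) p \<beta> x J l)\<^sup>2)
      \<le> ennreal (lower_density (lower_part l) * (?\<psi> (l 1) * (\<Prod>i=1..n. \<bar>l 1 - lower_part l i\<bar> powr (2 * \<beta>))))"
    proof (cases "decreasing n (lower_part l) \<and> max (p * x) (l 2) < l 1")
      case True
      then have d: "decreasing n (lower_part l)" "max (p * x) (l 2) < l 1" by auto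
      define D where "D = lower_density (lower_part l)"
      define e where "e = J * exp (- J * (l 1 - max (p * x) (l 2)))"
      define P where "P = (\<Prod>i=1..n. \<bar>l 1 - lower_part l i\<bar> powr \<beta>)"
      define c where "c = real (Suc n) * const_ratio"
      define w where "w = laguerre_weight \<kappa> (l 1)"
      have e: "e > 0" using J by (simp add: e_def)
      have D: "D \<ge> 0" unfolding D_def by (rule lower_density_nonneg)
      have ind: "indicator {max (p * x) (l 2)<..} (l 1) = (1 :: real)" "indicator {p * x<..} (l 1) = (1 :: real)" using d(2) by (simp_all add: indicator_def)
      have P2: "(\<Prod>i=1..n. \<bar>l 1 - lower_part l i\<bar> powr (2 * \<beta>)) = P\<^sup>2"
        unfolding P_def prod_power_distrib by (rule prod.cong) (simp_all add: power2_eq_square powr_add[symmetric])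
      have "1 / e = exp (J * (l 1 - max (p * x) (l 2))) / J" unfolding e_def mult_minus_left exp_minus by (simp add: divide_inverse mult.commute)
      also have "\<dots> \<le> exp (J * (l 1 - p * x)) / J" using J by (intro divide_right_mono) auto
      finally have e1: "1 / e \<le> exp (J * (l 1 - p * x)) / J" .
      have "D * (e * 1) * (c * (w * P) / e)\<^sup>2 = D * (c\<^sup>2 * w\<^sup>2 * P\<^sup>2) * (1 / e)"
        using e by (simp add: power2_eq_square)
      also have "\<dots> \<le> D * (c\<^sup>2 * w\<^sup>2 * P\<^sup>2) * (exp (J * (l 1 - p * x)) / J)"
        using D by (intro mult_left_mono e1) auto
      also have "\<dots> = D * (1 * (c\<^sup>2 / J * w\<^sup>2 * exp (J * (l 1 - p * x))) * P\<^sup>2)" by simp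
      finally show ?thesis
        unfolding importance_estimator_eq[OF d] D_def[symmetric] e_def[symmetric] P_def[symmetric] c_def[symmetric] w_def[symmetric] P2 ind
        by (subst ennreal_mult''[symmetric]) (auto intro: ennreal_leI)
    next
      case False
      then have "lower_density (lower_part l) = 0 \<or> indicator {max (p * x) (l 2)<..} (l 1) = (0 :: real)"
        by (auto simp: lower_density_def indicator_def)
      then show ?thesis by auto
    qed
  qed
  also have "\<dots> = (\<integral>\<^sup>+t. ennreal (?\<psi> t * normalized_moment t (2 * \<beta>)) \<partial>lborel)"
    using \<beta> by (intro nn_integral_first_coordinate \<psi>0) auto
  finally show ?thesis .
qed

text \<open>As \<open>0 powr 0 = 0\<close>, the product is not always 1, but where it is 0 the
  kernel vanishes as well. The total mass of the lower eigenvalues can thus be treated as a moment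
  of order 0.\<close>

lemma kernel_mult_powr_0: "laguerre_kernel \<beta> 0 \<kappa> n m * (\<Prod>i=1..n. \<bar>0 - m i\<bar> powr 0) = laguerre_kernel \<beta> 0 \<kappa> n m"
proof (cases "\<forall>i\<in>{1..n}. m i \<noteq> 0")
  case True
  then have "(\<Prod>i=1..n. \<bar>0 - m i\<bar> powr 0) = 1" by (intro prod.neutral) auto
  then show ?thesis by simp
next
  case False
  then obtain i where "i \<in> {1..n}" "m i \<le> 0" by auto
  then have "laguerre_kernel \<beta> 0 \<kappa> n m = 0" by (rule laguerre_kernel_eq_0)
  then show ?thesis by simp
qed

lemma prob_space_importance_measure: "prob_space (importance_measure (Suc n) p \<beta> x J)"
proof
  let ?Q = "importance_measure (Suc n) p \<beta> x J"
  have "emeasure ?Q (space ?Q) = (\<integral>\<^sup>+l. 1 \<partial>?Q)" by simp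
  also have "\<dots> = (\<integral>\<^sup>+l. ennreal (lower_density (lower_part l)) * (\<integral>\<^sup>+t. ennreal (sampling_density l t) * 1 \<partial>lborel) \<partial>lebesgue_on_indices {2..Suc n})"
    by (rule nn_integral_importance_iterated) simp
  also have "\<dots> = (\<integral>\<^sup>+l. ennreal (lower_density (lower_part l)) \<partial>lebesgue_on_indices {2..Suc n})"
  proof (rule nn_integral_cong)
    fix l :: "nat \<Rightarrow> real"
    interpret E: prob_space "shifted_exponential J (max (p * x) (l 2))" by (rule prob_space_shifted_exponential[OF J])
    have "(\<integral>\<^sup>+t. ennreal (sampling_density l t) * 1 \<partial>lborel) = 1"
      using nn_integral_shifted_exponential[OF J, of "\<lambda>_. 1" "max (p * x) (l 2)"] E.emeasure_space_1 by simp
    then show "ennreal (lower_density (lower_part l)) * (\<integral>\<^sup>+t. ennreal (sampling_density l t) * 1 \<partial>lborel) = ennreal (lower_density (lower_part l))"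
      by (simp only: mult_1_right)
  qed
  also have "\<dots> = (\<integral>\<^sup>+m. ennreal (lower_density m) \<partial>lebesgue_on_indices {1..n})"
    by (rule nn_integral_shift_coordinates) measurable
  also have "\<dots> = (\<integral>\<^sup>+m. ennreal (lower_density m * (\<Prod>i=1..n. \<bar>0 - m i\<bar> powr 0)) \<partial>lebesgue_on_indices {1..n})"
    unfolding lower_density_def if_distrib[where f = "\<lambda>u. u * _"] mult.assoc times_divide_eq_left kernel_mult_powr_0 mult_zero_left ..
  also have "\<dots> = ennreal (normalized_moment 0 0)" by (rule nn_integral_lower_moment) simp
  also have "normalized_moment 0 0 = 1"
    unfolding normalized_moment_def char_moment_def kernel_mult_powr_0 laguerre_integral_def[symmetric]
    using laguerre_integral_pos[OF \<beta> \<kappa>, of n] by simp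
  finally show "emeasure ?Q (space ?Q) = 1" by simp
qed

text \<open>The finite bound makes the estimator square integrable, so that its Bochner integral is
  the true second moment. The lower bound is the nonnegativity of the variance.\<close>

lemma second_moment_bounds:
  assumes "(\<integral>\<^sup>+t. ennreal (indicator {p * x<..} t * ((real (Suc n) * const_ratio)\<^sup>2 / J * (laguerre_weight \<kappa> t)\<^sup>2 * exp (J * (t - p * x))) * normalized_moment t (2 * \<beta>)) \<partial>lborel) \<le> ennreal B"
    and "B \<ge> 0"
  shows "(\<integral>l. (importance_estimator (Suc n) p \<beta> x J l)\<^sup>2 \<partial>importance_measure (Suc n) p \<beta> x J) \<le> B"
    and "(tail (p * x))\<^sup>2 \<le> (\<integral>l. (importance_estimator (Suc n) p \<beta> x J l)\<^sup>2 \<partial>importance_measure (Suc n) p \<beta> x J)"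
proof -
  let ?Q = "importance_measure (Suc n) p \<beta> x J" and ?X = "importance_estimator (Suc n) p \<beta> x J"
  interpret Q: prob_space ?Q by (rule prob_space_importance_measure)
  have m [measurable]: "?X \<in> borel_measurable ?Q"
    unfolding measurable_cong_sets[OF sets_importance_measure refl] by (rule measurable_importance_estimator)
  have le: "(\<integral>\<^sup>+l. ennreal ((?X l)\<^sup>2) \<partial>?Q) \<le> ennreal B" using second_moment_upper assms(1) by (rule order_trans)
  have i2: "integrable ?Q (\<lambda>l. (?X l)\<^sup>2)"
  proof (rule integrableI_bounded)
    show "(\<integral>\<^sup>+l. ennreal (norm ((?X l)\<^sup>2)) \<partial>?Q) < \<infinity>" using le by (simp add: order_le_less_trans)
  qed measurable
  have i1: "integrable ?Q ?X" by (rule Q.square_integrable_imp_integrable[OF m i2])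
  have "ennreal (\<integral>l. (?X l)\<^sup>2 \<partial>?Q) = (\<integral>\<^sup>+l. ennreal ((?X l)\<^sup>2) \<partial>?Q)"
    by (rule nn_integral_eq_integral[symmetric, OF i2]) simp
  with le have "ennreal (\<integral>l. (?X l)\<^sup>2 \<partial>?Q) \<le> ennreal B" by (simp only:)
  then show "(\<integral>l. (?X l)\<^sup>2 \<partial>?Q) \<le> B" by (simp only: ennreal_le_iff[OF assms(2)])
  show "(tail (p * x))\<^sup>2 \<le> (\<integral>l. (?X l)\<^sup>2 \<partial>?Q)"
    using Q.variance_eq[OF i1 i2] Q.variance_positive[of ?X] unfolding expectation_importance_estimator by simp
qed

end


section \<open>Decay rates\<close>

lemma nn_integral_exponential_tail:
  fixes K c a :: real
  assumes c: "c > 0" and K: "K \<ge> 0"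
  shows "(\<integral>\<^sup>+t. ennreal (indicator {a<..} t * (K * exp (- c * (t - a)))) \<partial>lborel) = ennreal (K / c)"
proof -
  interpret E: prob_space "shifted_exponential c a" by (rule prob_space_shifted_exponential[OF c])
  have "(\<integral>\<^sup>+t. ennreal (indicator {a<..} t * (K * exp (- c * (t - a)))) \<partial>lborel)
     = (\<integral>\<^sup>+t. ennreal (K / c) * ennreal (c * exp (- c * (t - a)) * indicator {a<..} t) \<partial>lborel)"
    using c K by (intro nn_integral_cong) (simp add: ennreal_mult'[symmetric] mult_ac)
  also have "\<dots> = ennreal (K / c) * (\<integral>\<^sup>+t. ennreal (c * exp (- c * (t - a)) * indicator {a<..} t) \<partial>lborel)"
    by (rule nn_integral_cmult) measurable
  also have "(\<integral>\<^sup>+t. ennreal (c * exp (- c * (t - a)) * indicator {a<..} t) \<partial>lborel) = 1"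
    using nn_integral_shifted_exponential[OF c, of "\<lambda>_. 1" a] E.emeasure_space_1 by simp
  finally show ?thesis by simp
qed

context laguerre_equilibrium begin

text \<open>The logarithm of the tail integrand with the moment of the characteristic polynomial
  replaced by its equilibrium value and constants left out.\<close>

definition log_weight :: "real \<Rightarrow> real" where
  "log_weight t = \<beta> * (\<Sum>i=1..n. ln (t - L i)) + (\<kappa> - 1) * ln t - t / 2"

lemma exp_log_weight:
  assumes t: "t > 0" "\<And>i. i \<in> {1..n} \<Longrightarrow> L i < t"
  shows "exp (log_weight t) = laguerre_weight \<kappa> t * (\<Prod>i=1..n. t - L i) powr \<beta>"
proof -
  have "exp (\<beta> * (\<Sum>i=1..n. ln (t - L i))) = (\<Prod>i=1..n. exp (\<beta> * ln (t - L i)))"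
    unfolding sum_distrib_left by (rule exp_sum) simp
  also have "\<dots> = (\<Prod>i=1..n. (t - L i) powr \<beta>)"
    using t by (intro prod.cong) (auto simp: powr_def dest: less_imp_neq)
  also have "\<dots> = (\<Prod>i=1..n. t - L i) powr \<beta>" by (rule prod_powr_distrib[symmetric])
  finally have D: "exp (\<beta> * (\<Sum>i=1..n. ln (t - L i))) = (\<Prod>i=1..n. t - L i) powr \<beta>" .
  have "exp (log_weight t) = exp (\<beta> * (\<Sum>i=1..n. ln (t - L i))) * (exp ((\<kappa> - 1) * ln t) * exp (- t / 2))"
    unfolding log_weight_def exp_add[symmetric] by simp
  also have "exp ((\<kappa> - 1) * ln t) * exp (- t / 2) = laguerre_weight \<kappa> t"
    using t by (simp add: laguerre_weight_def powr_def)
  finally show ?thesis unfolding D by (simp only: mult.commute)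
qed

lemma log_weight_deriv:
  assumes t: "t > 0" "\<And>i. i \<in> {1..n} \<Longrightarrow> L i < t"
  shows "(log_weight has_real_derivative (\<beta> * stieltjes t + (\<kappa> - 1) / t - 1 / 2)) (at t)"
proof -
  have "((\<lambda>t. \<Sum>i=1..n. ln (t - L i)) has_real_derivative stieltjes t) (at t)"
    unfolding stieltjes_def
  proof (rule DERIV_sum)
    fix i assume "i \<in> {1..n}"
    then show "((\<lambda>t. ln (t - L i)) has_real_derivative 1 / (t - L i)) (at t)"
      using t(2)[of i] by (auto intro!: derivative_eq_intros)
  qed
  moreover have "((\<lambda>t. (\<kappa> - 1) * ln t - t / 2) has_real_derivative (\<kappa> - 1) / t - 1 / 2) (at t)"
    using t(1) by (auto intro!: derivative_eq_intros)
  ultimately have "((\<lambda>t. \<beta> * (\<Sum>i=1..n. ln (t - L i)) + ((\<kappa> - 1) * ln t - t / 2)) has_real_derivative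
      \<beta> * stieltjes t + ((\<kappa> - 1) / t - 1 / 2)) (at t)"
    by (intro DERIV_add DERIV_cmult)
  then show ?thesis unfolding log_weight_def[abs_def] by (simp only: add_diff_eq)
qed

text \<open>Twice the decay rate of \<open>log_weight\<close> guaranteed by
  \<open>stieltjes_bound\<close>, hence the decay rate of the squared integrand, against which
  \<open>J\<close> competes in the second moment.\<close>

definition rate :: "real \<Rightarrow> real" where
  "rate z = sqrt ((1 - lower_edge / z) * (1 - edge / z))"

lemma rate_mono:
  assumes "edge < z" "z \<le> t"
  shows "rate z \<le> rate t"
proof -
  have z: "z > 0" "t > 0" using assms edge_bounds(4) by linarith+
  have "lower_edge / t \<le> lower_edge / z" "edge / t \<le> edge / z"
    using assms z edge_bounds by (auto intro!: divide_left_mono)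
  moreover have "edge / z \<le> 1" using assms z by simp
  moreover have "lower_edge / z \<le> 1" using assms z edge_bounds by simp
  ultimately show ?thesis unfolding rate_def by (intro real_sqrt_le_mono mult_mono) auto
qed

lemma rate_pos:
  assumes "edge < z" shows "rate z > 0"
proof -
  have "z > 0" using assms edge_bounds(4) by linarith
  then have "edge / z < 1" "lower_edge / z < 1" using assms edge_bounds(2) by auto
  then show ?thesis unfolding rate_def by (intro real_sqrt_gt_zero mult_pos_pos) auto
qed

lemma L_less_if_edge_less: "edge < t \<Longrightarrow> i \<in> {1..n} \<Longrightarrow> L i < t"
  using L_le_edge by force

lemma log_weight_decrease:
  assumes n: "n \<ge> 1" and z: "edge < z" "z \<le> t"
  shows "log_weight t \<le> log_weight z - rate z / 2 * (t - z)"
proof -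
  let ?h = "\<lambda>t. log_weight t + rate z / 2 * t"
  have "?h t \<le> ?h z"
  proof (rule DERIV_nonpos_imp_nonincreasing[OF z(2)])
    fix u assume u: "z \<le> u" "u \<le> t"
    have u0: "u > 0" "edge < u" using u z edge_bounds(4) by linarith+
    have d: "(?h has_real_derivative (\<beta> * stieltjes u + (\<kappa> - 1) / u - 1 / 2) + rate z / 2) (at u)"
      using L_less_if_edge_less[OF u0(2)] u0(1) by (auto intro!: derivative_eq_intros log_weight_deriv)
    have "\<beta> * stieltjes u + \<kappa> / u - 1 / 2 \<le> - rate u / 2"
      unfolding rate_def using n by (intro stieltjes_bound u0(2) L_less_if_edge_less) auto
    moreover have "rate z \<le> rate u" using z u by (intro rate_mono) auto
    moreover have "(\<kappa> - 1) / u \<le> \<kappa> / u" using u0 by (simp add: divide_right_mono)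
    ultimately have "(\<beta> * stieltjes u + (\<kappa> - 1) / u - 1 / 2) + rate z / 2 \<le> 0" by linarith
    with d show "\<exists>y. (?h has_real_derivative y) (at u) \<and> y \<le> 0" by blast
  qed
  moreover have "rate z / 2 * (t - z) = rate z / 2 * t - rate z / 2 * z" by (rule right_diff_distrib)
  ultimately show ?thesis by linarith
qed

text \<open>A crude complement to the decay: right of 1 the derivative is at least
  \<open>- 3 / 2\<close>, with \<open>- 1 / 2\<close> from the exponential and \<open>- 1\<close>
  from the exponent \<open>\<kappa> - 1\<close>. So the integrand loses at most a constant factor on
  an interval of length 1.\<close>

lemma log_weight_slow:
  assumes z: "edge < z" "1 \<le> z" "z \<le> t"
  shows "log_weight z - 3 / 2 * (t - z) \<le> log_weight t"
proof -
  let ?h = "\<lambda>t. log_weight t + 3 / 2 * t"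
  have "?h z \<le> ?h t"
  proof (rule DERIV_nonneg_imp_nondecreasing[OF z(3)])
    fix u assume u: "z \<le> u" "u \<le> t"
    have u0: "u \<ge> 1" "edge < u" using u z by linarith+
    have d: "(?h has_real_derivative (\<beta> * stieltjes u + (\<kappa> - 1) / u - 1 / 2) + 3 / 2) (at u)"
      using L_less_if_edge_less[OF u0(2)] u0(1) by (auto intro!: derivative_eq_intros log_weight_deriv)
    have "stieltjes u \<ge> 0" unfolding stieltjes_def using L_less_if_edge_less[OF u0(2)]
      by (intro sum_nonneg) (simp add: less_imp_le)
    then have "\<beta> * stieltjes u \<ge> 0" using \<beta> by simp
    moreover have "(\<kappa> - 1) / u \<ge> - 1"
    proof -
      have "- 1 / 1 \<le> - 1 / u" using u0 by simp
      also have "- 1 / u \<le> (\<kappa> - 1) / u" using \<kappa> u0 by (intro divide_right_mono) auto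
      finally show ?thesis by simp
    qed
    ultimately have "(\<beta> * stieltjes u + (\<kappa> - 1) / u - 1 / 2) + 3 / 2 \<ge> 0" by linarith
    with d show "\<exists>y. (?h has_real_derivative y) (at u) \<and> 0 \<le> y" by blast
  qed
  moreover have "3 / 2 * (t - z) = 3 / 2 * t - 3 / 2 * z" by (rule right_diff_distrib)
  ultimately show ?thesis by linarith
qed

end

context laguerre_sampling begin

text \<open>Here \<open>r\<close> is the margin beyond the edge, a lower bound for all
  \<open>t - L i\<close>. The three exponential moments belong to the orders 2, \<beta> and
  \<open>2 * \<beta>\<close>: the first for the lower bound on the moment of order \<beta>, the
  others for the upper bounds.\<close>

context
  fixes r C :: real
  assumes r: "r > 0" and C: "C \<ge> 1"
    and conc: "concentrated (2 / r) C" "concentrated (\<beta> / r) C" "concentrated (2 * \<beta> / r) C"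
begin

lemma normalized_moment_upper:
  assumes s: "s \<ge> 0" "concentrated (s / r) C" and t: "edge + r \<le> t"
  shows "normalized_moment t s \<le> (\<Prod>i=1..n. t - L i) powr s * C"
proof -
  have "char_moment t s \<le> laguerre_integral \<beta> \<kappa> n * ((\<Prod>i=1..n. t - L i) powr s * C)"
  proof (rule char_moment_upper[OF s(1) r _ s(2)])
    show "r \<le> t - L i" if "i \<in> {1..n}" for i using L_le_edge[OF that] t by linarith
  qed (use C in simp)
  then show ?thesis unfolding normalized_moment_def using laguerre_integral_pos[OF \<beta> \<kappa>, of n]
    by (simp add: pos_divide_le_eq mult.commute)
qed

lemma weight_moment_upper:
  assumes t: "edge + r \<le> t"
  shows "laguerre_weight \<kappa> t * normalized_moment t \<beta> \<le> C * exp (log_weight t)"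
    and "(laguerre_weight \<kappa> t)\<^sup>2 * normalized_moment t (2 * \<beta>) \<le> C * (exp (log_weight t))\<^sup>2"
proof -
  let ?D = "\<Prod>i=1..n. t - L i"
  have t0: "t > 0" "edge < t" using t r edge_bounds(4) by linarith+
  have e: "exp (log_weight t) = laguerre_weight \<kappa> t * ?D powr \<beta>"
    by (rule exp_log_weight[OF t0(1) L_less_if_edge_less[OF t0(2)]])
  have "laguerre_weight \<kappa> t * normalized_moment t \<beta> \<le> laguerre_weight \<kappa> t * (?D powr \<beta> * C)"
    using \<beta> by (intro mult_left_mono normalized_moment_upper conc t) auto
  then show "laguerre_weight \<kappa> t * normalized_moment t \<beta> \<le> C * exp (log_weight t)"
    unfolding e by (simp only: mult_ac)
  have "(laguerre_weight \<kappa> t)\<^sup>2 * normalized_moment t (2 * \<beta>) \<le> (laguerre_weight \<kappa> t)\<^sup>2 * (?D powr (2 * \<beta>) * C)"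
    using \<beta> by (intro mult_left_mono normalized_moment_upper conc t) auto
  also have "?D powr (2 * \<beta>) = (?D powr \<beta>)\<^sup>2" by (simp add: power2_eq_square powr_add[symmetric])
  also have "(laguerre_weight \<kappa> t)\<^sup>2 * ((?D powr \<beta>)\<^sup>2 * C) = C * (laguerre_weight \<kappa> t * ?D powr \<beta>)\<^sup>2"
    by (simp only: power_mult_distrib mult_ac)
  finally show "(laguerre_weight \<kappa> t)\<^sup>2 * normalized_moment t (2 * \<beta>) \<le> C * (exp (log_weight t))\<^sup>2"
    unfolding e .
qed

lemma weight_moment_lower:
  assumes t: "edge + r \<le> t"
  shows "exp (log_weight t) / (4 * 2 powr \<beta> * C) \<le> laguerre_weight \<kappa> t * normalized_moment t \<beta>"
proof -
  let ?D = "\<Prod>i=1..n. t - L i"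
  have t0: "t > 0" "edge < t" using t r edge_bounds(4) by linarith+
  have e: "exp (log_weight t) = laguerre_weight \<kappa> t * ?D powr \<beta>"
    by (rule exp_log_weight[OF t0(1) L_less_if_edge_less[OF t0(2)]])
  have "laguerre_integral \<beta> \<kappa> n * (?D powr \<beta> / (4 * 2 powr \<beta> * C)) \<le> char_moment t \<beta>"
  proof (rule char_moment_lower[OF r _ conc(1)])
    show "r \<le> t - L i" if "i \<in> {1..n}" for i using L_le_edge[OF that] t by linarith
  qed (use C in simp)
  then have "?D powr \<beta> / (4 * 2 powr \<beta> * C) \<le> normalized_moment t \<beta>"
    unfolding normalized_moment_def using laguerre_integral_pos[OF \<beta> \<kappa>, of n]
    by (simp only: pos_le_divide_eq mult.commute)
  then have "laguerre_weight \<kappa> t * (?D powr \<beta> / (4 * 2 powr \<beta> * C)) \<le> laguerre_weight \<kappa> t * normalized_moment t \<beta>"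
    by (intro mult_left_mono) auto
  then show ?thesis unfolding e by (simp only: times_divide_eq_right)
qed

lemma tail_upper_rate:
  assumes y: "edge + r \<le> y"
  shows "tail y \<le> real (Suc n) * const_ratio * C * exp (log_weight y) * (2 / rate y)"
proof -
  let ?K = "real (Suc n) * const_ratio * C * exp (log_weight y)"
  have ye: "edge < y" using y r by linarith
  have A: "0 \<le> real (Suc n) * const_ratio" using const_ratio_pos by simp
  have K: "?K \<ge> 0" using A C by simp
  have "ennreal (tail y) \<le> (\<integral>\<^sup>+t. ennreal (indicator {y<..} t * (?K * exp (- (rate y / 2) * (t - y)))) \<partial>lborel)"
  proof (rule order_trans[OF tail_upper], intro nn_integral_mono ennreal_leI)
    fix t
    show "indicator {y<..} t * (real (Suc n) * const_ratio * laguerre_weight \<kappa> t) * normalized_moment t \<beta>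
       \<le> indicator {y<..} t * (?K * exp (- (rate y / 2) * (t - y)))"
    proof (cases "y < t")
      case True
      have "real (Suc n) * const_ratio * (laguerre_weight \<kappa> t * normalized_moment t \<beta>) \<le> real (Suc n) * const_ratio * (C * exp (log_weight t))"
        using True y by (intro mult_left_mono A weight_moment_upper) auto
      also have "\<dots> \<le> real (Suc n) * const_ratio * (C * exp (log_weight y - rate y / 2 * (t - y)))"
        using True C log_weight_decrease[OF n ye, of t] by (intro mult_left_mono A) auto
      also have "exp (log_weight y - rate y / 2 * (t - y)) = exp (log_weight y) * exp (- (rate y / 2) * (t - y))"
        by (simp add: exp_add[symmetric])
      finally show ?thesis using True by (simp only: indicator_def mem_Collect_eq greaterThan_iff if_True of_bool_eq mult.assoc mult_1_left)
    qed simp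
  qed
  also have "\<dots> = ennreal (?K / (rate y / 2))"
    using rate_pos[OF ye] K by (intro nn_integral_exponential_tail) auto
  finally have "tail y \<le> ?K / (rate y / 2)"
    using rate_pos[OF ye] K by (subst (asm) ennreal_le_iff) auto
  then show ?thesis by simp
qed

text \<open>Only the interval of length 1 right of \<open>y\<close> is kept, where
  \<open>log_weight_slow\<close> costs \<open>exp (3 / 2)\<close>. Read from right to left, the
  estimate trades \<open>const_ratio\<close> for a tail probability.\<close>

lemma tail_lower_rate:
  assumes y: "edge + r \<le> y" "1 \<le> y"
  shows "const_ratio * exp (log_weight y) \<le> 4 * 2 powr \<beta> * C * exp (3 / 2) * tail y"
proof -
  let ?k = "const_ratio * (exp (log_weight y - 3 / 2) / (4 * 2 powr \<beta> * C))"
  have ye: "edge < y" using y r by linarith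
  have k: "?k \<ge> 0" using const_ratio_pos C by simp
  have "ennreal ?k = (\<integral>\<^sup>+t. ennreal ?k * indicator {y<..y+1} t \<partial>lborel)"
    by (simp add: nn_integral_cmult)
  also have "\<dots> \<le> (\<integral>\<^sup>+t. ennreal (indicator {y<..} t * (const_ratio * laguerre_weight \<kappa> t * normalized_moment t \<beta>)) \<partial>lborel)"
  proof (rule nn_integral_mono)
    fix t
    show "ennreal ?k * indicator {y<..y+1} t \<le> ennreal (indicator {y<..} t * (const_ratio * laguerre_weight \<kappa> t * normalized_moment t \<beta>))"
    proof (cases "y < t \<and> t \<le> y + 1")
      case True
      have "3 / 2 * (t - y) \<le> 3 / 2 * 1" using True by (intro mult_left_mono) auto
      then have "log_weight y - 3 / 2 \<le> log_weight t"
        using log_weight_slow[OF ye y(2) less_imp_le, of t] True by linarith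
      then have "exp (log_weight y - 3 / 2) \<le> exp (log_weight t)" by (simp only: exp_le_cancel_iff)
      then have "exp (log_weight y - 3 / 2) / (4 * 2 powr \<beta> * C) \<le> exp (log_weight t) / (4 * 2 powr \<beta> * C)"
        using C by (intro divide_right_mono) auto
      also have "\<dots> \<le> laguerre_weight \<kappa> t * normalized_moment t \<beta>"
        using y True by (intro weight_moment_lower) auto
      finally have "?k \<le> const_ratio * (laguerre_weight \<kappa> t * normalized_moment t \<beta>)"
        using const_ratio_pos by (intro mult_left_mono) auto
      then show ?thesis using True by (simp add: ennreal_leI mult.assoc)
    qed (auto simp: indicator_def)
  qed
  also have "\<dots> \<le> ennreal (tail y)" by (rule tail_lower)
  finally have "?k \<le> tail y" using tail_nonneg by (subst (asm) ennreal_le_iff) auto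
  moreover have "?k = const_ratio * exp (log_weight y) / (4 * 2 powr \<beta> * C * exp (3 / 2))"
    by (simp add: exp_diff)
  moreover have "4 * 2 powr \<beta> * C * exp (3 / 2) > 0" using C by simp
  ultimately show ?thesis by (simp only: pos_divide_le_eq mult_ac)
qed

lemma tail_pos:
  assumes "edge + r \<le> y" "1 \<le> y"
  shows "tail y > 0"
proof -
  have "0 < const_ratio * exp (log_weight y)" using const_ratio_pos by simp
  then have "0 < 4 * 2 powr \<beta> * C * exp (3 / 2) * tail y" using tail_lower_rate[OF assms] by linarith
  then show ?thesis by (rule zero_less_mult_pos) (use C in simp)
qed

text \<open>At \<open>z\<close> the tail is at most 1, so \<open>tail_lower_rate\<close> bounds
  \<open>const_ratio * exp (log_weight z)\<close> by a constant times \<open>C\<close>. From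
  \<open>z\<close> to \<open>y\<close> the weight decays by \<open>log_weight_decrease\<close>, and
  \<open>tail_upper_rate\<close> returns to the tail at the cost of a second factor
  \<open>C\<close>.\<close>

lemma tail_exponential:
  assumes z: "edge + r \<le> z" "1 \<le> z" "z \<le> y"
  shows "tail y \<le> real (Suc n) * (C\<^sup>2 * (8 * 2 powr \<beta> * exp (3 / 2))) / rate y * exp (- (rate z / 2 * (y - z)))"
proof -
  have ze: "edge < z" using z r by linarith
  have ry: "rate y > 0" using z ze by (intro rate_pos) auto
  have "const_ratio * exp (log_weight y) \<le> const_ratio * exp (log_weight z - rate z / 2 * (y - z))"
    using log_weight_decrease[OF n ze z(3)] const_ratio_pos by (intro mult_left_mono) auto
  also have "\<dots> = const_ratio * exp (log_weight z) * exp (- (rate z / 2 * (y - z)))" 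
    unfolding exp_diff exp_minus by (simp only: divide_inverse mult.assoc)
  also have "\<dots> \<le> 4 * 2 powr \<beta> * C * exp (3 / 2) * exp (- (rate z / 2 * (y - z)))"
  proof (intro mult_right_mono)
    have "4 * 2 powr \<beta> * C * exp (3 / 2) * tail z \<le> 4 * 2 powr \<beta> * C * exp (3 / 2) * 1"
      using C tail_le_1[of z] by (intro mult_left_mono) auto
    then show "const_ratio * exp (log_weight z) \<le> 4 * 2 powr \<beta> * C * exp (3 / 2)" using tail_lower_rate[OF z(1,2)] by linarith
  qed simp
  finally have b: "const_ratio * exp (log_weight y) \<le> 4 * 2 powr \<beta> * C * exp (3 / 2) * exp (- (rate z / 2 * (y - z)))" .
  have "tail y \<le> real (Suc n) * const_ratio * C * exp (log_weight y) * (2 / rate y)" using z by (intro tail_upper_rate) simp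
  also have "\<dots> = real (Suc n) * C * (2 / rate y) * (const_ratio * exp (log_weight y))" by (simp only: mult_ac)
  also have "\<dots> \<le> real (Suc n) * C * (2 / rate y) * (4 * 2 powr \<beta> * C * exp (3 / 2) * exp (- (rate z / 2 * (y - z))))"
    using C ry by (intro mult_left_mono b mult_nonneg_nonneg) auto
  also have "\<dots> = real (Suc n) * (C\<^sup>2 * (8 * 2 powr \<beta> * exp (3 / 2))) / rate y * exp (- (rate z / 2 * (y - z)))"
    by (simp add: power2_eq_square)
  finally show ?thesis .
qed

text \<open>The squared integrand decays at \<open>rate (p * x)\<close> and the reciprocal sampling
  density grows at rate \<open>J\<close>, so their product is integrable exactly because
  \<open>J\<close> is smaller. The square of \<open>const_ratio * exp (log_weight y)\<close> is then
  replaced by that of the tail through \<open>tail_lower_rate\<close>. One factor \<open>C\<close>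
  stems from the moment and two from this replacement.\<close>

lemma second_moment_sandwich:
  assumes y: "edge + r \<le> p * x" "1 \<le> p * x" and J_less: "J < rate (p * x)"
  shows "(tail (p * x))\<^sup>2 \<le> (\<integral>l. (importance_estimator (Suc n) p \<beta> x J l)\<^sup>2 \<partial>importance_measure (Suc n) p \<beta> x J)"
    and "(\<integral>l. (importance_estimator (Suc n) p \<beta> x J l)\<^sup>2 \<partial>importance_measure (Suc n) p \<beta> x J)
      \<le> (real (Suc n))\<^sup>2 * (C ^ 3 * (4 * 2 powr \<beta> * exp (3 / 2))\<^sup>2) / (J * (rate (p * x) - J)) * (tail (p * x))\<^sup>2"
proof -
  define y where "y = p * x"
  define E where "E = const_ratio * exp (log_weight y)"
  have ye: "edge < y" using assms(1) r unfolding y_def by linarith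
  have E0: "E > 0" using const_ratio_pos by (simp add: E_def)
  define K where "K = (real (Suc n))\<^sup>2 * C / J * E\<^sup>2"
  have K: "K \<ge> 0" using C J by (simp add: K_def)
  have c: "rate y - J > 0" using J_less by (simp add: y_def)
  have "(\<integral>\<^sup>+t. ennreal (indicator {p * x<..} t * ((real (Suc n) * const_ratio)\<^sup>2 / J * (laguerre_weight \<kappa> t)\<^sup>2 * exp (J * (t - p * x))) * normalized_moment t (2 * \<beta>)) \<partial>lborel)
    \<le> (\<integral>\<^sup>+t. ennreal (indicator {y<..} t * (K * exp (- (rate y - J) * (t - y)))) \<partial>lborel)"
    unfolding y_def[symmetric]
  proof (intro nn_integral_mono ennreal_leI)
    fix t
    define B where "B = (real (Suc n) * const_ratio)\<^sup>2 / J * exp (J * (t - y))"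
    have B: "B \<ge> 0" using J by (simp add: B_def)
    show "indicator {y<..} t * ((real (Suc n) * const_ratio)\<^sup>2 / J * (laguerre_weight \<kappa> t)\<^sup>2 * exp (J * (t - y))) * normalized_moment t (2 * \<beta>)
       \<le> indicator {y<..} t * (K * exp (- (rate y - J) * (t - y)))"
    proof (cases "y < t")
      case True
      have "(real (Suc n) * const_ratio)\<^sup>2 / J * (laguerre_weight \<kappa> t)\<^sup>2 * exp (J * (t - y)) * normalized_moment t (2 * \<beta>)
         = B * ((laguerre_weight \<kappa> t)\<^sup>2 * normalized_moment t (2 * \<beta>))" unfolding B_def by (simp only: mult_ac)
      also have "\<dots> \<le> B * (C * (exp (log_weight t))\<^sup>2)"
        using True assms(1) unfolding y_def by (intro mult_left_mono B weight_moment_upper) auto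
      also have "\<dots> \<le> B * (C * (exp (log_weight y - rate y / 2 * (t - y)))\<^sup>2)"
        using True C log_weight_decrease[OF n ye, of t] by (intro mult_left_mono B power_mono) auto
      also have "(exp (log_weight y - rate y / 2 * (t - y)))\<^sup>2 = (exp (log_weight y))\<^sup>2 * exp (- rate y * (t - y))"
        unfolding exp_double[symmetric] exp_add[symmetric] by (simp add: field_simps)
      also have "B * (C * ((exp (log_weight y))\<^sup>2 * exp (- rate y * (t - y)))) = K * (exp (J * (t - y)) * exp (- rate y * (t - y)))"
        unfolding B_def K_def E_def by (simp add: power_mult_distrib)
      also have "exp (J * (t - y)) * exp (- rate y * (t - y)) = exp (- (rate y - J) * (t - y))"
        unfolding exp_add[symmetric] by (simp add: algebra_simps)
      finally show ?thesis using True by simp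
    qed simp
  qed
  also have "\<dots> = ennreal (K / (rate y - J))" by (rule nn_integral_exponential_tail[OF c K])
  finally have le: "(\<integral>\<^sup>+t. ennreal (indicator {p * x<..} t * ((real (Suc n) * const_ratio)\<^sup>2 / J * (laguerre_weight \<kappa> t)\<^sup>2 * exp (J * (t - p * x))) * normalized_moment t (2 * \<beta>)) \<partial>lborel)
    \<le> ennreal (K / (rate y - J))" .
  have B0: "0 \<le> K / (rate y - J)" using K c by simp
  show "(tail (p * x))\<^sup>2 \<le> (\<integral>l. (importance_estimator (Suc n) p \<beta> x J l)\<^sup>2 \<partial>importance_measure (Suc n) p \<beta> x J)"
    by (rule second_moment_bounds(2)[OF le B0])
  have "(\<integral>l. (importance_estimator (Suc n) p \<beta> x J l)\<^sup>2 \<partial>importance_measure (Suc n) p \<beta> x J) \<le> K / (rate y - J)"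
    by (rule second_moment_bounds(1)[OF le B0])
  also have "K / (rate y - J) = (real (Suc n))\<^sup>2 * C / (J * (rate y - J)) * E\<^sup>2" unfolding K_def by simp
  also have "\<dots> \<le> (real (Suc n))\<^sup>2 * C / (J * (rate y - J)) * (4 * 2 powr \<beta> * C * exp (3 / 2) * tail y)\<^sup>2"
  proof (intro mult_left_mono power_mono)
    show "E \<le> 4 * 2 powr \<beta> * C * exp (3 / 2) * tail y"
      unfolding E_def by (rule tail_lower_rate) (use assms in \<open>auto simp: y_def\<close>)
  qed (use C J c E0 in auto)
  also have "\<dots> = (real (Suc n))\<^sup>2 * (C ^ 3 * (4 * 2 powr \<beta> * exp (3 / 2))\<^sup>2) / (J * (rate y - J)) * (tail y)\<^sup>2"
    by (simp add: power_mult_distrib power2_eq_square power3_eq_cube)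
  finally show "(\<integral>l. (importance_estimator (Suc n) p \<beta> x J l)\<^sup>2 \<partial>importance_measure (Suc n) p \<beta> x J)
      \<le> (real (Suc n))\<^sup>2 * (C ^ 3 * (4 * 2 powr \<beta> * exp (3 / 2))\<^sup>2) / (J * (rate (p * x) - J)) * (tail (p * x))\<^sup>2"
    unfolding y_def .
qed

end

end


section \<open>Asymptotics\<close>

text \<open>The logarithm of \<open>S n\<close> differs from \<open>2 * ln (P n)\<close> by at most
  \<open>4 * \<epsilon> * n\<close>, while \<open>- ln (P n)\<close> is at least of order
  \<open>n\<close>. The exponential smallness of \<open>P\<close> is what makes subexponential
  errors harmless.\<close>

lemma log_ratio_tendsto_1:
  fixes P S :: "nat \<Rightarrow> real"
  assumes c: "c > 0" and K: "K > 0"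
    and bounds: "\<And>\<epsilon>. \<epsilon> > 0 \<Longrightarrow> \<forall>\<^sub>F n in sequentially. 0 < P n \<and> P n \<le> K * real (Suc n) * exp ((2 * \<epsilon> - c) * real n)
      \<and> (P n)\<^sup>2 \<le> S n \<and> S n \<le> K * (real (Suc n))\<^sup>2 * exp (3 * \<epsilon> * real n) * (P n)\<^sup>2"
  shows "(\<lambda>n. ln (S n) / (2 * ln (P n))) \<longlonglongrightarrow> 1"
proof (rule tendstoI)
  fix e :: real assume e: "e > 0"
  \<comment> \<open>The first entry gives \<open>c / 4 + 2 * \<epsilon> - c \<le> - c / 2\<close>,
    the second makes the relative error \<open>4 * \<epsilon> / c\<close> at most
    \<open>e / 2\<close>.\<close>
  define \<epsilon> where "\<epsilon> = min (c / 8) (e * c / 8)"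
  have \<epsilon>: "\<epsilon> > 0" "\<epsilon> \<le> c / 8" "\<epsilon> \<le> e * c / 8" using c e by (auto simp: \<epsilon>_def)
  have 1: "\<forall>\<^sub>F n in sequentially. ln K + ln (real (Suc n)) \<le> c / 4 * real n" using c by real_asymp
  have 2: "\<forall>\<^sub>F n in sequentially. ln K + 2 * ln (real (Suc n)) \<le> \<epsilon> * real n" using \<epsilon>(1) by real_asymp
  show "\<forall>\<^sub>F n in sequentially. dist (ln (S n) / (2 * ln (P n))) 1 < e"
    using bounds[OF \<epsilon>(1)] 1 2 eventually_gt_at_top[of 0]
  proof eventually_elim
    case (elim n)
    then have P: "0 < P n" and Pu: "P n \<le> K * real (Suc n) * exp ((2 * \<epsilon> - c) * real n)" and Sl: "(P n)\<^sup>2 \<le> S n"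
      and Su: "S n \<le> K * (real (Suc n))\<^sup>2 * exp (3 * \<epsilon> * real n) * (P n)\<^sup>2" by auto
    have P2: "(P n)\<^sup>2 > 0" using P by simp
    then have S0: "S n > 0" using Sl by linarith
    have n0: "real n > 0" using elim by simp
    have "ln (P n) \<le> ln (K * real (Suc n) * exp ((2 * \<epsilon> - c) * real n))" using P Pu by (simp only: ln_le_cancel_iff less_le_trans[OF P Pu])
    also have "\<dots> = ln K + ln (real (Suc n)) + (2 * \<epsilon> - c) * real n" using K by (simp add: ln_mult)
    also have "\<dots> \<le> c / 4 * real n + (2 * \<epsilon> - c) * real n" using elim by simp
    also have "\<dots> = (c / 4 + (2 * \<epsilon> - c)) * real n" by (rule distrib_right[symmetric])
    also have "\<dots> \<le> (- c / 2) * real n" using \<epsilon>(2) n0 by (intro mult_right_mono) auto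
    finally have lP: "ln (P n) \<le> - c / 2 * real n" .
    have cn: "c / 2 * real n > 0" using c n0 by simp
    then have lP0: "ln (P n) < 0" using lP by simp
    have lower: "2 * ln (P n) \<le> ln (S n)"
    proof -
      have "ln ((P n)\<^sup>2) \<le> ln (S n)" using P2 S0 Sl by (simp only: ln_le_cancel_iff)
      then show ?thesis using P by (simp add: ln_realpow)
    qed
    have upper: "ln (S n) \<le> 2 * ln (P n) + 4 * \<epsilon> * real n"
    proof -
      have "ln (S n) \<le> ln (K * (real (Suc n))\<^sup>2 * exp (3 * \<epsilon> * real n) * (P n)\<^sup>2)"
        using S0 Su by (simp only: ln_le_cancel_iff less_le_trans[OF S0 Su])
      also have "\<dots> = ln K + 2 * ln (real (Suc n)) + 3 * \<epsilon> * real n + 2 * ln (P n)"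
        using K P by (simp add: ln_mult ln_realpow)
      finally show ?thesis using elim by simp
    qed
    have "dist (ln (S n) / (2 * ln (P n))) 1 = (ln (S n) - 2 * ln (P n)) / (2 * - ln (P n))"
    proof -
      have "ln (S n) / (2 * ln (P n)) - 1 = (ln (S n) - 2 * ln (P n)) / (2 * ln (P n))" using lP0 by (simp add: field_simps)
      then have "dist (ln (S n) / (2 * ln (P n))) 1 = \<bar>ln (S n) - 2 * ln (P n)\<bar> / \<bar>2 * ln (P n)\<bar>"
        unfolding dist_real_def by (simp only: abs_divide)
      then show ?thesis using lower lP0 by simp
    qed
    also have "\<dots> \<le> (4 * \<epsilon> * real n) / (c * real n)"
      using upper lP lower c n0 \<epsilon>(1) by (intro frac_le) auto
    also have "\<dots> = 4 * \<epsilon> / c" using n0 by simp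
    also have "\<dots> \<le> e / 2" using \<epsilon>(3) c by (simp add: field_simps)
    also have "\<dots> < e" using e by simp
    finally show ?case .
  qed
qed

context laguerre_equilibrium begin

text \<open>One power of \<open>n\<close> comes from \<open>inverse_scale\<close>, two from
  \<open>box_width\<close> and two from the sum of the \<open>L i\<close>. The price per particle is
  therefore polynomial, \<open>exp (O (n * ln n))\<close> for all particles together.\<close>

lemma entropy_factor_le:
  assumes n: "n \<ge> 1" and k: "\<beta> / 2 \<le> \<kappa>" and G: "(\<Sum>i=1..n. L i) \<le> G * (real n)\<^sup>2" "G > 0"
  shows "0 \<le> entropy_factor" "entropy_factor \<le> (exp 2 * (1 + 4 / \<beta>) * exp (3 * \<beta> / 2) * ((G + \<beta>) / \<beta>)) * real n ^ 5"
proof -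
  have n1: "real n \<ge> 1" using n by simp
  have n2: "(real n)\<^sup>2 \<ge> 1" using n1 by (simp add: one_le_power)
  have w: "box_width > 0" "box_width \<le> \<beta>" unfolding box_width_def using \<beta> n1 n2 by (auto simp: divide_le_eq mult_le_cancel_left1)
  have sL: "(\<Sum>i=1..n. L i) \<ge> 0" by (intro sum_nonneg less_imp_le L_pos)
  have isp: "inverse_scale > 0" unfolding inverse_scale_def using \<kappa> n1 by simp
  have i: "1 / inverse_scale \<le> (1 + 4 / \<beta>) * real n"
  proof (cases "\<kappa> / (2 * real n) \<ge> 1")
    case True
    have "1 \<le> (1 + 4 / \<beta>) * real n" using n1 \<beta> mult_mono[of 1 "1 + 4 / \<beta>" 1 "real n"] by simp
    then show ?thesis using True by (simp add: inverse_scale_def min_def)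
  next
    case False
    then have "1 / inverse_scale = 2 * real n / \<kappa>" by (simp add: inverse_scale_def min_def)
    also have "\<dots> \<le> 2 * real n / (\<beta> / 2)" using k \<beta> n1 by (intro divide_left_mono) auto
    also have "\<dots> \<le> (1 + 4 / \<beta>) * real n" using \<beta> n1 by (simp add: field_simps)
    finally show ?thesis .
  qed
  have b: "1 / box_factor \<le> exp (3 * \<beta> / 2) * ((G + \<beta>) / \<beta>) * real n ^ 4" and bp: "box_factor > 0"
  proof -
    have d: "(\<Sum>i=1..n. L i) + box_width > 0" using sL w by simp
    show "box_factor > 0" unfolding box_factor_def using d w by simp
    have "1 / box_factor = exp \<beta> * exp (box_width / 2) * (((\<Sum>i=1..n. L i) + box_width) * (1 / box_width))"
      unfolding box_factor_def minus_divide_left[symmetric] exp_minus using d w by (simp add: field_simps)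
    also have "1 / box_width = (real n)\<^sup>2 / \<beta>" unfolding box_width_def by simp
    also have "exp \<beta> * exp (box_width / 2) * (((\<Sum>i=1..n. L i) + box_width) * ((real n)\<^sup>2 / \<beta>))
       \<le> exp \<beta> * exp (\<beta> / 2) * ((G * (real n)\<^sup>2 + \<beta> * (real n)\<^sup>2) * ((real n)\<^sup>2 / \<beta>))"
    proof (intro mult_mono)
      have "\<beta> * 1 \<le> \<beta> * (real n)\<^sup>2" using n2 \<beta> by (intro mult_left_mono) auto
      then show "(\<Sum>i=1..n. L i) + box_width \<le> G * (real n)\<^sup>2 + \<beta> * (real n)\<^sup>2" using G(1) w(2) by linarith
    qed (use w \<beta> d G sL in auto)
    also have "\<dots> = exp (\<beta> + \<beta> / 2) * ((G + \<beta>) / \<beta>) * real n ^ 4"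
      unfolding exp_add by (simp add: distrib_right[symmetric] power_add[symmetric] flip: power_mult_distrib)
    finally show "1 / box_factor \<le> exp (3 * \<beta> / 2) * ((G + \<beta>) / \<beta>) * real n ^ 4" by simp
  qed
  show "0 \<le> entropy_factor" unfolding entropy_factor_def using isp bp by simp
  have "entropy_factor = exp 2 * (1 / inverse_scale) * (1 / box_factor)" by (simp add: entropy_factor_def)
  also have "\<dots> \<le> exp 2 * ((1 + 4 / \<beta>) * real n) * (exp (3 * \<beta> / 2) * ((G + \<beta>) / \<beta>) * real n ^ 4)"
    using isp bp \<beta> by (intro mult_mono i b mult_left_mono mult_nonneg_nonneg) auto
  also have "\<dots> = (exp 2 * (1 + 4 / \<beta>) * exp (3 * \<beta> / 2) * ((G + \<beta>) / \<beta>)) * real n ^ 5"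
    by (simp add: eval_nat_numeral)
  finally show "entropy_factor \<le> (exp 2 * (1 + 4 / \<beta>) * exp (3 * \<beta> / 2) * ((G + \<beta>) / \<beta>)) * real n ^ 5" .
qed

end

text \<open>The parameter is \<open>s / n\<close> because the margin to the edge grows like
  \<open>n\<close>. The threshold for \<open>n\<close> depends on \<kappa> and \<open>L\<close> only
  through \<beta> and \<open>G\<close>, so one threshold serves a whole sequence of
  equilibria.\<close>

lemma concentrated_eventually:
  fixes \<beta> s \<epsilon> G :: real
  assumes \<beta>: "\<beta> > 0" and s: "s > 0" and \<epsilon>: "\<epsilon> > 0" and G: "G > 0"
  shows "\<forall>\<^sub>F n in sequentially. \<forall>\<kappa> L. laguerre_equilibrium \<beta> \<kappa> n L \<and> \<beta> / 2 \<le> \<kappa> \<and> 2 * \<kappa> * n + \<beta> * n * (real n - 1) \<le> G * (real n)\<^sup>2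
    \<longrightarrow> laguerre_equilibrium.concentrated \<beta> \<kappa> n L (s / real n) (exp (\<epsilon> * real n))"
proof -
  \<comment> \<open>The sum of the \<open>L i\<close> is at most \<open>G * n\<^sup>2\<close>, so
    this \<eta> limits the linear error \<open>s / n * \<eta> * G * n\<^sup>2\<close> to
    \<open>\<epsilon> / 2 * n\<close>.\<close>
  define \<eta> where "\<eta> = min (1 / 2) (\<epsilon> / (2 * s * G))"
  have \<eta>: "0 < \<eta>" "\<eta> < 1" "\<eta> \<le> \<epsilon> / (2 * s * G)" using \<epsilon> s G by (auto simp: \<eta>_def)
  define c where "c = 4 * s / \<eta>"
  have c: "c > 0" using s \<eta> by (simp add: c_def)
  define K where "K = exp 2 * (1 + 4 / \<beta>) * exp (3 * \<beta> / 2) * ((G + \<beta>) / \<beta>)"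
  have K: "K > 0" unfolding K_def using \<beta> G by (intro mult_pos_pos divide_pos_pos) (auto intro: add_pos_pos)
  have 1: "\<forall>\<^sub>F n in sequentially. c / real n \<le> 1 / 4" using c by real_asymp
  have 2: "\<forall>\<^sub>F n in sequentially. exp (c * sqrt (real n)) + 1 \<le> exp (\<epsilon> / 2 * real n)" using c \<epsilon> by real_asymp
  have 3: "\<forall>\<^sub>F n in sequentially. real n * (ln K + 5 * ln (real n)) \<le> real n * sqrt (real n) / 4" using K by real_asymp
  show ?thesis
    using 1 2 3 eventually_ge_at_top[of 1]
  proof eventually_elim
    case (elim n)
    show ?case
    proof (intro allI impI, elim conjE)
      fix \<kappa> L assume le: "laguerre_equilibrium \<beta> \<kappa> n L" and k: "\<beta> / 2 \<le> \<kappa>" and S: "2 * \<kappa> * n + \<beta> * n * (real n - 1) \<le> G * (real n)\<^sup>2"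
      interpret E: laguerre_equilibrium \<beta> \<kappa> n L by (rule le)
      have n0: "real n > 0" using elim by simp
      have SL: "(\<Sum>i=1..n. L i) \<le> G * (real n)\<^sup>2" using S unfolding E.sum_L .
      \<comment> \<open>Large enough for \<open>T / 4\<close> to exceed the entropy
        \<open>n * (ln K + 5 * ln n)\<close>, small enough for \<open>T / n = sqrt n\<close> to be
        negligible against \<open>n\<close>.\<close>
      define T where "T = real n * sqrt (real n)"
      have ct: "4 * (s / real n) / \<eta> = c / real n" by (simp add: c_def)
      have "4 * (s / real n) / \<eta> * T = c * sqrt (real n)" unfolding ct T_def using n0 by simp
      then have e1: "exp (4 * (s / real n) / \<eta> * T) = exp (c * sqrt (real n))" by (simp only:)
      have e2: "exp (- T / 4) * E.entropy_factor ^ n \<le> 1"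
      proof -
        have "E.entropy_factor ^ n \<le> (K * real n ^ 5) ^ n"
          using E.entropy_factor_le[OF elim(4) k SL G] unfolding K_def by (intro power_mono) auto
        also have "\<dots> = exp (real n * ln (K * real n ^ 5))"
          using K n0 by (simp add: exp_of_nat_mult)
        also have "ln (K * real n ^ 5) = ln K + 5 * ln (real n)" using K n0 by (simp add: ln_mult ln_realpow)
        also have "exp (real n * (ln K + 5 * ln (real n))) \<le> exp (T / 4)" using elim(3) by (simp add: T_def)
        finally have "exp (- T / 4) * E.entropy_factor ^ n \<le> exp (- T / 4) * exp (T / 4)" by (intro mult_left_mono) auto
        then show ?thesis by (simp add: exp_add[symmetric])
      qed
      have e3: "exp (s / real n * \<eta> * (\<Sum>i=1..n. L i)) \<le> exp (\<epsilon> / 2 * real n)"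
      proof -
        have "s / real n * \<eta> * (\<Sum>i=1..n. L i) \<le> s / real n * \<eta> * (G * (real n)\<^sup>2)"
          using SL s \<eta> n0 by (intro mult_left_mono) auto
        also have "\<dots> = s * G * real n * \<eta>" using n0 by (simp add: power2_eq_square)
        also have "\<dots> \<le> s * G * real n * (\<epsilon> / (2 * s * G))" using \<eta>(3) s G n0 by (intro mult_left_mono) auto
        also have "\<dots> = \<epsilon> / 2 * real n" using s G by simp
        finally show ?thesis by simp
      qed
      have bound: "exp (s / real n * \<eta> * (\<Sum>i=1..n. L i)) * (exp (4 * (s / real n) / \<eta> * T) + exp (- T / 4) * E.entropy_factor ^ n) \<le> exp (\<epsilon> * real n)"
      proof -
        have "exp (4 * (s / real n) / \<eta> * T) + exp (- T / 4) * E.entropy_factor ^ n \<le> exp (\<epsilon> / 2 * real n)"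
          unfolding e1 using e2 elim(2) by linarith
        then have "exp (s / real n * \<eta> * (\<Sum>i=1..n. L i)) * (exp (4 * (s / real n) / \<eta> * T) + exp (- T / 4) * E.entropy_factor ^ n) \<le> exp (\<epsilon> / 2 * real n) * exp (\<epsilon> / 2 * real n)"
          using e3 E.entropy_factor_le(1)[OF elim(4) k SL G] by (intro mult_mono add_nonneg_nonneg mult_nonneg_nonneg) auto
        also have "\<dots> = exp (\<epsilon> * real n)" unfolding exp_add[symmetric] by (simp add: field_simps)
        finally show ?thesis .
      qed
      have "T \<ge> 0" by (simp add: T_def)
      moreover have "4 * (s / real n) / \<eta> \<le> 1 / 4" unfolding ct by (rule elim(1))
      moreover have "s / real n \<ge> 0" using s by simp
      ultimately have "(\<integral>\<^sup>+l. ennreal (laguerre_kernel \<beta> 0 \<kappa> n l * exp (s / real n * (\<Sum>i=1..n. \<bar>l i - L i\<bar>))) * indicator {l. decreasing n l} l \<partial>lebesgue_on_indices {1..n}) * fact n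
        \<le> ennreal (laguerre_integral \<beta> \<kappa> n * (exp (s / real n * \<eta> * (\<Sum>i=1..n. L i)) * (exp (4 * (s / real n) / \<eta> * T) + exp (- T / 4) * E.entropy_factor ^ n)))"
        using \<eta> by (intro E.concentration elim(4)) auto
      also have "\<dots> \<le> ennreal (laguerre_integral \<beta> \<kappa> n * exp (\<epsilon> * real n))"
        using laguerre_integral_pos[OF E.\<beta> E.\<kappa>, of n] by (intro ennreal_leI mult_left_mono bound) auto
      finally show "E.concentrated (s / real n) (exp (\<epsilon> * real n))"
        unfolding E.concentrated_def .
    qed
  qed
qed


lemma scaled_sqrt_square:
  fixes a b N \<beta> :: real
  assumes "N > 0" "a \<ge> 0"
  shows "\<beta> * (sqrt a + sqrt N)\<^sup>2 / N = \<beta> * (sqrt (a / N) + 1)\<^sup>2"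
    and "\<beta> * (sqrt a - sqrt N)\<^sup>2 / N = \<beta> * (sqrt (a / N) - 1)\<^sup>2"
proof -
  have "sqrt a = sqrt (a / N) * sqrt N" using assms by (simp add: real_sqrt_mult[symmetric])
  then have "(sqrt a + sqrt N)\<^sup>2 = (sqrt (a / N) + 1)\<^sup>2 * N" "(sqrt a - sqrt N)\<^sup>2 = (sqrt (a / N) - 1)\<^sup>2 * N"
    using assms by (simp_all add: power2_eq_square algebra_simps)
  then show "\<beta> * (sqrt a + sqrt N)\<^sup>2 / N = \<beta> * (sqrt (a / N) + 1)\<^sup>2"
    "\<beta> * (sqrt a - sqrt N)\<^sup>2 / N = \<beta> * (sqrt (a / N) - 1)\<^sup>2" using assms by simp_all
qed

theorem theorem3:
  fixes \<beta> \<gamma> x J :: real and p :: "nat \<Rightarrow> real"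
  assumes "\<beta> > 0"
    and "\<And>n. n \<ge> 1 \<Longrightarrow> p n \<ge> real n"
    and "\<gamma> \<ge> 1"
    and "(\<lambda>n. p n / real n) \<longlonglongrightarrow> \<gamma>"
    and "\<gamma> * x > mp_upper \<beta> \<gamma>"
    and "0 < J"
    and "J < 1 - 2 * \<beta> * (\<integral>y. 1 / (\<gamma> * x - y) \<partial>marchenko_pastur \<beta> \<gamma>)
               - \<beta> * ((\<gamma> - 1) / (\<gamma> * x))"
  shows "(\<forall>n\<ge>2. (\<integral>l. importance_estimator n (p n) \<beta> x J l \<partial>importance_measure n (p n) \<beta> x J)
              = largest_eigenvalue_tail n (p n) \<beta> (p n * x)) \<and>
         (\<lambda>n. ln (\<integral>l. (importance_estimator n (p n) \<beta> x J l)\<^sup>2 \<partial>importance_measure n (p n) \<beta> x J) /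
               (2 * ln (largest_eigenvalue_tail n (p n) \<beta> (p n * x)))) \<longlonglongrightarrow> 1"
proof -
  note \<beta> = assms(1) and p_ge = assms(2) and \<gamma> = assms(3) and lim = assms(4) and \<gamma>x = assms(5) and J = assms(6)
  \<comment> \<open>The locale counts the lower eigenvalues, so the ensemble of size
    \<open>Suc n\<close> is handled at index \<open>n\<close>. The shift is undone at the
    end.\<close>
  define q where "q n = p (Suc n)" for n
  define \<kappa> where "\<kappa> n = \<beta> * (q n - real n) / 2" for n
  have q_ge: "real (Suc n) \<le> q n" for n unfolding q_def by (rule p_ge) simp
  have \<kappa>_ge: "\<beta> / 2 \<le> \<kappa> n" for n
    using mult_left_mono[of 1 "q n - real n" \<beta>] q_ge[of n] \<beta> by (simp add: \<kappa>_def)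
  have \<kappa>_pos: "\<kappa> n > 0" for n using \<kappa>_ge[of n] \<beta> by linarith
  have "\<exists>L. equilibrium \<beta> (\<kappa> n) n L" for n using equilibrium_exists[OF \<beta> \<kappa>_pos] by blast
  then obtain L where L: "\<And>n. equilibrium \<beta> (\<kappa> n) n (L n)" by metis
  define y where "y = \<gamma> * x"
  define a b where "a = mp_lower \<beta> \<gamma>" and "b = mp_upper \<beta> \<gamma>"
  have b0: "b > 0" unfolding b_def mp_upper_def using \<beta> \<gamma> by (intro mult_pos_pos zero_less_power add_nonneg_pos) auto
  have yb: "y > b" using \<gamma>x by (simp add: y_def b_def)
  have ab: "0 \<le> a" "a \<le> b"
    using \<beta> \<gamma> unfolding a_def b_def mp_lower_def mp_upper_def by (auto intro!: mult_left_mono power_mono)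
  have "\<gamma> * x > 0" using yb b0 unfolding y_def by linarith
  then have x: "x > 0" by (rule zero_less_mult_pos) (use \<gamma> in simp)
  have le: "laguerre_equilibrium \<beta> (\<kappa> n) n (L n)" for n
    using \<beta> \<kappa>_pos L by unfold_locales
  have ls: "laguerre_sampling \<beta> (\<kappa> n) n (L n) (q n) x J" if "n \<ge> 1" for n
    using that J x q_ge by (intro laguerre_sampling.intro le laguerre_sampling_axioms.intro) (simp_all add: \<kappa>_def)

  let ?E = "\<lambda>n. laguerre_equilibrium.edge \<beta> (\<kappa> n) n"
  let ?R = "\<lambda>n. laguerre_equilibrium.rate \<beta> (\<kappa> n) n"
  let ?P = "\<lambda>n. largest_eigenvalue_tail (Suc n) (q n) \<beta> (q n * x)"
  let ?S = "\<lambda>n. \<integral>l. (importance_estimator (Suc n) (q n) \<beta> x J l)\<^sup>2 \<partial>importance_measure (Suc n) (q n) \<beta> x J"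

  have unbiased: "(\<integral>l. importance_estimator n (p n) \<beta> x J l \<partial>importance_measure n (p n) \<beta> x J)
              = largest_eigenvalue_tail n (p n) \<beta> (p n * x)" if n2: "n \<ge> 2" for n
  proof -
    obtain m where m: "n = Suc m" "m \<ge> 1" using n2 by (cases n) auto
    interpret laguerre_sampling \<beta> "\<kappa> m" m "L m" "q m" x J by (rule ls[OF m(2)])
    show ?thesis using expectation_importance_estimator[unfolded tail_def] unfolding m(1) q_def .
  qed

  have sq: "real n + 2 * \<kappa> n / \<beta> = q n" for n using \<beta> by (simp add: \<kappa>_def)
  have edge: "?E n = \<beta> * (sqrt (q n) + sqrt (real n))\<^sup>2" for n
    unfolding laguerre_equilibrium.edge_def[OF le] sq ..
  have lower_edge: "laguerre_equilibrium.lower_edge \<beta> (\<kappa> n) n = \<beta> * (sqrt (q n) - sqrt (real n))\<^sup>2" for n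
    unfolding laguerre_equilibrium.lower_edge_def[OF le] sq ..
  have q_lim: "(\<lambda>n. q n / real n) \<longlonglongrightarrow> \<gamma>"
  proof -
    have "(\<lambda>n. p (Suc n) / real (Suc n)) \<longlonglongrightarrow> \<gamma>" using lim by (rule LIMSEQ_Suc)
    moreover have "(\<lambda>n. real (Suc n) / real n) \<longlonglongrightarrow> 1" by real_asymp
    ultimately have "(\<lambda>n. p (Suc n) / real (Suc n) * (real (Suc n) / real n)) \<longlonglongrightarrow> \<gamma> * 1" by (rule tendsto_mult)
    moreover have "p (Suc n) / real (Suc n) * (real (Suc n) / real n) = q n / real n" for n by (simp add: q_def)
    ultimately show ?thesis by (simp only: mult_1_right)
  qed
  have q0: "q n \<ge> 0" for n using q_ge[of n] by simp
  have edge_lim: "(\<lambda>n. ?E n / real n) \<longlonglongrightarrow> b"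
  proof (rule Lim_transform_eventually)
    show "(\<lambda>n. \<beta> * (sqrt (q n / real n) + 1)\<^sup>2) \<longlonglongrightarrow> b"
      unfolding b_def mp_upper_def by (intro tendsto_intros q_lim)
    show "\<forall>\<^sub>F n in sequentially. \<beta> * (sqrt (q n / real n) + 1)\<^sup>2 = ?E n / real n"
      using eventually_gt_at_top[of 0] by eventually_elim (simp add: edge scaled_sqrt_square(1)[OF _ q0])
  qed
  have lower_lim: "(\<lambda>n. laguerre_equilibrium.lower_edge \<beta> (\<kappa> n) n / real n) \<longlonglongrightarrow> a"
  proof (rule Lim_transform_eventually)
    show "(\<lambda>n. \<beta> * (sqrt (q n / real n) - 1)\<^sup>2) \<longlonglongrightarrow> a"
      unfolding a_def mp_lower_def by (intro tendsto_intros q_lim)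
    show "\<forall>\<^sub>F n in sequentially. \<beta> * (sqrt (q n / real n) - 1)\<^sup>2 = laguerre_equilibrium.lower_edge \<beta> (\<kappa> n) n / real n"
      using eventually_gt_at_top[of 0] by eventually_elim (simp add: lower_edge scaled_sqrt_square(2)[OF _ q0])
  qed
  have rate_lim: "(\<lambda>n. ?R n (z n)) \<longlonglongrightarrow> sqrt ((1 - a / w) * (1 - b / w))"
    if z: "(\<lambda>n. z n / real n) \<longlonglongrightarrow> w" and w: "w > 0" for z w
  proof (rule Lim_transform_eventually)
    show "(\<lambda>n. sqrt ((1 - (laguerre_equilibrium.lower_edge \<beta> (\<kappa> n) n / real n) / (z n / real n)) * (1 - (?E n / real n) / (z n / real n))))
       \<longlonglongrightarrow> sqrt ((1 - a / w) * (1 - b / w))"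
      using w by (intro tendsto_intros lower_lim edge_lim z) auto
    show "\<forall>\<^sub>F n in sequentially. sqrt ((1 - (laguerre_equilibrium.lower_edge \<beta> (\<kappa> n) n / real n) / (z n / real n)) * (1 - (?E n / real n) / (z n / real n))) = ?R n (z n)"
      using eventually_gt_at_top[of 0] by eventually_elim (simp add: laguerre_equilibrium.rate_def[OF le])
  qed

  \<comment> \<open>The point \<open>n * y1\<close>, halfway between the limiting edge
    \<open>n * b\<close> and \<open>n * y\<close>, is where the tail gets bounded by 1. Half of its
    distance to the edge is kept as the margin \<delta>, which absorbs the difference between the
    finite edge and its limit.\<close>
  define y1 where "y1 = (b + y) / 2"
  define \<delta> where "\<delta> = (y1 - b) / 2"
  have y1: "b < y1" "y1 < y" "y1 > 0" using yb b0 by (auto simp: y1_def)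
  have \<delta>: "\<delta> > 0" "b + \<delta> < y1" using y1 by (auto simp: \<delta>_def field_simps)
  define \<rho>1 where "\<rho>1 = sqrt ((1 - a / y1) * (1 - b / y1))"
  define \<rho> where "\<rho> = sqrt ((1 - a / y) * (1 - b / y))"
  have \<rho>1: "\<rho>1 > 0" unfolding \<rho>1_def using y1 ab by (intro real_sqrt_gt_zero mult_pos_pos) auto
  \<comment> \<open>By the explicit Stieltjes transform the upper bound imposed on \<open>J\<close>
    equals \<open>sqrt ((y - a) * (y - b)) / y\<close>, the limit of the rate at
    \<open>p * x\<close>.\<close>
  have J\<rho>: "J < \<rho>"
  proof -
    have y0: "y > 0" using yb b0 by linarith
    have "1 - 2 * \<beta> * (\<integral>y. 1 / (\<gamma> * x - y) \<partial>marchenko_pastur \<beta> \<gamma>) - \<beta> * ((\<gamma> - 1) / (\<gamma> * x)) = sqrt ((y - a) * (y - b)) / y"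
      unfolding y_def[symmetric] marchenko_pastur_stieltjes[OF \<beta> \<gamma> \<gamma>x, folded y_def a_def b_def]
      using \<beta> y0 by (simp add: field_simps)
    also have "\<dots> = sqrt ((y - a) * (y - b) / y\<^sup>2)" using y0 by (simp add: real_sqrt_divide)
    also have "(y - a) * (y - b) / y\<^sup>2 = (1 - a / y) * (1 - b / y)" using y0 by (simp add: power2_eq_square field_simps)
    finally show ?thesis using assms(7) unfolding \<rho>_def by simp
  qed
  \<comment> \<open>Strictly between \<open>J\<close> and \<rho>, so that eventually the rate
    exceeds \<open>J\<close> by at least the fixed amount \<open>\<rho>0 - J\<close>.\<close>
  define \<rho>0 where "\<rho>0 = (J + \<rho>) / 2"
  have \<rho>0: "J < \<rho>0" "\<rho>0 < \<rho>" "\<rho>0 > 0" using J\<rho> J by (auto simp: \<rho>0_def)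
  have qx_lim: "(\<lambda>n. q n * x / real n) \<longlonglongrightarrow> y"
    unfolding y_def using tendsto_mult_right[OF q_lim, of x] by simp
  \<comment> \<open>Eventually the rate at \<open>n * y1\<close> exceeds \<open>\<rho>1 / 2\<close>
    and enters halved, and the distance from there to \<open>q n * x\<close> is at least
    \<open>n * (y - y1) / 2\<close>.\<close>
  define c where "c = \<rho>1 / 4 * ((y - y1) / 2)"
  have c: "c > 0" using \<rho>1 y1 by (simp add: c_def)
  define K1 where "K1 = 8 * 2 powr \<beta> * exp (3 / 2) / \<rho>0"
  define K2 where "K2 = (4 * 2 powr \<beta> * exp (3 / 2))\<^sup>2 / (J * (\<rho>0 - J))"
  define K where "K = K1 + K2"
  have K12: "K1 > 0" "K2 > 0" using \<rho>0 J by (auto simp: K1_def K2_def intro!: divide_pos_pos mult_pos_pos)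
  \<comment> \<open>The equilibrium points add up to \<open>\<beta> * n * (q n - 1)\<close>, and
    eventually \<open>q n \<le> (\<gamma> + 1) * n\<close>.\<close>
  define G where "G = \<beta> * (\<gamma> + 2)"
  have G: "G > 0" using \<beta> \<gamma> by (simp add: G_def)

  have ev_rate: "\<forall>\<^sub>F n in sequentially. \<rho>0 < ?R n (q n * x)"
    using order_tendstoD(1)[OF rate_lim[OF qx_lim] \<rho>0(2)[unfolded \<rho>_def]] yb b0 by simp
  have ev_rate1: "\<forall>\<^sub>F n in sequentially. \<rho>1 / 2 < ?R n (real n * y1)"
  proof -
    have "(\<lambda>n. real n * y1 / real n) \<longlonglongrightarrow> y1" by real_asymp
    from rate_lim[OF this y1(3)] show ?thesis using \<rho>1 unfolding \<rho>1_def[symmetric] by (intro order_tendstoD(1)) auto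
  qed
  have ev_edge: "\<forall>\<^sub>F n in sequentially. ?E n / real n < y1 - \<delta>"
    using edge_lim \<delta>(2) by (intro order_tendstoD(2)) auto
  have ev_x: "\<forall>\<^sub>F n in sequentially. (y + y1) / 2 < q n * x / real n"
    using qx_lim y1(2) by (intro order_tendstoD(1)) auto
  have ev_q: "\<forall>\<^sub>F n in sequentially. q n / real n < \<gamma> + 1"
    using q_lim by (intro order_tendstoD(2)) auto
  have ev_1: "\<forall>\<^sub>F n in sequentially. 1 \<le> real n * y1" using y1(3) by real_asymp

  have main: "(\<lambda>n. ln (?S n) / (2 * ln (?P n))) \<longlonglongrightarrow> 1"
  proof (rule log_ratio_tendsto_1[where c = c and K = K])
    fix \<epsilon> :: real assume \<epsilon>: "\<epsilon> > 0"
    have conc: "\<forall>\<^sub>F n in sequentially. laguerre_equilibrium.concentrated \<beta> (\<kappa> n) n (L n) (s / (\<delta> * real n)) (exp (\<epsilon> * real n))" if "s > 0" for s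
    proof -
      have "s / \<delta> > 0" using that \<delta>(1) by simp
      from concentrated_eventually[OF \<beta> this \<epsilon> G] show ?thesis
        using ev_q eventually_gt_at_top[of 0]
      proof eventually_elim
        case (elim n)
        have n: "real n > 0" using elim by simp
        have "2 * \<kappa> n * real n + \<beta> * real n * (real n - 1) = \<beta> * real n * (q n - 1)" by (simp add: \<kappa>_def field_simps)
        also have "\<dots> \<le> \<beta> * real n * ((\<gamma> + 2) * real n)"
        proof (intro mult_left_mono)
          have "q n \<le> (\<gamma> + 1) * real n" using elim(2) n by (simp add: pos_divide_less_eq)
          then show "q n - 1 \<le> (\<gamma> + 2) * real n" using n by (simp add: distrib_right)
        qed (use \<beta> n in simp)
        also have "\<dots> = G * (real n)\<^sup>2" by (simp add: G_def power2_eq_square)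
        finally have "laguerre_equilibrium.concentrated \<beta> (\<kappa> n) n (L n) (s / \<delta> / real n) (exp (\<epsilon> * real n))"
          using elim(1) le \<kappa>_ge by blast
        then show ?case by simp
      qed
    qed
    show "\<forall>\<^sub>F n in sequentially. 0 < ?P n \<and> ?P n \<le> K * real (Suc n) * exp ((2 * \<epsilon> - c) * real n)
      \<and> (?P n)\<^sup>2 \<le> ?S n \<and> ?S n \<le> K * (real (Suc n))\<^sup>2 * exp (3 * \<epsilon> * real n) * (?P n)\<^sup>2"
      using conc[OF zero_less_numeral, of "num.Bit0 num.One"] conc[OF \<beta>] conc[OF mult_pos_pos[OF zero_less_numeral \<beta>], of "num.Bit0 num.One"]
        ev_rate ev_rate1 ev_edge ev_x ev_1 eventually_ge_at_top[of 1]
    proof eventually_elim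
      case (elim n)
      note conc2 = elim(1) and conc\<beta> = elim(2) and conc2\<beta> = elim(3) and n1 = elim(9)
      have n: "real n > 0" using n1 by simp
      interpret laguerre_sampling \<beta> "\<kappa> n" n "L n" "q n" x J by (rule ls[OF n1])
      define r where "r = \<delta> * real n"
      define C where "C = exp (\<epsilon> * real n)"
      define z where "z = real n * y1"
      have r: "r > 0" using \<delta> n by (simp add: r_def)
      have C: "C \<ge> 1" using \<epsilon> by (simp add: C_def)
      note cs = conc2[folded r_def C_def] conc\<beta>[folded r_def C_def] conc2\<beta>[folded r_def C_def]
      have z: "edge + r \<le> z" using elim(6) n unfolding z_def r_def by (simp add: field_simps)
      have z1: "1 \<le> z" using elim(8) unfolding z_def .
      have gap: "real n * ((y - y1) / 2) \<le> q n * x - z"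
      proof -
        have "(y + y1) / 2 * real n < q n * x" using elim(7) n by (simp only: pos_less_divide_eq)
        moreover have "(y + y1) / 2 * real n = real n * ((y - y1) / 2) + real n * y1" by (simp add: field_simps)
        ultimately show ?thesis unfolding z_def by linarith
      qed
      have "0 \<le> real n * ((y - y1) / 2)" using n y1 by simp
      then have zx: "z \<le> q n * x" using gap by linarith
      have ex: "edge + r \<le> q n * x" "1 \<le> q n * x" using z z1 zx by linarith+
      have rx: "\<rho>0 < rate (q n * x)" by (rule elim(4))
      have Jr: "J < rate (q n * x)" using rx \<rho>0(1) by linarith
      have P: "?P n = tail (q n * x)" unfolding tail_def ..
      have P0: "tail (q n * x) > 0" by (rule tail_pos[OF r C cs ex])
      have "tail (q n * x) \<le> real (Suc n) * (C\<^sup>2 * (8 * 2 powr \<beta> * exp (3 / 2))) / rate (q n * x) * exp (- (rate z / 2 * (q n * x - z)))"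
        by (rule tail_exponential[OF r C cs z z1 zx])
      also have "\<dots> \<le> real (Suc n) * (C\<^sup>2 * (8 * 2 powr \<beta> * exp (3 / 2))) / \<rho>0 * exp (- (c * real n))"
      proof (intro mult_mono divide_left_mono)
        have "\<rho>1 / 4 * (real n * ((y - y1) / 2)) \<le> rate z / 2 * (q n * x - z)"
          using elim(5) gap \<rho>1 n y1 unfolding z_def[symmetric] by (intro mult_mono) auto
        then show "exp (- (rate z / 2 * (q n * x - z))) \<le> exp (- (c * real n))"
          unfolding c_def by (simp add: mult_ac)
      qed (use rx \<rho>0 in auto)
      also have "\<dots> = K1 * real (Suc n) * (C\<^sup>2 * exp (- (c * real n)))" unfolding K1_def by simp
      also have "C\<^sup>2 * exp (- (c * real n)) = exp ((2 * \<epsilon> - c) * real n)"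
        unfolding C_def exp_double[symmetric] exp_add[symmetric] by (simp add: algebra_simps)
      also have "K1 * real (Suc n) * exp ((2 * \<epsilon> - c) * real n) \<le> K * real (Suc n) * exp ((2 * \<epsilon> - c) * real n)"
        using K12 unfolding K_def by (intro mult_right_mono) auto
      finally have upper: "tail (q n * x) \<le> K * real (Suc n) * exp ((2 * \<epsilon> - c) * real n)" .
      have "?S n \<le> (real (Suc n))\<^sup>2 * (C ^ 3 * (4 * 2 powr \<beta> * exp (3 / 2))\<^sup>2) / (J * (rate (q n * x) - J)) * (tail (q n * x))\<^sup>2"
        by (rule second_moment_sandwich(2)[OF r C cs ex Jr])
      also have "\<dots> \<le> (real (Suc n))\<^sup>2 * (C ^ 3 * (4 * 2 powr \<beta> * exp (3 / 2))\<^sup>2) / (J * (\<rho>0 - J)) * (tail (q n * x))\<^sup>2"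
        using rx \<rho>0 J C by (intro mult_right_mono divide_left_mono mult_left_mono mult_pos_pos mult_nonneg_nonneg) auto
      also have "\<dots> = K2 * (real (Suc n))\<^sup>2 * C ^ 3 * (tail (q n * x))\<^sup>2" unfolding K2_def by simp
      also have "C ^ 3 = exp (3 * \<epsilon> * real n)" unfolding C_def exp_of_nat_mult[symmetric] by (simp add: mult.assoc)
      also have "K2 * (real (Suc n))\<^sup>2 * exp (3 * \<epsilon> * real n) * (tail (q n * x))\<^sup>2 \<le> K * (real (Suc n))\<^sup>2 * exp (3 * \<epsilon> * real n) * (tail (q n * x))\<^sup>2"
        using K12 unfolding K_def by (intro mult_right_mono) auto
      finally show ?case
        unfolding P using P0 upper second_moment_sandwich(1)[OF r C cs ex Jr] by blast
    qed
  qed (use c K12 in \<open>simp_all add: K_def\<close>)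
  have "(\<lambda>n. ln (\<integral>l. (importance_estimator n (p n) \<beta> x J l)\<^sup>2 \<partial>importance_measure n (p n) \<beta> x J) /
               (2 * ln (largest_eigenvalue_tail n (p n) \<beta> (p n * x)))) \<longlonglongrightarrow> 1"
    by (rule LIMSEQ_imp_Suc) (use main in \<open>simp add: q_def\<close>)
  with unbiased show ?thesis by blast
qed

end
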